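(* Let $\Omega=(0,1)^2$, let $K=SO(2)F_0\cup SO(2)F_0^{-1}$ be the two-well set defined in the context, and consider Model A or Model B (both defined in the context, with law $\mu$ of the random choices). There exists $\theta_{A,B}>0$ such that for all $s\in(0,1)$, $p\in(1,\infty)$ with $sp<\theta_{A,B}$ and for all $M\in\operatorname{int}K^{qc}$, the following holds for either model: for $\mu$-almost every sequence $\{y_k\}_{k\ge 0}$ generated by the model with boundary datum $M$ there exists a deformation $y:\Omega\to\mathbb{R}^2$ such that $y_k\to y$ in $W^{1,1}(\Omega;\mathbb{R}^2)$, $$\nabla y\in K \text{ a.e. in }\Omega,\qquad y(x)=Mx\ \text{ on }\partial\Omega,$$ and $y\in W^{1,\infty}(\Omega;\mathbb{R}^2)\cap W^{1+s,p}(\Omega;\mathbb{R}^2)$.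
   Context: **Wells.** Fix $\gamma>0$, $F_0=\begin{pmatrix}1&\gamma\\0&1\end{pmatrix}$, $F_0^{-1}=\begin{pmatrix}1&-\gamma\\0&1\end{pmatrix}$, $K=SO(2)F_0\cup SO(2)F_0^{-1}\subset\mathbb{R}^{2\times2}$. $K^{qc}$ is the quasiconvex hull of $K$; explicitly $K^{qc}=\{F:\det F=1,\ |Fe_1|^2\le 1,\ |Fe_2|^2\le 1+\gamma^2\}$, and $\operatorname{int}K^{qc}$ is its interior relative to $\{\det F=1\}$, i.e. $\{F:\det F=1,\ |Fe_1|^2<1,\ |Fe_2|^2<1+\gamma^2\}$. **Norms.** $\|f\|_{W^{s,p}(U)}^p=\|f\|_{L^p(U)}^p+\int_U\int_U\frac{|f(x)-f(y)|^p}{|x-y|^{2+sp}}dx\,dy$ for $s\in(0,1)$; $W^{1+s,p}(U)$ consists of $u\in W^{1,p}(U)$ with $\nabla u\in W^{s,p}(U)$. $|\cdot|$ of a set is Lebesgue measure, $\operatorname{Per}$ is perimeter. **Building blocks.** By the convex integration construction of Della Porta and Rüland (a known result) there are $\theta_0\in(0,1)$ and, for each $M\in\operatorname{int}K^{qc}$ and each open axis-parallel rectangle $R\subset\Omega$, a map $z_R=z_{R,M}\in W^{1,\infty}(R;\mathbb{R}^2)$ with $\nabla z_R\in K$ a.e. in $R$, $z_R(x)=Mx$ on $\partial R$, and such that for every $\theta\in(0,\theta_0)$, $p\in[1,\infty)$ there is $C_0=C_0(\theta,p,M)$ with $\|\nabla z_R\|_{W^{s,p}(R)}^p\le C_0\operatorname{Per}(R)^{sp}|R|^{1-sp}$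 for all $R$ and all $s\in(0,1)$ with $sp\le\theta$. Fix such a family, measurable in $R$. **Block rule.** Fix $\delta\in(0,1)$ and $q\in(0,1)$. For $d\in\{1,2\}$ let $d^\perp$ be the other index. For an open rectangle $D=(a_1,a_1+\ell_1)\times(a_2,a_2+\ell_2)$, a point $\mathbf p\in D$ and $d\in\{1,2\}$, define $\mathcal{B}(D,\mathbf p,d)$ as follows. If $\delta\ell_d\ge\ell_{d^\perp}$, then $\mathcal{B}(D,\mathbf p,d)=D$. If $\delta\ell_d<\ell_{d^\perp}$, then $\mathcal{B}(D,\mathbf p,d)=\{x\in D:\ \mathbf p_{d^\perp}-\sigma\delta\ell_d<x_{d^\perp}<\mathbf p_{d^\perp}+(1-\sigma)\delta\ell_d\}$, where $\sigma$ minimizes $|\sigma-\tfrac12|$ among $\sigma\in[0,1]$ with $a_{d^\perp}\le \mathbf p_{d^\perp}-\sigma\delta\ell_d$ and $\mathbf p_{d^\perp}+(1-\sigma)\delta\ell_d\le a_{d^\perp}+\ell_{d^\perp}$. **Model A.** $\mathcal V_0=\Omega$, $y_0(x)=Mx$. For $k\ge1$, $\mathcal V_{k-1}$ is a finite disjoint union of open rectangles (its connected components). For each component $D$ choose, independently of each other and (given $\mathcal V_{k-1}$) of the past, a point $\mathbf p_D$ uniformly in $D$ and a direction $d_D$ equal to $1$ with probability $q$ and $2$ with probability $1-q$. Set $\mathcal{B}_D=\mathcal{B}(D,\mathbf p_D,d_D)$, $\mathcal V_k=\mathcal V_{k-1}\setminus\overline{\bigcup_D\mathcal{B}_D}$,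 $y_k=z_{\mathcal{B}_D}$ on each $\mathcal{B}_D$ and $y_k=y_{k-1}$ elsewhere. **Model B.** $\mathcal V_0=\Omega$, $y_0(x)=Mx$. For $k\ge1$, if $\mathcal V_{k-1}\ne\emptyset$ choose $\mathbf p_k$ uniformly in $\mathcal V_{k-1}$ and, independently, $d_k$ equal to $1$ with probability $q$ and $2$ with probability $1-q$. Let $D$ be the connected component of $\mathcal V_{k-1}$ containing $\mathbf p_k$, $\mathcal{B}_k=\mathcal{B}(D,\mathbf p_k,d_k)$, $\mathcal V_k=\mathcal V_{k-1}\setminus\overline{\mathcal{B}_k}$, $y_k=z_{\mathcal{B}_k}$ on $\mathcal{B}_k$ and $y_k=y_{k-1}$ elsewhere. In both models, if $\mathcal V_{k-1}=\emptyset$ then $\mathcal V_k=\emptyset$ and $y_k=y_{k-1}$. $\mu$ denotes the law of the sequence of all random choices. $\delta,q,\gamma$ are fixed and the thresholds may depend on them. *)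

theory Defs
  imports "HOL-Probability.Probability"
begin

section \<open>Wells\<close>

definition F0 :: "real \<Rightarrow> real^2^2" where
  "F0 \<gamma> = vector [vector [1, \<gamma>], vector [0, 1]]"

definition F0_inv :: "real \<Rightarrow> real^2^2" where
  "F0_inv \<gamma> = vector [vector [1, - \<gamma>], vector [0, 1]]"

definition wells :: "real \<Rightarrow> (real^2^2) set" where
  "wells \<gamma> = {Q ** F0 \<gamma> | Q. rotation_matrix Q} \<union> {Q ** F0_inv \<gamma> | Q. rotation_matrix Q}"

text \<open>The quasiconvex hull of the wells is taken in its explicit form.\<close>

definition Kqc :: "real \<Rightarrow> (real^2^2) set" where
  "Kqc \<gamma> = {F. det F = 1 \<and> (norm (F *v axis 1 1))\<^sup>2 \<le> 1 \<and> (norm (F *v axis 2 1))\<^sup>2 \<le> 1 + \<gamma>\<^sup>2}"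

definition int_Kqc :: "real \<Rightarrow> (real^2^2) set" where
  "int_Kqc \<gamma> = (top_of_set {F. det F = 1}) interior_of (Kqc \<gamma>)"


section \<open>Sobolev spaces\<close>

definition test_function :: "(real^2) set \<Rightarrow> (real^2 \<Rightarrow> real) \<Rightarrow> (real^2 \<Rightarrow> real^2) \<Rightarrow> bool" where
  "test_function U \<phi> g \<longleftrightarrow>
     (\<forall>x. (\<phi> has_derivative (\<lambda>h. g x \<bullet> h)) (at x)) \<and> continuous_on UNIV g \<and>
     compact (closure {x. \<phi> x \<noteq> 0}) \<and> closure {x. \<phi> x \<noteq> 0} \<subseteq> U"

text \<open>Test functions are compactly supported and continuously differentiable, with gradient \<open>g\<close>;
  by mollification this gives the same weak gradients as smooth test functions.
  The entry \<open>G x $ i $ j\<close> is the \<open>j\<close>-th partial derivative of the \<open>i\<close>-th component.\<close>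

definition has_weak_gradient ::
  "(real^2) set \<Rightarrow> (real^2 \<Rightarrow> real^2) \<Rightarrow> (real^2 \<Rightarrow> real^2^2) \<Rightarrow> bool" where
  "has_weak_gradient U u G \<longleftrightarrow>
     (\<forall>C. compact C \<and> C \<subseteq> U \<longrightarrow> u absolutely_integrable_on C \<and> G absolutely_integrable_on C) \<and>
     (\<forall>\<phi> g i j. test_function U \<phi> g \<longrightarrow>
        (LINT x|lebesgue_on U. u x $ i * g x $ j) = - (LINT x|lebesgue_on U. G x $ i $ j * \<phi> x))"

text \<open>Unique up to null sets when it exists.\<close>

definition weak_grad :: "(real^2) set \<Rightarrow> (real^2 \<Rightarrow> real^2) \<Rightarrow> real^2 \<Rightarrow> real^2^2" where
  "weak_grad U u = (SOME G. has_weak_gradient U u G)"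

definition Lp_pow :: "(real^2) set \<Rightarrow> real \<Rightarrow> (real^2 \<Rightarrow> 'a::euclidean_space) \<Rightarrow> ennreal" where
  "Lp_pow U p f = (\<integral>\<^sup>+ x. ennreal (norm (f x) powr p) \<partial>lebesgue_on U)"

definition in_Lp :: "(real^2) set \<Rightarrow> real \<Rightarrow> (real^2 \<Rightarrow> 'a::euclidean_space) \<Rightarrow> bool" where
  "in_Lp U p f \<longleftrightarrow> f \<in> borel_measurable (lebesgue_on U) \<and> Lp_pow U p f < \<infinity>"

definition in_Linf :: "(real^2) set \<Rightarrow> (real^2 \<Rightarrow> 'a::euclidean_space) \<Rightarrow> bool" where
  "in_Linf U f \<longleftrightarrow>
     f \<in> borel_measurable (lebesgue_on U) \<and> (\<exists>C. AE x in lebesgue_on U. norm (f x) \<le> C)"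

definition Wsp_pow ::
  "(real^2) set \<Rightarrow> real \<Rightarrow> real \<Rightarrow> (real^2 \<Rightarrow> 'a::euclidean_space) \<Rightarrow> ennreal" where
  "Wsp_pow U s p f = Lp_pow U p f +
     (\<integral>\<^sup>+ x. (\<integral>\<^sup>+ y. ennreal (norm (f x - f y) powr p / norm (x - y) powr (2 + s * p))
        \<partial>lebesgue_on U) \<partial>lebesgue_on U)"

definition in_Wsp ::
  "(real^2) set \<Rightarrow> real \<Rightarrow> real \<Rightarrow> (real^2 \<Rightarrow> 'a::euclidean_space) \<Rightarrow> bool" where
  "in_Wsp U s p f \<longleftrightarrow> f \<in> borel_measurable (lebesgue_on U) \<and> Wsp_pow U s p f < \<infinity>"

definition in_W1p :: "(real^2) set \<Rightarrow> real \<Rightarrow> (real^2 \<Rightarrow> real^2) \<Rightarrow> bool" where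
  "in_W1p U p u \<longleftrightarrow>
     in_Lp U p u \<and> (\<exists>G. has_weak_gradient U u G) \<and> in_Lp U p (weak_grad U u)"

definition in_W1inf :: "(real^2) set \<Rightarrow> (real^2 \<Rightarrow> real^2) \<Rightarrow> bool" where
  "in_W1inf U u \<longleftrightarrow>
     in_Linf U u \<and> (\<exists>G. has_weak_gradient U u G) \<and> in_Linf U (weak_grad U u)"

definition in_W1sp :: "(real^2) set \<Rightarrow> real \<Rightarrow> real \<Rightarrow> (real^2 \<Rightarrow> real^2) \<Rightarrow> bool" where
  "in_W1sp U s p u \<longleftrightarrow> in_W1p U p u \<and> in_Wsp U s p (weak_grad U u)"

definition tendsto_W1p ::
  "(real^2) set \<Rightarrow> real \<Rightarrow> (nat \<Rightarrow> real^2 \<Rightarrow> real^2) \<Rightarrow> (real^2 \<Rightarrow> real^2) \<Rightarrow> bool" where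
  "tendsto_W1p U p u v \<longleftrightarrow>
     (\<forall>k. in_W1p U p (u k)) \<and> in_W1p U p v \<and>
     (\<lambda>k. Lp_pow U p (\<lambda>x. u k x - v x) + Lp_pow U p (weak_grad U (\<lambda>x. u k x - v x)))
       \<longlonglongrightarrow> 0"

text \<open>Used for functions in \<open>W\<^sup>1\<^sup>,\<^sup>\<infinity>\<close> on rectangles, which have a representative that is continuous up
  to the boundary; boundary values are those of this representative.\<close>

definition affine_boundary :: "(real^2) set \<Rightarrow> (real^2 \<Rightarrow> real^2) \<Rightarrow> real^2^2 \<Rightarrow> bool" where
  "affine_boundary U u M \<longleftrightarrow>
     continuous_on (closure U) u \<and> (\<forall>x\<in>frontier U. u x = M *v x)"


section \<open>Rectangles and building blocks\<close>

definition unit_square :: "(real^2) set" where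
  "unit_square = {x. \<forall>i. 0 < x $ i \<and> x $ i < 1}"

definition rectangle :: "(real^2) set \<Rightarrow> bool" where
  "rectangle R \<longleftrightarrow> R \<noteq> {} \<and> (\<exists>a b. R = box a b)"

definition lo :: "(real^2) set \<Rightarrow> 2 \<Rightarrow> real" where
  "lo D i = Inf ((\<lambda>x. x $ i) ` D)"

definition side :: "(real^2) set \<Rightarrow> 2 \<Rightarrow> real" where
  "side D i = Sup ((\<lambda>x. x $ i) ` D) - Inf ((\<lambda>x. x $ i) ` D)"

definition rect_perimeter :: "(real^2) set \<Rightarrow> real" where
  "rect_perimeter R = 2 * (side R 1 + side R 2)"

definition building_blocks ::
  "real \<Rightarrow> real \<Rightarrow> (real^2^2 \<Rightarrow> (real^2) set \<Rightarrow> real^2 \<Rightarrow> real^2) \<Rightarrow> bool" where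
  "building_blocks \<gamma> \<theta>\<^sub>0 z \<longleftrightarrow>
     0 < \<theta>\<^sub>0 \<and> \<theta>\<^sub>0 < 1 \<and>
     (\<forall>M\<in>int_Kqc \<gamma>.
        (\<forall>R. rectangle R \<and> R \<subseteq> unit_square \<longrightarrow>
           in_W1inf R (z M R) \<and>
           (AE x in lebesgue_on R. weak_grad R (z M R) x \<in> wells \<gamma>) \<and>
           affine_boundary R (z M R) M) \<and>
        (\<forall>\<theta> p. 0 < \<theta> \<and> \<theta> < \<theta>\<^sub>0 \<and> 1 \<le> p \<longrightarrow>
           (\<exists>C\<^sub>0::real. \<forall>R s. rectangle R \<and> R \<subseteq> unit_square \<and> 0 < s \<and> s < 1 \<and> s * p \<le> \<theta> \<longrightarrow>
              Wsp_pow R s p (weak_grad R (z M R))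
                \<le> ennreal (C\<^sub>0 * rect_perimeter R powr (s * p) *
                            measure lebesgue R powr (1 - s * p)))) \<and>
        (\<lambda>(a, b, x). z M (box a b) x) \<in> borel_measurable (restrict_space borel
           {(a, b, x). rectangle (box a b) \<and> box a b \<subseteq> unit_square \<and> x \<in> closure (box a b)}))"


section \<open>The block rule\<close>

definition perp :: "2 \<Rightarrow> 2" where
  "perp d = (if d = 1 then 2 else 1)"

definition block_shift :: "real \<Rightarrow> (real^2) set \<Rightarrow> real^2 \<Rightarrow> 2 \<Rightarrow> real" where
  "block_shift \<delta> D pt d = (ARG_MIN (\<lambda>\<sigma>. \<bar>\<sigma> - 1/2\<bar>) \<sigma>. 0 \<le> \<sigma> \<and> \<sigma> \<le> 1 \<and>
     lo D (perp d) \<le> pt $ perp d - \<sigma> * \<delta> * side D d \<and>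
     pt $ perp d + (1 - \<sigma>) * \<delta> * side D d \<le> lo D (perp d) + side D (perp d))"

definition block :: "real \<Rightarrow> (real^2) set \<Rightarrow> real^2 \<Rightarrow> 2 \<Rightarrow> (real^2) set" where
  "block \<delta> D pt d =
     (if \<delta> * side D d \<ge> side D (perp d) then D
      else let \<sigma> = block_shift \<delta> D pt d in
        {x \<in> D. pt $ perp d - \<sigma> * \<delta> * side D d < x $ perp d \<and>
                x $ perp d < pt $ perp d + (1 - \<sigma>) * \<delta> * side D d})"


section \<open>Random choices\<close>

abbreviation choice_space :: "((real^2) \<times> 2) measure" where
  "choice_space \<equiv> borel \<Otimes>\<^sub>M count_space UNIV"

definition direction_pmf :: "real \<Rightarrow> 2 pmf" where
  "direction_pmf q = map_pmf (\<lambda>b. if b then 1 else 2) (bernoulli_pmf q)"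

definition choice_law :: "real \<Rightarrow> (real^2) set \<Rightarrow> ((real^2) \<times> 2) measure" where
  "choice_law q V = uniform_measure lborel V \<Otimes>\<^sub>M measure_pmf (direction_pmf q)"

text \<open>\<open>\<mu>\<close> is the law of a sequence \<open>\<omega>\<close> in \<open>N\<close> for which the conditional law of \<open>\<omega> k\<close> given
  \<open>\<omega> 0, \<dots>, \<omega> (k - 1)\<close> is \<open>\<kappa> k \<omega>\<close>, where \<open>\<kappa> k \<omega>\<close> depends only on these entries. For measurable
  probability kernels, \<open>\<mu>\<close> exists and is unique by the Ionescu-Tulcea theorem.\<close>

definition sequence_law ::
  "'c measure \<Rightarrow> (nat \<Rightarrow> (nat \<Rightarrow> 'c) \<Rightarrow> 'c measure) \<Rightarrow> (nat \<Rightarrow> 'c) measure \<Rightarrow> bool" where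
  "sequence_law N \<kappa> \<mu> \<longleftrightarrow>
     prob_space \<mu> \<and> sets \<mu> = sets (\<Pi>\<^sub>M k\<in>UNIV. N) \<and>
     (\<forall>k. \<forall>E\<in>sets (\<Pi>\<^sub>M j\<in>{..<k}. N). \<forall>A\<in>sets N.
        emeasure \<mu> {\<omega> \<in> space \<mu>. restrict \<omega> {..<k} \<in> E \<and> \<omega> k \<in> A} =
        (\<integral>\<^sup>+ \<omega>. indicator E (restrict \<omega> {..<k}) * emeasure (\<kappa> k \<omega>) A \<partial>\<mu>))"


section \<open>Model A\<close>

text \<open>In both models \<open>\<omega> k\<close> holds the choices made in the step from \<open>k\<close> to \<open>k + 1\<close>. In Model A it is a
  sequence of pairs (point, direction). The component \<open>D\<close> uses the entry with index \<open>label D\<close>, the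
  first index of a rational point in \<open>D\<close>, so that distinct components use distinct entries.\<close>

definition rational_point :: "nat \<Rightarrow> real^2" where
  "rational_point n = (case from_nat n :: rat \<times> rat of (a, b) \<Rightarrow> vector [of_rat a, of_rat b])"

definition label :: "(real^2) set \<Rightarrow> nat" where
  "label D = (LEAST n. rational_point n \<in> D)"

definition A_block ::
  "real \<Rightarrow> (nat \<Rightarrow> (real^2) \<times> 2) \<Rightarrow> (real^2) set \<Rightarrow> (real^2) set" where
  "A_block \<delta> c D = block \<delta> D (fst (c (label D))) (snd (c (label D)))"

primrec A_set :: "real \<Rightarrow> (nat \<Rightarrow> nat \<Rightarrow> (real^2) \<times> 2) \<Rightarrow> nat \<Rightarrow> (real^2) set" where
  "A_set \<delta> \<omega> 0 = unit_square"
| "A_set \<delta> \<omega> (Suc k) =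
     A_set \<delta> \<omega> k - closure (\<Union>D\<in>components (A_set \<delta> \<omega> k). A_block \<delta> (\<omega> k) D)"

text \<open>Blocks are subsets of their components, so the only block that can contain \<open>x\<close> is the block of
  the component of \<open>x\<close>.\<close>

primrec A_deformation ::
  "real \<Rightarrow> (real^2^2 \<Rightarrow> (real^2) set \<Rightarrow> real^2 \<Rightarrow> real^2) \<Rightarrow> real^2^2 \<Rightarrow>
   (nat \<Rightarrow> nat \<Rightarrow> (real^2) \<times> 2) \<Rightarrow> nat \<Rightarrow> real^2 \<Rightarrow> real^2" where
  "A_deformation \<delta> z M \<omega> 0 = (\<lambda>x. M *v x)"
| "A_deformation \<delta> z M \<omega> (Suc k) = (\<lambda>x.
     let B = A_block \<delta> (\<omega> k) (connected_component_set (A_set \<delta> \<omega> k) x)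
     in if x \<in> A_set \<delta> \<omega> k \<and> x \<in> B then z M B x else A_deformation \<delta> z M \<omega> k x)"

text \<open>Entries whose index is not the label of a component are never used; they get a dummy value.\<close>

definition A_kernel ::
  "real \<Rightarrow> real \<Rightarrow> nat \<Rightarrow> (nat \<Rightarrow> nat \<Rightarrow> (real^2) \<times> 2) \<Rightarrow> (nat \<Rightarrow> (real^2) \<times> 2) measure" where
  "A_kernel \<delta> q k \<omega> = (\<Pi>\<^sub>M i\<in>UNIV.
     let V = A_set \<delta> \<omega> k; D = connected_component_set V (rational_point i)
     in if rational_point i \<in> V \<and> label D = i then choice_law q D
        else return choice_space (0, 1))"

definition A_law :: "real \<Rightarrow> real \<Rightarrow> (nat \<Rightarrow> nat \<Rightarrow> (real^2) \<times> 2) measure \<Rightarrow> bool" where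
  "A_law \<delta> q = sequence_law (\<Pi>\<^sub>M i\<in>UNIV. choice_space) (A_kernel \<delta> q)"


section \<open>Model B\<close>

definition B_block :: "real \<Rightarrow> (real^2) set \<Rightarrow> (real^2) \<times> 2 \<Rightarrow> (real^2) set" where
  "B_block \<delta> V c = block \<delta> (connected_component_set V (fst c)) (fst c) (snd c)"

text \<open>If the remaining set is empty, so is the block, and the step changes nothing.\<close>

primrec B_set :: "real \<Rightarrow> (nat \<Rightarrow> (real^2) \<times> 2) \<Rightarrow> nat \<Rightarrow> (real^2) set" where
  "B_set \<delta> \<omega> 0 = unit_square"
| "B_set \<delta> \<omega> (Suc k) = B_set \<delta> \<omega> k - closure (B_block \<delta> (B_set \<delta> \<omega> k) (\<omega> k))"

primrec B_deformation ::
  "real \<Rightarrow> (real^2^2 \<Rightarrow> (real^2) set \<Rightarrow> real^2 \<Rightarrow> real^2) \<Rightarrow> real^2^2 \<Rightarrow>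
   (nat \<Rightarrow> (real^2) \<times> 2) \<Rightarrow> nat \<Rightarrow> real^2 \<Rightarrow> real^2" where
  "B_deformation \<delta> z M \<omega> 0 = (\<lambda>x. M *v x)"
| "B_deformation \<delta> z M \<omega> (Suc k) = (\<lambda>x.
     let B = B_block \<delta> (B_set \<delta> \<omega> k) (\<omega> k)
     in if x \<in> B then z M B x else B_deformation \<delta> z M \<omega> k x)"

definition B_kernel ::
  "real \<Rightarrow> real \<Rightarrow> nat \<Rightarrow> (nat \<Rightarrow> (real^2) \<times> 2) \<Rightarrow> ((real^2) \<times> 2) measure" where
  "B_kernel \<delta> q k \<omega> =
     (if B_set \<delta> \<omega> k = {} then return choice_space (0, 1) else choice_law q (B_set \<delta> \<omega> k))"

definition B_law :: "real \<Rightarrow> real \<Rightarrow> (nat \<Rightarrow> (real^2) \<times> 2) measure \<Rightarrow> bool" where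
  "B_law \<delta> q = sequence_law choice_space (B_kernel \<delta> q)"


section \<open>The limit deformation\<close>

definition limit_deformation ::
  "real \<Rightarrow> real^2^2 \<Rightarrow> real \<Rightarrow> real \<Rightarrow> (nat \<Rightarrow> real^2 \<Rightarrow> real^2) \<Rightarrow> (real^2 \<Rightarrow> real^2) \<Rightarrow> bool" where
  "limit_deformation \<gamma> M s p y\<^sub>k y \<longleftrightarrow>
     tendsto_W1p unit_square 1 y\<^sub>k y \<and>
     (AE x in lebesgue_on unit_square. weak_grad unit_square y x \<in> wells \<gamma>) \<and>
     affine_boundary unit_square y M \<and>
     in_W1inf unit_square y \<and> in_W1sp unit_square s p y"

end

theory Submission
  imports Defs
begin

text \<open>
  Write \<open>t = s * p\<close>. A block \<open>R\<close> with sides \<open>l\<close> and \<open>m\<close> contributes at most a multiple of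
  \<open>phi t R = l * m * (l powr - t + m powr - t)\<close> to the \<open>p\<close>-th power of the seminorm of the gradient: this holds for
  the interaction of the block with itself by the assumed estimate on blocks (\<open>perimeter_phi\<close>), and for its interaction
  with everything else because gradients are bounded and \<open>t < 1\<close> (\<open>cross_integral\<close>). Blocks are disjoint
  and have the boundary values of the affine map, so the map glued from all blocks is continuous and its weak
  gradient is the glued gradient (\<open>glued_weak_gradient\<close>). It follows that a realisation of either model has the desired limit
  as soon as the values of \<open>phi t\<close> over all its blocks are summable and the area not yet covered tends to zero
  (\<open>limit_deformation_exists\<close>, \<open>process_limit\<close>). It remains to show that both hold almost surely if \<open>t\<close> is small.

  The sum of \<open>phi t\<close> over the components is a potential. If the chosen direction is that of the longer side of a
  component, the block removes at least the fraction \<open>\<delta>\<close> of it, and by concavity the one or two remaining rectangles have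
  a potential of at most \<open>2 powr t * (1 - \<delta>) powr (1 - t)\<close> times the old one (\<open>cut_weight\<close>). For the other direction the
  factor is at most \<open>2 powr t\<close>. The good direction has probability at least \<open>min q (1 - q)\<close>, so the expected factor
  is below some \<open>\<rho> < 1\<close> for small \<open>t\<close> (\<open>contraction_ratio_less_1\<close>, \<open>shrink_average\<close>); the threshold depends only on \<open>\<delta>\<close>, \<open>q\<close>
  and \<open>\<theta>\<^sub>0\<close>.

  In Model A every component is cut in every step. The expected potential after \<open>k\<close> steps is at most \<open>2 * \<rho> ^ k\<close>, and it
  dominates both \<open>phi t\<close> of the blocks and the area. In Model B only the component that is hit changes, and the
  expected potential decreases in step \<open>k\<close> by at least \<open>1 - \<rho>\<close> times the expected value \<open>h k\<close> of \<open>phi t\<close> on that component. Telescoping shows that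
  the series of the \<open>h k\<close> converges, which bounds the blocks. Moreover there are at most \<open>k + 1\<close> components and larger ones are hit more
  often, so \<open>h k\<close> is at least the expected area not yet covered divided by \<open>k + 1\<close> (\<open>hit_average_ge\<close>). This area decreases
  with \<open>k\<close> and the harmonic series diverges, so it tends to zero almost surely.
\<close>

section \<open>Cutoff functions\<close>

lemma DERIV_pos_part_sq: "((\<lambda>t::real. (max 0 t)\<^sup>2) has_real_derivative 2 * max 0 t) (at t)"
proof (cases "t = 0")
  case True
  have "((\<lambda>y::real. (max 0 y)\<^sup>2 / y) \<longlongrightarrow> 0) (at 0)"
  proof (rule Lim_null_comparison)
    show "\<forall>\<^sub>F y in at (0::real). norm ((max 0 y)\<^sup>2 / y) \<le> \<bar>y\<bar>"
      by (rule always_eventually) (auto simp: max_def power2_eq_square)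
    show "((\<lambda>y::real. \<bar>y\<bar>) \<longlongrightarrow> 0) (at 0)"
      by (rule tendsto_eq_intros refl | simp)+
  qed
  then show ?thesis using True by (simp add: has_field_derivative_iff)
next
  case False
  show ?thesis
  proof (cases "t > 0")
    case True
    have "((\<lambda>t::real. t\<^sup>2) has_real_derivative 2 * max 0 t) (at t)"
      using True by (auto intro!: derivative_eq_intros)
    then show ?thesis
      by (rule has_field_derivative_transform_within_open[where S="{0<..}"]) (use True in auto)
  next
    case F: False
    with False have "t < 0" by simp
    have "((\<lambda>t::real. 0) has_real_derivative 2 * max 0 t) (at t)"
      using \<open>t < 0\<close> by (auto intro!: derivative_eq_intros)
    then show ?thesis
      by (rule has_field_derivative_transform_within_open[where S="{..<0}"]) (use \<open>t < 0\<close> in auto)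
  qed
qed

text \<open>A piecewise linear bump on the unit interval with integral one; its primitive \<open>step\<close> is a
  continuously differentiable transition from zero to one, written in closed form so that no
  integration is needed.\<close>

definition tent :: "real \<Rightarrow> real" where
  "tent t = 4 * (max 0 t - 2 * max 0 (t - 1/2) + max 0 (t - 1))"

definition step :: "real \<Rightarrow> real" where
  "step t = 2 * ((max 0 t)\<^sup>2 - 2 * (max 0 (t - 1/2))\<^sup>2 + (max 0 (t - 1))\<^sup>2)"

lemma DERIV_step: "(step has_real_derivative tent t) (at t)"
proof -
  have 1: "((\<lambda>t::real. (max 0 (t - c))\<^sup>2) has_real_derivative 2 * max 0 (t - c)) (at t)" for c
  proof -
    have "((\<lambda>t. t - c) has_real_derivative 1) (at t)" by (auto intro!: derivative_eq_intros)
    from DERIV_chain2[OF DERIV_pos_part_sq this] show ?thesis by simp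
  qed
  show ?thesis
    unfolding step_def[abs_def] tent_def
    by (rule derivative_eq_intros DERIV_pos_part_sq 1 refl | simp)+
qed

lemma step_0: "t \<le> 0 \<Longrightarrow> step t = 0" and step_1: "t \<ge> 1 \<Longrightarrow> step t = 1"
  by (auto simp: step_def max_def power2_eq_square field_simps)

lemma tent_0: "t \<le> 0 \<Longrightarrow> tent t = 0" "t \<ge> 1 \<Longrightarrow> tent t = 0"
  and tent_nonneg: "0 \<le> tent t" and tent_le: "tent t \<le> 2"
  and tent_ge: "1/4 \<le> t \<Longrightarrow> t \<le> 3/4 \<Longrightarrow> 1 \<le> tent t"
  by (auto simp: tent_def max_def)

lemma continuous_tent [continuous_intros]:
  "continuous_on S f \<Longrightarrow> continuous_on S (\<lambda>x. tent (f x))"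
  unfolding tent_def by (intro continuous_intros)

lemma continuous_step [continuous_intros]:
  "continuous_on S f \<Longrightarrow> continuous_on S (\<lambda>x. step (f x))"
  unfolding step_def by (intro continuous_intros)

lemma step_nonneg: "0 \<le> step t" and step_le: "step t \<le> 1"
proof -
  have mono: "step x \<le> step y" if "x \<le> y" for x y
    by (rule DERIV_nonneg_imp_nondecreasing[OF that]) (use DERIV_step tent_nonneg in blast)
  show "0 \<le> step t" using mono[of "min t 0" t] by (simp add: step_0)
  show "step t \<le> 1" using mono[of t "max t 1"] by (simp add: step_1)
qed

text \<open>A smoothed indicator of the interval from \<open>a\<close> to \<open>b\<close>: it rises at distance between \<open>\<epsilon>\<close> and
  \<open>2 * \<epsilon>\<close> from either end, so that its support stays inside the open interval.\<close>

definition cutoff :: "real \<Rightarrow> real \<Rightarrow> real \<Rightarrow> real \<Rightarrow> real" where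
  "cutoff \<epsilon> a b s = step ((s - a) / \<epsilon> - 1) * step ((b - s) / \<epsilon> - 1)"

definition cutoff' :: "real \<Rightarrow> real \<Rightarrow> real \<Rightarrow> real \<Rightarrow> real" where
  "cutoff' \<epsilon> a b s = tent ((s - a) / \<epsilon> - 1) / \<epsilon> * step ((b - s) / \<epsilon> - 1)
     - step ((s - a) / \<epsilon> - 1) * (tent ((b - s) / \<epsilon> - 1) / \<epsilon>)"

lemma DERIV_cutoff: "(cutoff \<epsilon> a b has_real_derivative cutoff' \<epsilon> a b s) (at s)"
proof -
  have 1: "((\<lambda>s. step ((s - a) / \<epsilon> - 1)) has_real_derivative tent ((s - a) / \<epsilon> - 1) * (1 / \<epsilon>)) (at s)"
    unfolding divide_inverse by (rule DERIV_chain2[OF DERIV_step]) (auto intro!: derivative_eq_intros)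
  have 2: "((\<lambda>s. step ((b - s) / \<epsilon> - 1)) has_real_derivative tent ((b - s) / \<epsilon> - 1) * (- 1 / \<epsilon>)) (at s)"
    unfolding divide_inverse by (rule DERIV_chain2[OF DERIV_step]) (auto intro!: derivative_eq_intros)
  show ?thesis
    unfolding cutoff_def[abs_def] cutoff'_def
    using DERIV_mult[OF 1 2] by (simp add: algebra_simps)
qed

lemma continuous_cutoff [continuous_intros]:
  "continuous_on S f \<Longrightarrow> continuous_on S (\<lambda>x. cutoff \<epsilon> a b (f x))"
  unfolding cutoff_def divide_inverse by (intro continuous_intros)

lemma continuous_cutoff' [continuous_intros]:
  "continuous_on S f \<Longrightarrow> continuous_on S (\<lambda>x. cutoff' \<epsilon> a b (f x))"
  unfolding cutoff'_def divide_inverse by (intro continuous_intros)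

lemma cutoff_0:
  assumes "\<epsilon> > 0" "s \<le> a + \<epsilon> \<or> b - \<epsilon> \<le> s"
  shows "cutoff \<epsilon> a b s = 0"
proof -
  have "(s - a) / \<epsilon> - 1 \<le> 0 \<or> (b - s) / \<epsilon> - 1 \<le> 0"
    using assms by (auto simp: field_simps)
  then show ?thesis by (auto simp: cutoff_def step_0)
qed

lemma cutoff_1:
  assumes "\<epsilon> > 0" "a + 2 * \<epsilon> \<le> s" "s \<le> b - 2 * \<epsilon>"
  shows "cutoff \<epsilon> a b s = 1"
proof -
  have "(s - a) / \<epsilon> - 1 \<ge> 1" "(b - s) / \<epsilon> - 1 \<ge> 1"
    using assms by (auto simp: field_simps)
  then show ?thesis by (auto simp: cutoff_def step_1)
qed

lemma cutoff_nonneg: "0 \<le> cutoff \<epsilon> a b s" and cutoff_le: "cutoff \<epsilon> a b s \<le> 1"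
  by (auto simp: cutoff_def step_nonneg step_le intro!: mult_le_one mult_nonneg_nonneg)

text \<open>The derivative has size of order \<open>1 / \<epsilon>\<close>, but only on two transition layers of width \<open>\<epsilon>\<close>. Products
  with a function that vanishes at the ends are therefore negligible in the limit.\<close>

lemma cutoff'_bound:
  assumes "\<epsilon> > 0"
  shows "\<bar>cutoff' \<epsilon> a b s\<bar> \<le> 2 / \<epsilon> * (indicator {a + \<epsilon>..a + 2 * \<epsilon>} s + indicator {b - 2 * \<epsilon>..b - \<epsilon>} s)"
proof -
  have 1: "\<bar>tent r\<bar> * \<bar>step q\<bar> \<le> 2 * indicator {0..1} r" for r q
  proof (cases "r \<in> {0..1}")
    case True
    have "\<bar>tent r\<bar> * \<bar>step q\<bar> \<le> 2 * 1"
      using tent_nonneg tent_le step_nonneg step_le by (intro mult_mono) auto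
    then show ?thesis using True by simp
  qed (auto simp: tent_0)
  have i1: "indicator {0..1} ((s - a) / \<epsilon> - 1) = (indicator {a + \<epsilon>..a + 2 * \<epsilon>} s :: real)"
    using assms by (auto simp: indicator_def field_simps)
  have i2: "indicator {0..1} ((b - s) / \<epsilon> - 1) = (indicator {b - 2 * \<epsilon>..b - \<epsilon>} s :: real)"
    using assms by (auto simp: indicator_def field_simps)
  have "\<bar>cutoff' \<epsilon> a b s\<bar> \<le> (\<bar>tent ((s - a) / \<epsilon> - 1)\<bar> * \<bar>step ((b - s) / \<epsilon> - 1)\<bar>
      + \<bar>tent ((b - s) / \<epsilon> - 1)\<bar> * \<bar>step ((s - a) / \<epsilon> - 1)\<bar>) / \<epsilon>"
  proof -
    have "\<bar>cutoff' \<epsilon> a b s\<bar> \<le> \<bar>tent ((s - a) / \<epsilon> - 1) / \<epsilon> * step ((b - s) / \<epsilon> - 1)\<bar>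
        + \<bar>step ((s - a) / \<epsilon> - 1) * (tent ((b - s) / \<epsilon> - 1) / \<epsilon>)\<bar>"
      unfolding cutoff'_def by (rule abs_triangle_ineq4)
    also have "\<dots> = (\<bar>tent ((s - a) / \<epsilon> - 1)\<bar> * \<bar>step ((b - s) / \<epsilon> - 1)\<bar>
      + \<bar>tent ((b - s) / \<epsilon> - 1)\<bar> * \<bar>step ((s - a) / \<epsilon> - 1)\<bar>) / \<epsilon>"
      using assms by (simp add: abs_mult add_divide_distrib)
    finally show ?thesis .
  qed
  also have "\<dots> \<le> (2 * indicator {0..1} ((s - a) / \<epsilon> - 1) + 2 * indicator {0..1} ((b - s) / \<epsilon> - 1)) / \<epsilon>"
    using assms by (intro divide_right_mono add_mono 1) auto
  finally show ?thesis unfolding i1 i2 by (simp add: algebra_simps add_divide_distrib)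
qed

section \<open>Continuously differentiable test functions\<close>

definition C1_fun :: "(real^2 \<Rightarrow> real) \<Rightarrow> (real^2 \<Rightarrow> real^2) \<Rightarrow> bool" where
  "C1_fun \<phi> g \<longleftrightarrow> (\<forall>x. (\<phi> has_derivative (\<lambda>h. g x \<bullet> h)) (at x)) \<and> continuous_on UNIV g"

lemma test_function_iff:
  "test_function U \<phi> g \<longleftrightarrow> C1_fun \<phi> g \<and> compact (closure {x. \<phi> x \<noteq> 0}) \<and> closure {x. \<phi> x \<noteq> 0} \<subseteq> U"
  by (auto simp: test_function_def C1_fun_def)

lemma C1_fun_continuous: "C1_fun \<phi> g \<Longrightarrow> continuous_on S \<phi>"
  unfolding C1_fun_def
  by (meson differentiable_def differentiable_imp_continuous_on differentiable_on_def
      has_derivative_at_withinI)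

lemma C1_fun_mult:
  assumes "C1_fun \<phi> g" "C1_fun \<psi> h"
  shows "C1_fun (\<lambda>x. \<phi> x * \<psi> x) (\<lambda>x. \<phi> x *\<^sub>R h x + \<psi> x *\<^sub>R g x)"
proof -
  have "((\<lambda>x. \<phi> x * \<psi> x) has_derivative (\<lambda>k. (\<phi> x *\<^sub>R h x + \<psi> x *\<^sub>R g x) \<bullet> k)) (at x)" for x
  proof -
    have "(\<phi> has_derivative (\<lambda>h. g x \<bullet> h)) (at x)" "(\<psi> has_derivative (\<lambda>k. h x \<bullet> k)) (at x)"
      using assms by (auto simp: C1_fun_def)
    from has_derivative_mult[OF this] show ?thesis
      by (simp add: inner_add_left algebra_simps)
  qed
  moreover have "continuous_on UNIV (\<lambda>x. \<phi> x *\<^sub>R h x + \<psi> x *\<^sub>R g x)"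
    using assms C1_fun_continuous[OF assms(1)] C1_fun_continuous[OF assms(2)]
    by (auto simp: C1_fun_def intro!: continuous_intros)
  ultimately show ?thesis by (auto simp: C1_fun_def)
qed

lemma C1_fun_coordinate:
  fixes i :: 2
  assumes "\<And>s. (f has_real_derivative f' s) (at s)" "continuous_on UNIV f'"
  shows "C1_fun (\<lambda>x. f (x $ i)) (\<lambda>x. f' (x $ i) *\<^sub>R axis i 1)"
proof -
  have "((\<lambda>x::real^2. f (x $ i)) has_derivative (\<lambda>k. (f' (x $ i) *\<^sub>R axis i 1) \<bullet> k)) (at x)" for x
  proof -
    have "((\<lambda>x::real^2. x $ i) has_derivative (\<lambda>k. k $ i)) (at x)"
      by (rule bounded_linear_imp_has_derivative[OF bounded_linear_vec_nth])
    from has_derivative_compose[OF this assms(1)[unfolded has_field_derivative_def]]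
    show ?thesis by (simp add: inner_axis' mult.commute)
  qed
  moreover have "continuous_on UNIV (\<lambda>x::real^2. f' (x $ i) *\<^sub>R (axis i 1 :: real^2))"
    by (intro continuous_intros continuous_on_compose2[OF assms(2)]) auto
  ultimately show ?thesis by (auto simp: C1_fun_def)
qed

definition box_cutoff :: "real \<Rightarrow> real^2 \<Rightarrow> real^2 \<Rightarrow> real^2 \<Rightarrow> real" where
  "box_cutoff \<epsilon> a b x = cutoff \<epsilon> (a$1) (b$1) (x$1) * cutoff \<epsilon> (a$2) (b$2) (x$2)"

definition box_cutoff_grad :: "real \<Rightarrow> real^2 \<Rightarrow> real^2 \<Rightarrow> real^2 \<Rightarrow> real^2" where
  "box_cutoff_grad \<epsilon> a b x =
     cutoff \<epsilon> (a$1) (b$1) (x$1) *\<^sub>R cutoff' \<epsilon> (a$2) (b$2) (x$2) *\<^sub>R axis 2 1 +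
     cutoff \<epsilon> (a$2) (b$2) (x$2) *\<^sub>R cutoff' \<epsilon> (a$1) (b$1) (x$1) *\<^sub>R axis 1 1"

lemma C1_box_cutoff: "C1_fun (box_cutoff \<epsilon> a b) (box_cutoff_grad \<epsilon> a b)"
  unfolding box_cutoff_def[abs_def] box_cutoff_grad_def[abs_def]
  by (intro C1_fun_mult C1_fun_coordinate DERIV_cutoff continuous_intros)

lemma box_cutoff_nonneg: "0 \<le> box_cutoff \<epsilon> a b x" and box_cutoff_le: "box_cutoff \<epsilon> a b x \<le> 1"
  by (auto simp: box_cutoff_def cutoff_nonneg cutoff_le intro!: mult_le_one mult_nonneg_nonneg)

lemma box_cutoff_0:
  assumes "\<epsilon> > 0" "x \<notin> box (a + vec \<epsilon>) (b - vec \<epsilon>)"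
  shows "box_cutoff \<epsilon> a b x = 0"
  using assms by (auto simp: box_cutoff_def mem_box_cart forall_2 not_less intro!: cutoff_0)

lemma box_cutoff_1:
  assumes "\<epsilon> > 0" "x \<in> cbox (a + vec (2*\<epsilon>)) (b - vec (2*\<epsilon>))"
  shows "box_cutoff \<epsilon> a b x = 1"
  using assms by (simp add: box_cutoff_def mem_box_cart forall_2 cutoff_1)

lemma box_cutoff_grad_bound:
  assumes "\<epsilon> > 0"
  shows "\<bar>box_cutoff_grad \<epsilon> a b x $ j\<bar> \<le> 2 / \<epsilon> *
    (indicator {a$j + \<epsilon>..a$j + 2 * \<epsilon>} (x$j) + indicator {b$j - 2 * \<epsilon>..b$j - \<epsilon>} (x$j))"
proof -
  have "\<bar>cutoff \<epsilon> p q r * cutoff' \<epsilon> (a$j) (b$j) (x$j)\<bar> \<le> 1 * \<bar>cutoff' \<epsilon> (a$j) (b$j) (x$j)\<bar>" for p q r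
    unfolding abs_mult by (intro mult_right_mono) (auto simp: cutoff_nonneg cutoff_le)
  then have "\<bar>box_cutoff_grad \<epsilon> a b x $ j\<bar> \<le> \<bar>cutoff' \<epsilon> (a$j) (b$j) (x$j)\<bar>"
    using exhaust_2[of j] by (auto simp: box_cutoff_grad_def axis_def)
  then show ?thesis using cutoff'_bound[OF assms] by (rule order_trans)
qed

text \<open>A cutoff turns an arbitrary \<open>C\<^sup>1\<close> function into an admissible test function. This is how identities
  for compactly supported test functions are carried over to test functions on all of the plane.\<close>

lemma test_function_box_cutoff:
  assumes "C1_fun \<phi> g" "\<epsilon> > 0" "cbox (a + vec \<epsilon>) (b - vec \<epsilon>) \<subseteq> U"
  shows "test_function U (\<lambda>x. \<phi> x * box_cutoff \<epsilon> a b x)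
           (\<lambda>x. \<phi> x *\<^sub>R box_cutoff_grad \<epsilon> a b x + box_cutoff \<epsilon> a b x *\<^sub>R g x)"
proof -
  have "{x. \<phi> x * box_cutoff \<epsilon> a b x \<noteq> 0} \<subseteq> cbox (a + vec \<epsilon>) (b - vec \<epsilon>)"
    using box_cutoff_0[OF assms(2)] box_subset_cbox by fastforce
  then have "closure {x. \<phi> x * box_cutoff \<epsilon> a b x \<noteq> 0} \<subseteq> cbox (a + vec \<epsilon>) (b - vec \<epsilon>)"
    by (rule closure_minimal) (rule closed_cbox)
  moreover from this have "compact (closure {x. \<phi> x * box_cutoff \<epsilon> a b x \<noteq> 0})"
    by (meson bounded_cbox bounded_subset closed_closure compact_eq_bounded_closed)
  ultimately show ?thesis
    using assms by (auto simp: test_function_iff intro: C1_fun_mult C1_box_cutoff)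
qed

lemma perp_neq: "perp k \<noteq> k" "k \<noteq> perp k" and perp_perp: "perp (perp k) = k"
  and prod_perp: "(\<Prod>i\<in>UNIV. f i) = f k * f (perp k)"
  and all_perp: "(\<forall>i. P i) \<longleftrightarrow> P k \<and> P (perp k)"
  for f :: "2 \<Rightarrow> 'a::comm_monoid_mult"
  using exhaust_2[of k] by (auto simp: perp_def UNIV_2 forall_2 mult.commute)

lemma measure_box_perp:
  fixes a b :: "real^2"
  assumes "\<And>i. a $ i \<le> b $ i"
  shows "measure lebesgue (cbox a b) = (b$k - a$k) * (b$(perp k) - a$(perp k))"
    "measure lebesgue (box a b) = (b$k - a$k) * (b$(perp k) - a$(perp k))"
proof -
  have "cbox a b \<noteq> {}" using assms by (simp add: interval_ne_empty_cart)
  then show 1: "measure lebesgue (cbox a b) = (b$k - a$k) * (b$(perp k) - a$(perp k))"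
    using content_cbox_cart[of a b] prod_perp[of "\<lambda>i. b$i - a$i" k] by simp
  then show "measure lebesgue (box a b) = (b$k - a$k) * (b$(perp k) - a$(perp k))"
    by (simp add: measure_lborel_box_eq measure_lborel_cbox_eq)
qed

text \<open>Strips are covered by closed boxes because boxes have a computed measure.\<close>

lemma strip_subset_box:
  fixes a b :: "real^2"
  assumes "p \<le> q" "\<And>i. a $ i \<le> b $ i"
  obtains c d where "{x \<in> cbox a b. p \<le> x $ k \<and> x $ k \<le> q} \<subseteq> cbox c d"
    "measure lebesgue (cbox c d) = (q - p) * (b $ perp k - a $ perp k)"
proof
  let ?c = "\<chi> i. if i = k then p else a$i" and ?d = "\<chi> i. if i = k then q else b$i"
  show "{x \<in> cbox a b. p \<le> x $ k \<and> x $ k \<le> q} \<subseteq> cbox ?c ?d"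
    by (auto simp: mem_box_cart)
  show "measure lebesgue (cbox ?c ?d) = (q - p) * (b $ perp k - a $ perp k)"
    using measure_box_perp(1)[of ?c ?d k] assms by (simp add: perp_neq)
qed

section \<open>Weak gradients\<close>

lemma C1_fun_grad_0:
  assumes "C1_fun \<phi> g" "x \<notin> closure {x. \<phi> x \<noteq> 0}"
  shows "g x = 0"
proof -
  have "(\<phi> has_derivative (\<lambda>h. g x \<bullet> h)) (at x)" using assms(1) by (auto simp: C1_fun_def)
  moreover have "(\<phi> has_derivative (\<lambda>h. 0)) (at x)"
  proof (rule has_derivative_transform_within_open[where f="\<lambda>_. 0" and s="- closure {x. \<phi> x \<noteq> 0}"])
    show "0 = \<phi> y" if "y \<in> - closure {x. \<phi> x \<noteq> 0}" for y
      using that subsetD[OF closure_subset, of y "{x. \<phi> x \<noteq> 0}"] by auto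
  qed (use assms(2) in \<open>simp_all add: open_Compl\<close>)
  ultimately have "(\<lambda>h. g x \<bullet> h) = (\<lambda>h. 0)" by (rule has_derivative_unique)
  then have "g x \<bullet> g x = 0" by metis
  then show ?thesis by simp
qed

lemma C1_fun_grad_continuous: "C1_fun \<phi> g \<Longrightarrow> continuous_on S (\<lambda>x. g x $ j)"
  unfolding C1_fun_def by (intro continuous_on_component) (metis continuous_on_subset subset_UNIV)

lemma test_function_0:
  assumes "test_function U \<phi> g" "x \<notin> closure {x. \<phi> x \<noteq> 0}"
  shows "g x = 0" "\<phi> x = 0"
  using assms C1_fun_grad_0[of \<phi> g x] subsetD[OF closure_subset, of x "{x. \<phi> x \<noteq> 0}"]
  by (auto simp: test_function_iff)

lemma continuous_bounded_on_compact:
  fixes f :: "'a::topological_space \<Rightarrow> 'b::real_normed_vector"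
  assumes "compact C" "continuous_on C f"
  obtains K where "K > 0" "\<And>x. x \<in> C \<Longrightarrow> norm (f x) \<le> K"
  using compact_imp_bounded[OF compact_continuous_image[OF assms(2,1)]]
  by (auto simp: bounded_pos)

lemma integrable_compact_support:
  fixes f :: "real^2 \<Rightarrow> real"
  assumes "continuous_on UNIV f" "compact S" "\<And>x. f x \<noteq> 0 \<Longrightarrow> x \<in> S"
  shows "integrable lborel f"
proof -
  have "integrable lborel (\<lambda>x. indicator S x *\<^sub>R f x)"
    using assms(2) continuous_on_subset[OF assms(1) subset_UNIV] by (rule borel_integrable_compact)
  moreover have "(\<lambda>x. indicator S x *\<^sub>R f x) = f" using assms(3) by (auto simp: indicator_def fun_eq_iff)
  ultimately show ?thesis by simp
qed

text \<open>Fubini, and the fundamental theorem of calculus on each line in direction \<open>j\<close>: both end points lie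
  outside the support.\<close>

lemma integral_partial_derivative_0:
  assumes "C1_fun \<psi> g" "compact (closure {x. \<psi> x \<noteq> 0})"
  shows "(LINT x|lborel. g x $ j) = 0"
proof -
  obtain R where R: "R > 0" "\<And>x. \<psi> x \<noteq> 0 \<Longrightarrow> norm x \<le> R"
    using compact_imp_bounded[OF assms(2)] closure_subset[of "{x. \<psi> x \<noteq> 0}"]
    unfolding bounded_pos by blast
  let ?D = "cball (0::real^2) (R + 2)"
  obtain K where K: "K > 0" "\<And>x. x \<in> ?D \<Longrightarrow> norm (g x) \<le> K"
    using continuous_bounded_on_compact[of ?D g] assms(1) continuous_on_subset
    unfolding C1_fun_def by (metis compact_cball subset_UNIV)
  have cont: "continuous_on UNIV \<psi>" using assms(1) by (rule C1_fun_continuous)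
  have lip: "\<bar>\<psi> x - \<psi> y\<bar> \<le> K * norm (x - y)" if "x \<in> ?D" "y \<in> ?D" for x y
  proof -
    have "norm (\<psi> x - \<psi> y) \<le> K * norm (x - y)"
    proof (rule differentiable_bound[of ?D \<psi> "\<lambda>x h. g x \<bullet> h"])
      show "(\<psi> has_derivative (\<bullet>) (g x)) (at x within ?D)" for x
        using assms(1) by (auto simp: C1_fun_def intro: has_derivative_at_withinI)
      show "onorm ((\<bullet>) (g x)) \<le> K" if "x \<in> ?D" for x
      proof (rule onorm_bound)
        show "norm (g x \<bullet> y) \<le> K * norm y" for y
          using Cauchy_Schwarz_ineq2[of "g x" y] K(2)[OF that] mult_right_mono[of "norm (g x)" K "norm y"]
          by simp
      qed (use K in simp)
    qed (use that in auto)
    then show ?thesis by simp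
  qed
  define e where "e = (axis j 1 :: real^2)"
  have ne: "norm e = 1" by (simp add: e_def norm_axis_1)
  define h where "h n = 1 / real (Suc n)" for n
  have h: "0 < h n" "h n \<le> 1" for n by (auto simp: h_def)
  define F where "F n x = (\<psi> (h n *\<^sub>R e + x) - \<psi> x) / h n" for n x
  have ps: "integrable lborel \<psi>"
    using integrable_compact_support[OF cont, of "cball 0 R"] R(2) by auto
  have ps': "integrable lborel (\<lambda>x. \<psi> (v + x))" "(LINT x|lborel. \<psi> (v + x)) = (LINT x|lborel. \<psi> x)" for v
  proof -
    have [measurable]: "\<psi> \<in> borel_measurable borel" using cont by (rule borel_measurable_continuous_onI)
    have "lborel = distr lborel borel ((+) v)" by (simp add: lborel_distr_plus)
    then show "integrable lborel (\<lambda>x. \<psi> (v + x))" "(LINT x|lborel. \<psi> (v + x)) = (LINT x|lborel. \<psi> x)"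
      using ps integrable_distr_eq[of "(+) v" lborel borel \<psi>] integral_distr[of "(+) v" lborel borel \<psi>]
      by auto
  qed
  have "(\<lambda>n. LINT x|lborel. F n x) \<longlonglongrightarrow> (LINT x|lborel. g x $ j)"
  proof (rule integral_dominated_convergence)
    show "(\<lambda>x. g x $ j) \<in> borel_measurable lborel"
      using assms(1) by (auto simp: C1_fun_def intro!: borel_measurable_continuous_onI continuous_intros)
    show "F n \<in> borel_measurable lborel" for n
      unfolding F_def[abs_def] using ps ps'(1)[of "h n *\<^sub>R e"] by simp
    show "integrable lborel (\<lambda>x. K * indicator (cball (0::real^2) (R + 1)) x)"
      by (intro integrable_mult_right integrable_real_indicator) (use emeasure_lborel_cball_finite[of "0::real^2" "R + 1"] in simp_all)
    show "AE x in lborel. norm (F n x) \<le> K * indicator (cball (0::real^2) (R + 1)) x" for n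
    proof (rule AE_I2)
      fix x
      show "norm (F n x) \<le> K * indicator (cball (0::real^2) (R + 1)) x"
      proof (cases "norm x \<le> R + 1")
        case True
        have "norm (h n *\<^sub>R e + x) \<le> R + 2"
          using norm_triangle_ineq[of "h n *\<^sub>R e" x] True h[of n] ne by auto
        then have "\<bar>\<psi> (h n *\<^sub>R e + x) - \<psi> x\<bar> \<le> K * norm ((h n *\<^sub>R e + x) - x)"
          using True by (intro lip) auto
        then show ?thesis using True h[of n] ne by (simp add: F_def field_simps)
      next
        case False
        have "norm (h n *\<^sub>R e + x) > R"
          using norm_triangle_ineq4[of "h n *\<^sub>R e + x" "h n *\<^sub>R e"] False h[of n] ne by auto
        then have "\<psi> (h n *\<^sub>R e + x) = 0" "\<psi> x = 0" using R(2) False R(1) by force+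
        then show ?thesis using K by (simp add: F_def)
      qed
    qed
    show "AE x in lborel. (\<lambda>n. F n x) \<longlonglongrightarrow> g x $ j"
    proof (rule AE_I2)
      fix x
      have "((\<lambda>s. \<psi> (s *\<^sub>R e + x)) has_derivative (\<lambda>s. g x \<bullet> (s *\<^sub>R e))) (at 0)"
      proof (rule has_derivative_compose[where f="\<lambda>s. s *\<^sub>R e + x" and f'="\<lambda>s. s *\<^sub>R e"])
        show "((\<lambda>s. s *\<^sub>R e + x) has_derivative (\<lambda>s. s *\<^sub>R e)) (at 0)"
          by (auto intro!: derivative_eq_intros)
        show "(\<psi> has_derivative (\<bullet>) (g x)) (at (0 *\<^sub>R e + x))"
          using assms(1) by (auto simp: C1_fun_def)
      qed
      then have "((\<lambda>s. \<psi> (s *\<^sub>R e + x)) has_real_derivative g x $ j) (at 0)"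
        by (simp add: e_def inner_axis has_field_derivative_def mult.commute[of _ "g x $ j"])
      then have lim: "((\<lambda>s. (\<psi> (s *\<^sub>R e + x) - \<psi> x) / s) \<longlongrightarrow> g x $ j) (at 0)"
        by (simp add: has_field_derivative_iff)
      have "filterlim h (at 0) sequentially"
        unfolding filterlim_at h_def[abs_def] using LIMSEQ_inverse_real_of_nat
        by (auto simp: inverse_eq_divide)
      from filterlim_compose[OF lim this] show "(\<lambda>n. F n x) \<longlonglongrightarrow> g x $ j"
        unfolding F_def .
    qed
  qed
  moreover have "(LINT x|lborel. F n x) = 0" for n
    unfolding F_def using ps ps' by simp
  ultimately show ?thesis by (simp add: LIMSEQ_const_iff)
qed

lemma integral_lebesgue_on_support:
  fixes f :: "real^2 \<Rightarrow> real"
  assumes "U \<in> sets lebesgue" "\<And>x. x \<notin> U \<Longrightarrow> f x = 0"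
  shows "(LINT x|lebesgue_on U. f x) = (LINT x|lebesgue. f x)"
proof -
  have "(\<lambda>x. indicator U x *\<^sub>R f x) = f" using assms(2) by (auto simp: indicator_def fun_eq_iff)
  then show ?thesis using assms(1) by (subst integral_restrict_space) auto
qed

lemma integrable_mult_test:
  fixes w :: "real^2 \<Rightarrow> real"
  assumes U: "U \<in> sets lebesgue" and C: "compact C" "C \<subseteq> U"
    and w: "w absolutely_integrable_on C"
    and g: "continuous_on UNIV g" "\<And>x. x \<notin> C \<Longrightarrow> g x = 0"
  shows "integrable (lebesgue_on U) (\<lambda>x. w x * g x)"
proof -
  obtain K where K: "K > 0" "\<And>x. x \<in> C \<Longrightarrow> norm (g x) \<le> K"
    using continuous_bounded_on_compact[OF C(1)] continuous_on_subset[OF g(1)] by blast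
  have i: "integrable lebesgue (\<lambda>x. indicator C x *\<^sub>R w x)"
    using w by (simp add: set_integrable_def)
  have g': "g \<in> borel_measurable lebesgue"
    using borel_measurable_continuous_onI[OF g(1)] by (simp add: measurable_completion)
  have eq: "indicator U x *\<^sub>R (w x * g x) = (indicator C x *\<^sub>R w x) * g x" for x
    using g(2) C(2) by (auto simp: indicator_def)
  have "integrable lebesgue (\<lambda>x. (indicator C x *\<^sub>R w x) * g x)"
  proof (rule Bochner_Integration.integrable_bound)
    show "integrable lebesgue (\<lambda>x. K * (indicator C x *\<^sub>R w x))" using i by simp
    show "(\<lambda>x. (indicator C x *\<^sub>R w x) * g x) \<in> borel_measurable lebesgue"
      using i g' by (intro borel_measurable_times) auto
    show "AE x in lebesgue. norm ((indicator C x *\<^sub>R w x) * g x) \<le> norm (K * (indicator C x *\<^sub>R w x))"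
      using K by (auto intro!: AE_I2 mult_right_mono simp: abs_mult indicator_def mult.commute)
  qed
  then show ?thesis using U
    by (subst integrable_restrict_space) (auto simp: eq[unfolded real_scaleR_def])
qed

lemma absolutely_integrable_vec_nth:
  fixes u :: "real^2 \<Rightarrow> real^2"
  shows "u absolutely_integrable_on C \<Longrightarrow> (\<lambda>x. u x $ i) absolutely_integrable_on C"
  by (auto simp: o_def dest!: absolutely_integrable_linear[OF _ bounded_linear_vec_nth, of _ _ i])

lemma absolutely_integrable_mat_nth:
  fixes G :: "real^2 \<Rightarrow> real^2^2"
  assumes "G absolutely_integrable_on C" shows "(\<lambda>x. G x $ i $ j) absolutely_integrable_on C"
  using absolutely_integrable_linear[OF assms bounded_linear_vec_nth, of i]
  by (auto simp: o_def intro: absolutely_integrable_vec_nth)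

lemma weak_gradient_integrable:
  assumes "has_weak_gradient U u G" "test_function U \<phi> g" "U \<in> sets lebesgue"
  shows "integrable (lebesgue_on U) (\<lambda>x. u x $ i * g x $ j)"
    "integrable (lebesgue_on U) (\<lambda>x. G x $ i $ j * \<phi> x)"
proof -
  let ?C = "closure {x. \<phi> x \<noteq> 0}"
  have C: "compact ?C" "?C \<subseteq> U" and c1: "C1_fun \<phi> g" using assms(2) by (auto simp: test_function_iff)
  have ui: "(\<lambda>x. u x $ i) absolutely_integrable_on ?C" "(\<lambda>x. G x $ i $ j) absolutely_integrable_on ?C"
    using assms(1) C by (auto simp: has_weak_gradient_def intro: absolutely_integrable_vec_nth absolutely_integrable_mat_nth)
  show "integrable (lebesgue_on U) (\<lambda>x. u x $ i * g x $ j)"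
  proof (rule integrable_mult_test[OF assms(3) C ui(1)])
    show "continuous_on UNIV (\<lambda>x. g x $ j)"
      by (rule C1_fun_grad_continuous[OF c1])
    show "g x $ j = 0" if "x \<notin> ?C" for x using test_function_0(1)[OF assms(2) that] by simp
  qed
  show "integrable (lebesgue_on U) (\<lambda>x. G x $ i $ j * \<phi> x)"
    using test_function_0(2)[OF assms(2)]
    by (rule integrable_mult_test[OF assms(3) C ui(2) C1_fun_continuous[OF c1]])
qed

lemma has_weak_gradient_diff:
  assumes "has_weak_gradient U u G" "has_weak_gradient U v H" "U \<in> sets lebesgue"
  shows "has_weak_gradient U (\<lambda>x. u x - v x) (\<lambda>x. G x - H x)"
  unfolding has_weak_gradient_def
proof (intro conjI allI impI)
  fix C assume "compact C \<and> C \<subseteq> U"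
  then show "(\<lambda>x. u x - v x) absolutely_integrable_on C" "(\<lambda>x. G x - H x) absolutely_integrable_on C"
    using assms(1,2) by (auto simp: has_weak_gradient_def)
next
  fix \<phi> g i j assume t: "test_function U \<phi> g"
  have "(LINT x|lebesgue_on U. u x $ i * g x $ j) = - (LINT x|lebesgue_on U. G x $ i $ j * \<phi> x)"
    "(LINT x|lebesgue_on U. v x $ i * g x $ j) = - (LINT x|lebesgue_on U. H x $ i $ j * \<phi> x)"
    using assms(1,2) t by (auto simp: has_weak_gradient_def)
  then show "(LINT x|lebesgue_on U. (u x - v x) $ i * g x $ j) = - (LINT x|lebesgue_on U. (G x - H x) $ i $ j * \<phi> x)"
    using weak_gradient_integrable[OF assms(1) t assms(3)] weak_gradient_integrable[OF assms(2) t assms(3)]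
    by (simp add: left_diff_distrib)
qed

lemma absolutely_integrable_compact:
  fixes f :: "real^2 \<Rightarrow> 'b::euclidean_space"
  assumes "continuous_on UNIV f" "compact C"
  shows "f absolutely_integrable_on C"
proof -
  obtain a where "C \<subseteq> cbox (- a) a"
    using assms(2) compact_imp_bounded bounded_subset_cbox_symmetric by metis
  moreover have "f absolutely_integrable_on cbox (- a) a"
    using assms(1) continuous_on_subset by (blast intro: absolutely_integrable_continuous)
  ultimately show ?thesis using assms(2) by (meson set_integrable_subset lmeasurable_compact fmeasurableD)
qed

text \<open>A test function times a component of the affine map has compact support, so the integral of its \<open>j\<close>-th
  derivative vanishes, and the product rule gives the identity.\<close>

lemma has_weak_gradient_linear:
  assumes U: "U \<in> sets lebesgue"
  shows "has_weak_gradient U (\<lambda>x. M *v x) (\<lambda>_. M)"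
  unfolding has_weak_gradient_def
proof (intro conjI allI impI)
  fix C assume C: "compact C \<and> C \<subseteq> U"
  show "(\<lambda>x. M *v x) absolutely_integrable_on C" "(\<lambda>_. M) absolutely_integrable_on C"
    using C absolutely_integrable_compact[OF linear_continuous_on[OF matrix_vector_mul_bounded_linear[of M]]]
      absolutely_integrable_compact[OF continuous_on_const[of UNIV M]] by blast+
next
  fix \<phi> g i j assume t: "test_function U \<phi> g"
  have c1: "C1_fun \<phi> g" and C: "compact (closure {x. \<phi> x \<noteq> 0})" "closure {x. \<phi> x \<noteq> 0} \<subseteq> U"
    using t by (auto simp: test_function_iff)
  have w: "C1_fun (\<lambda>x. (M *v x) $ i) (\<lambda>_. M $ i)"
    unfolding C1_fun_def matrix_vector_mul_component
    by (intro conjI allI bounded_linear_imp_has_derivative bounded_linear_inner_right continuous_on_const)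
  note p = C1_fun_mult[OF w c1]
  have sub: "closure {x. (M *v x) $ i * \<phi> x \<noteq> 0} \<subseteq> closure {x. \<phi> x \<noteq> 0}"
    by (rule closure_mono) auto
  then have "compact (closure {x. (M *v x) $ i * \<phi> x \<noteq> 0})"
    using C(1) by (meson bounded_subset closed_closure compact_eq_bounded_closed)
  from integral_partial_derivative_0[OF p this, of j]
  have "(LINT x|lborel. (M *v x) $ i * g x $ j + \<phi> x * M $ i $ j) = 0" by simp
  moreover have "continuous_on UNIV (\<lambda>x. (M *v x) $ i * g x $ j + \<phi> x * M $ i $ j)"
    by (intro continuous_on_add continuous_on_mult continuous_on_const C1_fun_continuous[OF c1]
        C1_fun_continuous[OF w]) (rule C1_fun_grad_continuous[OF c1])
  then have "(\<lambda>x. (M *v x) $ i * g x $ j + \<phi> x * M $ i $ j) \<in> borel_measurable lborel"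
    by (subst measurable_cong_sets[OF sets_lborel refl]) (rule borel_measurable_continuous_onI)
  ultimately have "(LINT x|lebesgue. (M *v x) $ i * g x $ j + \<phi> x * M $ i $ j) = 0"
    by (simp only: integral_completion)
  then have z: "(LINT x|lebesgue_on U. (M *v x) $ i * g x $ j + \<phi> x * M $ i $ j) = 0"
  proof (subst integral_lebesgue_on_support[OF U])
    show "(M *v x) $ i * g x $ j + \<phi> x * M $ i $ j = 0" if "x \<notin> U" for x
    proof -
      have "x \<notin> closure {x. \<phi> x \<noteq> 0}" using C(2) that by blast
      from test_function_0[OF t this] show ?thesis by simp
    qed
  qed
  have "integrable (lebesgue_on U) (\<lambda>x. (M *v x) $ i * g x $ j)"
  proof (rule integrable_mult_test[OF U C])
    show "(\<lambda>x. (M *v x) $ i) absolutely_integrable_on closure {x. \<phi> x \<noteq> 0}"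
      using C1_fun_continuous[OF w] C(1) by (rule absolutely_integrable_compact)
    show "continuous_on UNIV (\<lambda>x. g x $ j)" by (rule C1_fun_grad_continuous[OF c1])
    show "g x $ j = 0" if "x \<notin> closure {x. \<phi> x \<noteq> 0}" for x using test_function_0(1)[OF t that] by simp
  qed
  moreover have "integrable (lebesgue_on U) (\<lambda>x. M $ i $ j * \<phi> x)"
  proof (rule integrable_mult_test[OF U C])
    show "(\<lambda>x. M $ i $ j) absolutely_integrable_on closure {x. \<phi> x \<noteq> 0}"
      using C(1) by (intro absolutely_integrable_compact continuous_on_const)
  qed (use test_function_0(2)[OF t] C1_fun_continuous[OF c1] in blast)+
  ultimately show "(LINT x|lebesgue_on U. (M *v x) $ i * g x $ j) = - (LINT x|lebesgue_on U. M $ i $ j * \<phi> x)"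
    using z by (simp add: mult.commute[of "\<phi> _"])
qed

lemma integrable_bounded_lebesgue_on:
  fixes f :: "real^2 \<Rightarrow> 'b::{banach, second_countable_topology}"
  assumes "B \<in> lmeasurable" "f \<in> borel_measurable (lebesgue_on B)" "AE x in lebesgue_on B. norm (f x) \<le> C"
  shows "integrable (lebesgue_on B) f"
  using finite_measure.integrable_const_bound[OF finite_measure_lebesgue_on[OF assms(1)] assms(3,2)] .

lemma integrable_continuous_box:
  fixes f :: "real^2 \<Rightarrow> real"
  assumes "continuous_on (cbox a b) f"
  shows "integrable (lebesgue_on (box a b)) f"
proof -
  obtain K where K: "\<And>x. x \<in> cbox a b \<Longrightarrow> norm (f x) \<le> K"
    using continuous_bounded_on_compact[OF compact_cbox assms] by blast
  show ?thesis
  proof (rule integrable_bounded_lebesgue_on)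
    show "f \<in> borel_measurable (lebesgue_on (box a b))"
      by (rule continuous_imp_measurable_on_sets_lebesgue[OF continuous_on_subset[OF assms box_subset_cbox]]) simp
    show "AE x in lebesgue_on (box a b). norm (f x) \<le> K"
      using K box_subset_cbox[of a b] by (intro AE_I2) auto
  qed simp
qed

lemma integral_indicator_lebesgue_on:
  assumes "Q \<in> lmeasurable" "B \<in> sets lebesgue"
  shows "integrable (lebesgue_on B) (indicator Q :: _ \<Rightarrow> real)"
    "(LINT x|lebesgue_on B. indicator Q x) = measure lebesgue (B \<inter> Q)"
    "(LINT x|lebesgue_on B. indicator Q x) \<le> measure lebesgue Q"
proof -
  have eq: "(\<lambda>x. indicator B x *\<^sub>R indicator Q x) = (indicator (B \<inter> Q) :: _ \<Rightarrow> real)"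
    by (auto simp: indicator_def fun_eq_iff)
  have BQ: "B \<inter> Q \<in> lmeasurable" using fmeasurable_Int_fmeasurable[OF assms] by (simp add: inf_commute)
  show "integrable (lebesgue_on B) (indicator Q :: _ \<Rightarrow> real)"
    using assms(2) BQ by (subst integrable_restrict_space) (auto simp: eq[unfolded real_scaleR_def] fmeasurable_def intro!: integrable_real_indicator)
  show 2: "(LINT x|lebesgue_on B. indicator Q x) = measure lebesgue (B \<inter> Q)"
    using assms(2) by (subst integral_restrict_space) (auto simp: eq[unfolded real_scaleR_def])
  show "(LINT x|lebesgue_on B. indicator Q x) \<le> measure lebesgue Q"
    unfolding 2 using assms BQ by (intro measure_mono_fmeasurable) auto
qed

lemma cbox_shrink_subset:
  fixes a b :: "real^2"
  assumes "\<epsilon> > 0" shows "cbox (a + vec \<epsilon>) (b - vec \<epsilon>) \<subseteq> box a b"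
proof
  fix x assume "x \<in> cbox (a + vec \<epsilon>) (b - vec \<epsilon>)"
  then have "a $ k + \<epsilon> \<le> x $ k \<and> x $ k \<le> b $ k - \<epsilon>" for k by (auto simp: mem_box_cart)
  with assms show "x \<in> box a b" by (smt (verit) mem_box_cart(1))
qed

lemma box_cutoff_tendsto:
  assumes "x \<in> box a b" "e \<longlonglongrightarrow> 0" "\<And>n. e n > 0"
  shows "(\<lambda>n. box_cutoff (e n) a b x) \<longlonglongrightarrow> 1"
proof (rule tendsto_eventually)
  define d where "d = min (min (x$1 - a$1) (b$1 - x$1)) (min (x$2 - a$2) (b$2 - x$2))"
  have "d > 0" using assms(1) by (auto simp: d_def mem_box_cart forall_2)
  then have "\<forall>\<^sub>F n in sequentially. e n < d / 2" by (intro order_tendstoD(2)[OF assms(2)]) auto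
  then show "\<forall>\<^sub>F n in sequentially. box_cutoff (e n) a b x = 1"
  proof eventually_elim
    case (elim n)
    then show ?case by (intro box_cutoff_1 assms(3)) (auto simp: d_def mem_box_cart forall_2)
  qed
qed

text \<open>A function with zero boundary values can be tested with functions that do not vanish on the boundary.
  Multiply the test function by a cutoff at distance \<open>\<epsilon>\<close> from the boundary. The cutoff's derivative
  is of order \<open>1 / \<epsilon>\<close> on layers of area of order \<open>\<epsilon>\<close>, and the function is uniformly small
  there, so the extra term vanishes in the limit.\<close>

lemma integration_by_parts_zero_trace:
  fixes v :: "real^2 \<Rightarrow> real^2" and G :: "real^2 \<Rightarrow> real^2^2"
  assumes ne: "box a b \<noteq> {}"
    and cont: "continuous_on (cbox a b) v"
    and zero: "\<forall>x\<in>cbox a b - box a b. v x = 0"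
    and wg: "has_weak_gradient (box a b) v G"
    and Gm: "G \<in> borel_measurable (lebesgue_on (box a b))"
    and Gb: "AE x in lebesgue_on (box a b). norm (G x) \<le> C"
    and c1: "C1_fun \<phi> g"
  shows "integrable (lebesgue_on (box a b)) (\<lambda>x. v x $ i * g x $ j)"
    "integrable (lebesgue_on (box a b)) (\<lambda>x. G x $ i $ j * \<phi> x)"
    "(LINT x|lebesgue_on (box a b). v x $ i * g x $ j) = - (LINT x|lebesgue_on (box a b). G x $ i $ j * \<phi> x)"
proof -
  let ?B = "box a b" and ?M = "lebesgue_on (box a b)"
  have ab: "a $ i < b $ i" for i using ne by (simp add: interval_ne_empty_cart)
  define e where "e n = 1 / real (Suc n)" for n
  have e: "e n > 0" "e \<longlonglongrightarrow> 0" for n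
    using LIMSEQ_inverse_real_of_nat by (auto simp: e_def[abs_def] inverse_eq_divide)
  have vi: "continuous_on (cbox a b) (\<lambda>x. v x $ i)" by (rule continuous_on_component[OF cont])
  obtain K where K: "K > 0" "\<And>x. x \<in> cbox a b \<Longrightarrow> norm (\<phi> x) \<le> K"
    using continuous_bounded_on_compact[OF compact_cbox C1_fun_continuous[OF c1]] by blast
  define \<eta> where "\<eta> n = box_cutoff (e n) a b" for n
  define \<eta>' where "\<eta>' n = box_cutoff_grad (e n) a b" for n
  have \<eta>: "C1_fun (\<eta> n) (\<eta>' n)" for n by (simp add: \<eta>_def \<eta>'_def C1_box_cutoff)
  have \<eta>01: "0 \<le> \<eta> n x" "\<eta> n x \<le> 1" for n x by (simp_all add: \<eta>_def box_cutoff_nonneg box_cutoff_le)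
  have \<eta>lim: "(\<lambda>n. \<eta> n x) \<longlonglongrightarrow> 1" if "x \<in> ?B" for x
    unfolding \<eta>_def by (rule box_cutoff_tendsto[OF that e(2) e(1)])
  \<comment> \<open>The product rule for the test function times the cutoff: \<open>f1\<close> carries the derivative of the cutoff.\<close>
  define f1 where "f1 n x = v x $ i * (\<phi> x * \<eta>' n x $ j)" for n x
  define f2 where "f2 n x = v x $ i * (\<eta> n x * g x $ j)" for n x
  define f3 where "f3 n x = G x $ i $ j * (\<phi> x * \<eta> n x)" for n x
  have i1: "integrable ?M (f1 n)" for n
    unfolding f1_def[abs_def]
    by (intro integrable_continuous_box continuous_on_mult vi C1_fun_continuous[OF c1] C1_fun_grad_continuous[OF \<eta>])
  have i2: "integrable ?M (f2 n)" for n
    unfolding f2_def[abs_def]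
    by (intro integrable_continuous_box continuous_on_mult vi C1_fun_continuous[OF \<eta>] C1_fun_grad_continuous[OF c1])
  have i2': "integrable ?M (\<lambda>x. v x $ i * g x $ j)"
    by (intro integrable_continuous_box continuous_on_mult vi C1_fun_grad_continuous[OF c1])
  have m: "\<psi> \<in> borel_measurable ?M" if "continuous_on UNIV \<psi>" for \<psi> :: "real^2 \<Rightarrow> real"
    using that by (intro continuous_imp_measurable_on_sets_lebesgue) (auto intro: continuous_on_subset)
  have Gij: "(\<lambda>x. G x $ i $ j) \<in> borel_measurable ?M"
    using Gm by (rule measurable_compose) (intro borel_measurable_continuous_onI continuous_intros)
  have i3': "integrable ?M (\<lambda>x. G x $ i $ j * \<phi> x)"
  proof (rule integrable_bounded_lebesgue_on)
    show "(\<lambda>x. G x $ i $ j * \<phi> x) \<in> borel_measurable ?M"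
      using Gij m[OF C1_fun_continuous[OF c1]] by (rule borel_measurable_times)
    have "AE x in ?M. x \<in> ?B" by (rule AE_I2) simp
    with Gb show "AE x in ?M. norm (G x $ i $ j * \<phi> x) \<le> C * K"
    proof eventually_elim
      case (elim x)
      have "norm (G x $ i $ j) \<le> C"
        using Finite_Cartesian_Product.norm_nth_le[of "G x $ i" j] Finite_Cartesian_Product.norm_nth_le[of "G x" i] elim(1) by linarith
      moreover have "norm (\<phi> x) \<le> K" using K(2) elim(2) box_subset_cbox by blast
      ultimately show ?case unfolding norm_mult by (intro mult_mono) (auto intro: order_trans[OF norm_ge_zero])
    qed
  qed simp
  have eq: "(LINT x|?M. f1 n x) + (LINT x|?M. f2 n x) = - (LINT x|?M. f3 n x)" for n
  proof -
    from test_function_box_cutoff[OF c1 e(1)[of n] cbox_shrink_subset[OF e(1)[of n]]]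
    have tf: "test_function ?B (\<lambda>x. \<phi> x * \<eta> n x) (\<lambda>x. \<phi> x *\<^sub>R \<eta>' n x + \<eta> n x *\<^sub>R g x)"
      by (simp add: \<eta>_def \<eta>'_def)
    have "(LINT x|?M. v x $ i * (\<phi> x *\<^sub>R \<eta>' n x + \<eta> n x *\<^sub>R g x) $ j) = - (LINT x|?M. G x $ i $ j * (\<phi> x * \<eta> n x))"
      using wg tf unfolding has_weak_gradient_def by blast
    moreover have "(\<lambda>x. v x $ i * (\<phi> x *\<^sub>R \<eta>' n x + \<eta> n x *\<^sub>R g x) $ j) = (\<lambda>x. f1 n x + f2 n x)"
      by (simp add: f1_def f2_def distrib_left fun_eq_iff)
    ultimately show ?thesis using i1 i2 by (simp add: f3_def)
  qed
  have l2: "(\<lambda>n. LINT x|?M. f2 n x) \<longlonglongrightarrow> (LINT x|?M. v x $ i * g x $ j)"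
  proof (rule integral_dominated_convergence[where w="\<lambda>x. \<bar>v x $ i * g x $ j\<bar>"])
    show "AE x in ?M. (\<lambda>n. f2 n x) \<longlonglongrightarrow> v x $ i * g x $ j"
      using \<eta>lim by (intro AE_I2) (auto simp: f2_def intro!: tendsto_eq_intros)
    show "AE x in ?M. norm (f2 n x) \<le> \<bar>v x $ i * g x $ j\<bar>" for n
      using \<eta>01[of n] by (intro AE_I2) (auto simp: f2_def abs_mult intro!: mult_left_mono mult_left_le_one_le)
  qed (use i2 i2' in auto)
  have l3: "(\<lambda>n. LINT x|?M. f3 n x) \<longlonglongrightarrow> (LINT x|?M. G x $ i $ j * \<phi> x)"
  proof (rule integral_dominated_convergence[where w="\<lambda>x. \<bar>G x $ i $ j * \<phi> x\<bar>"])
    show "AE x in ?M. (\<lambda>n. f3 n x) \<longlonglongrightarrow> G x $ i $ j * \<phi> x"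
      using \<eta>lim by (intro AE_I2) (auto simp: f3_def intro!: tendsto_eq_intros)
    show "AE x in ?M. norm (f3 n x) \<le> \<bar>G x $ i $ j * \<phi> x\<bar>" for n
      using \<eta>01[of n] by (intro AE_I2) (auto simp: f3_def abs_mult intro!: mult_left_mono mult_right_le_one_le)
    show "f3 n \<in> borel_measurable ?M" for n
      unfolding f3_def[abs_def] by (intro borel_measurable_times Gij m C1_fun_continuous[OF c1] C1_fun_continuous[OF \<eta>])
  qed (use i3' in auto)
  have l1: "(\<lambda>n. LINT x|?M. f1 n x) \<longlonglongrightarrow> 0"
  proof (rule LIMSEQ_I)
    fix r :: real assume "r > 0"
    define l where "l = b $ perp j - a $ perp j"
    have l: "l > 0" using ab[of "perp j"] by (simp add: l_def)
    define e' where "e' = r / (4 * K * l + 1)"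
    have e': "e' > 0" using \<open>r > 0\<close> K(1) l by (simp add: e'_def add_pos_pos)
    obtain d where d: "d > 0" "\<And>x x'. x \<in> cbox a b \<Longrightarrow> x' \<in> cbox a b \<Longrightarrow> dist x' x < d \<Longrightarrow> dist (v x') (v x) < e'"
      using compact_uniformly_continuous[OF cont compact_cbox] e' unfolding uniformly_continuous_on_def by metis
    have "\<forall>\<^sub>F n in sequentially. e n < d / 2" using d(1) by (intro order_tendstoD(2)[OF e(2)]) auto
    then obtain N where N: "\<And>n. n \<ge> N \<Longrightarrow> e n < d / 2" unfolding eventually_sequentially by blast
    have "norm ((LINT x|?M. f1 n x) - 0) < r" if "n \<ge> N" for n
    proof -
      have en: "0 < e n" "2 * e n < d" using e(1)[of n] N[OF that] by auto
      obtain c1 d1 where Q1: "{x \<in> cbox a b. a$j + e n \<le> x $ j \<and> x $ j \<le> a$j + 2 * e n} \<subseteq> cbox c1 d1"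
        "measure lebesgue (cbox c1 d1) = (a$j + 2 * e n - (a$j + e n)) * (b $ perp j - a $ perp j)"
        by (rule strip_subset_box[of "a$j + e n" "a$j + 2 * e n" a b j]) (use en less_imp_le[OF ab] in auto)
      obtain c2 d2 where Q2: "{x \<in> cbox a b. b$j - 2 * e n \<le> x $ j \<and> x $ j \<le> b$j - e n} \<subseteq> cbox c2 d2"
        "measure lebesgue (cbox c2 d2) = (b$j - e n - (b$j - 2 * e n)) * (b $ perp j - a $ perp j)"
        by (rule strip_subset_box[of "b$j - 2 * e n" "b$j - e n" a b j]) (use en less_imp_le[OF ab] in auto)
      \<comment> \<open>Within distance \<open>2 * e n\<close> of an edge, \<open>v\<close> is compared with its value zero at the nearest point of that edge.\<close>
      have small: "\<bar>v x $ i\<bar> \<le> e'" if x: "x \<in> ?B" and y: "y = a $ j \<or> y = b $ j" "\<bar>x $ j - y\<bar> \<le> 2 * e n" for x y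
      proof -
        define x' where "x' = (\<chi> k. if k = j then y else x $ k)"
        have "x' \<in> cbox a b - ?B"
          using x y(1) ab[of j] by (auto simp: x'_def mem_box_cart less_imp_le)
        moreover have "dist x x' = \<bar>x $ j - y\<bar>"
          using exhaust_2[of j] by (auto simp: x'_def dist_norm norm_vec_def L2_set_def sum_2)
        ultimately have "dist (v x) (v x') < e'" "v x' = 0"
          using d(2)[of x' x] x y(2) en box_subset_cbox zero by (auto simp: subset_iff)
        then show ?thesis using Finite_Cartesian_Product.norm_nth_le[of "v x" i] by simp
      qed
      have "norm (LINT x|?M. f1 n x) \<le> (LINT x|?M. e' * K * (2 / e n) * (indicator (cbox c1 d1) x + indicator (cbox c2 d2) x))"
      proof (rule Bochner_Integration.integral_norm_bound_integral[OF i1])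
        show "integrable ?M (\<lambda>x. e' * K * (2 / e n) * (indicator (cbox c1 d1) x + indicator (cbox c2 d2) x))"
          by (intro integrable_mult_right Bochner_Integration.integrable_add integral_indicator_lebesgue_on) auto
        fix x assume "x \<in> space ?M"
        then have x: "x \<in> ?B" by simp
        then have xc: "x \<in> cbox a b" using box_subset_cbox by blast
        let ?I = "indicator {a$j + e n..a$j + 2 * e n} (x$j) + indicator {b$j - 2 * e n..b$j - e n} (x$j) :: real"
        have \<eta>b: "\<bar>\<eta>' n x $ j\<bar> \<le> 2 / e n * ?I"
          unfolding \<eta>'_def by (rule box_cutoff_grad_bound[OF en(1)])
        have "\<bar>v x $ i\<bar> * ?I \<le> e' * ?I"
        proof (cases "?I = 0")
          case False
          then have "x $ j \<in> {a$j + e n..a$j + 2 * e n} \<or> x $ j \<in> {b$j - 2 * e n..b$j - e n}"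
            by (metis add.right_neutral indicator_simps(2))
          then have "\<bar>x $ j - a $ j\<bar> \<le> 2 * e n \<or> \<bar>x $ j - b $ j\<bar> \<le> 2 * e n" using en by auto
          then have "\<bar>v x $ i\<bar> \<le> e'" using small[OF x] by blast
          then show ?thesis by (intro mult_right_mono) auto
        qed simp
        have "norm (f1 n x) = \<bar>v x $ i\<bar> * (\<bar>\<phi> x\<bar> * \<bar>\<eta>' n x $ j\<bar>)" by (simp add: f1_def abs_mult)
        also have "\<dots> \<le> \<bar>v x $ i\<bar> * (K * (2 / e n * ?I))"
          using \<eta>b K(2)[OF xc] K(1) by (intro mult_left_mono mult_mono) auto
        also have "\<dots> = K * (2 / e n) * (\<bar>v x $ i\<bar> * ?I)" by (simp add: mult_ac)
        also have "\<dots> \<le> K * (2 / e n) * (e' * ?I)"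
          using K(1) en by (intro mult_left_mono \<open>\<bar>v x $ i\<bar> * ?I \<le> e' * ?I\<close>) auto
        also have "\<dots> = e' * K * (2 / e n) * ?I" by (simp add: mult_ac)
        also have "\<dots> \<le> e' * K * (2 / e n) * (indicator (cbox c1 d1) x + indicator (cbox c2 d2) x)"
          using Q1(1) Q2(1) xc e' K(1) en
          by (intro mult_left_mono add_mono) (auto simp: indicator_def)
        finally show "norm (f1 n x) \<le> \<dots>" .
      qed
      also have "\<dots> = e' * K * (2 / e n) * ((LINT x|?M. indicator (cbox c1 d1) x) + (LINT x|?M. indicator (cbox c2 d2) x))"
        by (simp add: integral_indicator_lebesgue_on(1))
      also have "\<dots> \<le> e' * K * (2 / e n) * (e n * l + e n * l)"
        using integral_indicator_lebesgue_on(3)[of "cbox c1 d1" ?B] integral_indicator_lebesgue_on(3)[of "cbox c2 d2" ?B]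
          Q1(2) Q2(2) e' K(1) en by (intro mult_left_mono add_mono) (auto simp: l_def)
      also have "\<dots> = e' * (4 * K * l)" using en by (simp add: field_simps)
      also have "\<dots> < r"
      proof -
        have "4 * K * l > 0" using K(1) l by simp
        then show ?thesis using \<open>r > 0\<close> by (simp add: e'_def field_simps)
      qed
      finally show ?thesis by simp
    qed
    then show "\<exists>no. \<forall>n\<ge>no. norm ((LINT x|?M. f1 n x) - 0) < r" by blast
  qed
  have "(\<lambda>n. - (LINT x|?M. f3 n x)) \<longlonglongrightarrow> 0 + (LINT x|?M. v x $ i * g x $ j)"
    using tendsto_add[OF l1 l2] unfolding eq .
  from LIMSEQ_unique[OF this tendsto_minus[OF l3]]
  show "(LINT x|?M. v x $ i * g x $ j) = - (LINT x|?M. G x $ i $ j * \<phi> x)" by simp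
  show "integrable ?M (\<lambda>x. v x $ i * g x $ j)" "integrable ?M (\<lambda>x. G x $ i $ j * \<phi> x)" by fact+
qed

text \<open>The Poincare inequality in the uniform norm: a function with zero boundary values and gradient at most
  \<open>C\<close> is at most of order \<open>C\<close> times the width of the box in any direction. Only a weak gradient is given, so the
  integration along lines is replaced by a test function that is a step in direction \<open>j\<close> and a thin cutoff
  across it; its \<open>j\<close>-th derivative concentrates at \<open>x0\<close>. The factor 12 comes from the
  shape of that test function.\<close>

lemma zero_trace_bound:
  fixes v :: "real^2 \<Rightarrow> real^2" and G :: "real^2 \<Rightarrow> real^2^2"
  assumes ne: "box a b \<noteq> {}"
    and cont: "continuous_on (cbox a b) v"
    and zero: "\<forall>x\<in>cbox a b - box a b. v x = 0"
    and wg: "has_weak_gradient (box a b) v G"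
    and Gm: "G \<in> borel_measurable (lebesgue_on (box a b))"
    and Gb: "AE x in lebesgue_on (box a b). norm (G x) \<le> C" and C: "C \<ge> 0"
    and x0: "x0 \<in> box a b"
  shows "\<bar>v x0 $ i\<bar> \<le> 12 * C * (b $ j - a $ j)"
proof (cases "v x0 $ i = 0")
  case True
  have "a $ j < b $ j" using ne by (simp add: interval_ne_empty_cart)
  then show ?thesis using True C by simp
next
  case False
  let ?B = "box a b" and ?M = "lebesgue_on (box a b)"
  have ab: "a $ i < b $ i" for i using ne by (simp add: interval_ne_empty_cart)
  define m where "m = \<bar>v x0 $ i\<bar>"
  \<comment> \<open>The sign makes the component positive at \<open>x0\<close>.\<close>
  define s where "s = sgn (v x0 $ i)"
  have m: "m > 0" "s * v x0 $ i = m" "\<bar>s\<bar> = 1" using False by (auto simp: m_def s_def sgn_if)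
  define k where "k = perp j"
  have k: "k \<noteq> j" "j \<noteq> k" "perp k = j" by (simp_all add: k_def perp_neq perp_perp)
  have "continuous_on ?B (\<lambda>x. s * v x $ i)"
    using continuous_on_subset[OF cont box_subset_cbox] by (intro continuous_on_mult continuous_on_const continuous_on_component)
  then have "((\<lambda>x. s * v x $ i) \<longlongrightarrow> s * v x0 $ i) (nhds x0)"
    using x0 tendsto_at_iff_tendsto_nhds[of "\<lambda>x. s * v x $ i" x0]
    by (simp add: continuous_on_eq_continuous_at[OF open_box] isCont_def)
  then have "\<forall>\<^sub>F x in nhds x0. m / 2 < s * v x $ i"
    by (rule order_tendstoD(1)) (use m in simp)
  moreover have "\<forall>\<^sub>F x in nhds x0. x \<in> ?B" using x0 by (intro eventually_nhds_in_open) auto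
  ultimately have "\<forall>\<^sub>F x in nhds x0. x \<in> ?B \<and> m / 2 < s * v x $ i" by eventually_elim auto
  then obtain d where d: "d > 0" "\<And>x. dist x x0 < d \<Longrightarrow> x \<in> ?B \<and> m / 2 < s * v x $ i"
    unfolding eventually_nhds_metric by blast
  define \<epsilon> where "\<epsilon> = d / 10"
  have \<epsilon>: "\<epsilon> > 0" using d(1) by (simp add: \<epsilon>_def)
  have near: "x \<in> ?B \<and> m / 2 < s * v x $ i" if "\<bar>x $ j - x0 $ j\<bar> \<le> 3 * \<epsilon>" "\<bar>x $ k - x0 $ k\<bar> \<le> 3 * \<epsilon>" for x
  proof (rule d(2))
    have "dist x x0 \<le> (\<Sum>l\<in>UNIV. \<bar>(x - x0) $ l\<bar>)" unfolding dist_norm by (rule norm_le_l1_cart)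
    also have "\<dots> = \<bar>x $ j - x0 $ j\<bar> + \<bar>x $ k - x0 $ k\<bar>"
      using exhaust_2[of j] by (auto simp: k_def perp_def sum_2)
    also have "\<dots> < d" using that d(1) by (simp add: \<epsilon>_def)
    finally show "dist x x0 < d" .
  qed
  define p where "p = x0 $ k - \<epsilon>"
  \<comment> \<open>In direction \<open>j\<close> a step just after \<open>x0\<close>, in direction \<open>k\<close> a cutoff of width of order \<open>\<epsilon>\<close> around \<open>x0\<close>.\<close>
  define \<phi> where "\<phi> x = step ((x $ j - x0 $ j) * (1 / \<epsilon>)) * cutoff \<epsilon> p (p + 5 * \<epsilon>) (x $ k)" for x :: "real^2"
  define g where "g x = step ((x $ j - x0 $ j) * (1 / \<epsilon>)) *\<^sub>R (cutoff' \<epsilon> p (p + 5 * \<epsilon>) (x $ k) *\<^sub>R (axis k 1 :: real^2))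
    + cutoff \<epsilon> p (p + 5 * \<epsilon>) (x $ k) *\<^sub>R ((tent ((x $ j - x0 $ j) * (1 / \<epsilon>)) * (1 / \<epsilon>)) *\<^sub>R (axis j 1 :: real^2))" for x :: "real^2"
  have c1: "C1_fun \<phi> g"
    unfolding \<phi>_def[abs_def] g_def[abs_def]
  proof (intro C1_fun_mult C1_fun_coordinate DERIV_cutoff)
    show "((\<lambda>t. step ((t - x0 $ j) * (1 / \<epsilon>))) has_real_derivative tent ((t - x0 $ j) * (1 / \<epsilon>)) * (1 / \<epsilon>)) (at t)" for t
      by (rule DERIV_chain2[OF DERIV_step]) (use \<epsilon> in \<open>auto intro!: derivative_eq_intros\<close>)
  qed (intro continuous_intros)+
  have gj: "g x $ j = cutoff \<epsilon> p (p + 5 * \<epsilon>) (x $ k) * (tent ((x $ j - x0 $ j) * (1 / \<epsilon>)) * (1 / \<epsilon>))" for x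
    using k by (simp add: g_def axis_def)
  note parts = integration_by_parts_zero_trace[OF ne cont zero wg Gm Gb c1, where i=i and j=j]
  \<comment> \<open>The box on which the derivative of \<open>\<phi>\<close> is at least \<open>1 / \<epsilon>\<close>.\<close>
  let ?q = "\<chi> l. if l = j then x0 $ j + \<epsilon> / 4 else x0 $ k + \<epsilon>"
  let ?r = "\<chi> l. if l = j then x0 $ j + 3 * \<epsilon> / 4 else x0 $ k + 2 * \<epsilon>"
  let ?Q = "cbox ?q ?r :: (real^2) set"
  have Q: "x0 $ j + \<epsilon> / 4 \<le> x $ j" "x $ j \<le> x0 $ j + 3 * \<epsilon> / 4" "x0 $ k + \<epsilon> \<le> x $ k" "x $ k \<le> x0 $ k + 2 * \<epsilon>"
    if "x \<in> ?Q" for x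
  proof -
    have *: "\<forall>l. ?q $ l \<le> x $ l \<and> x $ l \<le> ?r $ l" using that unfolding mem_box_cart .
    show "x0 $ j + \<epsilon> / 4 \<le> x $ j" "x $ j \<le> x0 $ j + 3 * \<epsilon> / 4" "x0 $ k + \<epsilon> \<le> x $ k" "x $ k \<le> x0 $ k + 2 * \<epsilon>"
      using *[rule_format, of j] *[rule_format, of k] k(1) by simp_all
  qed
  have QB: "?Q \<subseteq> ?B"
  proof
    fix x assume "x \<in> ?Q"
    from Q[OF this] have "\<bar>x $ j - x0 $ j\<bar> \<le> 3 * \<epsilon>" "\<bar>x $ k - x0 $ k\<bar> \<le> 3 * \<epsilon>" using \<epsilon> by linarith+
    then show "x \<in> ?B" using near by blast
  qed
  have mQ: "measure lebesgue ?Q = \<epsilon> / 2 * \<epsilon>"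
    using measure_box_perp(1)[of ?q ?r j] \<epsilon> k by (simp add: k_def[symmetric])
  have lower: "(m / 2) * (1 / \<epsilon>) * indicator ?Q x \<le> s * (v x $ i * g x $ j)" if x: "x \<in> ?B" for x
  proof (cases "0 \<le> x $ j - x0 $ j \<and> x $ j - x0 $ j \<le> \<epsilon> \<and> p + \<epsilon> \<le> x $ k \<and> x $ k \<le> p + 4 * \<epsilon>")
    case True
    then have n: "m / 2 < s * v x $ i" using near[of x] \<epsilon> by (auto simp: p_def)
    have g0: "g x $ j \<ge> 0" unfolding gj using \<epsilon> by (intro mult_nonneg_nonneg cutoff_nonneg tent_nonneg) auto
    have "(1 / \<epsilon>) * indicator ?Q x \<le> g x $ j"
    proof (cases "x \<in> ?Q")
      case inQ: True
      from Q[OF inQ] have "cutoff \<epsilon> p (p + 5 * \<epsilon>) (x $ k) = 1" using \<epsilon> by (intro cutoff_1) (auto simp: p_def)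
      moreover have "1 \<le> tent ((x $ j - x0 $ j) * (1 / \<epsilon>))"
        using Q[OF inQ] \<epsilon> by (intro tent_ge) (auto simp: field_simps)
      ultimately show ?thesis using inQ \<epsilon> unfolding gj by (simp add: field_simps)
    qed (use g0 in simp)
    then have "(m / 2) * ((1 / \<epsilon>) * indicator ?Q x) \<le> (s * v x $ i) * g x $ j"
      using n m \<epsilon> g0 by (intro mult_mono) auto
    then show ?thesis by (simp add: mult_ac)
  next
    case False
    have "tent ((x $ j - x0 $ j) * (1 / \<epsilon>)) = 0 \<or> cutoff \<epsilon> p (p + 5 * \<epsilon>) (x $ k) = 0"
    proof (cases "0 \<le> x $ j - x0 $ j \<and> x $ j - x0 $ j \<le> \<epsilon>")
      case True
      with False have "x $ k \<le> p + \<epsilon> \<or> p + 5 * \<epsilon> - \<epsilon> \<le> x $ k" by auto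
      then show ?thesis using cutoff_0[OF \<epsilon>] by blast
    next
      case F: False
      then have "(x $ j - x0 $ j) * (1 / \<epsilon>) \<le> 0 \<or> 1 \<le> (x $ j - x0 $ j) * (1 / \<epsilon>)"
        using \<epsilon> by (auto simp: field_simps)
      then show ?thesis using tent_0 by blast
    qed
    then have "g x $ j = 0" unfolding gj by auto
    moreover have "x \<notin> ?Q"
    proof
      assume "x \<in> ?Q"
      from Q[OF this] False \<epsilon> show False by (auto simp: p_def)
    qed
    ultimately show ?thesis by simp
  qed
  obtain c1 d1 where Q1: "{x \<in> cbox a b. p + \<epsilon> \<le> x $ k \<and> x $ k \<le> p + 4 * \<epsilon>} \<subseteq> cbox c1 d1"
    "measure lebesgue (cbox c1 d1) = (p + 4 * \<epsilon> - (p + \<epsilon>)) * (b $ perp k - a $ perp k)"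
    by (rule strip_subset_box[of "p + \<epsilon>" "p + 4 * \<epsilon>" a b k]) (use \<epsilon> less_imp_le[OF ab] in auto)
  have upper: "\<bar>\<phi> x\<bar> \<le> indicator (cbox c1 d1) x" if x: "x \<in> ?B" for x
  proof (cases "p + \<epsilon> \<le> x $ k \<and> x $ k \<le> p + 4 * \<epsilon>")
    case True
    then have "x \<in> cbox c1 d1" using Q1(1) x box_subset_cbox[of a b] by blast
    moreover have "\<bar>\<phi> x\<bar> \<le> 1" unfolding \<phi>_def abs_mult
      by (intro mult_le_one) (auto simp: step_nonneg step_le cutoff_nonneg cutoff_le)
    ultimately show ?thesis by simp
  next
    case False
    then have "cutoff \<epsilon> p (p + 5 * \<epsilon>) (x $ k) = 0" by (intro cutoff_0 \<epsilon>) auto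
    then show ?thesis by (simp add: \<phi>_def)
  qed
  have Bs: "?B \<in> sets lebesgue" by simp
  have "(LINT x|?M. indicator ?Q x) = \<epsilon> / 2 * \<epsilon>"
    unfolding integral_indicator_lebesgue_on(2)[OF lmeasurable_cbox Bs] inf_absorb2[OF QB] by (rule mQ)
  then have "(m / 2) * (1 / \<epsilon>) * (\<epsilon> / 2 * \<epsilon>) = (LINT x|?M. (m / 2) * (1 / \<epsilon>) * indicator ?Q x)"
    by (simp only: integral_mult_right_zero)
  also have "\<dots> \<le> (LINT x|?M. s * (v x $ i * g x $ j))"
  proof (rule integral_mono)
    show "integrable ?M (\<lambda>x. (m / 2) * (1 / \<epsilon>) * indicator ?Q x)"
      by (intro integrable_mult_right integral_indicator_lebesgue_on(1) lmeasurable_cbox Bs)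
    show "integrable ?M (\<lambda>x. s * (v x $ i * g x $ j))" by (intro integrable_mult_right parts(1))
  qed (use lower in simp)
  also have "\<dots> = - s * (LINT x|?M. G x $ i $ j * \<phi> x)" unfolding integral_mult_right_zero parts(3) by simp
  also have "\<dots> \<le> \<bar>LINT x|?M. G x $ i $ j * \<phi> x\<bar>" using m(3) by (auto simp: abs_if split: if_splits)
  also have "\<dots> \<le> (LINT x|?M. \<bar>G x $ i $ j * \<phi> x\<bar>)" by (rule integral_abs_bound)
  also have "\<dots> \<le> (LINT x|?M. C * indicator (cbox c1 d1) x)"
  proof (rule integral_mono_AE)
    show "integrable ?M (\<lambda>x. \<bar>G x $ i $ j * \<phi> x\<bar>)" by (rule integrable_abs[OF parts(2)])
    show "integrable ?M (\<lambda>x. C * indicator (cbox c1 d1) x)" by (intro integrable_mult_right integral_indicator_lebesgue_on) auto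
    have "AE x in ?M. x \<in> ?B" by (rule AE_I2) simp
    with Gb show "AE x in ?M. \<bar>G x $ i $ j * \<phi> x\<bar> \<le> C * indicator (cbox c1 d1) x"
    proof eventually_elim
      case (elim x)
      have "\<bar>G x $ i $ j\<bar> \<le> C"
        using Finite_Cartesian_Product.norm_nth_le[of "G x $ i" j] Finite_Cartesian_Product.norm_nth_le[of "G x" i] elim(1) by simp
      then show ?case unfolding abs_mult using upper[OF elim(2)] C by (intro mult_mono) auto
    qed
  qed
  also have "\<dots> = C * (LINT x|?M. indicator (cbox c1 d1) x)" by (rule integral_mult_right_zero)
  also have "\<dots> \<le> C * (3 * \<epsilon> * (b $ j - a $ j))"
    using integral_indicator_lebesgue_on(3)[OF lmeasurable_cbox Bs, of c1 d1]
    unfolding Q1(2) k(3) by (intro mult_left_mono C) simp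
  finally have "m * \<epsilon> \<le> 12 * C * (b $ j - a $ j) * \<epsilon>" using \<epsilon> by (simp add: field_simps)
  then show ?thesis using \<epsilon> by (simp add: m_def)
qed

lemma weak_gradient_entry_integrable:
  assumes "has_weak_gradient U u G" "compact C" "C \<subseteq> U"
  shows "(\<lambda>x. G x $ i $ j) absolutely_integrable_on C"
  using assms by (intro absolutely_integrable_mat_nth) (simp add: has_weak_gradient_def)

lemma weak_gradient_test:
  assumes "has_weak_gradient U u G" "test_function U \<phi> g"
  shows "(LINT x|lebesgue_on U. u x $ i * g x $ j) = - (LINT x|lebesgue_on U. G x $ i $ j * \<phi> x)"
  using assms(1) unfolding has_weak_gradient_def using assms(2) by (elim conjE allE) (erule mp)

text \<open>Test with cutoffs that converge to the indicator of the box.\<close>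

lemma weak_gradient_box_integral:
  assumes "has_weak_gradient U u G" "has_weak_gradient U u H" "U \<in> sets lebesgue" "cbox p q \<subseteq> U"
  shows "(LINT x:box p q|lebesgue. G x $ i $ j) = (LINT x:box p q|lebesgue. H x $ i $ j)"
proof -
  define e where "e n = 1 / real (Suc n)" for n
  have e: "e n > 0" "e \<longlonglongrightarrow> 0" for n
    using LIMSEQ_inverse_real_of_nat by (auto simp: e_def[abs_def] inverse_eq_divide)
  define \<eta> where "\<eta> n = box_cutoff (e n) p q" for n
  have tf: "test_function U (\<lambda>x. 1 * \<eta> n x) (\<lambda>x. 1 *\<^sub>R box_cutoff_grad (e n) p q x + \<eta> n x *\<^sub>R 0)" for n
    unfolding \<eta>_def
  proof (rule test_function_box_cutoff[OF _ e(1)])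
    show "C1_fun (\<lambda>_. 1) (\<lambda>_. 0)"
      unfolding C1_fun_def inner_zero_left by (intro conjI allI has_derivative_const continuous_on_const)
    show "cbox (p + vec (e n)) (q - vec (e n)) \<subseteq> U"
      using cbox_shrink_subset[OF e(1)[of n], of p q] box_subset_cbox[of p q] assms(4) by blast
  qed
  have lim: "(\<lambda>n. LINT x|lebesgue_on U. K x $ i $ j * \<eta> n x) \<longlonglongrightarrow> (LINT x:box p q|lebesgue. K x $ i $ j)"
    if K: "has_weak_gradient U u K" for K
  proof -
    have ac: "integrable lebesgue (\<lambda>x. indicator (cbox p q) x *\<^sub>R K x $ i $ j)"
      using weak_gradient_entry_integrable[OF K compact_cbox assms(4)] unfolding set_integrable_def .
    have z: "\<eta> n x = 0" if "x \<notin> box p q" for n x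
    proof -
      have "x \<notin> box (p + vec (e n)) (q - vec (e n))"
        using that cbox_shrink_subset[OF e(1)[of n], of p q] box_subset_cbox by blast
      then show ?thesis unfolding \<eta>_def using box_cutoff_0[OF e(1)] by blast
    qed
    have z': "\<eta> n x = 0" if "x \<notin> cbox p q" for n x using z[of x n] that box_subset_cbox by blast
    have eq: "(LINT x|lebesgue_on U. K x $ i $ j * \<eta> n x) = (LINT x|lebesgue. indicator (cbox p q) x *\<^sub>R K x $ i $ j * \<eta> n x)" for n
    proof -
      have "(LINT x|lebesgue_on U. K x $ i $ j * \<eta> n x) = (LINT x|lebesgue. K x $ i $ j * \<eta> n x)"
        using assms(3,4) z' by (intro integral_lebesgue_on_support) auto
      also have "\<dots> = (LINT x|lebesgue. indicator (cbox p q) x *\<^sub>R K x $ i $ j * \<eta> n x)"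
        using z' by (intro Bochner_Integration.integral_cong) (auto simp: indicator_def)
      finally show ?thesis .
    qed
    have m: "\<eta> n \<in> borel_measurable lebesgue" for n
      unfolding \<eta>_def using borel_measurable_continuous_onI[OF C1_fun_continuous[OF C1_box_cutoff]] by (simp add: measurable_completion)
    show ?thesis unfolding eq set_lebesgue_integral_def
    proof (rule integral_dominated_convergence[where w="\<lambda>x. \<bar>indicator (cbox p q) x *\<^sub>R K x $ i $ j\<bar>"])
      show "AE x in lebesgue. norm (indicator (cbox p q) x *\<^sub>R K x $ i $ j * \<eta> n x) \<le> \<bar>indicator (cbox p q) x *\<^sub>R K x $ i $ j\<bar>" for n
        by (intro AE_I2) (auto simp: \<eta>_def abs_mult box_cutoff_nonneg box_cutoff_le intro!: mult_right_le_one_le)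
      show "AE x in lebesgue. (\<lambda>n. indicator (cbox p q) x *\<^sub>R K x $ i $ j * \<eta> n x) \<longlonglongrightarrow> indicator (box p q) x *\<^sub>R K x $ i $ j"
      proof (rule AE_I2)
        fix x
        show "(\<lambda>n. indicator (cbox p q) x *\<^sub>R K x $ i $ j * \<eta> n x) \<longlonglongrightarrow> indicator (box p q) x *\<^sub>R K x $ i $ j"
        proof (cases "x \<in> box p q")
          case True
          then have "x \<in> cbox p q" using box_subset_cbox by blast
          then show ?thesis using True tendsto_mult_left[OF box_cutoff_tendsto[OF True e(2) e(1)], of "K x $ i $ j"]
            by (simp add: \<eta>_def)
        qed (simp add: z)
      qed
      show "(\<lambda>x. indicator (box p q) x *\<^sub>R K x $ i $ j) \<in> borel_measurable lebesgue"
      proof -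
        have "(\<lambda>x. indicator (box p q) x *\<^sub>R (indicator (cbox p q) x *\<^sub>R K x $ i $ j)) \<in> borel_measurable lebesgue"
          by (rule borel_measurable_scaleR[OF borel_measurable_indicator borel_measurable_integrable[OF ac]]) simp
        moreover have "(\<lambda>x. indicator (box p q) x *\<^sub>R (indicator (cbox p q) x *\<^sub>R K x $ i $ j)) = (\<lambda>x. indicator (box p q) x *\<^sub>R K x $ i $ j)"
          using box_subset_cbox[of p q] by (auto simp: indicator_def fun_eq_iff)
        ultimately show ?thesis by simp
      qed
      show "(\<lambda>x. indicator (cbox p q) x *\<^sub>R K x $ i $ j * \<eta> n x) \<in> borel_measurable lebesgue" for n
        by (rule borel_measurable_times[OF borel_measurable_integrable[OF ac] m])
      show "integrable lebesgue (\<lambda>x. \<bar>indicator (cbox p q) x *\<^sub>R K x $ i $ j\<bar>)" by (rule integrable_abs[OF ac])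
    qed
  qed
  have "(LINT x|lebesgue_on U. G x $ i $ j * \<eta> n x) = (LINT x|lebesgue_on U. H x $ i $ j * \<eta> n x)" for n
    using weak_gradient_test[OF assms(1) tf[of n], where i=i and j=j] weak_gradient_test[OF assms(2) tf[of n], where i=i and j=j]
    by simp
  then show ?thesis using LIMSEQ_unique[OF lim[OF assms(1)]] lim[OF assms(2)] by simp
qed

lemma One_vec: "(One :: real^2) $ l = 1"
proof -
  have "(One :: real^2) \<bullet> axis l 1 = 1"
    by (subst inner_commute, subst inner_sum_right) (simp add: inner_Basis axis_in_Basis_iff sum.delta)
  then show ?thesis by (simp add: inner_axis)
qed

text \<open>Two weak gradients have equal integrals over all small squares, and by Lebesgue differentiation
  almost every value is the limit of averages over such squares.\<close>

lemma weak_gradient_unique: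
  assumes G: "has_weak_gradient U u G" and H: "has_weak_gradient U u H" and U: "open U"
  shows "AE x in lebesgue_on U. G x = H x"
proof -
  have Us: "U \<in> sets lebesgue" using U by (simp add: borel_open sets_completionI_sets)
  obtain D where D: "countable D" "D \<subseteq> Pow U" "\<And>X. X \<in> D \<Longrightarrow> \<exists>a b. X = cbox a b" "\<Union>D = U"
    using open_countable_Union_open_cbox[OF U] by metis
  have "\<exists>N. negligible N \<and> (\<forall>x\<in>interior X - N. G x $ i $ j = H x $ i $ j)" if X: "X \<in> D" for X and i j
  proof -
    obtain a b where ab: "X = cbox a b" using D(3)[OF X] by blast
    have sub: "cbox a b \<subseteq> U" using D(2) X ab by blast
    define f where "f x = (if x \<in> cbox a b then G x $ i $ j - H x $ i $ j else 0)" for x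
    have GH: "(\<lambda>x. G x $ i $ j) integrable_on cbox a b" "(\<lambda>x. H x $ i $ j) integrable_on cbox a b"
      and GHa: "(\<lambda>x. G x $ i $ j) absolutely_integrable_on cbox a b" "(\<lambda>x. H x $ i $ j) absolutely_integrable_on cbox a b"
      using weak_gradient_entry_integrable[OF G compact_cbox sub] weak_gradient_entry_integrable[OF H compact_cbox sub]
      by (auto simp: absolutely_integrable_on_def)
    have "(\<lambda>x. G x $ i $ j - H x $ i $ j) integrable_on cbox a b"
      by (intro integrable_diff GH)
    then have fU: "f integrable_on UNIV"
      using integrable_restrict_UNIV[of "cbox a b" "\<lambda>x. G x $ i $ j - H x $ i $ j"] unfolding f_def by simp
    then have "f integrable_on cbox c d" for c d
      using integrable_on_subcbox by blast
    then obtain N where N: "negligible N" "\<And>x e. x \<notin> N \<Longrightarrow> 0 < e \<Longrightarrow>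
        \<exists>d>0. \<forall>h. 0 < h \<and> h < d \<longrightarrow> norm (integral (cbox x (x + h *\<^sub>R One)) f /\<^sub>R h ^ DIM(real^2) - f x) < e"
      using integrable_ccontinuous_explicit[of f] by metis
    have "G x $ i $ j = H x $ i $ j" if x: "x \<in> interior X - N" for x
    proof -
      have xb: "x \<in> box a b" using x ab by (simp add: interior_cbox)
      obtain r where r: "r > 0" "ball x r \<subseteq> box a b" using xb open_box open_contains_ball by blast
      have small: "integral (cbox x (x + h *\<^sub>R One)) f = 0" if h: "0 < h" "h < r / 3" for h
      proof -
        have ss: "cbox x (x + h *\<^sub>R One) \<subseteq> cbox a b"
        proof
          fix y assume y: "y \<in> cbox x (x + h *\<^sub>R One)"
          have "dist x y \<le> (\<Sum>l\<in>UNIV. \<bar>(x - y) $ l\<bar>)" unfolding dist_norm by (rule norm_le_l1_cart)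
          also have "\<dots> \<le> (\<Sum>l\<in>(UNIV::2 set). h)"
          proof (rule sum_mono)
            fix l :: 2
            note One_vec[of l]
            then show "\<bar>(x - y) $ l\<bar> \<le> h" using y[unfolded mem_box_cart, rule_format, of l] by (simp del: sum_component)
          qed
          also have "\<dots> < r" using h by simp
          finally show "y \<in> cbox a b" using r(2) box_subset_cbox[of a b] by (auto simp: subset_iff)
        qed
        have "integral (cbox x (x + h *\<^sub>R One)) f = integral (cbox x (x + h *\<^sub>R One)) (\<lambda>x. G x $ i $ j - H x $ i $ j)"
          by (rule integral_cong) (use ss in \<open>auto simp: f_def\<close>)
        also have "\<dots> = integral (cbox x (x + h *\<^sub>R One)) (\<lambda>x. G x $ i $ j) - integral (cbox x (x + h *\<^sub>R One)) (\<lambda>x. H x $ i $ j)"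
          by (rule integral_diff) (use GH ss integrable_on_subcbox in blast)+
        also have "integral (cbox x (x + h *\<^sub>R One)) (\<lambda>x. G x $ i $ j) = integral (cbox x (x + h *\<^sub>R One)) (\<lambda>x. H x $ i $ j)"
        proof -
          have Keq: "integral (cbox x (x + h *\<^sub>R One)) (\<lambda>x. K x $ i $ j) = (LINT y:box x (x + h *\<^sub>R One)|lebesgue. K y $ i $ j)"
            if "(\<lambda>x. K x $ i $ j) absolutely_integrable_on cbox a b" for K :: "real^2 \<Rightarrow> real^2^2"
          proof -
            have "(\<lambda>x. K x $ i $ j) absolutely_integrable_on box x (x + h *\<^sub>R One)"
              using that by (rule set_integrable_subset) (use ss box_subset_cbox in auto)
            then show ?thesis
              by (simp add: set_lebesgue_integral_eq_integral(2) integral_open_interval)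
          qed
          show ?thesis unfolding Keq[OF GHa(1)] Keq[OF GHa(2)]
            by (rule weak_gradient_box_integral[OF G H Us order_trans[OF ss sub]])
        qed
        finally show ?thesis by simp
      qed
      have "\<bar>f x\<bar> < e" if "e > 0" for e
      proof -
        obtain d where d: "d > 0" "\<And>h. 0 < h \<Longrightarrow> h < d \<Longrightarrow> norm (integral (cbox x (x + h *\<^sub>R One)) f /\<^sub>R h ^ DIM(real^2) - f x) < e"
          using N(2)[of x e] x \<open>e > 0\<close> by blast
        define h where "h = min d (r / 3) / 2"
        have "0 < h" "h < d" "h < r / 3" using d(1) r(1) by (auto simp: h_def)
        then show ?thesis using d(2)[of h] small[of h] by simp
      qed
      then have "f x = 0" by (metis zero_less_abs_iff less_irrefl)
      then show ?thesis using xb box_subset_cbox[of a b] by (auto simp: f_def split: if_splits)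
    qed
    with N(1) show ?thesis by blast
  qed
  note ex = this
  define N where "N X i j = (SOME N. negligible N \<and> (\<forall>x\<in>interior X - N. G x $ i $ j = H x $ i $ j))" for X i j
  have N': "negligible (N X i j) \<and> (\<forall>x\<in>interior X - N X i j. G x $ i $ j = H x $ i $ j)" if "X \<in> D" for X i j
    unfolding N_def by (rule someI_ex[OF ex[OF that]])
  then have N: "\<And>X i j. X \<in> D \<Longrightarrow> negligible (N X i j)"
      "\<And>X i j x. X \<in> D \<Longrightarrow> x \<in> interior X - N X i j \<Longrightarrow> G x $ i $ j = H x $ i $ j"
    by blast+
  define Z where "Z = (\<Union>X\<in>D. frontier X \<union> (\<Union>i. \<Union>j. N X i j))"
  have fr: "negligible (frontier X)" if "X \<in> D" for X
    using D(3)[OF that] by (auto intro: negligible_convex_frontier)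
  have "negligible Z"
    unfolding Z_def using D(1) fr N(1)
    by (intro negligible_countable_Union countable_image) (auto intro!: negligible_Un negligible_Union)
  moreover have "G x = H x" if x: "x \<in> U - Z" for x
  proof -
    obtain X where X: "X \<in> D" "x \<in> X" using x D(4) by blast
    have "x \<notin> frontier X" using x X unfolding Z_def by blast
    then have "x \<in> interior X" using X(2) by (auto simp: frontier_def closure_def)
    then have "G x $ i $ j = H x $ i $ j" for i j using N(2)[OF X(1)] x X(1) unfolding Z_def by blast
    then show ?thesis by (simp add: vec_eq_iff)
  qed
  ultimately have "AE x in lebesgue. x \<in> U \<longrightarrow> G x = H x"
    unfolding eventually_ae_filter negligible_iff_null_sets by (auto intro!: bexI[of _ Z])
  then show ?thesis using Us by (subst AE_restrict_space_iff) auto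
qed

section \<open>Boundedness of the wells\<close>

lemma norm_matrix_le:
  fixes F :: "real^2^2"
  assumes "\<And>j. norm (F *v axis j 1) \<le> c"
  shows "norm F \<le> 4 * c"
proof -
  have e: "\<bar>F $ i $ j\<bar> \<le> c" for i j
  proof -
    have "(F *v axis j 1) $ i = F $ i $ j" by (simp add: matrix_vector_mul_component inner_axis)
    then show ?thesis using Finite_Cartesian_Product.norm_nth_le[of "F *v axis j 1" i] assms[of j] by simp
  qed
  have "norm F \<le> (\<Sum>i\<in>UNIV. norm (F $ i))" unfolding norm_vec_def[of F] by (rule L2_set_le_sum) simp
  also have "\<dots> \<le> (\<Sum>i\<in>(UNIV::2 set). \<Sum>j\<in>(UNIV::2 set). c)"
    using e by (intro sum_mono order_trans[OF norm_le_l1_cart]) auto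
  finally show ?thesis by simp
qed

lemma wells_bounded: "\<exists>K. \<forall>F\<in>wells \<gamma>. norm F \<le> K"
proof -
  define c where "c = Max (range (\<lambda>j. norm (F0 \<gamma> *v axis j 1)) \<union> range (\<lambda>j. norm (F0_inv \<gamma> *v axis j 1)))"
  have "norm (Q ** A) \<le> 4 * c" if Q: "rotation_matrix Q" and A: "A = F0 \<gamma> \<or> A = F0_inv \<gamma>" for Q A
  proof (rule norm_matrix_le)
    fix j
    have "orthogonal_transformation ((*v) Q)"
      using Q by (simp add: rotation_matrix_def orthogonal_transformation_matrix matrix_vector_mul_linear matrix_of_matrix_vector_mul)
    then have "norm ((Q ** A) *v axis j 1) = norm (A *v axis j 1)"
      by (simp add: matrix_vector_mul_assoc[symmetric] orthogonal_transformation_norm)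
    also have "\<dots> \<le> c" unfolding c_def using A by (intro Max_ge) auto
    finally show "norm ((Q ** A) *v axis j 1) \<le> c" .
  qed
  then show ?thesis by (intro exI[of _ "4 * c"]) (auto simp: wells_def)
qed

section \<open>Bounded functions on the unit square\<close>

lemma unit_square_box: "unit_square = box 0 1"
  by (auto simp: unit_square_def mem_box_cart)

lemma open_unit_square: "open unit_square" and lmeasurable_unit_square: "unit_square \<in> lmeasurable"
  and sets_unit_square: "unit_square \<in> sets lebesgue"
  by (simp_all only: unit_square_box open_box lmeasurable_box lmeasurable_box[THEN fmeasurableD])

lemma measure_unit_square: "measure lebesgue unit_square = 1"
  using measure_box_perp(2)[of 0 1 1] by (simp add: unit_square_box)

lemma emeasure_unit_square: "emeasure lebesgue unit_square = 1"
  using emeasure_eq_measure2[OF lmeasurable_unit_square] by (simp add: measure_unit_square)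

lemma borel_measurable_lebesgue_on_AE:
  fixes f g :: "real^2 \<Rightarrow> 'b::euclidean_space"
  assumes U: "U \<in> sets lebesgue" and f: "f \<in> borel_measurable (lebesgue_on U)"
    and ae: "AE x in lebesgue_on U. f x = g x"
  shows "g \<in> borel_measurable (lebesgue_on U)"
proof -
  have "(\<lambda>x. indicator U x *\<^sub>R f x) \<in> borel_measurable lebesgue"
    using f U by (subst borel_measurable_restrict_space_iff[symmetric]) auto
  moreover have "AE x in lebesgue. indicator U x *\<^sub>R f x = indicator U x *\<^sub>R g x"
    using ae U by (subst (asm) AE_restrict_space_iff) (auto elim!: eventually_mono simp: indicator_def)
  ultimately have "(\<lambda>x. indicator U x *\<^sub>R g x) \<in> borel_measurable lebesgue"
    by (rule borel_measurable_AE)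
  then show ?thesis using U by (subst borel_measurable_restrict_space_iff) auto
qed

lemma nn_integral_bounded_lebesgue_on:
  assumes "U \<in> sets lebesgue" "AE x in lebesgue_on U. f x \<le> ennreal c"
  shows "(\<integral>\<^sup>+ x. f x \<partial>lebesgue_on U) \<le> ennreal c * emeasure lebesgue U"
proof -
  have "(\<integral>\<^sup>+ x. f x \<partial>lebesgue_on U) \<le> (\<integral>\<^sup>+ x. ennreal c \<partial>lebesgue_on U)"
    by (rule nn_integral_mono_AE) fact
  then show ?thesis using assms(1) by (simp add: emeasure_restrict_space)
qed

lemma in_Lp_bounded:
  assumes "f \<in> borel_measurable (lebesgue_on unit_square)" "AE x in lebesgue_on unit_square. norm (f x) \<le> K" "p > 0"
  shows "in_Lp unit_square p f"
proof -
  have "Lp_pow unit_square p f \<le> ennreal (K powr p) * emeasure lebesgue unit_square"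
    unfolding Lp_pow_def
  proof (rule nn_integral_bounded_lebesgue_on[OF sets_unit_square])
    show "AE x in lebesgue_on unit_square. ennreal (norm (f x) powr p) \<le> ennreal (K powr p)"
      using assms(2) by eventually_elim (use assms(3) in \<open>auto intro!: ennreal_leI powr_mono2\<close>)
  qed
  then show ?thesis using assms(1) by (auto simp: in_Lp_def emeasure_unit_square intro: le_less_trans)
qed

section \<open>Gluing building blocks\<close>

text \<open>One boundary matrix \<open>M\<close> and a family of maps on rectangles with gradient in the wells and
  boundary values \<open>M *v x\<close>: the part of the building-block assumption that is independent of \<open>s\<close> and \<open>p\<close>.\<close>

locale well_blocks =
  fixes \<gamma> :: real and M :: "real^2^2" and z :: "(real^2) set \<Rightarrow> real^2 \<Rightarrow> real^2"
  assumes z_block: "rectangle R \<Longrightarrow> R \<subseteq> unit_square \<Longrightarrow>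
      in_W1inf R (z R) \<and> (AE x in lebesgue_on R. weak_grad R (z R) x \<in> wells \<gamma>) \<and> affine_boundary R (z R) M"
begin

text \<open>A common bound for the gradients of the blocks, for the affine map, and for differences of the two.\<close>

definition bound :: real where
  "bound = \<bar>SOME K. \<forall>F\<in>wells \<gamma>. norm F \<le> K\<bar> + norm M"

lemma wells_le_bound: "F \<in> wells \<gamma> \<Longrightarrow> norm F \<le> bound"
  and wells_diff_le_bound: "F \<in> wells \<gamma> \<Longrightarrow> norm (F - M) \<le> bound"
  and bound_nonneg: "bound \<ge> 0" and M_le_bound: "norm M \<le> bound"
proof -
  have *: "\<forall>F\<in>wells \<gamma>. norm F \<le> (SOME K. \<forall>F\<in>wells \<gamma>. norm F \<le> K)"
    by (rule someI_ex[OF wells_bounded])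
  show "norm F \<le> bound" if "F \<in> wells \<gamma>" using *[rule_format, OF that] norm_ge_zero[of M] unfolding bound_def by linarith
  show "norm (F - M) \<le> bound" if "F \<in> wells \<gamma>"
    using *[rule_format, OF that] norm_triangle_ineq4[of F M] unfolding bound_def by linarith
qed (auto simp: bound_def)

text \<open>Extension by zero of the deviation from the affine map. It is continuous on the plane because the
  boundary values agree.\<close>

definition excess :: "(real^2) set \<Rightarrow> real^2 \<Rightarrow> real^2" where
  "excess R x = (if x \<in> R then z R x - M *v x else 0)"

lemma block_weak_gradient:
  assumes R: "rectangle R" "R \<subseteq> unit_square"
  shows "has_weak_gradient R (z R) (weak_grad R (z R))"
    "weak_grad R (z R) \<in> borel_measurable (lebesgue_on R)"
    "AE x in lebesgue_on R. weak_grad R (z R) x \<in> wells \<gamma>"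
proof -
  have w: "in_W1inf R (z R)" using z_block[OF R] by blast
  then have "\<exists>G. has_weak_gradient R (z R) G" by (simp add: in_W1inf_def)
  then show "has_weak_gradient R (z R) (weak_grad R (z R))"
    unfolding weak_grad_def by (rule someI_ex)
  show "weak_grad R (z R) \<in> borel_measurable (lebesgue_on R)" using w by (simp add: in_W1inf_def in_Linf_def)
  show "AE x in lebesgue_on R. weak_grad R (z R) x \<in> wells \<gamma>" using z_block[OF R] by blast
qed

text \<open>The deviation from the affine map has zero boundary values. It can hence be integrated by parts against
  test functions that do not vanish on the boundary of the block, and it is small on small blocks. The
  uniform bound is applied in both directions, so that the product of the widths is the area; the constant 288 is the
  square of 12, once for each of the two components.\<close>

lemma block_excess:
  assumes R: "rectangle R" "R \<subseteq> unit_square"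
  shows "continuous_on UNIV (excess R)"
    "(norm (excess R x))\<^sup>2 \<le> 288 * bound\<^sup>2 * measure lebesgue R"
    "C1_fun \<phi> g \<Longrightarrow> integrable (lebesgue_on R) (\<lambda>x. excess R x $ i * g x $ j)"
    "C1_fun \<phi> g \<Longrightarrow> integrable (lebesgue_on R) (\<lambda>x. (weak_grad R (z R) x - M) $ i $ j * \<phi> x)"
    "C1_fun \<phi> g \<Longrightarrow> (LINT x|lebesgue_on R. excess R x $ i * g x $ j) =
       - (LINT x|lebesgue_on R. (weak_grad R (z R) x - M) $ i $ j * \<phi> x)"
proof -
  obtain a b where ab: "R = box a b" "box a b \<noteq> {}" using R(1) by (auto simp: rectangle_def)
  have ab': "a $ i < b $ i" for i using ab(2) by (simp add: interval_ne_empty_cart)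
  have cl: "closure R = cbox a b" using ab by (simp add: closure_box)
  have fr: "frontier R = cbox a b - box a b" using ab by (simp add: frontier_box)
  have z: "continuous_on (cbox a b) (z R)" "\<forall>x\<in>cbox a b - box a b. z R x = M *v x"
    using z_block[OF R] by (auto simp: affine_boundary_def cl fr)
  define v where "v x = z R x - M *v x" for x
  have cont: "continuous_on (cbox a b) v"
    unfolding v_def by (intro continuous_on_diff z linear_continuous_on matrix_vector_mul_bounded_linear)
  have zero: "\<forall>x\<in>cbox a b - box a b. v x = 0" using z(2) by (simp add: v_def)
  have ex: "excess R x = v x" if "x \<in> cbox a b" for x
    using that zero by (auto simp: excess_def v_def ab(1))
  have Rs: "R \<in> sets lebesgue" by (simp add: ab)
  have wg: "has_weak_gradient (box a b) v (\<lambda>x. weak_grad R (z R) x - M)"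
    using has_weak_gradient_diff[OF block_weak_gradient(1)[OF R] has_weak_gradient_linear[OF Rs] Rs]
    by (simp add: ab(1) v_def[abs_def])
  have Gm: "(\<lambda>x. weak_grad R (z R) x - M) \<in> borel_measurable (lebesgue_on (box a b))"
    using block_weak_gradient(2)[OF R] by (simp add: ab(1))
  have Gb: "AE x in lebesgue_on (box a b). norm (weak_grad R (z R) x - M) \<le> bound"
    using block_weak_gradient(3)[OF R] wells_diff_le_bound unfolding ab(1) by (auto elim: eventually_mono)
  note parts = integration_by_parts_zero_trace[OF ab(2) cont zero wg Gm Gb]
  show "continuous_on UNIV (excess R)"
  proof -
    have "continuous_on (cbox a b \<union> (UNIV - box a b)) (\<lambda>x. if x \<in> cbox a b then v x else 0)"
      by (intro continuous_on_cases cont continuous_on_const) (use zero in \<open>auto simp: closed_Diff\<close>)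
    moreover have "cbox a b \<union> (UNIV - box a b) = UNIV" using box_subset_cbox by blast
    moreover have "(\<lambda>x. if x \<in> cbox a b then v x else 0) = excess R"
    proof
      fix x
      show "(if x \<in> cbox a b then v x else 0) = excess R x"
      proof (cases "x \<in> cbox a b")
        case False
        then have "x \<notin> R" using box_subset_cbox ab(1) by blast
        then show ?thesis using False by (simp add: excess_def)
      qed (simp add: ex)
    qed
    ultimately show ?thesis by (simp only:)
  qed
  show "(norm (excess R x))\<^sup>2 \<le> 288 * bound\<^sup>2 * measure lebesgue R"
  proof (cases "x \<in> R")
    case True
    have comp: "(v x $ i)\<^sup>2 \<le> 144 * bound\<^sup>2 * measure lebesgue R" for i
    proof -
      have "\<bar>v x $ i\<bar> \<le> 12 * bound * (b $ j - a $ j)" for j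
        using zero_trace_bound[OF ab(2) cont zero wg Gm Gb bound_nonneg] True ab(1) by blast
      then have "\<bar>v x $ i\<bar> * \<bar>v x $ i\<bar> \<le> (12 * bound * (b $ 1 - a $ 1)) * (12 * bound * (b $ 2 - a $ 2))"
        using bound_nonneg ab' by (intro mult_mono) (auto simp: less_imp_le)
      moreover have "measure lebesgue R = (b $ 1 - a $ 1) * (b $ 2 - a $ 2)"
        using measure_box_perp(2)[of a b 1] less_imp_le[OF ab'] by (simp add: ab(1) perp_def)
      then have "(12 * bound * (b $ 1 - a $ 1)) * (12 * bound * (b $ 2 - a $ 2)) = 144 * bound\<^sup>2 * measure lebesgue R"
        by (simp only:) (simp add: power2_eq_square algebra_simps)
      ultimately show ?thesis by (simp only: power2_eq_square[of "v x $ i"] abs_mult_self_eq)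
    qed
    have "x \<in> cbox a b" using True ab(1) box_subset_cbox by blast
    then have "(norm (excess R x))\<^sup>2 = (v x $ 1)\<^sup>2 + (v x $ 2)\<^sup>2"
      by (simp add: ex norm_vec_def L2_set_def sum_2)
    then show ?thesis using comp[of 1] comp[of 2] by simp
  next
    case False
    then show ?thesis by (simp add: excess_def)
  qed
  have eqR: "integrable (lebesgue_on R) (\<lambda>x. excess R x $ i * g x $ j) \<longleftrightarrow> integrable (lebesgue_on R) (\<lambda>x. v x $ i * g x $ j)"
    "(LINT x|lebesgue_on R. excess R x $ i * g x $ j) = (LINT x|lebesgue_on R. v x $ i * g x $ j)"
    by (intro Bochner_Integration.integrable_cong Bochner_Integration.integral_cong; simp add: excess_def v_def)+
  assume c1: "C1_fun \<phi> g"
  show "integrable (lebesgue_on R) (\<lambda>x. excess R x $ i * g x $ j)"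
    unfolding eqR using parts(1)[OF c1] ab(1) by simp
  show "integrable (lebesgue_on R) (\<lambda>x. (weak_grad R (z R) x - M) $ i $ j * \<phi> x)"
    using parts(2)[OF c1, of i j] unfolding ab(1) .
  show "(LINT x|lebesgue_on R. excess R x $ i * g x $ j) = - (LINT x|lebesgue_on R. (weak_grad R (z R) x - M) $ i $ j * \<phi> x)"
    unfolding eqR using parts(3)[OF c1, of i j] unfolding ab(1) .
qed

definition glued :: "(nat \<Rightarrow> (real^2) set) \<Rightarrow> real^2 \<Rightarrow> real^2" where
  "glued B x = (if \<exists>n. x \<in> B n then z (B (SOME n. x \<in> B n)) x else M *v x)"

definition glued_grad :: "(nat \<Rightarrow> (real^2) set) \<Rightarrow> real^2 \<Rightarrow> real^2^2" where
  "glued_grad B x =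
     (if \<exists>n. x \<in> B n then let R = B (SOME n. x \<in> B n) in weak_grad R (z R) x else M)"

text \<open>Empty members are allowed, so that a packing can be indexed by all natural numbers.\<close>

definition packing :: "(nat \<Rightarrow> (real^2) set) \<Rightarrow> bool" where
  "packing B \<longleftrightarrow> disjoint_family B \<and> (\<forall>n. B n = {} \<or> rectangle (B n)) \<and> (\<forall>n. B n \<subseteq> unit_square)"

lemma packing_unique: "packing B \<Longrightarrow> x \<in> B n \<Longrightarrow> (SOME n. x \<in> B n) = n"
  by (rule some_equality) (auto simp: packing_def disjoint_family_on_def)

lemma packing_eq: "packing B \<Longrightarrow> x \<in> B n \<Longrightarrow> x \<in> B k \<Longrightarrow> n = k"
  using packing_unique by metis

lemma glued_in: "packing B \<Longrightarrow> x \<in> B n \<Longrightarrow> glued B x = z (B n) x"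
  and glued_grad_in: "packing B \<Longrightarrow> x \<in> B n \<Longrightarrow> glued_grad B x = weak_grad (B n) (z (B n)) x"
  and glued_out: "x \<notin> (\<Union>n. B n) \<Longrightarrow> glued B x = M *v x"
  and glued_grad_out: "x \<notin> (\<Union>n. B n) \<Longrightarrow> glued_grad B x = M"
  using packing_unique by (auto simp: glued_def glued_grad_def Let_def)

lemma packing_rectangle: "packing B \<Longrightarrow> x \<in> B n \<Longrightarrow> rectangle (B n)"
  and packing_subset: "packing B \<Longrightarrow> B n \<subseteq> unit_square"
  and packing_open: "packing B \<Longrightarrow> open (B n)"
proof -
  show "packing B \<Longrightarrow> x \<in> B n \<Longrightarrow> rectangle (B n)" "packing B \<Longrightarrow> B n \<subseteq> unit_square"
    by (auto simp: packing_def)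
  assume "packing B"
  then have "B n = {} \<or> rectangle (B n)" by (simp add: packing_def)
  then show "open (B n)" by (auto simp: rectangle_def)
qed

lemma packing_lmeasurable: "packing B \<Longrightarrow> B n \<in> lmeasurable"
  and packing_sets: "packing B \<Longrightarrow> B n \<in> sets lebesgue"
proof -
  assume "packing B"
  then have "B n = {} \<or> rectangle (B n)" by (simp add: packing_def)
  then show "B n \<in> lmeasurable" by (auto simp: rectangle_def)
  then show "B n \<in> sets lebesgue" by (rule fmeasurableD)
qed

lemma glued_excess:
  assumes "packing B" "x \<in> B n"
  shows "glued B x - M *v x = excess (B n) x"
  using glued_in[OF assms] assms(2) by (simp add: excess_def)

lemma packing_measure_tendsto_0:
  assumes "packing B" shows "(\<lambda>n. measure lebesgue (B n)) \<longlonglongrightarrow> 0"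
proof -
  have "range B \<subseteq> lmeasurable" using packing_lmeasurable[OF assms] by auto
  have "(\<lambda>n. measure lebesgue (B n)) sums measure lebesgue (\<Union>n. B n)"
  proof (rule measure_UNION)
    show "range B \<subseteq> sets lebesgue" using packing_sets[OF assms] by auto
    show "disjoint_family B" using assms by (simp add: packing_def)
    have "emeasure lebesgue (\<Union>n. B n) \<le> emeasure lebesgue unit_square"
      using packing_subset[OF assms] sets_unit_square by (intro emeasure_mono) auto
    then show "emeasure lebesgue (\<Union>n. B n) \<noteq> \<infinity>" by (auto simp: emeasure_unit_square top_unique)
  qed
  then show ?thesis using sums_summable summable_LIMSEQ_zero by blast
qed

text \<open>The deviation from the affine map is a sum of continuous functions with disjoint supports, and the sum
  converges uniformly because small blocks have small deviation and only finitely many disjoint blocks are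
  large.\<close>

lemma continuous_glued:
  assumes B: "packing B" shows "continuous_on UNIV (glued B)"
proof -
  \<comment> \<open>The test for emptiness keeps the statements about \<open>excess\<close> restricted to rectangles.\<close>
  define S where "S N x = (\<Sum>n<N. if B n = {} then 0 else excess (B n) x)" for N x
  have S_eq: "S N x = (if \<exists>n<N. x \<in> B n then glued B x - M *v x else 0)" for N x
  proof (cases "\<exists>n<N. x \<in> B n")
    case True
    then obtain n where n: "n < N" "x \<in> B n" by blast
    have "S N x = (\<Sum>k<N. if k = n then excess (B n) x else 0)"
      unfolding S_def
    proof (rule sum.cong[OF refl])
      fix k
      show "(if B k = {} then 0 else excess (B k) x) = (if k = n then excess (B n) x else 0)"
      proof (cases "k = n")
        case True
        then show ?thesis using n(2) by auto
      next
        case False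
        then have "x \<notin> B k" using packing_eq[OF B n(2)] by blast
        then show ?thesis using False by (simp add: excess_def)
      qed
    qed
    also have "\<dots> = excess (B n) x" using n(1) by simp
    finally show ?thesis using True glued_excess[OF B n(2)] by simp
  next
    case False
    then have "(if B n = {} then 0 else excess (B n) x) = 0" if "n < N" for n
      using that by (simp add: excess_def)
    then have "S N x = 0" unfolding S_def by (intro sum.neutral) blast
    then show ?thesis using False by (simp only: if_False)
  qed
  have "continuous_on UNIV (\<lambda>x. glued B x - M *v x)"
  proof (rule uniform_limit_theorem[OF _ _ sequentially_bot])
    show "\<forall>\<^sub>F N in sequentially. continuous_on UNIV (S N)"
      unfolding S_def[abs_def]
    proof (intro always_eventually allI continuous_on_sum)
      fix n
      show "continuous_on UNIV (\<lambda>x. if B n = {} then 0 else excess (B n) x)"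
      proof (cases "B n = {}")
        case False
        then have "rectangle (B n)" using B by (auto simp: packing_def)
        then show ?thesis using block_excess(1)[OF _ packing_subset[OF B], of n] False by (simp only: if_False)
      qed (simp add: continuous_on_const)
    qed
    show "uniform_limit UNIV S (\<lambda>x. glued B x - M *v x) sequentially"
    proof (rule uniform_limitI)
      fix e :: real assume e: "e > 0"
      have "(\<lambda>n. 288 * bound\<^sup>2 * measure lebesgue (B n)) \<longlonglongrightarrow> 288 * bound\<^sup>2 * 0"
        by (intro tendsto_mult tendsto_const packing_measure_tendsto_0[OF B])
      then have "\<forall>\<^sub>F n in sequentially. 288 * bound\<^sup>2 * measure lebesgue (B n) < e\<^sup>2"
        using e by (intro order_tendstoD(2)) auto
      then obtain N0 where N0: "\<And>n. n \<ge> N0 \<Longrightarrow> 288 * bound\<^sup>2 * measure lebesgue (B n) < e\<^sup>2"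
        unfolding eventually_sequentially by blast
      have "dist (S N x) (glued B x - M *v x) < e" if N: "N \<ge> N0" for N x
      proof (cases "\<exists>n. x \<in> B n")
        case True
        then obtain n where n: "x \<in> B n" by blast
        show ?thesis
        proof (cases "n < N")
          case True
          then have "S N x = glued B x - M *v x" using n S_eq[of N x] by auto
          then show ?thesis using e by simp
        next
          case False
          then have "\<not> (\<exists>k<N. x \<in> B k)" using packing_eq[OF B n] by blast
          then have "S N x = 0" using S_eq[of N x] by (simp only: if_False)
          then have "dist (S N x) (glued B x - M *v x) = norm (excess (B n) x)"
            by (simp only: glued_excess[OF B n] dist_0_norm)
          moreover have "(norm (excess (B n) x))\<^sup>2 < e\<^sup>2"
            using block_excess(2)[OF packing_rectangle[OF B n] packing_subset[OF B], of x] N0[of n] False N by simp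
          ultimately show ?thesis using e power_less_imp_less_base[of "norm (excess (B n) x)" 2 e] by simp
        qed
      next
        case False
        then show ?thesis using e S_eq[of N x] glued_out[of x B] by auto
      qed
      then show "\<forall>\<^sub>F N in sequentially. \<forall>x\<in>UNIV. dist (S N x) (glued B x - M *v x) < e"
        unfolding eventually_sequentially by blast
    qed
  qed
  then have "continuous_on UNIV (\<lambda>x. (glued B x - M *v x) + M *v x)"
    by (rule continuous_on_add[OF _ linear_continuous_on[OF matrix_vector_mul_bounded_linear]])
  then show ?thesis by simp
qed

lemma measurable_glued_grad:
  assumes B: "packing B" shows "glued_grad B \<in> borel_measurable lebesgue"
proof (rule measurable_piecewise_restrict[of "insert (- (\<Union>n. B n)) (range B)"])
  show "countable (insert (- (\<Union>n. B n)) (range B))" by auto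
  show "\<Omega> \<inter> space lebesgue \<in> sets lebesgue" if "\<Omega> \<in> insert (- (\<Union>n. B n)) (range B)" for \<Omega>
    using that packing_sets[OF B] by (auto simp: Compl_in_sets_lebesgue)
  show "space lebesgue \<subseteq> \<Union>(insert (- (\<Union>n. B n)) (range B))" by auto
  show "glued_grad B \<in> borel_measurable (restrict_space lebesgue \<Omega>)"
    if Om: "\<Omega> \<in> insert (- (\<Union>n. B n)) (range B)" for \<Omega>
  proof (cases "\<Omega> = - (\<Union>n. B n)")
    case True
    have "glued_grad B \<in> borel_measurable (restrict_space lebesgue \<Omega>) \<longleftrightarrow> (\<lambda>_. M) \<in> borel_measurable (restrict_space lebesgue \<Omega>)"
      by (intro measurable_cong) (use True glued_grad_out in auto)
    then show ?thesis by simp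
  next
    case False
    then obtain n where n: "\<Omega> = B n" using Om by blast
    show ?thesis
    proof (cases "B n = {}")
      case True
      then show ?thesis using n by (auto simp: measurable_def space_restrict_space sets_restrict_space)
    next
      case F: False
      then have r: "rectangle (B n)" using packing_rectangle[OF B] by blast
      have "glued_grad B \<in> borel_measurable (restrict_space lebesgue \<Omega>) \<longleftrightarrow> weak_grad (B n) (z (B n)) \<in> borel_measurable (restrict_space lebesgue \<Omega>)"
        by (intro measurable_cong) (use n glued_grad_in[OF B] in auto)
      then show ?thesis using block_weak_gradient(2)[OF r packing_subset[OF B]] n by simp
    qed
  qed
qed

lemma glued_grad_wells:
  assumes B: "packing B"
  shows "AE x in lebesgue. x \<in> (\<Union>n. B n) \<longrightarrow> glued_grad B x \<in> wells \<gamma>"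
proof -
  have "AE x in lebesgue. x \<in> B n \<longrightarrow> glued_grad B x \<in> wells \<gamma>" for n
  proof (cases "B n = {}")
    case False
    then have r: "rectangle (B n)" using packing_rectangle[OF B] by blast
    from block_weak_gradient(3)[OF r packing_subset[OF B]]
    have "AE x in lebesgue. x \<in> B n \<longrightarrow> weak_grad (B n) (z (B n)) x \<in> wells \<gamma>"
      using packing_sets[OF B, of n] by (subst (asm) AE_restrict_space_iff) auto
    then show ?thesis by eventually_elim (use glued_grad_in[OF B] in auto)
  qed simp
  then have "AE x in lebesgue. \<forall>n. x \<in> B n \<longrightarrow> glued_grad B x \<in> wells \<gamma>" unfolding AE_all_countable by blast
  then show ?thesis by eventually_elim auto
qed

lemma glued_grad_bound:
  assumes B: "packing B" shows "AE x in lebesgue. norm (glued_grad B x) \<le> bound"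
  using glued_grad_wells[OF B]
proof eventually_elim
  case (elim x)
  then show ?case using wells_le_bound M_le_bound glued_grad_out[of x B] by (cases "x \<in> (\<Union>n. B n)") auto
qed

text \<open>The deviation from the affine map is integrated by parts on each block separately. No boundary
  terms arise, as it vanishes on the boundaries of the blocks, and outside the blocks it is zero; countable
  additivity then sums the identities. The affine part is treated directly.\<close>

lemma glued_weak_gradient:
  assumes B: "packing B" shows "has_weak_gradient unit_square (glued B) (glued_grad B)"
  unfolding has_weak_gradient_def
proof (intro conjI allI impI)
  have Gint: "integrable (lebesgue_on unit_square) (\<lambda>x. glued_grad B x)"
  proof (rule integrable_bounded_lebesgue_on[OF lmeasurable_unit_square])
    show "(\<lambda>x. glued_grad B x) \<in> borel_measurable (lebesgue_on unit_square)"
      using measurable_glued_grad[OF B] by (rule measurable_restrict_space1)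
    show "AE x in lebesgue_on unit_square. norm (glued_grad B x) \<le> bound"
      using glued_grad_bound[OF B] sets_unit_square by (subst AE_restrict_space_iff) (auto elim: eventually_mono)
  qed
  {
    fix C :: "(real^2) set" assume C: "compact C \<and> C \<subseteq> unit_square"
    show "glued B absolutely_integrable_on C"
      using C by (intro absolutely_integrable_compact continuous_glued[OF B]) auto
    have "set_integrable lebesgue unit_square (glued_grad B)"
      using Gint sets_unit_square unfolding set_integrable_def by (subst (asm) integrable_restrict_space) auto
    then show "glued_grad B absolutely_integrable_on C"
      by (rule set_integrable_subset) (use C in \<open>auto intro: fmeasurableD lmeasurable_compact\<close>)
  }
  fix \<phi> g i j assume t: "test_function unit_square \<phi> g"
  have c1: "C1_fun \<phi> g" using t by (simp add: test_function_iff)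
  let ?U = "\<Union>n. B n"
  have Us: "?U \<in> sets lebesgue" using packing_sets[OF B] by auto
  have UO: "?U \<subseteq> unit_square" using packing_subset[OF B] by blast
  have disj: "B m \<inter> B n = {}" if "m \<noteq> n" for m n using B that by (auto simp: packing_def disjoint_family_on_def)
  obtain K where K: "\<And>x. x \<in> cbox 0 1 \<Longrightarrow> norm (\<phi> x) \<le> K"
    using continuous_bounded_on_compact[OF compact_cbox C1_fun_continuous[OF c1]] by blast
  have O01: "unit_square \<subseteq> cbox 0 1" using box_subset_cbox by (simp add: unit_square_box)
  define f1 where "f1 x = (glued B x - M *v x) $ i * g x $ j" for x
  define f2 where "f2 x = (glued_grad B x - M) $ i $ j * \<phi> x" for x
  have cont1: "continuous_on UNIV f1"
    unfolding f1_def by (intro continuous_on_mult continuous_on_component continuous_on_diff continuous_glued[OF B]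
        linear_continuous_on matrix_vector_mul_bounded_linear C1_fun_grad_continuous[OF c1])
  have i1: "integrable (lebesgue_on unit_square) f1"
    unfolding unit_square_box by (intro integrable_continuous_box continuous_on_subset[OF cont1]) auto
  have contL: "continuous_on UNIV (\<lambda>x. (M *v x) $ i * g x $ j)"
    by (intro continuous_on_mult continuous_on_component linear_continuous_on matrix_vector_mul_bounded_linear C1_fun_grad_continuous[OF c1])
  have iL: "integrable (lebesgue_on unit_square) (\<lambda>x. (M *v x) $ i * g x $ j)"
    unfolding unit_square_box by (intro integrable_continuous_box continuous_on_subset[OF contL]) auto
  have iL2: "integrable (lebesgue_on unit_square) (\<lambda>x. M $ i $ j * \<phi> x)"
    unfolding unit_square_box
    by (intro integrable_continuous_box continuous_on_mult continuous_on_const C1_fun_continuous[OF c1])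
  have m2: "f2 \<in> borel_measurable lebesgue"
  proof -
    have "\<phi> \<in> borel_measurable lebesgue"
      using borel_measurable_continuous_onI[OF C1_fun_continuous[OF c1]] by (simp add: measurable_completion)
    moreover have "(\<lambda>x. (glued_grad B x - M) $ i $ j) \<in> borel_measurable lebesgue"
      by (rule measurable_compose[OF measurable_glued_grad[OF B], of "\<lambda>F. (F - M) $ i $ j"])
         (intro borel_measurable_continuous_onI continuous_intros)
    ultimately show ?thesis unfolding f2_def[abs_def] by (intro borel_measurable_times)
  qed
  have i2: "integrable (lebesgue_on unit_square) f2"
  proof (rule integrable_bounded_lebesgue_on[OF lmeasurable_unit_square])
    show "f2 \<in> borel_measurable (lebesgue_on unit_square)" using m2 by (rule measurable_restrict_space1)
    have "AE x in lebesgue. x \<in> unit_square \<longrightarrow> norm (f2 x) \<le> (bound + norm M) * K"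
      using glued_grad_bound[OF B]
    proof eventually_elim
      case (elim x)
      show ?case
      proof
        assume x: "x \<in> unit_square"
        have "\<bar>(glued_grad B x - M) $ i $ j\<bar> \<le> norm (glued_grad B x - M)"
          using Finite_Cartesian_Product.norm_nth_le[of "(glued_grad B x - M) $ i" j]
            Finite_Cartesian_Product.norm_nth_le[of "glued_grad B x - M" i] by simp
        also have "\<dots> \<le> bound + norm M" using norm_triangle_ineq4[of "glued_grad B x" M] elim by simp
        finally show "norm (f2 x) \<le> (bound + norm M) * K"
          unfolding f2_def norm_mult using K[of x] x O01 bound_nonneg by (intro mult_mono) auto
      qed
    qed
    then show "AE x in lebesgue_on unit_square. norm (f2 x) \<le> (bound + norm M) * K"
      using sets_unit_square by (subst AE_restrict_space_iff) auto
  qed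
  have block: "(LINT x:B n|lebesgue. f1 x) = - (LINT x:B n|lebesgue. f2 x)" for n
  proof (cases "B n = {}")
    case True
    then show ?thesis by (simp add: set_lebesgue_integral_def)
  next
    case False
    then have r: "rectangle (B n)" using packing_rectangle[OF B] by blast
    have to_on: "(LINT x:B n|lebesgue. f x) = (LINT x|lebesgue_on (B n). f x)" for f :: "real^2 \<Rightarrow> real"
      unfolding set_lebesgue_integral_def using packing_sets[OF B] by (subst integral_restrict_space) auto
    have "(LINT x|lebesgue_on (B n). f1 x) = (LINT x|lebesgue_on (B n). excess (B n) x $ i * g x $ j)"
      by (intro Bochner_Integration.integral_cong) (use glued_excess[OF B] in \<open>auto simp: f1_def\<close>)
    also have "\<dots> = - (LINT x|lebesgue_on (B n). (weak_grad (B n) (z (B n)) x - M) $ i $ j * \<phi> x)"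
      by (rule block_excess(5)[OF r packing_subset[OF B] c1])
    also have "(LINT x|lebesgue_on (B n). (weak_grad (B n) (z (B n)) x - M) $ i $ j * \<phi> x) = (LINT x|lebesgue_on (B n). f2 x)"
      by (intro Bochner_Integration.integral_cong) (use glued_grad_in[OF B] in \<open>auto simp: f2_def\<close>)
    finally show ?thesis unfolding to_on .
  qed
  have total: "(LINT x|lebesgue_on unit_square. f x) = (\<Sum>n. LINT x:B n|lebesgue. f x)"
    if f: "integrable (lebesgue_on unit_square) f" "\<And>x. x \<notin> ?U \<Longrightarrow> f x = 0" for f :: "real^2 \<Rightarrow> real"
  proof -
    have "set_integrable lebesgue unit_square f"
      using f(1) sets_unit_square unfolding set_integrable_def by (subst (asm) integrable_restrict_space) auto
    then have "set_integrable lebesgue ?U f" using Us UO by (rule set_integrable_subset)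
    from lebesgue_integral_countable_add[OF packing_sets[OF B] disj this]
    have "(LINT x:?U|lebesgue. f x) = (\<Sum>n. LINT x:B n|lebesgue. f x)" .
    moreover have "(LINT x|lebesgue_on unit_square. f x) = (LINT x:?U|lebesgue. f x)"
    proof -
      have "(LINT x|lebesgue_on unit_square. f x) = (LINT x|lebesgue. f x)"
        using f(2) UO by (intro integral_lebesgue_on_support[OF sets_unit_square]) blast
      also have "\<dots> = (LINT x:?U|lebesgue. f x)" unfolding set_lebesgue_integral_def
        by (intro Bochner_Integration.integral_cong refl) (use f(2) in \<open>auto simp: indicator_def\<close>)
      finally show ?thesis .
    qed
    ultimately show ?thesis by simp
  qed
  have f1_0: "f1 x = 0" if "x \<notin> ?U" for x unfolding f1_def glued_out[OF that] by simp
  have f2_0: "f2 x = 0" if "x \<notin> ?U" for x unfolding f2_def glued_grad_out[OF that] by simp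
  have block': "(LINT x:B n|lebesgue. f1 x) = (LINT x:B n|lebesgue. - f2 x)" for n
  proof -
    have "- (LINT x:B n|lebesgue. f2 x) = (LINT x:B n|lebesgue. - f2 x)"
      unfolding set_lebesgue_integral_def scaleR_minus_right by (rule Bochner_Integration.integral_minus[symmetric])
    then show ?thesis using block[of n] by simp
  qed
  have "(LINT x|lebesgue_on unit_square. f1 x) = (LINT x|lebesgue_on unit_square. - f2 x)"
    using total[OF i1 f1_0] total[of "\<lambda>x. - f2 x"] i2 f2_0 by (simp add: block')
  then have "(LINT x|lebesgue_on unit_square. f1 x) = - (LINT x|lebesgue_on unit_square. f2 x)" by simp
  moreover have "(LINT x|lebesgue_on unit_square. (M *v x) $ i * g x $ j) = - (LINT x|lebesgue_on unit_square. M $ i $ j * \<phi> x)"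
    by (rule weak_gradient_test[OF has_weak_gradient_linear[OF sets_unit_square] t])
  moreover have "(LINT x|lebesgue_on unit_square. glued B x $ i * g x $ j)
      = (LINT x|lebesgue_on unit_square. f1 x + (M *v x) $ i * g x $ j)"
    by (intro Bochner_Integration.integral_cong refl) (simp add: f1_def left_diff_distrib)
  moreover have "(LINT x|lebesgue_on unit_square. glued_grad B x $ i $ j * \<phi> x)
      = (LINT x|lebesgue_on unit_square. f2 x + M $ i $ j * \<phi> x)"
    by (intro Bochner_Integration.integral_cong refl) (simp add: f2_def left_diff_distrib)
  ultimately show "(LINT x|lebesgue_on unit_square. glued B x $ i * g x $ j) = - (LINT x|lebesgue_on unit_square. glued_grad B x $ i $ j * \<phi> x)"
    using i1 i2 iL iL2 by simp
qed

lemma glued_affine_boundary: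
  assumes B: "packing B" shows "affine_boundary unit_square (glued B) M"
  unfolding affine_boundary_def
proof (intro conjI ballI)
  show "continuous_on (closure unit_square) (glued B)" using continuous_glued[OF B] continuous_on_subset by blast
  fix x assume "x \<in> frontier unit_square"
  then have "x \<notin> unit_square" using open_unit_square by (simp add: frontier_def interior_open)
  then show "glued B x = M *v x" using packing_subset[OF B] by (intro glued_out) blast
qed

end

lemma weak_grad_AE:
  assumes "has_weak_gradient unit_square u G"
  shows "AE x in lebesgue_on unit_square. weak_grad unit_square u x = G x"
proof -
  have "has_weak_gradient unit_square u (weak_grad unit_square u)"
    unfolding weak_grad_def by (rule someI[of "has_weak_gradient unit_square u", OF assms])
  then show ?thesis using assms open_unit_square by (rule weak_gradient_unique)
qed

text \<open>\<open>weak_grad\<close> is a choice among all weak gradients; by uniqueness it inherits bounds and measurability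
  from any one of them.\<close>

lemma Sobolev_bounded:
  assumes wg: "has_weak_gradient unit_square u G"
    and u: "u \<in> borel_measurable (lebesgue_on unit_square)" "AE x in lebesgue_on unit_square. norm (u x) \<le> K"
    and G: "G \<in> borel_measurable (lebesgue_on unit_square)" "AE x in lebesgue_on unit_square. norm (G x) \<le> K'"
  shows "weak_grad unit_square u \<in> borel_measurable (lebesgue_on unit_square)"
    "in_W1inf unit_square u" "p > 0 \<Longrightarrow> in_W1p unit_square p u"
proof -
  note w = weak_grad_AE[OF wg]
  show m: "weak_grad unit_square u \<in> borel_measurable (lebesgue_on unit_square)"
  proof (rule borel_measurable_lebesgue_on_AE[OF sets_unit_square G(1)])
    show "AE x in lebesgue_on unit_square. G x = weak_grad unit_square u x"
      using w by eventually_elim simp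
  qed
  have b: "AE x in lebesgue_on unit_square. norm (weak_grad unit_square u x) \<le> K'"
    using w G(2) by eventually_elim simp
  show "in_W1inf unit_square u" using u m b wg by (auto simp: in_W1inf_def in_Linf_def)
  show "in_W1p unit_square p u" if "p > 0"
    using in_Lp_bounded[OF u that] in_Lp_bounded[OF m b that] wg by (auto simp: in_W1p_def)
qed

section \<open>Perimeter and area of rectangles\<close>

lemma image_nth_box:
  fixes a b :: "real^2"
  assumes "box a b \<noteq> {}"
  shows "(\<lambda>x. x $ i) ` box a b = {a $ i<..<b $ i}"
proof
  show "(\<lambda>x. x $ i) ` box a b \<subseteq> {a $ i<..<b $ i}" by (auto simp: mem_box_cart)
  show "{a $ i<..<b $ i} \<subseteq> (\<lambda>x. x $ i) ` box a b"
  proof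
    fix t assume t: "t \<in> {a $ i<..<b $ i}"
    obtain c where c: "c \<in> box a b" using assms by blast
    define x where "x = (\<chi> k. if k = i then t else c $ k)"
    have "x \<in> box a b" using c t by (simp add: x_def mem_box_cart)
    moreover have "x $ i = t" by (simp add: x_def)
    ultimately show "t \<in> (\<lambda>x. x $ i) ` box a b" by blast
  qed
qed

lemma lo_box: "box a b \<noteq> {} \<Longrightarrow> lo (box a b) i = a $ i"
  and side_box: "box a b \<noteq> {} \<Longrightarrow> side (box a b) i = b $ i - a $ i"
  using interval_ne_empty_cart(2)[of a b] by (auto simp: lo_def side_def image_nth_box)

text \<open>For sides \<open>l\<close> and \<open>m\<close> this is \<open>l powr (1 - t) * m + l * m powr (1 - t)\<close>, comparable for \<open>0 < t < 1\<close>
  to the \<open>W\<^sup>t\<^sup>,\<^sup>1\<close>-seminorm of the indicator of the rectangle. It is then monotone and concave in each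
  side.\<close>

definition phi :: "real \<Rightarrow> (real^2) set \<Rightarrow> real" where
  "phi t R = measure lebesgue R * (side R 1 powr - t + side R 2 powr - t)"

lemma phi_nonneg: "0 \<le> phi t R" by (simp add: phi_def)

lemma rectangle_sides:
  assumes "rectangle R"
  shows "side R i > 0" "measure lebesgue R = side R 1 * side R 2"
proof -
  obtain a b where ab: "R = box a b" "box a b \<noteq> {}" using assms by (auto simp: rectangle_def)
  have l: "a $ i < b $ i" for i using ab(2) by (simp add: interval_ne_empty_cart)
  show "side R i > 0" using l[of i] ab by (simp add: side_box)
  show "measure lebesgue R = side R 1 * side R 2"
    using measure_box_perp(2)[of a b 1] less_imp_le[OF l] ab by (simp add: side_box perp_def)
qed

text \<open>Perimeter and area are comparable to the longer side and to the product of the sides, so the left-hand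
  side is comparable to the area times the shorter side to the power \<open>- t\<close>.\<close>

lemma perimeter_phi:
  assumes R: "rectangle R" and t: "0 < t" "t < 1"
  shows "rect_perimeter R powr t * measure lebesgue R powr (1 - t) \<le> 4 * phi t R"
proof -
  define m where "m = min (side R 1) (side R 2)"
  define l where "l = max (side R 1) (side R 2)"
  have m: "m > 0" and l: "l > 0" using rectangle_sides(1)[OF R] by (auto simp: m_def l_def less_max_iff_disj)
  have A: "measure lebesgue R = m * l" by (simp add: rectangle_sides(2)[OF R] m_def l_def min_def max_def)
  have "rect_perimeter R \<le> 4 * l" by (simp add: rect_perimeter_def l_def)
  then have "rect_perimeter R powr t \<le> (4 * l) powr t"
    using t rectangle_sides(1)[OF R, THEN less_imp_le] by (intro powr_mono2) (auto simp: rect_perimeter_def)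
  also have "\<dots> = 4 powr t * l powr t" using l by (simp add: powr_mult)
  also have "\<dots> \<le> 4 powr 1 * l powr t" using t by (intro mult_right_mono powr_mono) auto
  finally have "rect_perimeter R powr t * measure lebesgue R powr (1 - t) \<le> 4 * l powr t * (m * l) powr (1 - t)"
    unfolding A by (intro mult_right_mono) auto
  also have "(m * l) powr (1 - t) = (m * l) * (m powr - t * l powr - t)"
    using m l powr_add[of "m * l" 1 "- t"] by (simp add: powr_mult)
  also have "4 * l powr t * ((m * l) * (m powr - t * l powr - t)) = 4 * (measure lebesgue R * m powr - t)"
  proof -
    have "l powr t * l powr - t = 1" using l by (simp add: powr_add[symmetric])
    moreover have "4 * l powr t * ((m * l) * (m powr - t * l powr - t)) = 4 * ((m * l) * m powr - t) * (l powr t * l powr - t)"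
      by (simp only: mult_ac)
    ultimately show ?thesis by (simp add: A)
  qed
  also have "\<dots> \<le> 4 * phi t R"
    unfolding phi_def by (intro mult_left_mono) (auto simp: m_def min_def)
  finally show ?thesis .
qed

section \<open>Singular integrals\<close>

lemma ennreal_suminf_ge: "f n \<le> (\<Sum>n. f n)" for f :: "nat \<Rightarrow> ennreal"
  using sum_le_suminf[of f "{n}"] by (simp add: summableI)

lemma two_power_powr: "(2 ^ n) powr t = (2 powr t) ^ n" for t :: real
  by (simp add: powr_realpow[symmetric] powr_powr mult.commute)

lemma dyadic_sum:
  assumes "0 \<le> c" "0 < r" "r < 1"
  shows "(\<Sum>n. ennreal (c * r ^ n)) = ennreal (c / (1 - r))"
proof -
  have "(\<lambda>n. c * r ^ n) sums (c * (1 / (1 - r)))" using assms by (intro sums_mult geometric_sums) auto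
  then show ?thesis using assms by (subst suminf_ennreal2) (auto simp: sums_iff)
qed

lemma cball_measure_le:
  fixes x :: "real^2"
  assumes "r > 0" shows "emeasure lborel (ball x r) \<le> ennreal (4 * r\<^sup>2)"
proof -
  have "ball x r \<subseteq> cbox (x - vec r) (x + vec r)"
  proof
    fix y assume "y \<in> ball x r"
    then have d: "norm (x - y) < r" by (simp add: dist_norm)
    have "x $ i - r \<le> y $ i \<and> y $ i \<le> x $ i + r" for i
    proof -
      have "\<bar>x $ i - y $ i\<bar> \<le> norm (x - y)"
        using Finite_Cartesian_Product.norm_nth_le[of "x - y" i] by simp
      with d show ?thesis by linarith
    qed
    then show "y \<in> cbox (x - vec r) (x + vec r)" by (simp add: mem_box_cart)
  qed
  then have "emeasure lborel (ball x r) \<le> emeasure lborel (cbox (x - vec r) (x + vec r))"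
    by (intro emeasure_mono) auto
  also have "\<dots> = emeasure lebesgue (cbox (x - vec r) (x + vec r))" by simp
  also have "\<dots> = ennreal (measure lebesgue (cbox (x - vec r) (x + vec r)))"
    by (rule emeasure_eq_measure2[OF lmeasurable_cbox])
  also have "measure lebesgue (cbox (x - vec r) (x + vec r)) = 4 * r\<^sup>2"
    using measure_box_perp(1)[of "x - vec r" "x + vec r" 1] assms by (simp add: power2_eq_square)
  finally show ?thesis .
qed

text \<open>Dyadic annuli: the \<open>n\<close>-th has area of order \<open>(2 ^ n * r)\<^sup>2\<close>, which leaves a geometric series with
  ratio \<open>2 powr - t\<close>.\<close>

lemma tail_integral:
  fixes x :: "real^2"
  assumes r: "r > 0" and t: "t > 0"
  shows "(\<integral>\<^sup>+y. ennreal (1 / norm (x - y) powr (2 + t)) * indicator {y. r \<le> norm (x - y)} y \<partial>lborel)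
    \<le> ennreal (16 / (1 - 2 powr - t) * r powr - t)"
proof -
  define A where "A n = ball x (2 ^ Suc n * r)" for n
  have [measurable]: "A n \<in> sets borel" for n by (simp add: A_def)
  define c where "c n = 1 / (2 ^ n * r) powr (2 + t)" for n
  have "ennreal (1 / norm (x - y) powr (2 + t)) * indicator {y. r \<le> norm (x - y)} y \<le> (\<Sum>n. ennreal (c n) * indicator (A n) y)" for y
  proof (cases "r \<le> norm (x - y)")
    case True
    obtain n0 where "norm (x - y) / r < 2 ^ n0" using real_arch_pow[of 2 "norm (x - y) / r"] by auto
    then have "norm (x - y) < 2 ^ n0 * r" using r by (simp add: field_simps)
    also have "\<dots> \<le> 2 ^ Suc n0 * r" using r by simp
    finally have ex: "norm (x - y) < 2 ^ Suc n0 * r" .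
    \<comment> \<open>The annulus that contains \<open>y\<close>.\<close>
    define n where "n = (LEAST n. norm (x - y) < 2 ^ Suc n * r)"
    have n: "norm (x - y) < 2 ^ Suc n * r" unfolding n_def by (rule LeastI[of _ n0]) (rule ex)
    have n': "2 ^ n * r \<le> norm (x - y)"
    proof (cases n)
      case 0 then show ?thesis using True by simp
    next
      case (Suc k)
      then have "k < n" by simp
      then have "\<not> norm (x - y) < 2 ^ Suc k * r" unfolding n_def by (rule not_less_Least)
      then show ?thesis using Suc by simp
    qed
    have pos: "0 < 2 ^ n * r" using r by simp
    with n' have pos': "0 < norm (x - y)" by linarith
    have "(2 ^ n * r) powr (2 + t) \<le> norm (x - y) powr (2 + t)"
      using n' pos t by (intro powr_mono2) auto
    then have "1 / norm (x - y) powr (2 + t) \<le> c n"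
      unfolding c_def using pos pos' by (intro divide_left_mono mult_pos_pos powr_gt_zero[THEN iffD2]) auto
    then have "ennreal (1 / norm (x - y) powr (2 + t)) * indicator {y. r \<le> norm (x - y)} y \<le> ennreal (c n) * indicator (A n) y"
      using True n by (auto simp: A_def dist_norm intro!: ennreal_leI)
    also have "\<dots> \<le> (\<Sum>n. ennreal (c n) * indicator (A n) y)"
      by (rule ennreal_suminf_ge)
    finally show ?thesis .
  qed simp
  then have "(\<integral>\<^sup>+y. ennreal (1 / norm (x - y) powr (2 + t)) * indicator {y. r \<le> norm (x - y)} y \<partial>lborel)
      \<le> (\<integral>\<^sup>+y. (\<Sum>n. ennreal (c n) * indicator (A n) y) \<partial>lborel)"
    by (intro nn_integral_mono)
  also have "\<dots> = (\<Sum>n. \<integral>\<^sup>+y. ennreal (c n) * indicator (A n) y \<partial>lborel)"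
    by (rule nn_integral_suminf) measurable
  also have "\<dots> = (\<Sum>n. ennreal (c n) * emeasure lborel (A n))"
    by (simp add: nn_integral_cmult)
  also have "\<dots> \<le> (\<Sum>n. ennreal (16 * r powr - t * (2 powr - t) ^ n))"
  proof (rule suminf_le)
    fix n
    have "ennreal (c n) * emeasure lborel (A n) \<le> ennreal (c n) * ennreal (4 * (2 ^ Suc n * r)\<^sup>2)"
      unfolding A_def using r by (intro mult_left_mono cball_measure_le) auto
    also have "\<dots> = ennreal (c n * (4 * (2 ^ Suc n * r)\<^sup>2))" by (rule ennreal_mult'[symmetric]) (simp add: c_def)
    also have "c n * (4 * (2 ^ Suc n * r)\<^sup>2) = 16 * r powr - t * (2 powr - t) ^ n"
    proof -
      have "r powr - t * (2 powr - t) ^ n = (2 ^ n * r) powr - t"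
        using r by (simp add: powr_mult two_power_powr)
      moreover have "c n = (2 ^ n * r) powr - t / (2 ^ n * r)\<^sup>2"
        using r unfolding c_def by (simp add: powr_add powr_minus divide_inverse powr_numeral)
      ultimately show ?thesis using r by (simp add: power2_eq_square field_simps)
    qed
    finally show "ennreal (c n) * emeasure lborel (A n) \<le> ennreal (16 * r powr - t * (2 powr - t) ^ n)" .
  qed (auto intro: summableI)
  also have "\<dots> = ennreal (16 * r powr - t / (1 - 2 powr - t))"
    using t powr_less_mono[of "-t" 0 2] by (intro dyadic_sum) auto
  finally show ?thesis by (simp add: mult.commute)
qed

text \<open>\<open>h\<close> stands for the distance to one edge of the rectangle. Dyadic layers again: the set where \<open>h\<close> is
  about \<open>l / 2 ^ n\<close> has an area of at most the fraction \<open>1 / 2 ^ n\<close>, and the series converges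
  because \<open>t < 1\<close>. The hypothesis \<open>strip\<close> covers both orientations of the edge.\<close>

lemma edge_integral:
  fixes a b :: "real^2"
  assumes ne: "box a b \<noteq> {}" and t: "0 < t" "t < 1"
    and h: "\<And>x. x \<in> box a b \<Longrightarrow> 0 < h x \<and> h x < b $ i - a $ i"
    and strip: "\<And>w. {x \<in> box a b. h x \<le> w} \<subseteq> {x \<in> cbox a b. lo' w \<le> x $ i \<and> x $ i \<le> lo' w + w}"
  shows "(\<integral>\<^sup>+x. ennreal (h x powr - t) * indicator (box a b) x \<partial>lborel)
    \<le> ennreal (2 / (1 - 2 powr (t - 1)) * ((b $ i - a $ i) powr - t * measure lebesgue (box a b)))"
proof -
  define l where "l = b $ i - a $ i"
  define k where "k = b $ perp i - a $ perp i"
  have ab: "a $ i < b $ i" for i using ne by (simp add: interval_ne_empty_cart)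
  have lk: "l > 0" "k > 0" using ab by (auto simp: l_def k_def)
  have mB: "measure lebesgue (box a b) = l * k"
    using measure_box_perp(2)[of a b i] less_imp_le[OF ab] by (simp add: l_def k_def)
  define Q where "Q n = {x \<in> cbox a b. lo' (l / 2 ^ n) \<le> x $ i \<and> x $ i \<le> lo' (l / 2 ^ n) + l / 2 ^ n}" for n
  define c where "c n = (l / 2 ^ Suc n) powr - t" for n
  have Qc: "closed (Q n)" for n
  proof -
    have "Q n = cbox a b \<inter> {x. lo' (l / 2 ^ n) \<le> x $ i} \<inter> {x. x $ i \<le> lo' (l / 2 ^ n) + l / 2 ^ n}" by (auto simp: Q_def)
    then show ?thesis
      by (simp only:) (intro closed_Int closed_cbox closed_halfspace_component_le_cart closed_halfspace_component_ge_cart)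
  qed
  then have [measurable]: "Q n \<in> sets borel" for n by (rule borel_closed)
  have Qm: "emeasure lborel (Q n) \<le> ennreal (l / 2 ^ n * k)" for n
  proof -
    obtain c d where cd: "Q n \<subseteq> cbox c d" "measure lebesgue (cbox c d) = (lo' (l / 2 ^ n) + l / 2 ^ n - lo' (l / 2 ^ n)) * (b $ perp i - a $ perp i)"
      unfolding Q_def by (rule strip_subset_box[of "lo' (l / 2 ^ n)" "lo' (l / 2 ^ n) + l / 2 ^ n" a b i])
        (use lk less_imp_le[OF ab] in auto)
    have "emeasure lborel (Q n) \<le> emeasure lborel (cbox c d)" using cd(1) by (intro emeasure_mono) auto
    also have "\<dots> = emeasure lebesgue (cbox c d)" by simp
    also have "\<dots> = ennreal (measure lebesgue (cbox c d))" by (rule emeasure_eq_measure2[OF lmeasurable_cbox])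
    finally show ?thesis unfolding cd(2) k_def by simp
  qed
  have "ennreal (h x powr - t) * indicator (box a b) x \<le> (\<Sum>n. ennreal (c n) * indicator (Q n) x)" for x
  proof (cases "x \<in> box a b")
    case True
    have hx: "0 < h x" "h x < l" using h[OF True] by (auto simp: l_def)
    obtain n0 where "l / h x < 2 ^ n0" using real_arch_pow[of 2 "l / h x"] by auto
    then have "l < 2 ^ n0 * h x" using hx by (simp add: field_simps)
    then have ex: "l < 2 ^ Suc n0 * h x" using hx by simp
    define n where "n = (LEAST n. l < 2 ^ Suc n * h x)"
    have n: "l < 2 ^ Suc n * h x" unfolding n_def by (rule LeastI[of _ n0]) (rule ex)
    have n': "2 ^ n * h x \<le> l"
    proof (cases n)
      case 0 then show ?thesis using hx by simp
    next
      case (Suc j)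
      then have "j < n" by simp
      then have "\<not> l < 2 ^ Suc j * h x" unfolding n_def by (rule not_less_Least)
      then show ?thesis using Suc by simp
    qed
    have "h x \<le> l / 2 ^ n" using n' by (simp add: field_simps)
    then have "x \<in> Q n" using strip[of "l / 2 ^ n"] True by (auto simp: Q_def)
    moreover have "h x powr - t \<le> c n"
      unfolding c_def using n hx lk t by (intro powr_mono2') (auto simp: field_simps)
    ultimately have "ennreal (h x powr - t) * indicator (box a b) x \<le> ennreal (c n) * indicator (Q n) x"
      using True by (auto intro!: ennreal_leI)
    also have "\<dots> \<le> (\<Sum>n. ennreal (c n) * indicator (Q n) x)"
      by (rule ennreal_suminf_ge)
    finally show ?thesis .
  qed simp
  then have "(\<integral>\<^sup>+x. ennreal (h x powr - t) * indicator (box a b) x \<partial>lborel)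
      \<le> (\<integral>\<^sup>+x. (\<Sum>n. ennreal (c n) * indicator (Q n) x) \<partial>lborel)"
    by (intro nn_integral_mono)
  also have "\<dots> = (\<Sum>n. \<integral>\<^sup>+x. ennreal (c n) * indicator (Q n) x \<partial>lborel)"
    by (rule nn_integral_suminf) measurable
  also have "\<dots> = (\<Sum>n. ennreal (c n) * emeasure lborel (Q n))"
    by (simp add: nn_integral_cmult)
  also have "\<dots> \<le> (\<Sum>n. ennreal (2 powr t * l powr - t * (l * k) * (2 powr (t - 1)) ^ n))"
  proof (rule suminf_le)
    fix n
    have "ennreal (c n) * emeasure lborel (Q n) \<le> ennreal (c n) * ennreal (l / 2 ^ n * k)"
      by (intro mult_left_mono Qm) auto
    also have "\<dots> = ennreal (c n * (l / 2 ^ n * k))" by (rule ennreal_mult'[symmetric]) (simp add: c_def)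
    also have "c n * (l / 2 ^ n * k) = 2 powr t * l powr - t * (l * k) * (2 powr (t - 1)) ^ n"
    proof -
      have "(2 powr (t - 1)) ^ n = (2 powr t / 2) ^ n" by (simp add: powr_diff)
      also have "\<dots> = (2 powr t) ^ n / 2 ^ n" by (rule power_divide)
      finally have 1: "(2 powr (t - 1)) ^ n = (2 powr t) ^ n / 2 ^ n" .
      have "c n = l powr - t * (2 ^ Suc n) powr t"
      proof -
        have "(l / 2 ^ Suc n) powr - t = l powr - t / (2 ^ Suc n) powr - t"
          by (rule powr_divide)
        then show ?thesis unfolding c_def by (simp only: powr_minus[of _ t] divide_inverse inverse_inverse_eq)
      qed
      also have "\<dots> = l powr - t * (2 powr t * (2 powr t) ^ n)" unfolding two_power_powr by simp
      finally show ?thesis unfolding 1 by (simp add: mult_ac)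
    qed
    finally show "ennreal (c n) * emeasure lborel (Q n) \<le> ennreal (2 powr t * l powr - t * (l * k) * (2 powr (t - 1)) ^ n)" .
  qed (auto intro: summableI)
  also have "\<dots> = ennreal (2 powr t * l powr - t * (l * k) / (1 - 2 powr (t - 1)))"
    using lk t powr_less_mono[of "t - 1" 0 2] by (intro dyadic_sum) auto
  also have "\<dots> \<le> ennreal (2 / (1 - 2 powr (t - 1)) * (l powr - t * (l * k)))"
  proof (rule ennreal_leI)
    have "2 powr t \<le> 2 powr 1" using t by (intro powr_mono) auto
    moreover have "1 - 2 powr (t - 1) > 0" using t powr_less_mono[of "t - 1" 0 2] by auto
    ultimately have "2 powr t * (l powr - t * (l * k)) / (1 - 2 powr (t - 1)) \<le> 2 * (l powr - t * (l * k)) / (1 - 2 powr (t - 1))"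
      using lk by (intro divide_right_mono mult_right_mono) auto
    then show "2 powr t * l powr - t * (l * k) / (1 - 2 powr (t - 1)) \<le> 2 / (1 - 2 powr (t - 1)) * (l powr - t * (l * k))"
      by (simp add: mult_ac)
  qed
  finally show ?thesis unfolding mB l_def .
qed

lemma measurable_vec_nth [measurable]: "(\<lambda>x::real^2. x $ i) \<in> borel_measurable borel"
  by (intro borel_measurable_continuous_onI continuous_intros)

definition cross_const :: "real \<Rightarrow> real" where
  "cross_const t = 16 / (1 - 2 powr - t) * (4 / (1 - 2 powr (t - 1)))"

text \<open>The interaction of a rectangle with its complement. Seen from a point of the rectangle the complement
  starts at the distance to the nearest edge, so the inner integral is at most the sum over the four edges of
  the distance to the power \<open>- t\<close>.\<close>

lemma cross_integral:
  assumes R: "rectangle R" and t: "0 < t" "t < 1"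
  shows "(\<integral>\<^sup>+x. (\<integral>\<^sup>+y. ennreal (1 / norm (x - y) powr (2 + t)) * indicator (- R) y \<partial>lborel) * indicator R x \<partial>lborel)
    \<le> ennreal (cross_const t * phi t R)"
proof -
  obtain a b where ab: "R = box a b" "box a b \<noteq> {}" using R by (auto simp: rectangle_def)
  define c where "c = 16 / (1 - 2 powr - t)"
  define d where "d = 2 / (1 - 2 powr (t - 1))"
  have c: "c \<ge> 0" using powr_less_mono[of "-t" 0 2] t by (auto simp: c_def)
  have d: "d \<ge> 0" using powr_less_mono[of "t - 1" 0 2] t by (auto simp: d_def)
  define e where "e i x = ennreal ((x $ i - a $ i) powr - t) * indicator R x" for i :: 2 and x :: "real^2"
  define f where "f i x = ennreal ((b $ i - x $ i) powr - t) * indicator R x" for i :: 2 and x :: "real^2"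
  have Rm [measurable]: "R \<in> sets borel" by (simp add: ab(1))
  have em [measurable]: "e i \<in> borel_measurable borel" and fm [measurable]: "f i \<in> borel_measurable borel" for i
    unfolding e_def[abs_def] f_def[abs_def] by measurable
  have pw: "(\<integral>\<^sup>+y. ennreal (1 / norm (x - y) powr (2 + t)) * indicator (- R) y \<partial>lborel) * indicator R x
      \<le> ennreal c * (e 1 x + f 1 x + (e 2 x + f 2 x))" for x
  proof (cases "x \<in> R")
    case True
    have pos: "0 < x $ i - a $ i" "0 < b $ i - x $ i" for i using True by (auto simp: ab(1) mem_box_cart)
    define r where "r = min (min (x $ 1 - a $ 1) (b $ 1 - x $ 1)) (min (x $ 2 - a $ 2) (b $ 2 - x $ 2))"
    have r: "r > 0" using pos by (simp add: r_def)
    have far: "r \<le> norm (x - y)" if "y \<notin> R" for y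
    proof -
      obtain i where "\<not> (a $ i < y $ i \<and> y $ i < b $ i)" using \<open>y \<notin> R\<close> by (auto simp: ab(1) mem_box_cart)
      then have "min (x $ i - a $ i) (b $ i - x $ i) \<le> \<bar>(x - y) $ i\<bar>" by auto
      also have "\<dots> \<le> norm (x - y)" using Finite_Cartesian_Product.norm_nth_le[of "x - y" i] by simp
      finally show ?thesis using exhaust_2[of i] by (auto simp: r_def)
    qed
    have "(\<integral>\<^sup>+y. ennreal (1 / norm (x - y) powr (2 + t)) * indicator (- R) y \<partial>lborel)
        \<le> (\<integral>\<^sup>+y. ennreal (1 / norm (x - y) powr (2 + t)) * indicator {y. r \<le> norm (x - y)} y \<partial>lborel)"
      using far by (intro nn_integral_mono mult_left_mono) (auto simp: indicator_def)
    also have "\<dots> \<le> ennreal (c * r powr - t)" unfolding c_def by (rule tail_integral[OF r t(1)])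
    also have "\<dots> \<le> ennreal (c * ((x $ 1 - a $ 1) powr - t + (b $ 1 - x $ 1) powr - t + ((x $ 2 - a $ 2) powr - t + (b $ 2 - x $ 2) powr - t)))"
      using c by (intro ennreal_leI mult_left_mono) (auto simp: r_def min_def)
    also have "\<dots> = ennreal c * (ennreal ((x $ 1 - a $ 1) powr - t) + ennreal ((b $ 1 - x $ 1) powr - t) + (ennreal ((x $ 2 - a $ 2) powr - t) + ennreal ((b $ 2 - x $ 2) powr - t)))"
      using c by (simp add: ennreal_mult ennreal_plus)
    finally show ?thesis using True by (simp add: e_def f_def)
  qed simp
  have sides: "side R i = b $ i - a $ i" for i using ab by (simp add: side_box)
  have ei: "(\<integral>\<^sup>+x. e i x \<partial>lborel) \<le> ennreal (d * (side R i powr - t * measure lebesgue R))" for i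
    unfolding e_def ab(1) d_def side_box[OF ab(2)]
    by (rule edge_integral[OF ab(2) t, where lo'="\<lambda>w. a $ i"]) (auto simp: mem_box_cart less_imp_le)
  have fi: "(\<integral>\<^sup>+x. f i x \<partial>lborel) \<le> ennreal (d * (side R i powr - t * measure lebesgue R))" for i
    unfolding f_def ab(1) d_def side_box[OF ab(2)]
    by (rule edge_integral[OF ab(2) t, where lo'="\<lambda>w. b $ i - w"]) (auto simp: mem_box_cart less_imp_le)
  have "(\<integral>\<^sup>+x. (\<integral>\<^sup>+y. ennreal (1 / norm (x - y) powr (2 + t)) * indicator (- R) y \<partial>lborel) * indicator R x \<partial>lborel)
      \<le> (\<integral>\<^sup>+x. ennreal c * (e 1 x + f 1 x + (e 2 x + f 2 x)) \<partial>lborel)"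
    by (intro nn_integral_mono pw)
  also have "\<dots> = ennreal c * ((\<integral>\<^sup>+x. e 1 x \<partial>lborel) + (\<integral>\<^sup>+x. f 1 x \<partial>lborel) + ((\<integral>\<^sup>+x. e 2 x \<partial>lborel) + (\<integral>\<^sup>+x. f 2 x \<partial>lborel)))"
    by (simp add: nn_integral_cmult nn_integral_add)
  also have "\<dots> \<le> ennreal c * (ennreal (d * (side R 1 powr - t * measure lebesgue R)) + ennreal (d * (side R 1 powr - t * measure lebesgue R))
      + (ennreal (d * (side R 2 powr - t * measure lebesgue R)) + ennreal (d * (side R 2 powr - t * measure lebesgue R))))"
    by (intro mult_left_mono add_mono ei fi) auto
  also have "\<dots> = ennreal (c * (2 * d) * phi t R)"
    using c d by (simp add: ennreal_plus[symmetric] ennreal_mult[symmetric] phi_def algebra_simps del: ennreal_plus)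
  also have "c * (2 * d) = cross_const t" by (simp add: c_def d_def cross_const_def)
  finally show ?thesis .
qed

context well_blocks
begin

text \<open>For a point in a block, the integral over the same block is controlled by the assumed bound on blocks,
  and the integral over the rest by the crude bound on the gradient and the interaction of the block with
  its complement. Both are at most a multiple of \<open>phi\<close> of the block, and blocks cover almost everything.\<close>

lemma glued_seminorm_finite:
  assumes B: "packing B"
    and p: "1 < p" and s: "0 < s" "s * p < 1"
    and C0: "\<And>R. rectangle R \<Longrightarrow> R \<subseteq> unit_square \<Longrightarrow>
      Wsp_pow R s p (weak_grad R (z R)) \<le> ennreal (C\<^sub>0 * rect_perimeter R powr (s * p) * measure lebesgue R powr (1 - s * p))"
    and full: "AE x in lebesgue. x \<in> unit_square \<longrightarrow> x \<in> (\<Union>n. B n)"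
    and sum: "(\<Sum>n. ennreal (phi (s * p) (B n))) < \<infinity>"
  shows "Wsp_pow unit_square s p (glued_grad B) < \<infinity>"
proof -
  define t where "t = s * p"
  have t: "0 < t" "t < 1" using p s by (auto simp: t_def)
  have cc: "cross_const t \<ge> 0" using t powr_less_mono[of "t - 1" 0 2] powr_less_mono[of "- t" 0 2]
    unfolding cross_const_def by (intro mult_nonneg_nonneg divide_nonneg_nonneg) auto
  define G where "G = glued_grad B"
  have Gm: "G \<in> borel_measurable lebesgue" unfolding G_def by (rule measurable_glued_grad[OF B])
  have Gb: "AE x in lebesgue. norm (G x) \<le> bound" unfolding G_def by (rule glued_grad_bound[OF B])
  have Bs: "B n \<in> sets lebesgue" for n by (rule packing_sets[OF B])
  have Bb [measurable]: "B n \<in> sets borel" for n by (rule borel_open[OF packing_open[OF B]])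
  have idm: "(\<lambda>x. x) \<in> borel_measurable (lebesgue :: (real^2) measure)" by (simp add: measurable_completion)
  define f where "f x y = ennreal (norm (G x - G y) powr p / norm (x - y) powr (2 + t))" for x y
  define K where "K = ennreal ((2 * bound) powr p)"
  define q where "q x y = ennreal (1 / norm (x - y) powr (2 + t))" for x y :: "real^2"
  define I where "I n x = (\<integral>\<^sup>+y. f x y \<partial>lebesgue_on (B n))" for n x
  define J where "J n x = (\<integral>\<^sup>+y. q x y * indicator (- B n) y \<partial>lborel)" for n x
  have fm: "f x \<in> borel_measurable lebesgue" for x
  proof -
    note [measurable] = Gm idm
    show ?thesis unfolding f_def[abs_def] by measurable
  qed
  have qm: "q x \<in> borel_measurable lborel" for x
    unfolding q_def[abs_def] by measurable
  have Im: "I n \<in> borel_measurable lebesgue" for n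
  proof -
    interpret fin: finite_measure "lebesgue_on (B n)"
      by (rule finite_measure_lebesgue_on[OF packing_lmeasurable[OF B]])
    let ?P = "lebesgue \<Otimes>\<^sub>M lebesgue_on (B n) :: ((real^2) \<times> (real^2)) measure"
    have [measurable]: "(\<lambda>w. G (fst w)) \<in> borel_measurable ?P" "(\<lambda>w. fst w) \<in> borel_measurable ?P"
      by (rule measurable_compose[OF measurable_fst Gm], rule measurable_compose[OF measurable_fst idm])
    have [measurable]: "(\<lambda>w. G (snd w)) \<in> borel_measurable ?P" "(\<lambda>w. snd w) \<in> borel_measurable ?P"
      by (rule measurable_compose[OF measurable_snd measurable_restrict_space1[OF Gm]],
          rule measurable_compose[OF measurable_snd measurable_restrict_space1[OF idm]])
    have "case_prod f \<in> borel_measurable ?P"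
      unfolding f_def[abs_def] split_beta' by measurable
    then show ?thesis unfolding I_def[abs_def] by (rule fin.borel_measurable_nn_integral)
  qed
  have Jm: "J n \<in> borel_measurable lborel" for n
  proof -
    have "case_prod (\<lambda>x y. q x y * indicator (- B n) y) \<in> borel_measurable (lborel \<Otimes>\<^sub>M lborel)"
      unfolding q_def split_beta' by measurable
    then show ?thesis unfolding J_def[abs_def] by (rule lborel.borel_measurable_nn_integral)
  qed
  have pw: "AE x in lebesgue. (\<integral>\<^sup>+y. f x y \<partial>lebesgue_on unit_square) * indicator unit_square x
      \<le> (\<Sum>n. (I n x + K * J n x) * indicator (B n) x)"
    using full Gb
  proof eventually_elim
    case (elim x)
    show ?case
    proof (cases "x \<in> unit_square")
      case True
      then obtain n where n: "x \<in> B n" using elim(1) by blast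
      have "(\<integral>\<^sup>+y. f x y \<partial>lebesgue_on unit_square) = (\<integral>\<^sup>+y. f x y * indicator unit_square y \<partial>lebesgue)"
        using sets_unit_square by (simp add: nn_integral_restrict_space)
      also have "\<dots> \<le> (\<integral>\<^sup>+y. f x y * indicator (B n) y + K * (q x y * indicator (- B n) y) \<partial>lebesgue)"
      proof (rule nn_integral_mono_AE)
        show "AE y in lebesgue. f x y * indicator unit_square y \<le> f x y * indicator (B n) y + K * (q x y * indicator (- B n) y)"
          using Gb
        proof eventually_elim
          case (elim y)
          show ?case
          proof (cases "y \<in> B n")
            case False
            have "norm (G x - G y) \<le> 2 * bound"
              using norm_triangle_ineq4[of "G x" "G y"] elim \<open>norm (G x) \<le> bound\<close> by simp
            then have "norm (G x - G y) powr p \<le> (2 * bound) powr p" using p by (intro powr_mono2) auto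
            then have "norm (G x - G y) powr p / norm (x - y) powr (2 + t) \<le> (2 * bound) powr p * (1 / norm (x - y) powr (2 + t))"
              by (simp add: divide_right_mono)
            then have "f x y \<le> K * q x y"
              unfolding f_def K_def q_def by (subst ennreal_mult[symmetric]) (auto intro: ennreal_leI)
            then show ?thesis using False by (auto simp: indicator_def)
          next
            case True
            then show ?thesis using packing_subset[OF B, of n] by (auto simp: indicator_def)
          qed
        qed
      qed
      also have "\<dots> = (\<integral>\<^sup>+y. f x y * indicator (B n) y \<partial>lebesgue) + (\<integral>\<^sup>+y. K * (q x y * indicator (- B n) y) \<partial>lebesgue)"
      proof (rule nn_integral_add)
        show "(\<lambda>y. f x y * indicator (B n) y) \<in> borel_measurable lebesgue"
          using fm Bs by (intro borel_measurable_times_ennreal borel_measurable_indicator) auto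
        have "(\<lambda>y. K * (q x y * indicator (- B n) y)) \<in> borel_measurable lborel" using qm by measurable
        then show "(\<lambda>y. K * (q x y * indicator (- B n) y)) \<in> borel_measurable lebesgue" by (rule measurable_completion)
      qed
      also have "(\<integral>\<^sup>+y. f x y * indicator (B n) y \<partial>lebesgue) = I n x"
        unfolding I_def using Bs by (simp add: nn_integral_restrict_space)
      also have "(\<integral>\<^sup>+y. K * (q x y * indicator (- B n) y) \<partial>lebesgue) = K * J n x"
      proof -
        have "(\<lambda>y. q x y * indicator (- B n) y) \<in> borel_measurable lborel" using qm by measurable
        then show ?thesis unfolding nn_integral_completion J_def by (rule nn_integral_cmult)
      qed
      also have "I n x + K * J n x = (I n x + K * J n x) * indicator (B n) x" using n by simp
      also have "\<dots> \<le> (\<Sum>n. (I n x + K * J n x) * indicator (B n) x)" by (rule ennreal_suminf_ge)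
      finally show ?thesis using True by simp
    qed simp
  qed
  have m2: "(\<lambda>x. (I n x + K * J n x) * indicator (B n) x) \<in> borel_measurable lebesgue" for n
    using Im[of n] measurable_completion[OF Jm[of n]] Bs[of n]
    by (intro borel_measurable_times_ennreal borel_measurable_add borel_measurable_const borel_measurable_indicator) auto
  have piece: "(\<integral>\<^sup>+x. (I n x + K * J n x) * indicator (B n) x \<partial>lebesgue)
      \<le> ennreal (4 * \<bar>C\<^sub>0\<bar> + (2 * bound) powr p * cross_const t) * ennreal (phi t (B n))" for n
  proof (cases "B n = {}")
    case False
    then have r: "rectangle (B n)" using packing_rectangle[OF B] by blast
    have "(\<integral>\<^sup>+x. (I n x + K * J n x) * indicator (B n) x \<partial>lebesgue)
        = (\<integral>\<^sup>+x. I n x * indicator (B n) x + K * (J n x * indicator (B n) x) \<partial>lebesgue)"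
      by (intro nn_integral_cong) (simp add: algebra_simps)
    also have "\<dots> = (\<integral>\<^sup>+x. I n x * indicator (B n) x \<partial>lebesgue) + (\<integral>\<^sup>+x. K * (J n x * indicator (B n) x) \<partial>lebesgue)"
    proof (rule nn_integral_add)
      show "(\<lambda>x. I n x * indicator (B n) x) \<in> borel_measurable lebesgue"
        using Im[of n] Bs[of n] by (intro borel_measurable_times_ennreal borel_measurable_indicator) auto
      show "(\<lambda>x. K * (J n x * indicator (B n) x)) \<in> borel_measurable lebesgue"
        using measurable_completion[OF Jm[of n]] Bs[of n]
        by (intro borel_measurable_times_ennreal borel_measurable_const borel_measurable_indicator) auto
    qed
    also have "(\<integral>\<^sup>+x. I n x * indicator (B n) x \<partial>lebesgue) \<le> ennreal (4 * \<bar>C\<^sub>0\<bar>) * ennreal (phi t (B n))"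
    proof -
      have "(\<integral>\<^sup>+x. I n x * indicator (B n) x \<partial>lebesgue) = (\<integral>\<^sup>+x. I n x \<partial>lebesgue_on (B n))"
        using Bs by (simp add: nn_integral_restrict_space)
      also have "\<dots> = (\<integral>\<^sup>+x. (\<integral>\<^sup>+y. ennreal (norm (weak_grad (B n) (z (B n)) x - weak_grad (B n) (z (B n)) y) powr p
          / norm (x - y) powr (2 + s * p)) \<partial>lebesgue_on (B n)) \<partial>lebesgue_on (B n))"
        unfolding I_def f_def G_def t_def
        by (intro nn_integral_cong) (simp add: glued_grad_in[OF B, where n=n])
      also have "\<dots> \<le> Wsp_pow (B n) s p (weak_grad (B n) (z (B n)))" unfolding Wsp_pow_def by simp
      also have "\<dots> \<le> ennreal (C\<^sub>0 * rect_perimeter (B n) powr (s * p) * measure lebesgue (B n) powr (1 - s * p))"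
        by (rule C0[OF r packing_subset[OF B]])
      also have "\<dots> \<le> ennreal (4 * \<bar>C\<^sub>0\<bar> * phi t (B n))"
      proof (rule ennreal_leI)
        have "C\<^sub>0 * (rect_perimeter (B n) powr t * measure lebesgue (B n) powr (1 - t)) \<le> \<bar>C\<^sub>0\<bar> * (4 * phi t (B n))"
          by (rule mult_mono[OF abs_ge_self perimeter_phi[OF r t]]) auto
        then show "C\<^sub>0 * rect_perimeter (B n) powr (s * p) * measure lebesgue (B n) powr (1 - s * p) \<le> 4 * \<bar>C\<^sub>0\<bar> * phi t (B n)"
          by (simp add: t_def mult_ac)
      qed
      also have "\<dots> = ennreal (4 * \<bar>C\<^sub>0\<bar>) * ennreal (phi t (B n))" by (rule ennreal_mult) (simp_all add: phi_nonneg)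
      finally show ?thesis .
    qed
    also have "(\<integral>\<^sup>+x. K * (J n x * indicator (B n) x) \<partial>lebesgue) \<le> ennreal ((2 * bound) powr p * cross_const t) * ennreal (phi t (B n))"
    proof -
      have "(\<lambda>x. J n x * indicator (B n) x) \<in> borel_measurable lborel" using Jm[of n] by measurable
      then have "(\<integral>\<^sup>+x. K * (J n x * indicator (B n) x) \<partial>lebesgue) = K * (\<integral>\<^sup>+x. J n x * indicator (B n) x \<partial>lborel)"
        unfolding nn_integral_completion by (rule nn_integral_cmult)
      also have "\<dots> \<le> K * ennreal (cross_const t * phi t (B n))"
        unfolding J_def q_def by (intro mult_left_mono cross_integral[OF r t]) auto
      also have "\<dots> = ennreal ((2 * bound) powr p * cross_const t) * ennreal (phi t (B n))"
        unfolding K_def using cc by (simp add: ennreal_mult phi_nonneg mult_ac)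
      finally show ?thesis .
    qed
    also have "ennreal (4 * \<bar>C\<^sub>0\<bar>) * ennreal (phi t (B n)) + ennreal ((2 * bound) powr p * cross_const t) * ennreal (phi t (B n))
        = ennreal (4 * \<bar>C\<^sub>0\<bar> + (2 * bound) powr p * cross_const t) * ennreal (phi t (B n))"
      using cc by (simp add: distrib_right)
    finally show ?thesis by (simp add: add_mono)
  qed simp
  have "(\<integral>\<^sup>+x. (\<integral>\<^sup>+y. f x y \<partial>lebesgue_on unit_square) \<partial>lebesgue_on unit_square)
      = (\<integral>\<^sup>+x. (\<integral>\<^sup>+y. f x y \<partial>lebesgue_on unit_square) * indicator unit_square x \<partial>lebesgue)"
    using sets_unit_square by (simp add: nn_integral_restrict_space)
  also have "\<dots> \<le> (\<integral>\<^sup>+x. (\<Sum>n. (I n x + K * J n x) * indicator (B n) x) \<partial>lebesgue)"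
    by (rule nn_integral_mono_AE[OF pw])
  also have "\<dots> = (\<Sum>n. \<integral>\<^sup>+x. (I n x + K * J n x) * indicator (B n) x \<partial>lebesgue)"
    by (rule nn_integral_suminf[OF m2])
  also have "\<dots> \<le> (\<Sum>n. ennreal (4 * \<bar>C\<^sub>0\<bar> + (2 * bound) powr p * cross_const t) * ennreal (phi t (B n)))"
    by (intro suminf_le piece) (auto intro: summableI)
  also have "\<dots> < \<infinity>" using sum by (simp add: t_def ennreal_mult_less_top)
  finally have fin: "(\<integral>\<^sup>+x. (\<integral>\<^sup>+y. f x y \<partial>lebesgue_on unit_square) \<partial>lebesgue_on unit_square) < \<infinity>" .
  have "in_Lp unit_square p (glued_grad B)"
  proof (rule in_Lp_bounded)
    show "glued_grad B \<in> borel_measurable (lebesgue_on unit_square)"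
      using measurable_glued_grad[OF B] by (rule measurable_restrict_space1)
    show "AE x in lebesgue_on unit_square. norm (glued_grad B x) \<le> bound"
      using glued_grad_bound[OF B] sets_unit_square by (subst AE_restrict_space_iff) (auto elim: eventually_mono)
  qed (use p in simp)
  with fin show ?thesis by (simp add: Wsp_pow_def in_Lp_def f_def G_def t_def)
qed

text \<open>The limit is the map glued from all blocks. After \<open>k\<close> steps the map differs from the limit only on
  the part that is not yet covered, whose area tends to zero, and all gradients are uniformly bounded; this gives convergence
  in \<open>W\<^sup>1\<^sup>,\<^sup>1\<close>.\<close>

lemma limit_deformation_exists:
  fixes BB :: "nat \<Rightarrow> nat \<Rightarrow> (real^2) set"
  assumes B: "packing (\<lambda>n. case prod_decode n of (k, i) \<Rightarrow> BB k i)"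
    and p: "1 < p" and s: "0 < s" "s * p < 1"
    and C0: "\<And>R. rectangle R \<Longrightarrow> R \<subseteq> unit_square \<Longrightarrow>
      Wsp_pow R s p (weak_grad R (z R)) \<le> ennreal (C\<^sub>0 * rect_perimeter R powr (s * p) * measure lebesgue R powr (1 - s * p))"
    and y_in: "\<And>k j i x. j < k \<Longrightarrow> x \<in> BB j i \<Longrightarrow> y k x = z (BB j i) x"
    and y_out: "\<And>k x. (\<And>j i. j < k \<Longrightarrow> x \<notin> BB j i) \<Longrightarrow> y k x = M *v x"
    and exhaust: "(\<lambda>k. emeasure lebesgue (unit_square - (\<Union>j<k. \<Union>i. BB j i))) \<longlonglongrightarrow> 0"
    and sum: "(\<Sum>k. \<Sum>i. ennreal (phi (s * p) (BB k i))) < \<infinity>"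
  shows "\<exists>u. limit_deformation \<gamma> M s p y u"
proof -
  define Bf where "Bf n = (case prod_decode n of (k, i) \<Rightarrow> BB k i)" for n
  \<comment> \<open>The blocks of the first \<open>k\<close> steps, as a packing with the same index set.\<close>
  define Bk where "Bk k n = (if fst (prod_decode n) < k then Bf n else {})" for k n
  have Bf: "packing Bf" using B by (simp add: Bf_def[abs_def])
  have Bk: "packing (Bk k)" for k using Bf by (auto simp: packing_def disjoint_family_on_def Bk_def)
  have Bf_pair: "Bf (prod_encode (k, i)) = BB k i" for k i by (simp add: Bf_def)
  have Bf_Un: "(\<Union>n. Bf n) = (\<Union>k. \<Union>i. BB k i)"
  proof -
    have "x \<in> Bf n \<Longrightarrow> \<exists>k i. x \<in> BB k i" for x n by (auto simp: Bf_def split: prod.splits)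
    then show ?thesis using Bf_pair by (auto, metis)
  qed
  define W where "W k = unit_square - (\<Union>j<k. \<Union>i. BB j i)" for k
  have Ws: "W k \<in> sets lebesgue" for k
  proof -
    have "BB j i \<in> sets lebesgue" for j i using packing_sets[OF Bf, of "prod_encode (j, i)"] by (simp add: Bf_pair)
    then show ?thesis unfolding W_def using sets_unit_square by auto
  qed
  have y: "y k = glued (Bk k)" for k
  proof
    fix x
    show "y k x = glued (Bk k) x"
    proof (cases "\<exists>j i. j < k \<and> x \<in> BB j i")
      case True
      then obtain j i where ji: "j < k" "x \<in> BB j i" by blast
      then have e: "Bk k (prod_encode (j, i)) = BB j i" by (simp add: Bk_def Bf_pair)
      then have "x \<in> Bk k (prod_encode (j, i))" using ji by simp
      from glued_in[OF Bk this] show ?thesis using y_in[OF ji] by (simp only: e)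
    next
      case False
      then have "x \<notin> (\<Union>n. Bk k n)" by (auto simp: Bk_def Bf_def split: prod.splits if_splits)
      from glued_out[OF this] y_out[of k x] False show ?thesis by auto
    qed
  qed
  have same: "glued (Bk k) x = glued Bf x" "glued_grad (Bk k) x = glued_grad Bf x" if xW: "x \<in> unit_square - W k" for k x
  proof -
    obtain j i where ji: "j < k" "x \<in> BB j i" using xW by (auto simp: W_def)
    then have e: "Bk k (prod_encode (j, i)) = Bf (prod_encode (j, i))" by (simp add: Bk_def)
    have n: "x \<in> Bk k (prod_encode (j, i))" "x \<in> Bf (prod_encode (j, i))" using ji by (simp_all only: e Bf_pair)
    show "glued (Bk k) x = glued Bf x" "glued_grad (Bk k) x = glued_grad Bf x"
      using glued_in[OF Bk n(1)] glued_in[OF Bf n(2)] glued_grad_in[OF Bk n(1)] glued_grad_in[OF Bf n(2)]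
      by (simp_all only: e)
  qed
  have exc: "norm (glued B' x - M *v x) \<le> 17 * bound" if B': "packing B'" for B' x
  proof (cases "\<exists>n. x \<in> B' n")
    case True
    then obtain n where n: "x \<in> B' n" by blast
    have "measure lebesgue (B' n) \<le> measure lebesgue unit_square"
      by (rule measure_mono_fmeasurable[OF packing_subset[OF B'] packing_sets[OF B'] lmeasurable_unit_square])
    then have "288 * bound\<^sup>2 * measure lebesgue (B' n) \<le> 288 * bound\<^sup>2 * 1"
      unfolding measure_unit_square by (rule mult_left_mono) simp
    also have "\<dots> \<le> (17 * bound)\<^sup>2" by (simp add: power_mult_distrib)
    finally have "(norm (excess (B' n) x))\<^sup>2 \<le> (17 * bound)\<^sup>2"
      using block_excess(2)[OF packing_rectangle[OF B' n] packing_subset[OF B'], of x] by linarith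
    then have "norm (excess (B' n) x) \<le> 17 * bound"
      by (rule power2_le_imp_le) (use bound_nonneg in simp)
    then show ?thesis unfolding glued_excess[OF B' n] .
  next
    case False
    then have "x \<notin> (\<Union>n. B' n)" by blast
    from glued_out[OF this] show ?thesis using bound_nonneg by simp
  qed
  have Gon: "glued_grad B' \<in> borel_measurable (lebesgue_on unit_square)" "AE x in lebesgue_on unit_square. norm (glued_grad B' x) \<le> bound"
    if B': "packing B'" for B'
  proof -
    show "glued_grad B' \<in> borel_measurable (lebesgue_on unit_square)"
      using measurable_glued_grad[OF B'] by (rule measurable_restrict_space1)
    show "AE x in lebesgue_on unit_square. norm (glued_grad B' x) \<le> bound"
      using glued_grad_bound[OF B'] sets_unit_square by (subst AE_restrict_space_iff) (auto elim: eventually_mono)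
  qed
  have um: "glued B' \<in> borel_measurable (lebesgue_on unit_square)" if B': "packing B'" for B'
    by (rule continuous_imp_measurable_on_sets_lebesgue[OF continuous_on_subset[OF continuous_glued[OF B'] subset_UNIV] sets_unit_square])
  have ub: "\<exists>K. AE x in lebesgue_on unit_square. norm (glued B' x) \<le> K" if B': "packing B'" for B'
  proof -
    obtain K where K: "\<And>x. x \<in> cbox 0 1 \<Longrightarrow> norm (glued B' x) \<le> K"
      using continuous_bounded_on_compact[OF compact_cbox continuous_on_subset[OF continuous_glued[OF B']]] by blast
    have "unit_square \<subseteq> cbox 0 1" using box_subset_cbox by (simp add: unit_square_box)
    then show ?thesis using K by (intro exI[of _ K] AE_I2) auto
  qed
  have Sob: "in_W1inf unit_square (glued B')" "in_W1p unit_square r (glued B')"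
    "weak_grad unit_square (glued B') \<in> borel_measurable (lebesgue_on unit_square)"
    if B': "packing B'" "r > 0" for B' r
  proof -
    obtain K where K: "AE x in lebesgue_on unit_square. norm (glued B' x) \<le> K" using ub[OF B'(1)] by blast
    note S = Sobolev_bounded[OF glued_weak_gradient[OF B'(1)] um[OF B'(1)] K Gon[OF B'(1)]]
    show "in_W1inf unit_square (glued B')" "in_W1p unit_square r (glued B')"
      "weak_grad unit_square (glued B') \<in> borel_measurable (lebesgue_on unit_square)" using S B'(2) by auto
  qed
  define c where "c = ennreal (34 * bound) + ennreal (2 * bound)"
  have close: "Lp_pow unit_square 1 (\<lambda>x. y k x - glued Bf x)
      + Lp_pow unit_square 1 (weak_grad unit_square (\<lambda>x. y k x - glued Bf x)) \<le> c * emeasure lebesgue (W k)" for k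
  proof -
    have est: "Lp_pow unit_square 1 h \<le> ennreal C * emeasure lebesgue (W k)"
      if h: "AE x in lebesgue_on unit_square. norm (h x) \<le> C * indicator (W k) x" and C: "C \<ge> 0"
      for h :: "real^2 \<Rightarrow> 'b::euclidean_space" and C
    proof -
      have "Lp_pow unit_square 1 h \<le> (\<integral>\<^sup>+x. ennreal C * indicator (W k) x \<partial>lebesgue_on unit_square)"
        unfolding Lp_pow_def
      proof (rule nn_integral_mono_AE)
        show "AE x in lebesgue_on unit_square. ennreal (norm (h x) powr 1) \<le> ennreal C * indicator (W k) x"
          using h
        proof eventually_elim
          case (elim x)
          then have "ennreal (norm (h x) powr 1) \<le> ennreal (C * indicator (W k) x)" by (intro ennreal_leI) simp
          then show ?case using C by (simp add: ennreal_mult ennreal_indicator)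
        qed
      qed
      also have "\<dots> = (\<integral>\<^sup>+x. ennreal C * indicator (W k) x * indicator unit_square x \<partial>lebesgue)"
        using sets_unit_square by (simp add: nn_integral_restrict_space)
      also have "\<dots> \<le> (\<integral>\<^sup>+x. ennreal C * indicator (W k) x \<partial>lebesgue)"
        by (intro nn_integral_mono) (auto simp: indicator_def)
      also have "\<dots> = ennreal C * emeasure lebesgue (W k)" using Ws by (simp add: nn_integral_cmult)
      finally show ?thesis .
    qed
    have "Lp_pow unit_square 1 (\<lambda>x. y k x - glued Bf x) \<le> ennreal (34 * bound) * emeasure lebesgue (W k)"
    proof (rule est)
      show "AE x in lebesgue_on unit_square. norm (y k x - glued Bf x) \<le> 34 * bound * indicator (W k) x"
      proof (rule AE_I2)
        fix x assume "x \<in> space (lebesgue_on unit_square)"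
        then have x: "x \<in> unit_square" by simp
        show "norm (y k x - glued Bf x) \<le> 34 * bound * indicator (W k) x"
        proof (cases "x \<in> W k")
          case True
          have "norm (y k x - glued Bf x) \<le> norm (glued (Bk k) x - M *v x) + norm (glued Bf x - M *v x)"
            unfolding y using norm_triangle_ineq4[of "glued (Bk k) x - M *v x" "glued Bf x - M *v x"] by simp
          then show ?thesis using exc[OF Bk, of k x] exc[OF Bf, of x] True by simp
        next
          case False
          then show ?thesis using same(1)[of x k] x by (simp add: y)
        qed
      qed
    qed (use bound_nonneg in simp)
    moreover have "Lp_pow unit_square 1 (weak_grad unit_square (\<lambda>x. y k x - glued Bf x)) \<le> ennreal (2 * bound) * emeasure lebesgue (W k)"
    proof (rule est)
      have "has_weak_gradient unit_square (\<lambda>x. y k x - glued Bf x) (\<lambda>x. glued_grad (Bk k) x - glued_grad Bf x)"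
        unfolding y by (rule has_weak_gradient_diff[OF glued_weak_gradient[OF Bk] glued_weak_gradient[OF Bf] sets_unit_square])
      from weak_grad_AE[OF this] Gon(2)[OF Bk[of k]] Gon(2)[OF Bf] AE_space
      show "AE x in lebesgue_on unit_square. norm (weak_grad unit_square (\<lambda>x. y k x - glued Bf x) x) \<le> 2 * bound * indicator (W k) x"
      proof eventually_elim
        case (elim x)
        show ?case
        proof (cases "x \<in> W k")
          case True
          then show ?thesis using elim norm_triangle_ineq4[of "glued_grad (Bk k) x" "glued_grad Bf x"] by simp
        next
          case False
          then show ?thesis using same(2)[of x k] elim by simp
        qed
      qed
    qed (use bound_nonneg in simp)
    ultimately show ?thesis unfolding c_def distrib_right by (rule add_mono)
  qed
  have null: "AE x in lebesgue. x \<in> unit_square \<longrightarrow> x \<in> (\<Union>n. Bf n)"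
  proof -
    define Z where "Z = unit_square - (\<Union>n. Bf n)"
    have Zs: "Z \<in> sets lebesgue" unfolding Z_def using sets_unit_square packing_sets[OF Bf] by auto
    have "emeasure lebesgue Z \<le> emeasure lebesgue (W k)" for k
      using Ws by (intro emeasure_mono) (auto simp: Z_def W_def Bf_Un)
    then have "emeasure lebesgue Z \<le> 0"
      using exhaust unfolding W_def[symmetric] by (intro LIMSEQ_le_const) auto
    then have "Z \<in> null_sets lebesgue" using Zs by auto
    from AE_not_in[OF this] show ?thesis by eventually_elim (simp add: Z_def)
  qed
  have wg: "AE x in lebesgue_on unit_square. weak_grad unit_square (glued Bf) x = glued_grad Bf x"
    by (rule weak_grad_AE[OF glued_weak_gradient[OF Bf]])
  have "tendsto_W1p unit_square 1 y (glued Bf)"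
    unfolding tendsto_W1p_def
  proof (intro conjI allI)
    show "in_W1p unit_square 1 (y k)" for k unfolding y by (rule Sob(2)[OF Bk]) simp
    show "in_W1p unit_square 1 (glued Bf)" by (rule Sob(2)[OF Bf]) simp
    have lim: "(\<lambda>k. c * emeasure lebesgue (W k)) \<longlonglongrightarrow> c * 0"
      unfolding W_def by (intro ennreal_tendsto_cmult exhaust) (auto simp: c_def)
    show "(\<lambda>k. Lp_pow unit_square 1 (\<lambda>x. y k x - glued Bf x) + Lp_pow unit_square 1 (weak_grad unit_square (\<lambda>x. y k x - glued Bf x))) \<longlonglongrightarrow> 0"
    proof (rule tendsto_sandwich[OF _ _ tendsto_const])
      show "(\<lambda>k. c * emeasure lebesgue (W k)) \<longlonglongrightarrow> 0" using lim by simp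
    qed (rule always_eventually, rule allI, rule zero_le, rule always_eventually, rule allI, rule close)
  qed
  moreover have "AE x in lebesgue_on unit_square. weak_grad unit_square (glued Bf) x \<in> wells \<gamma>"
  proof -
    have "AE x in lebesgue. x \<in> unit_square \<longrightarrow> glued_grad Bf x \<in> wells \<gamma>"
      using null glued_grad_wells[OF Bf] by eventually_elim auto
    then have "AE x in lebesgue_on unit_square. glued_grad Bf x \<in> wells \<gamma>"
      using sets_unit_square by (subst AE_restrict_space_iff) auto
    with wg show ?thesis by eventually_elim simp
  qed
  moreover have "in_W1sp unit_square s p (glued Bf)"
  proof -
    have "(\<Sum>n. ennreal (phi (s * p) (Bf n))) = (\<Sum>k. \<Sum>i. ennreal (phi (s * p) (BB k i)))"
    proof -
      have "(\<Sum>n. (\<lambda>(k, i). ennreal (phi (s * p) (BB k i))) (prod_decode n)) = (\<Sum>k. \<Sum>i. ennreal (phi (s * p) (BB k i)))"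
        by (rule suminf_ennreal_2dimen) simp
      moreover have "ennreal (phi (s * p) (Bf n)) = (\<lambda>(k, i). ennreal (phi (s * p) (BB k i))) (prod_decode n)" for n
        by (simp add: Bf_def split: prod.split)
      ultimately show ?thesis by (simp only:)
    qed
    then have sumf: "(\<Sum>n. ennreal (phi (s * p) (Bf n))) < \<infinity>" using sum by simp
    from glued_seminorm_finite[OF Bf p s C0 null sumf]
    have fin: "Wsp_pow unit_square s p (glued_grad Bf) < \<infinity>" .
    have "Lp_pow unit_square p (weak_grad unit_square (glued Bf)) = Lp_pow unit_square p (glued_grad Bf)"
      unfolding Lp_pow_def by (intro nn_integral_cong_AE) (use wg in \<open>auto elim: eventually_mono\<close>)
    moreover have "(\<integral>\<^sup>+ x. (\<integral>\<^sup>+ y. ennreal (norm (weak_grad unit_square (glued Bf) x - weak_grad unit_square (glued Bf) y) powr p / norm (x - y) powr (2 + s * p))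
        \<partial>lebesgue_on unit_square) \<partial>lebesgue_on unit_square)
      = (\<integral>\<^sup>+ x. (\<integral>\<^sup>+ y. ennreal (norm (glued_grad Bf x - glued_grad Bf y) powr p / norm (x - y) powr (2 + s * p))
        \<partial>lebesgue_on unit_square) \<partial>lebesgue_on unit_square)"
    proof (rule nn_integral_cong_AE, use wg in eventually_elim)
      case (elim x)
      show ?case by (rule nn_integral_cong_AE, use wg in eventually_elim) (simp add: elim)
    qed
    ultimately have "Wsp_pow unit_square s p (weak_grad unit_square (glued Bf)) < \<infinity>"
      using fin unfolding Wsp_pow_def by simp
    then show ?thesis unfolding in_W1sp_def in_Wsp_def using Sob(2)[OF Bf, of p] Sob(3)[OF Bf, of 1] p by simp
  qed
  ultimately show ?thesis
    unfolding limit_deformation_def using glued_affine_boundary[OF Bf] Sob(1)[OF Bf, of 1] by auto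
qed

end

section \<open>Cutting rectangles\<close>

text \<open>A rectangle is given by two opposite corners, and the block inside it by the coordinate direction
  in which it is bounded and the two bounds. Working with corners instead of sets keeps measurability in
  the random choices elementary: it is measurability of real-valued functions.\<close>

type_synonym rect = "(real^2) \<times> (real^2)"
type_synonym slab = "2 \<times> real \<times> real"

abbreviation box_of :: "rect \<Rightarrow> (real^2) set" where
  "box_of st \<equiv> box (fst st) (snd st)"

definition upd :: "real^2 \<Rightarrow> 2 \<Rightarrow> real \<Rightarrow> real^2" where
  "upd a e v = (\<chi> i. if i = e then v else a $ i)"

lemma upd_nth: "upd a e v $ i = (if i = e then v else a $ i)"
  by (simp add: upd_def)

definition slab_lo :: "slab \<Rightarrow> rect \<Rightarrow> real" where
  "slab_lo sl st = max (fst (snd sl)) (fst st $ fst sl)"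

definition slab_hi :: "slab \<Rightarrow> rect \<Rightarrow> real" where
  "slab_hi sl st = min (snd (snd sl)) (snd st $ fst sl)"

definition slab_part :: "slab \<Rightarrow> rect \<Rightarrow> (real^2) set" where
  "slab_part sl st = {x \<in> box_of st. fst (snd sl) < x $ fst sl \<and> x $ fst sl < snd (snd sl)}"

definition lower_part :: "slab \<Rightarrow> rect \<Rightarrow> rect" where
  "lower_part sl st = (fst st, upd (snd st) (fst sl) (slab_lo sl st))"

definition upper_part :: "slab \<Rightarrow> rect \<Rightarrow> rect" where
  "upper_part sl st = (upd (fst st) (fst sl) (slab_hi sl st), snd st)"

text \<open>The residual rectangle that contains \<open>x\<close> when a slab has been removed. The value \<open>(0, 0)\<close> is
  the empty rectangle and encodes that \<open>x\<close> has been covered; a slab without interior removes nothing.\<close>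

definition cut :: "slab \<Rightarrow> real^2 \<Rightarrow> rect \<Rightarrow> rect" where
  "cut sl x st =
     (if slab_hi sl st \<le> slab_lo sl st then st
      else if x $ fst sl < slab_lo sl st then lower_part sl st
      else if slab_hi sl st < x $ fst sl then upper_part sl st
      else (0, 0))"

lemma box_of_alt: "x \<in> box_of st \<longleftrightarrow> (\<forall>i. fst st $ i < x $ i \<and> x $ i < snd st $ i)"
  by (simp add: mem_box_cart)

lemma slab_lo_ge: "fst st $ fst sl \<le> slab_lo sl st" and slab_hi_le: "slab_hi sl st \<le> snd st $ fst sl"
  by (simp_all add: slab_lo_def slab_hi_def)

lemma mem_lower: "slab_lo sl st < slab_hi sl st \<Longrightarrow> x \<in> box_of (lower_part sl st) \<longleftrightarrow> x \<in> box_of st \<and> x $ fst sl < slab_lo sl st"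
  using slab_hi_le[of sl st]
  by (auto simp: lower_part_def mem_box_cart all_perp[where k="fst sl"] upd_nth perp_neq)

lemma mem_upper: "slab_lo sl st < slab_hi sl st \<Longrightarrow> x \<in> box_of (upper_part sl st) \<longleftrightarrow> x \<in> box_of st \<and> slab_hi sl st < x $ fst sl"
  using slab_lo_ge[of st sl]
  by (auto simp: upper_part_def mem_box_cart all_perp[where k="fst sl"] upd_nth perp_neq)

lemma mem_dead: "x \<notin> box_of (0, 0)" by simp

lemma cut_subset: "box_of (cut sl x st) \<subseteq> box_of st"
proof
  fix y assume y: "y \<in> box_of (cut sl x st)"
  show "y \<in> box_of st"
  proof (cases "slab_lo sl st < slab_hi sl st")
    case True
    then show ?thesis using y mem_lower[OF True, of y] mem_upper[OF True, of y] mem_dead[of y]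
      by (simp add: cut_def split: if_splits)
  next
    case False
    then show ?thesis using y by (simp add: cut_def)
  qed
qed

text \<open>All points of a residual rectangle agree on what the residual rectangle is.\<close>

lemma cut_consistent: "y \<in> box_of (cut sl x st) \<Longrightarrow> cut sl y st = cut sl x st"
proof (cases "slab_hi sl st \<le> slab_lo sl st")
  case True
  then show "cut sl y st = cut sl x st" by (simp add: cut_def)
next
  case False
  assume y: "y \<in> box_of (cut sl x st)"
  have lt: "slab_lo sl st < slab_hi sl st" using False by simp
  consider "x $ fst sl < slab_lo sl st" | "slab_hi sl st < x $ fst sl" "\<not> x $ fst sl < slab_lo sl st"
    | "\<not> x $ fst sl < slab_lo sl st" "\<not> slab_hi sl st < x $ fst sl" by blast
  then show "cut sl y st = cut sl x st"
  proof cases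
    case 1
    then have "y $ fst sl < slab_lo sl st" using y False mem_lower[OF lt, of y] by (simp add: cut_def)
    then show ?thesis using 1 by (simp add: cut_def)
  next
    case 2
    then have "slab_hi sl st < y $ fst sl" using y False mem_upper[OF lt, of y] by (simp add: cut_def)
    then show ?thesis using 2 lt by (simp add: cut_def)
  next
    case 3
    then have "y \<in> box_of (0, 0)" using y False by (simp add: cut_def)
    then show ?thesis by simp
  qed
qed

lemma cut_alive: "box_of (cut sl x st) \<noteq> {} \<Longrightarrow> x \<in> box_of st \<Longrightarrow> x \<in> box_of (cut sl x st)"
  using mem_lower[of sl st x] mem_upper[of sl st x] unfolding cut_def by (auto simp: not_le split: if_splits)

lemma slab_part_box:
  assumes "slab_lo sl st < slab_hi sl st"
  shows "slab_part sl st = box (upd (fst st) (fst sl) (slab_lo sl st)) (upd (snd st) (fst sl) (slab_hi sl st))"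
  by (auto simp: slab_part_def mem_box_cart all_perp[where k="fst sl"] upd_nth perp_neq slab_lo_def slab_hi_def)

lemma slab_part_empty:
  assumes "\<not> slab_lo sl st < slab_hi sl st" shows "slab_part sl st = {}"
  using assms by (auto simp: slab_part_def mem_box_cart all_perp[where k="fst sl"] slab_lo_def slab_hi_def)

lemma cut_mem:
  assumes x: "x \<in> box_of st"
  shows "x \<in> box_of (cut sl x st) \<longleftrightarrow> x \<notin> closure (slab_part sl st)"
proof (cases "slab_lo sl st < slab_hi sl st")
  case True
  let ?a = "upd (fst st) (fst sl) (slab_lo sl st)" and ?b = "upd (snd st) (fst sl) (slab_hi sl st)"
  have "?a $ i < ?b $ i" for i using x True by (auto simp: upd_nth box_of_alt intro: order_less_trans)
  then have ne: "box ?a ?b \<noteq> {}" by (simp add: interval_ne_empty_cart)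
  have "x \<in> closure (slab_part sl st) \<longleftrightarrow> x \<in> cbox ?a ?b"
    unfolding slab_part_box[OF True] using ne by (simp add: closure_box)
  also have "\<dots> \<longleftrightarrow> slab_lo sl st \<le> x $ fst sl \<and> x $ fst sl \<le> slab_hi sl st"
    using x by (auto simp: mem_box_cart all_perp[where k="fst sl"] upd_nth perp_neq less_imp_le)
  finally show ?thesis
    using x True mem_lower[OF True, of x] mem_upper[OF True, of x] mem_dead[of x] by (simp add: cut_def not_le)
next
  case False
  then show ?thesis using x slab_part_empty[OF False] by (simp add: cut_def not_less)
qed

text \<open>The rectangle that contains \<open>x\<close> after \<open>k\<close> steps of a process which removes the slab \<open>sl j R\<close> from each
  rectangle \<open>R\<close> of step \<open>j\<close>. Describing the process pointwise avoids finite sets of components.\<close>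

primrec cell_at :: "(nat \<Rightarrow> rect \<Rightarrow> slab) \<Rightarrow> nat \<Rightarrow> real^2 \<Rightarrow> rect" where
  "cell_at sl 0 x = (if x \<in> unit_square then (0, 1) else (0, 0))"
| "cell_at sl (Suc k) x = cut (sl k (cell_at sl k x)) x (cell_at sl k x)"

lemma cell_at_consistent: "y \<in> box_of (cell_at sl k x) \<Longrightarrow> cell_at sl k y = cell_at sl k x"
proof (induction k)
  case 0
  then show ?case by (auto simp: unit_square_box split: if_splits)
next
  case (Suc k)
  then have y: "y \<in> box_of (cut (sl k (cell_at sl k x)) x (cell_at sl k x))" by simp
  then have "y \<in> box_of (cell_at sl k x)" using cut_subset by blast
  then have "cell_at sl k y = cell_at sl k x" by (rule Suc.IH)
  then show ?case using cut_consistent[OF y] by simp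
qed

lemma cell_at_alive: "box_of (cell_at sl k x) \<noteq> {} \<Longrightarrow> x \<in> box_of (cell_at sl k x)"
proof (induction k)
  case 0
  then show ?case by (auto simp: unit_square_box split: if_splits)
next
  case (Suc k)
  have "box_of (cell_at sl k x) \<noteq> {}" using Suc.prems cut_subset[of "sl k (cell_at sl k x)" x "cell_at sl k x"] by auto
  then have "x \<in> box_of (cell_at sl k x)" by (rule Suc.IH)
  with Suc.prems show ?case using cut_alive by simp
qed

lemma cell_at_antimono: "box_of (cell_at sl (Suc k) x) \<subseteq> box_of (cell_at sl k x)"
  using cut_subset by simp

lemma cell_at_subset: "box_of (cell_at sl k x) \<subseteq> unit_square"
proof (induction k)
  case 0 then show ?case by (simp add: unit_square_box)
next
  case (Suc k) then show ?case using cell_at_antimono by blast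
qed

definition alive :: "(nat \<Rightarrow> rect \<Rightarrow> slab) \<Rightarrow> nat \<Rightarrow> (real^2) set" where
  "alive sl k = {x. x \<in> box_of (cell_at sl k x)}"

lemma box_of_cell_at_subset_alive: "box_of (cell_at sl k x) \<subseteq> alive sl k"
proof
  fix y assume y: "y \<in> box_of (cell_at sl k x)"
  from cell_at_consistent[OF y] y show "y \<in> alive sl k" by (simp add: alive_def)
qed

text \<open>The rectangles of a step are open and disjoint, so they are the connected components.\<close>

lemma alive_component: "connected_component_set (alive sl k) x = box_of (cell_at sl k x)"
proof (cases "x \<in> alive sl k")
  case False
  then have "box_of (cell_at sl k x) = {}" using cell_at_alive unfolding alive_def by blast
  then show ?thesis using False connected_component_eq_empty by metis
next
  case True
  let ?C = "connected_component_set (alive sl k) x"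
  have xC: "x \<in> ?C" using True by simp
  have 1: "box_of (cell_at sl k x) \<subseteq> ?C"
  proof (rule connected_component_maximal)
    show "x \<in> box_of (cell_at sl k x)" using True by (simp add: alive_def)
    show "connected (box_of (cell_at sl k x))" by (rule convex_connected[OF convex_box(2)])
  qed (rule box_of_cell_at_subset_alive)
  define B where "B = \<Union>{box_of (cell_at sl k y) |y. y \<notin> box_of (cell_at sl k x)}"
  have "open B" unfolding B_def by (auto intro!: open_Union)
  have AB: "box_of (cell_at sl k x) \<inter> B = {}"
  proof (rule ccontr)
    assume "box_of (cell_at sl k x) \<inter> B \<noteq> {}"
    then obtain w y where w: "w \<in> box_of (cell_at sl k x)" "w \<in> box_of (cell_at sl k y)" "y \<notin> box_of (cell_at sl k x)" by (auto simp: B_def)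
    then have "cell_at sl k y = cell_at sl k x" using cell_at_consistent[OF w(1)] cell_at_consistent[OF w(2)] by simp
    then show False using w cell_at_alive[of sl k y] by auto
  qed
  have "?C \<subseteq> alive sl k" by (rule connected_component_subset)
  then have cov: "?C \<subseteq> box_of (cell_at sl k x) \<union> B" unfolding alive_def B_def by blast
  have "box_of (cell_at sl k x) \<inter> ?C = {} \<or> B \<inter> ?C = {}"
    by (rule connectedD[OF connected_connected_component open_box \<open>open B\<close>]) (use AB cov in auto)
  moreover have "x \<in> box_of (cell_at sl k x) \<inter> ?C" using True xC unfolding alive_def by blast
  ultimately have "?C \<subseteq> box_of (cell_at sl k x)" using cov by blast
  with 1 show ?thesis by blast
qed

text \<open>A point of a component can lie in the closure of the union of all blocks only through the block of that
  component, because the component is a neighbourhood of the point that meets no other block.\<close>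

lemma alive_Suc:
  assumes "\<And>st. box_of st \<noteq> {} \<Longrightarrow> blk (box_of st) = slab_part (sl k st) st"
  shows "alive sl (Suc k) = alive sl k - closure (\<Union>D\<in>components (alive sl k). blk D)"
proof -
  have "x \<in> alive sl (Suc k) \<longleftrightarrow> x \<notin> closure (\<Union>D\<in>components (alive sl k). blk D)" if x: "x \<in> alive sl k" for x
  proof -
    define st where "st = cell_at sl k x"
    have xs: "x \<in> box_of st" using x by (simp add: alive_def st_def)
    define S where "S = (\<Union>D\<in>components (alive sl k). blk D)"
    have comp: "D \<in> components (alive sl k) \<Longrightarrow> \<exists>y. y \<in> alive sl k \<and> D = box_of (cell_at sl k y)" for D
      by (auto simp: components_def alive_component)
    have inD: "blk D \<subseteq> D" if Dc: "D \<in> components (alive sl k)" for D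
    proof -
      obtain y where y: "y \<in> alive sl k" "D = box_of (cell_at sl k y)" using comp[OF Dc] by blast
      then have "box_of (cell_at sl k y) \<noteq> {}" by (auto simp: alive_def)
      from assms[OF this] y show ?thesis by (auto simp: slab_part_def)
    qed
    have stc: "box_of st \<in> components (alive sl k)"
      using x unfolding components_def st_def alive_component[symmetric] by blast
    have "box_of st \<inter> S \<subseteq> blk (box_of st)"
    proof
      fix w assume w: "w \<in> box_of st \<inter> S"
      then obtain D where D: "D \<in> components (alive sl k)" "w \<in> blk D" by (auto simp: S_def)
      obtain y where y: "D = box_of (cell_at sl k y)" using comp[OF D(1)] by blast
      have "w \<in> box_of (cell_at sl k y)" using inD[OF D(1)] D(2) y by blast
      then have "cell_at sl k y = cell_at sl k x" using cell_at_consistent[of w sl k x] cell_at_consistent[of w sl k y] w unfolding st_def by simp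
      then show "w \<in> blk (box_of st)" using D(2) y by (simp add: st_def)
    qed
    then have "box_of st \<inter> closure S \<subseteq> closure (blk (box_of st))"
      using open_Int_closure_subset[OF open_box, of "fst st" "snd st" S] closure_mono by blast
    moreover have "closure (blk (box_of st)) \<subseteq> closure S" unfolding S_def using stc by (intro closure_mono) blast
    ultimately have "x \<in> closure S \<longleftrightarrow> x \<in> closure (blk (box_of st))" using xs by blast
    also have "blk (box_of st) = slab_part (sl k st) st" by (rule assms) (use xs in blast)
    finally have "x \<notin> closure S \<longleftrightarrow> x \<in> box_of (cut (sl k st) x st)" using cut_mem[OF xs] by simp
    then show ?thesis by (simp add: S_def alive_def st_def)
  qed
  moreover have "alive sl (Suc k) \<subseteq> alive sl k" unfolding alive_def using cell_at_antimono by blast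
  ultimately show ?thesis by blast
qed

section \<open>The weight of a rectangle under cutting\<close>

text \<open>Concavity of \<open>x powr u\<close> through its tangent at the mean of \<open>v\<close> and \<open>w\<close>.\<close>

lemma powr_concave_sum:
  fixes u v w :: real
  assumes u: "0 \<le> u" "u \<le> 1" and v: "v \<ge> 0" and w: "w \<ge> 0"
  shows "v powr u + w powr u \<le> 2 powr (1 - u) * (v + w) powr u"
proof (cases "v + w = 0")
  case True
  then have "v = 0" "w = 0" using v w by auto
  then show ?thesis by simp
next
  case False
  define s where "s = (v + w) / 2"
  have s: "s > 0" using False v w by (simp add: s_def)
  have B: "x powr u \<le> 1 + u * (x - 1)" if "x \<ge> 0" for x
  proof (cases "x = 0")
    case True then show ?thesis using u by simp
  next
    case False
    then have "x powr u * 1 powr (1 - u) \<le> u * x + (1 - u) * 1"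
      using u that by (intro Youngs_inequality_0) auto
    then show ?thesis by (simp add: algebra_simps)
  qed
  have T: "x powr u \<le> s powr u * (1 + u * (x / s - 1))" if "x \<ge> 0" for x
  proof -
    have "x powr u = s powr u * (x / s) powr u" using s that by (simp add: powr_mult[symmetric])
    also have "\<dots> \<le> s powr u * (1 + u * (x / s - 1))" using s that by (intro mult_left_mono B) auto
    finally show ?thesis .
  qed
  have "v powr u + w powr u \<le> s powr u * (1 + u * (v / s - 1)) + s powr u * (1 + u * (w / s - 1))"
    by (intro add_mono T v w)
  also have "\<dots> = s powr u * (2 + u * ((v + w) / s - 2))" by (simp add: algebra_simps add_divide_distrib)
  also have "(v + w) / s = 2"
  proof -
    have "v + w = 2 * s" by (simp add: s_def)
    then show ?thesis using s by simp
  qed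
  also have "s powr u * (2 + u * (2 - 2)) = 2 * s powr u" by simp
  also have "2 * s powr u = 2 powr (1 - u) * (v + w) powr u"
    by (simp add: s_def powr_divide powr_diff)
  finally show ?thesis .
qed

definition weight :: "real \<Rightarrow> rect \<Rightarrow> real" where
  "weight t st = (snd st $ 1 - fst st $ 1) powr - t + (snd st $ 2 - fst st $ 2) powr - t"

lemma weight_perp:
  "weight t st = (snd st $ e - fst st $ e) powr - t + (snd st $ perp e - fst st $ perp e) powr - t"
  using exhaust_2[of e] by (auto simp: weight_def perp_def)

lemma phi_weight: "box_of st \<noteq> {} \<Longrightarrow> phi t (box_of st) = measure lebesgue (box_of st) * weight t st"
  by (simp add: phi_def weight_def side_box)

lemma emeasure_box_of: "emeasure lborel (box_of st) = ennreal (measure lebesgue (box_of st))"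
  using emeasure_eq_measure2[OF lmeasurable_box, of "fst st" "snd st"] by simp

text \<open>The form in which the dependence on the side in direction \<open>e\<close> is visible: one term is linear in it, the other a
  power below one.\<close>

lemma phi_perp:
  assumes "\<And>i. fst st $ i \<le> snd st $ i"
  shows "measure lebesgue (box_of st) * weight t st =
    (snd st $ perp e - fst st $ perp e) powr (1 - t) * (snd st $ e - fst st $ e)
    + (snd st $ perp e - fst st $ perp e) * (snd st $ e - fst st $ e) powr (1 - t)"
proof -
  have p: "x powr (1 - t) = x * x powr - t" if "x \<ge> 0" for x :: real
    using that by (cases "x = 0") (auto simp: powr_mult_base)
  have "snd st $ i - fst st $ i \<ge> 0" for i using assms by simp
  then show ?thesis
    unfolding measure_box_perp(2)[OF assms, where k=e] weight_perp[of t st e] by (simp add: p algebra_simps)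
qed

text \<open>Turns an integral over the points of a rectangle into a sum over its two residual parts.\<close>

lemma cut_integral:
  fixes g :: "rect \<Rightarrow> ennreal"
  assumes lt: "slab_lo sl st < slab_hi sl st"
  shows "(\<integral>\<^sup>+x. g (cut sl x st) * indicator (box_of (cut sl x st)) x * indicator (box_of st) x \<partial>lborel)
    = g (lower_part sl st) * emeasure lborel (box_of (lower_part sl st))
      + g (upper_part sl st) * emeasure lborel (box_of (upper_part sl st))"
proof -
  have "g (cut sl x st) * indicator (box_of (cut sl x st)) x * indicator (box_of st) x
      = g (lower_part sl st) * indicator (box_of (lower_part sl st)) x + g (upper_part sl st) * indicator (box_of (upper_part sl st)) x" for x
    using lt mem_lower[OF lt, of x] mem_upper[OF lt, of x] mem_dead[of x]
    by (auto simp: cut_def indicator_def)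
  then show ?thesis by (simp add: nn_integral_add nn_integral_cmult)
qed

text \<open>The estimate behind the contraction. If at least the fraction \<open>r\<close> of a side is removed, the two remaining
  parts have sides \<open>v + w \<le> (1 - r) * n\<close> in this direction. By concavity splitting them costs at most
  the factor \<open>2 powr t\<close>, and the total length gives the factor \<open>(1 - r) powr (1 - t)\<close>.\<close>

lemma cut_weight:
  assumes ne: "box_of st \<noteq> {}" and t: "0 < t" "t < 1"
    and r: "0 \<le> r" "r \<le> 1" "r * (snd st $ fst sl - fst st $ fst sl) \<le> max 0 (slab_hi sl st - slab_lo sl st)"
  shows "(\<integral>\<^sup>+x. ennreal (weight t (cut sl x st)) * indicator (box_of (cut sl x st)) x * indicator (box_of st) x \<partial>lborel)
    \<le> ennreal (2 powr t * (1 - r) powr (1 - t)) * ennreal (phi t (box_of st))"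
proof -
  define e where "e = fst sl"
  define l where "l = snd st $ perp e - fst st $ perp e"
  define n where "n = snd st $ e - fst st $ e"
  have ab: "fst st $ i < snd st $ i" for i using ne by (simp add: interval_ne_empty_cart)
  have l: "l > 0" and n: "n > 0" using ab by (auto simp: l_def n_def)
  have ph: "phi t (box_of st) = l powr (1 - t) * n + l * n powr (1 - t)"
    unfolding phi_weight[OF ne] l_def n_def by (rule phi_perp) (simp add: ab less_imp_le)
  have w0: "weight t s \<ge> 0" for s by (simp add: weight_def)
  show ?thesis
  proof (cases "slab_lo sl st < slab_hi sl st")
    case True
    define v where "v = slab_lo sl st - fst st $ e"
    define w where "w = snd st $ e - slab_hi sl st"
    have vw: "v \<ge> 0" "w \<ge> 0" using slab_lo_ge[of st sl] slab_hi_le[of sl st] by (simp_all add: v_def w_def e_def)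
    have sum: "v + w \<le> (1 - r) * n" using r(3) True by (simp add: v_def w_def n_def e_def left_diff_distrib)
    have lo: "measure lebesgue (box_of (lower_part sl st)) * weight t (lower_part sl st) = l powr (1 - t) * v + l * v powr (1 - t)"
    proof -
      have "fst (lower_part sl st) $ i \<le> snd (lower_part sl st) $ i" for i
        using ab[of i] slab_lo_ge[of st sl] by (simp add: lower_part_def upd_nth less_imp_le)
      from phi_perp[OF this, of t e] show ?thesis
        by (simp add: lower_part_def upd_nth e_def[symmetric] perp_neq l_def v_def)
    qed
    have up: "measure lebesgue (box_of (upper_part sl st)) * weight t (upper_part sl st) = l powr (1 - t) * w + l * w powr (1 - t)"
    proof -
      have "fst (upper_part sl st) $ i \<le> snd (upper_part sl st) $ i" for i
        using ab[of i] slab_hi_le[of sl st] by (simp add: upper_part_def upd_nth less_imp_le)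
      from phi_perp[OF this, of t e] show ?thesis
        by (simp add: upper_part_def upd_nth e_def[symmetric] perp_neq l_def w_def)
    qed
    have "(\<integral>\<^sup>+x. ennreal (weight t (cut sl x st)) * indicator (box_of (cut sl x st)) x * indicator (box_of st) x \<partial>lborel)
        = ennreal (measure lebesgue (box_of (lower_part sl st)) * weight t (lower_part sl st)) + ennreal (measure lebesgue (box_of (upper_part sl st)) * weight t (upper_part sl st))"
      unfolding cut_integral[OF True, of "\<lambda>s. ennreal (weight t s)"] emeasure_box_of
      by (simp add: ennreal_mult w0 mult.commute)
    also have "\<dots> = ennreal ((l powr (1 - t) * v + l * v powr (1 - t)) + (l powr (1 - t) * w + l * w powr (1 - t)))"
      unfolding lo up using l vw by (simp add: ennreal_plus)
    also have "\<dots> \<le> ennreal (2 powr t * (1 - r) powr (1 - t) * phi t (box_of st))"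
    proof (rule ennreal_leI)
      have 1: "l powr (1 - t) * (v + w) \<le> 2 powr t * (1 - r) powr (1 - t) * (l powr (1 - t) * n)"
      proof -
        have "1 - r \<le> (1 - r) powr (1 - t)"
          using r t powr_mono'[of "1 - t" 1 "1 - r"] by (cases "r = 1") auto
        moreover have "1 \<le> 2 powr t" using t by (simp add: ge_one_powr_ge_zero)
        ultimately have "1 * (1 - r) \<le> 2 powr t * (1 - r) powr (1 - t)" using r by (intro mult_mono) auto
        then have "l powr (1 - t) * ((1 - r) * n) \<le> l powr (1 - t) * (2 powr t * (1 - r) powr (1 - t) * n)"
          using n by (intro mult_left_mono mult_right_mono) auto
        then show ?thesis using mult_left_mono[OF sum, of "l powr (1 - t)"] by (simp add: mult_ac)
      qed
      have 2: "l * (v powr (1 - t) + w powr (1 - t)) \<le> 2 powr t * (1 - r) powr (1 - t) * (l * n powr (1 - t))"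
      proof -
        have "v powr (1 - t) + w powr (1 - t) \<le> 2 powr t * (v + w) powr (1 - t)"
          using powr_concave_sum[of "1 - t" v w] t vw by simp
        also have "\<dots> \<le> 2 powr t * ((1 - r) * n) powr (1 - t)"
          using sum vw t by (intro mult_left_mono powr_mono2) auto
        also have "\<dots> = 2 powr t * (1 - r) powr (1 - t) * n powr (1 - t)"
          using r n by (simp add: powr_mult)
        finally show ?thesis using l by (simp add: mult_ac)
      qed
      show "(l powr (1 - t) * v + l * v powr (1 - t)) + (l powr (1 - t) * w + l * w powr (1 - t)) \<le> 2 powr t * (1 - r) powr (1 - t) * phi t (box_of st)"
        using 1 2 unfolding ph by (simp add: algebra_simps)
    qed
    finally show ?thesis by (simp add: ennreal_mult phi_nonneg)
  next
    case False
    then have "r * n \<le> 0" using r(3) by (simp add: n_def e_def)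
    then have r0: "r = 0" using r(1) n by (simp add: mult_le_0_iff)
    have cut: "cut sl x st = st" for x using False by (simp add: cut_def)
    have "(\<integral>\<^sup>+x. ennreal (weight t (cut sl x st)) * indicator (box_of (cut sl x st)) x * indicator (box_of st) x \<partial>lborel)
        = (\<integral>\<^sup>+x. ennreal (weight t st) * indicator (box_of st) x \<partial>lborel)"
      unfolding cut by (intro nn_integral_cong) (auto simp: indicator_def)
    also have "\<dots> = ennreal (phi t (box_of st))"
      by (simp add: nn_integral_cmult emeasure_box_of phi_weight[OF ne] ennreal_mult w0 mult.commute)
    also have "\<dots> = 1 * ennreal (phi t (box_of st))" by simp
    also have "\<dots> \<le> ennreal (2 powr t * (1 - r) powr (1 - t)) * ennreal (phi t (box_of st))"
      using t by (intro mult_right_mono) (auto simp: r0 ge_one_powr_ge_zero)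
    finally show ?thesis .
  qed
qed

text \<open>Dividing by the area of the residual rectangle counts residual rectangles, so the claim is that a cut leaves at
  most two.\<close>

lemma cut_count:
  "(\<integral>\<^sup>+x. 1 / emeasure lborel (box_of (cut sl x st)) * indicator (box_of (cut sl x st)) x * indicator (box_of st) x \<partial>lborel) \<le> 2"
proof -
  have one: "1 / emeasure lborel (box_of s) * emeasure lborel (box_of s) \<le> 1" for s
  proof (cases "emeasure lborel (box_of s) = 0")
    case False
    have "emeasure lborel (box_of s) < top" by (simp add: emeasure_box_of)
    with False have "emeasure lborel (box_of s) / emeasure lborel (box_of s) = 1" by (rule ennreal_divide_self)
    then show ?thesis by (simp add: ennreal_divide_times)
  qed simp
  show ?thesis
  proof (cases "slab_lo sl st < slab_hi sl st")
    case True
    show ?thesis unfolding cut_integral[OF True, of "\<lambda>s. 1 / emeasure lborel (box_of s)"]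
      using add_mono[OF one[of "lower_part sl st"] one[of "upper_part sl st"]] by simp
  next
    case False
    then have cut: "cut sl x st = st" for x by (simp add: cut_def)
    have "(\<integral>\<^sup>+x. 1 / emeasure lborel (box_of (cut sl x st)) * indicator (box_of (cut sl x st)) x * indicator (box_of st) x \<partial>lborel)
        = (\<integral>\<^sup>+x. 1 / emeasure lborel (box_of st) * indicator (box_of st) x \<partial>lborel)"
      unfolding cut by (intro nn_integral_cong) (auto simp: indicator_def)
    also have "\<dots> = 1 / emeasure lborel (box_of st) * emeasure lborel (box_of st)" by (simp add: nn_integral_cmult)
    also have "\<dots> \<le> 2" using order_trans[OF one[of st]] by simp
    finally show ?thesis .
  qed
qed

lemma phi_slab_part:
  assumes ne: "box_of st \<noteq> {}" and t: "0 < t" "t < 1"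
  shows "phi t (slab_part sl st) \<le> phi t (box_of st)"
proof (cases "slab_lo sl st < slab_hi sl st")
  case True
  define e where "e = fst sl"
  have ab: "fst st $ i < snd st $ i" for i using ne by (simp add: interval_ne_empty_cart)
  define s where "s = (upd (fst st) (fst sl) (slab_lo sl st), upd (snd st) (fst sl) (slab_hi sl st))"
  have sp: "slab_part sl st = box_of s" using slab_part_box[OF True] by (simp add: s_def)
  have s: "fst s $ i < snd s $ i" for i using ab[of i] True by (simp add: s_def upd_nth)
  have nes: "box_of s \<noteq> {}" using s by (simp add: interval_ne_empty_cart)
  have "phi t (box_of s) = (snd st $ perp e - fst st $ perp e) powr (1 - t) * (slab_hi sl st - slab_lo sl st)
    + (snd st $ perp e - fst st $ perp e) * (slab_hi sl st - slab_lo sl st) powr (1 - t)"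
    unfolding phi_weight[OF nes] phi_perp[OF less_imp_le[OF s], of t e] by (simp add: s_def upd_nth e_def perp_neq)
  also have "\<dots> \<le> (snd st $ perp e - fst st $ perp e) powr (1 - t) * (snd st $ e - fst st $ e)
    + (snd st $ perp e - fst st $ perp e) * (snd st $ e - fst st $ e) powr (1 - t)"
    using ab[of "perp e"] slab_lo_ge[of st sl] slab_hi_le[of sl st] True t
    by (intro add_mono mult_left_mono powr_mono2) (auto simp: e_def)
  also have "\<dots> = phi t (box_of st)"
    unfolding phi_weight[OF ne] by (rule phi_perp[symmetric]) (simp add: ab less_imp_le)
  finally show ?thesis unfolding sp .
next
  case False
  then show ?thesis using slab_part_empty[OF False] by (simp add: phi_def[of t "{}"] phi_nonneg)
qed

section \<open>The block rule\<close>

definition shift_lo :: "real \<Rightarrow> rect \<Rightarrow> real^2 \<Rightarrow> 2 \<Rightarrow> real" where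
  "shift_lo \<delta> st p d = max 0 ((p $ perp d + \<delta> * (snd st $ d - fst st $ d) - snd st $ perp d) / (\<delta> * (snd st $ d - fst st $ d)))"

definition shift_hi :: "real \<Rightarrow> rect \<Rightarrow> real^2 \<Rightarrow> 2 \<Rightarrow> real" where
  "shift_hi \<delta> st p d = min 1 ((p $ perp d - fst st $ perp d) / (\<delta> * (snd st $ d - fst st $ d)))"

text \<open>The explicit form of \<open>block_shift\<close>, with the same unspecified value where no admissible shift exists.\<close>

definition shift :: "real \<Rightarrow> rect \<Rightarrow> real^2 \<Rightarrow> 2 \<Rightarrow> real" where
  "shift \<delta> st p d =
     (if shift_lo \<delta> st p d \<le> shift_hi \<delta> st p d
      then max (shift_lo \<delta> st p d) (min (shift_hi \<delta> st p d) (1/2)) else (SOME \<sigma>. False))"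

text \<open>A block that is its whole component is the slab bounded by the two sides of the component.\<close>

definition slab_of :: "real \<Rightarrow> rect \<Rightarrow> real^2 \<Rightarrow> 2 \<Rightarrow> slab" where
  "slab_of \<delta> st p d =
     (if snd st $ perp d - fst st $ perp d \<le> \<delta> * (snd st $ d - fst st $ d)
      then (perp d, fst st $ perp d, snd st $ perp d)
      else (perp d, p $ perp d - shift \<delta> st p d * (\<delta> * (snd st $ d - fst st $ d)),
                    p $ perp d + (1 - shift \<delta> st p d) * (\<delta> * (snd st $ d - fst st $ d))))"

text \<open>The minimiser is the projection of one half onto the interval; for an empty interval the operator returns
  an unspecified but fixed number, which is recorded to obtain an equation without hypotheses.\<close>

lemma arg_min_clamp:
  fixes l u :: real
  shows "(ARG_MIN (\<lambda>\<sigma>. \<bar>\<sigma> - 1/2\<bar>) \<sigma>. l \<le> \<sigma> \<and> \<sigma> \<le> u) =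
    (if l \<le> u then max l (min u (1/2)) else (SOME \<sigma>. False))"
proof (cases "l \<le> u")
  case True
  let ?c = "max l (min u (1/2))"
  have best: "\<bar>?c - 1/2\<bar> < \<bar>x - 1/2\<bar>" if "l \<le> x" "x \<le> u" "x \<noteq> ?c" for x
    using that True by (auto simp: max_def min_def abs_if split: if_splits)
  have "(SOME x. is_arg_min (\<lambda>\<sigma>. \<bar>\<sigma> - 1/2\<bar>) (\<lambda>\<sigma>. l \<le> \<sigma> \<and> \<sigma> \<le> u) x) = ?c"
  proof (rule some_equality)
    have c: "l \<le> ?c \<and> ?c \<le> u" using True by auto
    have "\<not> \<bar>y - 1/2\<bar> < \<bar>?c - 1/2\<bar>" if "l \<le> y" "y \<le> u" for y
    proof (cases "y = ?c")
      case False
      then show ?thesis using best[OF that] by simp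
    qed simp
    then show "is_arg_min (\<lambda>\<sigma>. \<bar>\<sigma> - 1/2\<bar>) (\<lambda>\<sigma>. l \<le> \<sigma> \<and> \<sigma> \<le> u) ?c"
      unfolding is_arg_min_def using c by blast
    fix x assume "is_arg_min (\<lambda>\<sigma>. \<bar>\<sigma> - 1/2\<bar>) (\<lambda>\<sigma>. l \<le> \<sigma> \<and> \<sigma> \<le> u) x"
    then have x: "l \<le> x" "x \<le> u" "\<not> (\<exists>y. (l \<le> y \<and> y \<le> u) \<and> \<bar>y - 1/2\<bar> < \<bar>x - 1/2\<bar>)"
      by (auto simp: is_arg_min_def)
    have "l \<le> ?c \<and> ?c \<le> u" using True by auto
    then show "x = ?c" using best[OF x(1,2)] x(3) by blast
  qed
  then show ?thesis using True by (simp add: arg_min_def)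
next
  case False
  then have "is_arg_min (\<lambda>\<sigma>. \<bar>\<sigma> - 1/2\<bar>) (\<lambda>\<sigma>. l \<le> \<sigma> \<and> \<sigma> \<le> u) = (\<lambda>x::real. False)"
    by (auto simp: is_arg_min_def fun_eq_iff)
  then show ?thesis using False by (simp add: arg_min_def)
qed

lemma box_of_less: "box_of st \<noteq> {} \<Longrightarrow> fst st $ i < snd st $ i"
  by (simp add: interval_ne_empty_cart)

lemma block_shift_eq:
  assumes ne: "box_of st \<noteq> {}" and \<delta>: "\<delta> > 0"
  shows "block_shift \<delta> (box_of st) p d = shift \<delta> st p d"
proof -
  define m where "m = \<delta> * (snd st $ d - fst st $ d)"
  have m: "m > 0" using box_of_less[OF ne, of d] \<delta> by (simp add: m_def)
  have "(0 \<le> \<sigma> \<and> \<sigma> \<le> 1 \<and> lo (box_of st) (perp d) \<le> p $ perp d - \<sigma> * \<delta> * side (box_of st) d \<and>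
     p $ perp d + (1 - \<sigma>) * \<delta> * side (box_of st) d \<le> lo (box_of st) (perp d) + side (box_of st) (perp d))
    \<longleftrightarrow> shift_lo \<delta> st p d \<le> \<sigma> \<and> \<sigma> \<le> shift_hi \<delta> st p d" for \<sigma>
  proof -
    have 1: "\<sigma> * \<delta> * side (box_of st) d = \<sigma> * m" "(1 - \<sigma>) * \<delta> * side (box_of st) d = m - \<sigma> * m"
      by (simp_all add: side_box[OF ne] m_def algebra_simps)
    have 2: "fst st $ perp d \<le> p $ perp d - \<sigma> * m \<longleftrightarrow> \<sigma> \<le> (p $ perp d - fst st $ perp d) / m"
      using m by (auto simp: pos_le_divide_eq)
    have 3: "p $ perp d + (m - \<sigma> * m) \<le> snd st $ perp d \<longleftrightarrow> (p $ perp d + m - snd st $ perp d) / m \<le> \<sigma>"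
      using m by (auto simp: pos_divide_le_eq)
    show ?thesis
      unfolding 1 lo_box[OF ne] side_box[OF ne, of "perp d"] shift_lo_def shift_hi_def m_def[symmetric]
      using 2 3 by auto
  qed
  then show ?thesis unfolding block_shift_def shift_def by (simp only: arg_min_clamp)
qed

lemma block_slab:
  assumes ne: "box_of st \<noteq> {}" and \<delta>: "\<delta> > 0"
  shows "block \<delta> (box_of st) p d = slab_part (slab_of \<delta> st p d) st"
proof (cases "snd st $ perp d - fst st $ perp d \<le> \<delta> * (snd st $ d - fst st $ d)")
  case True
  then have "block \<delta> (box_of st) p d = box_of st" by (simp add: block_def side_box[OF ne])
  moreover have "slab_part (slab_of \<delta> st p d) st = box_of st"
    using True by (auto simp: slab_part_def slab_of_def mem_box_cart)
  ultimately show ?thesis by simp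
next
  case False
  then show ?thesis
    by (simp add: block_def side_box[OF ne] block_shift_eq[OF ne \<delta>] Let_def slab_part_def slab_of_def mult.assoc)
qed

text \<open>If the chosen direction \<open>d\<close> is a longest one, the block has width \<open>\<delta>\<close> times the longer side or fills the
  component, in either case at least the fraction \<open>\<delta>\<close> of the shorter side. An admissible shift exists
  because the block is thinner than the component and \<open>p\<close> lies inside.\<close>

lemma slab_of_thick:
  assumes ne: "box_of st \<noteq> {}" and \<delta>: "0 < \<delta>" "\<delta> < 1" and p: "p \<in> box_of st"
    and long: "snd st $ perp d - fst st $ perp d \<le> snd st $ d - fst st $ d"
  shows "\<delta> * (snd st $ fst (slab_of \<delta> st p d) - fst st $ fst (slab_of \<delta> st p d))
    \<le> slab_hi (slab_of \<delta> st p d) st - slab_lo (slab_of \<delta> st p d) st"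
proof -
  define m where "m = \<delta> * (snd st $ d - fst st $ d)"
  have m: "m > 0" using box_of_less[OF ne, of d] \<delta> by (simp add: m_def)
  define n where "n = snd st $ perp d - fst st $ perp d"
  have n: "n > 0" using box_of_less[OF ne, of "perp d"] by (simp add: n_def)
  have nm: "\<delta> * n \<le> m" using long \<delta> by (simp add: m_def n_def)
  have pp: "fst st $ perp d < p $ perp d" "p $ perp d < snd st $ perp d" using p by (auto simp: mem_box_cart)
  show ?thesis
  proof (cases "n \<le> m")
    case True
    then have s: "slab_of \<delta> st p d = (perp d, fst st $ perp d, snd st $ perp d)"
      by (simp add: slab_of_def n_def m_def)
    have "\<delta> * n \<le> 1 * n" using \<delta> n by (intro mult_right_mono) auto
    then show ?thesis unfolding s by (simp add: slab_hi_def slab_lo_def n_def)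
  next
    case False
    define \<sigma> where "\<sigma> = shift \<delta> st p d"
    have s: "slab_of \<delta> st p d = (perp d, p $ perp d - \<sigma> * m, p $ perp d + (1 - \<sigma>) * m)"
      using False by (simp add: slab_of_def n_def m_def \<sigma>_def)
    have lo_le: "shift_lo \<delta> st p d \<le> shift_hi \<delta> st p d"
    proof -
      have "(p $ perp d + m - snd st $ perp d) / m \<le> (p $ perp d - fst st $ perp d) / m"
        using m False by (intro divide_right_mono) (auto simp: n_def)
      moreover have "(p $ perp d + m - snd st $ perp d) / m \<le> 1" using m pp by (simp add: pos_divide_le_eq)
      moreover have "0 \<le> (p $ perp d - fst st $ perp d) / m" using m pp by simp
      ultimately show ?thesis unfolding shift_lo_def shift_hi_def m_def[symmetric] by simp
    qed
    then have "shift_lo \<delta> st p d \<le> \<sigma>" "\<sigma> \<le> shift_hi \<delta> st p d" by (auto simp: \<sigma>_def shift_def)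
    then have "(p $ perp d + m - snd st $ perp d) / m \<le> \<sigma>" "\<sigma> \<le> (p $ perp d - fst st $ perp d) / m"
      unfolding shift_lo_def shift_hi_def m_def[symmetric] by auto
    then have "p $ perp d + m - snd st $ perp d \<le> \<sigma> * m" "\<sigma> * m \<le> p $ perp d - fst st $ perp d"
      using m by (simp_all add: pos_divide_le_eq pos_le_divide_eq)
    then have "slab_lo (slab_of \<delta> st p d) st = p $ perp d - \<sigma> * m" "slab_hi (slab_of \<delta> st p d) st = p $ perp d + (1 - \<sigma>) * m"
      unfolding s by (auto simp: slab_lo_def slab_hi_def algebra_simps)
    then show ?thesis unfolding s using nm by (simp add: n_def algebra_simps)
  qed
qed

text \<open>The direction whose choice makes the block thick.\<close>

definition long :: "rect \<Rightarrow> 2" where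
  "long st = (if snd st $ 2 - fst st $ 2 \<le> snd st $ 1 - fst st $ 1 then 1 else 2)"

lemma long_side: "snd st $ perp (long st) - fst st $ perp (long st) \<le> snd st $ long st - fst st $ long st"
  by (simp add: long_def perp_def)

section \<open>Components and their labels\<close>

lemma rational_point_dense:
  assumes "box_of st \<noteq> {}" shows "\<exists>n. rational_point n \<in> box_of st"
proof -
  obtain r1 where r1: "fst st $ 1 < of_rat r1" "of_rat r1 < snd st $ 1" using of_rat_dense[OF box_of_less[OF assms]] by blast
  obtain r2 where r2: "fst st $ 2 < of_rat r2" "of_rat r2 < snd st $ 2" using of_rat_dense[OF box_of_less[OF assms]] by blast
  have "rational_point (to_nat (r1, r2)) \<in> box_of st"
    using r1 r2 by (simp add: rational_point_def mem_box_cart forall_2)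
  then show ?thesis by blast
qed

lemma rational_point_label: "box_of st \<noteq> {} \<Longrightarrow> rational_point (label (box_of st)) \<in> box_of st"
  unfolding label_def using rational_point_dense by (rule LeastI_ex)

text \<open>The component with label \<open>i\<close>, or the empty rectangle \<open>(0, 0)\<close>. It enumerates the
  components by natural numbers, each exactly once.\<close>

definition cell :: "(nat \<Rightarrow> rect \<Rightarrow> slab) \<Rightarrow> nat \<Rightarrow> nat \<Rightarrow> rect" where
  "cell sl k i =
     (let st = cell_at sl k (rational_point i)
      in if rational_point i \<in> box_of st \<and> label (box_of st) = i then st else (0, 0))"

lemma cell_nonempty:
  assumes x: "x \<in> box_of (cell sl k i)"
  shows "cell sl k i = cell_at sl k (rational_point i)" "label (box_of (cell_at sl k (rational_point i))) = i"
proof -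
  have "rational_point i \<in> box_of (cell_at sl k (rational_point i)) \<and> label (box_of (cell_at sl k (rational_point i))) = i"
  proof (rule ccontr)
    assume "\<not> ?thesis"
    then have "cell sl k i = (0, 0)" unfolding cell_def Let_def by (rule if_not_P)
    with x show False by simp
  qed
  then show "cell sl k i = cell_at sl k (rational_point i)" "label (box_of (cell_at sl k (rational_point i))) = i"
    unfolding cell_def Let_def by (rule if_P, blast)
qed

lemma cell_at_eq_cell: "x \<in> box_of (cell sl k i) \<Longrightarrow> cell_at sl k x = cell sl k i"
  using cell_nonempty(1)[of x sl k i] cell_at_consistent[of x sl k "rational_point i"] by simp

lemma mem_cell: "x \<in> box_of (cell sl k i) \<longleftrightarrow> x \<in> alive sl k \<and> label (box_of (cell_at sl k x)) = i"
proof
  assume x: "x \<in> box_of (cell sl k i)"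
  have e: "cell_at sl k x = cell sl k i" by (rule cell_at_eq_cell[OF x])
  then have "x \<in> alive sl k" using x by (simp add: alive_def)
  moreover have "label (box_of (cell_at sl k x)) = i"
    unfolding e cell_nonempty(1)[OF x] by (rule cell_nonempty(2)[OF x])
  ultimately show "x \<in> alive sl k \<and> label (box_of (cell_at sl k x)) = i" ..
next
  assume x: "x \<in> alive sl k \<and> label (box_of (cell_at sl k x)) = i"
  then have "box_of (cell_at sl k x) \<noteq> {}" by (auto simp: alive_def)
  from rational_point_label[OF this] have r: "rational_point i \<in> box_of (cell_at sl k x)"
    by (simp only: x[THEN conjunct2])
  have e: "cell_at sl k (rational_point i) = cell_at sl k x" by (rule cell_at_consistent[OF r])
  have "cell sl k i = cell_at sl k x"
    unfolding cell_def Let_def e by (rule if_P) (use x r in blast)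
  then show "x \<in> box_of (cell sl k i)" using x by (simp add: alive_def)
qed

lemma alive_cells: "indicator (alive sl k) x = (\<Sum>i. indicator (box_of (cell sl k i)) x :: ennreal)"
proof -
  have "(\<Sum>i. indicator (box_of (cell sl k i)) x :: ennreal) = (\<Sum>i. if i = label (box_of (cell_at sl k x)) then indicator (alive sl k) x else 0)"
    by (intro suminf_cong) (simp add: indicator_def mem_cell)
  also have "\<dots> = indicator (alive sl k) x" by (subst suminf_finite[of "{label (box_of (cell_at sl k x))}"]) auto
  finally show ?thesis by simp
qed

definition cell_block :: "(nat \<Rightarrow> rect \<Rightarrow> slab) \<Rightarrow> nat \<Rightarrow> nat \<Rightarrow> (real^2) set" where
  "cell_block sl k i = slab_part (sl k (cell sl k i)) (cell sl k i)"

lemma mem_cell_block: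
  "x \<in> cell_block sl k i \<longleftrightarrow> x \<in> slab_part (sl k (cell_at sl k x)) (cell_at sl k x) \<and> x \<in> box_of (cell sl k i)"
proof
  assume x: "x \<in> cell_block sl k i"
  then have "x \<in> box_of (cell sl k i)" by (auto simp: cell_block_def slab_part_def)
  with x cell_at_eq_cell[OF this] show "x \<in> slab_part (sl k (cell_at sl k x)) (cell_at sl k x) \<and> x \<in> box_of (cell sl k i)"
    by (simp add: cell_block_def)
next
  assume "x \<in> slab_part (sl k (cell_at sl k x)) (cell_at sl k x) \<and> x \<in> box_of (cell sl k i)"
  then show "x \<in> cell_block sl k i" using cell_at_eq_cell[of x sl k i] by (simp add: cell_block_def)
qed

lemma alive_decreasing: "j \<le> k \<Longrightarrow> alive sl k \<subseteq> alive sl j"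
proof (induction k)
  case (Suc k)
  have "alive sl (Suc k) \<subseteq> alive sl k" unfolding alive_def using cell_at_antimono by blast
  then show ?case using Suc by (cases "j = Suc k") auto
qed simp

lemma cell_block_not_alive:
  assumes "x \<in> cell_block sl j i" "j < k" shows "x \<notin> alive sl k"
proof -
  have s: "x \<in> slab_part (sl j (cell_at sl j x)) (cell_at sl j x)" using assms(1) mem_cell_block by blast
  then have "x \<in> box_of (cell_at sl j x)" by (simp add: slab_part_def)
  from cut_mem[OF this] s have "x \<notin> alive sl (Suc j)"
    using closure_subset[of "slab_part (sl j (cell_at sl j x)) (cell_at sl j x)"] by (auto simp: alive_def)
  then show ?thesis using alive_decreasing[of "Suc j" k sl] assms(2) by auto
qed

lemma slab_part_rectangle: "slab_part s st = {} \<or> rectangle (slab_part s st)"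
  using slab_part_box[of s st] slab_part_empty[of s st] by (cases "slab_part s st = {}") (auto simp: rectangle_def)

lemma alive_subset: "alive sl k \<subseteq> unit_square"
  using cell_at_subset by (auto simp: alive_def)

context well_blocks
begin

text \<open>The blocks of all steps form a packing, and the maps of the process are the ones glued from the blocks
  so far. What is not covered by blocks after \<open>k\<close> steps is the open set \<open>alive sl k\<close> up to the boundaries of
  blocks, a null set.\<close>

lemma process_limit:
  assumes y0: "\<And>x. y 0 x = M *v x"
    and ySuc: "\<And>k x. y (Suc k) x =
      (if x \<in> slab_part (sl k (cell_at sl k x)) (cell_at sl k x) then z (slab_part (sl k (cell_at sl k x)) (cell_at sl k x)) x else y k x)"
    and p: "1 < p" and s: "0 < s" "s * p < 1"
    and C0: "\<And>R. rectangle R \<Longrightarrow> R \<subseteq> unit_square \<Longrightarrow>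
      Wsp_pow R s p (weak_grad R (z R)) \<le> ennreal (C\<^sub>0 * rect_perimeter R powr (s * p) * measure lebesgue R powr (1 - s * p))"
    and exhaust: "(\<lambda>k. emeasure lebesgue (alive sl k)) \<longlonglongrightarrow> 0"
    and sum: "(\<Sum>k. \<Sum>i. ennreal (phi (s * p) (cell_block sl k i))) < \<infinity>"
  shows "\<exists>u. limit_deformation \<gamma> M s p y u"
proof (rule limit_deformation_exists[OF _ p s C0 _ _ _ sum])
  show "packing (\<lambda>n. case prod_decode n of (k, i) \<Rightarrow> cell_block sl k i)"
    unfolding packing_def
  proof (intro conjI allI)
    have "k = k' \<and> i = i'" if "x \<in> cell_block sl k i" "x \<in> cell_block sl k' i'" for x k i k' i'
    proof -
      have a: "x \<in> alive sl k" "x \<in> alive sl k'" using that mem_cell_block mem_cell by blast+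
      then have "k = k'"
        using cell_block_not_alive[OF that(1), of k'] cell_block_not_alive[OF that(2), of k] by (meson linorder_neqE_nat)
      moreover have "label (box_of (cell_at sl k x)) = i" "label (box_of (cell_at sl k' x)) = i'"
        using that mem_cell_block mem_cell by blast+
      ultimately show ?thesis by blast
    qed
    then have *: "prod_encode (k, i) = prod_encode (k', i')" if "x \<in> cell_block sl k i" "x \<in> cell_block sl k' i'" for x k i k' i'
      using that by metis
    show "disjoint_family (\<lambda>n. case prod_decode n of (k, i) \<Rightarrow> cell_block sl k i)"
      unfolding disjoint_family_on_def
    proof (intro ballI impI)
      fix m n :: nat assume "m \<noteq> n"
      show "(case prod_decode m of (k, i) \<Rightarrow> cell_block sl k i) \<inter> (case prod_decode n of (k, i) \<Rightarrow> cell_block sl k i) = {}"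
      proof (rule ccontr)
        assume "\<not> ?thesis"
        then obtain x where "x \<in> cell_block sl (fst (prod_decode m)) (snd (prod_decode m))"
          "x \<in> cell_block sl (fst (prod_decode n)) (snd (prod_decode n))" by (auto simp: case_prod_beta)
        from *[OF this] \<open>m \<noteq> n\<close> show False by simp
      qed
    qed
    show "(case prod_decode n of (k, i) \<Rightarrow> cell_block sl k i) = {} \<or> rectangle (case prod_decode n of (k, i) \<Rightarrow> cell_block sl k i)" for n
      using slab_part_rectangle by (auto simp: cell_block_def split: prod.splits)
    show "(case prod_decode n of (k, i) \<Rightarrow> cell_block sl k i) \<subseteq> unit_square" for n
      using alive_subset mem_cell_block mem_cell by (fastforce split: prod.splits)
  qed
  have stay: "y k x = y (Suc j) x" if "j < k" "x \<notin> alive sl (Suc j)" for j k x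
    using that(1)
  proof (induction k)
    case (Suc k)
    show ?case
    proof (cases "j = k")
      case False
      then have jk: "j < k" using Suc.prems by simp
      then have "x \<notin> alive sl k" using that(2) alive_decreasing[of "Suc j" k sl] by auto
      then have "x \<notin> slab_part (sl k (cell_at sl k x)) (cell_at sl k x)" by (auto simp: slab_part_def alive_def)
      then show ?thesis using Suc.IH[OF jk] ySuc by simp
    qed simp
  qed simp
  show "y k x = z (cell_block sl j i) x" if "j < k" "x \<in> cell_block sl j i" for k j i x
  proof -
    have x: "x \<in> slab_part (sl j (cell_at sl j x)) (cell_at sl j x)" "cell_at sl j x = cell sl j i"
      using that(2) mem_cell_block cell_at_eq_cell by blast+
    have "y k x = y (Suc j) x" using stay[OF that(1)] cell_block_not_alive[OF that(2)] by blast
    also have "\<dots> = z (cell_block sl j i) x" using x ySuc[of j x] by (simp add: cell_block_def)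
    finally show ?thesis .
  qed
  have blk: "x \<in> cell_block sl j (label (box_of (cell_at sl j x)))" if "x \<in> slab_part (sl j (cell_at sl j x)) (cell_at sl j x)" for j x
    using that by (auto simp: mem_cell_block mem_cell alive_def slab_part_def)
  show "y k x = M *v x" if "\<And>j i. j < k \<Longrightarrow> x \<notin> cell_block sl j i" for k x
    using that
  proof (induction k)
    case 0 then show ?case by (simp add: y0)
  next
    case (Suc k)
    have "x \<notin> slab_part (sl k (cell_at sl k x)) (cell_at sl k x)" using Suc.prems[of k] blk[of x k] by blast
    then show ?case using Suc ySuc by simp
  qed
  have null: "negligible (frontier (cell_block sl j i))" for j i
    using slab_part_rectangle[of "sl j (cell sl j i)" "cell sl j i"]
    by (auto simp: cell_block_def rectangle_def intro: negligible_convex_frontier)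
  have le: "emeasure lebesgue (unit_square - (\<Union>j<k. \<Union>i. cell_block sl j i)) \<le> emeasure lebesgue (alive sl k)" for k
  proof -
    define Z where "Z = (\<Union>j. \<Union>i. frontier (cell_block sl j i))"
    have Z: "Z \<in> null_sets lebesgue"
      unfolding Z_def using null by (intro null_sets_UN) (simp add: negligible_iff_null_sets)
    have "x \<in> alive sl k \<union> Z" if x: "x \<in> unit_square" "x \<notin> (\<Union>j<k. \<Union>i. cell_block sl j i)" for x
    proof (rule ccontr)
      assume c: "x \<notin> alive sl k \<union> Z"
      have "x \<in> alive sl j" if "j \<le> k" for j
        using that
      proof (induction j)
        case 0 then show ?case using x(1) by (simp add: alive_def unit_square_box)
      next
        case (Suc j)
        then have a: "x \<in> alive sl j" by simp
        let ?i = "label (box_of (cell_at sl j x))"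
        have xc: "x \<in> box_of (cell sl j ?i)" using a by (simp add: mem_cell)
        have cb: "cell_block sl j ?i = slab_part (sl j (cell_at sl j x)) (cell_at sl j x)"
          using cell_at_eq_cell[OF xc] by (simp add: cell_block_def)
        have "x \<notin> cell_block sl j ?i" using x(2) Suc.prems by auto
        moreover have "x \<notin> frontier (cell_block sl j ?i)" using c by (auto simp: Z_def)
        ultimately have "x \<notin> closure (cell_block sl j ?i)"
          using interior_subset[of "cell_block sl j ?i"] by (auto simp: frontier_def)
        then show ?case using cut_mem[of x "cell_at sl j x" "sl j (cell_at sl j x)"] a cb by (simp add: alive_def)
      qed
      then show False using c by blast
    qed
    then have sub: "unit_square - (\<Union>j<k. \<Union>i. cell_block sl j i) \<subseteq> alive sl k \<union> Z" by blast
    have "open (alive sl k)"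
    proof (subst open_subopen, intro ballI)
      fix x assume "x \<in> alive sl k"
      then show "\<exists>T. open T \<and> x \<in> T \<and> T \<subseteq> alive sl k"
        using box_of_cell_at_subset_alive[of sl k x] by (intro exI[of _ "box_of (cell_at sl k x)"]) (auto simp: alive_def)
    qed
    then have as: "alive sl k \<in> sets lebesgue" by (simp add: borel_open sets_completionI_sets)
    have "emeasure lebesgue (unit_square - (\<Union>j<k. \<Union>i. cell_block sl j i)) \<le> emeasure lebesgue (alive sl k \<union> Z)"
      using sub as Z by (intro emeasure_mono) auto
    also have "\<dots> = emeasure lebesgue (alive sl k)" using as Z by (rule emeasure_Un_null_set)
    finally show ?thesis .
  qed
  show "(\<lambda>k. emeasure lebesgue (unit_square - (\<Union>j<k. \<Union>i. cell_block sl j i))) \<longlonglongrightarrow> 0"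
    by (rule tendsto_sandwich[OF _ _ tendsto_const exhaust]; rule always_eventually; rule allI; (rule le | rule zero_le))
qed

end

section \<open>Both models as cutting processes\<close>

definition slab_A :: "real \<Rightarrow> (nat \<Rightarrow> nat \<Rightarrow> (real^2) \<times> 2) \<Rightarrow> nat \<Rightarrow> rect \<Rightarrow> slab" where
  "slab_A \<delta> \<omega> k st = slab_of \<delta> st (fst (\<omega> k (label (box_of st)))) (snd (\<omega> k (label (box_of st))))"

text \<open>Components that are not hit get the slab \<open>(1, 0, 0)\<close>, which has no interior and hence removes nothing.\<close>

definition slab_B :: "real \<Rightarrow> (nat \<Rightarrow> (real^2) \<times> 2) \<Rightarrow> nat \<Rightarrow> rect \<Rightarrow> slab" where
  "slab_B \<delta> \<omega> k st = (if fst (\<omega> k) \<in> box_of st then slab_of \<delta> st (fst (\<omega> k)) (snd (\<omega> k)) else (1, 0, 0))"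

lemma A_set_alive:
  assumes \<delta>: "\<delta> > 0" shows "A_set \<delta> \<omega> k = alive (slab_A \<delta> \<omega>) k"
proof (induction k)
  case 0
  then show ?case by (auto simp: alive_def unit_square_box split: if_splits)
next
  case (Suc k)
  have "alive (slab_A \<delta> \<omega>) (Suc k) = alive (slab_A \<delta> \<omega>) k - closure (\<Union>D\<in>components (alive (slab_A \<delta> \<omega>) k). A_block \<delta> (\<omega> k) D)"
    by (rule alive_Suc) (simp add: A_block_def slab_A_def block_slab[OF _ \<delta>])
  then show ?case using Suc by simp
qed

lemma A_deformation_Suc:
  assumes \<delta>: "\<delta> > 0"
  shows "A_deformation \<delta> z M \<omega> (Suc k) x =
    (let R = slab_part (slab_A \<delta> \<omega> k (cell_at (slab_A \<delta> \<omega>) k x)) (cell_at (slab_A \<delta> \<omega>) k x)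
     in if x \<in> R then z M R x else A_deformation \<delta> z M \<omega> k x)"
proof (cases "x \<in> alive (slab_A \<delta> \<omega>) k")
  case True
  then have "box_of (cell_at (slab_A \<delta> \<omega>) k x) \<noteq> {}" by (auto simp: alive_def)
  from block_slab[OF this \<delta>]
  show ?thesis using True by (simp add: A_set_alive[OF \<delta>] alive_component A_block_def slab_A_def Let_def)
next
  case False
  then have "x \<notin> slab_part (slab_A \<delta> \<omega> k (cell_at (slab_A \<delta> \<omega>) k x)) (cell_at (slab_A \<delta> \<omega>) k x)"
    by (auto simp: slab_part_def alive_def)
  then show ?thesis using False by (simp add: A_set_alive[OF \<delta>] Let_def)
qed

lemma B_block_eq:
  assumes \<delta>: "\<delta> > 0"
  shows "B_block \<delta> (alive sl k) (p, d) =
    (if p \<in> alive sl k then slab_part (slab_of \<delta> (cell_at sl k p) p d) (cell_at sl k p) else {})"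
proof (cases "p \<in> alive sl k")
  case True
  then have "box_of (cell_at sl k p) \<noteq> {}" by (auto simp: alive_def)
  from block_slab[OF this \<delta>] True show ?thesis by (simp add: B_block_def alive_component)
next
  case False
  then have "connected_component_set (alive sl k) p = {}" using connected_component_eq_empty by metis
  then show ?thesis using False by (simp add: B_block_def block_def Let_def)
qed

lemma B_set_alive:
  assumes \<delta>: "\<delta> > 0" shows "B_set \<delta> \<omega> k = alive (slab_B \<delta> \<omega>) k"
proof (induction k)
  case 0
  then show ?case by (auto simp: alive_def unit_square_box split: if_splits)
next
  case (Suc k)
  let ?sl = "slab_B \<delta> \<omega>"
  define p where "p = fst (\<omega> k)"
  define d where "d = snd (\<omega> k)"
  define blk where "blk D = (if p \<in> D then block \<delta> D p d else {})" for D
  have "alive ?sl (Suc k) = alive ?sl k - closure (\<Union>D\<in>components (alive ?sl k). blk D)"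
  proof (rule alive_Suc)
    fix st :: rect assume ne: "box_of st \<noteq> {}"
    show "blk (box_of st) = slab_part (?sl k st) st"
    proof (cases "p \<in> box_of st")
      case True
      then have "?sl k st = slab_of \<delta> st p d" by (simp add: slab_B_def p_def d_def)
      then show ?thesis using True block_slab[OF ne \<delta>] by (simp add: blk_def)
    next
      case False
      then have "?sl k st = (1, 0, 0)" by (simp add: slab_B_def p_def)
      moreover have "slab_part (1, 0, 0) st = {}" by (auto simp: slab_part_def)
      ultimately show ?thesis using False by (simp add: blk_def)
    qed
  qed
  also have "(\<Union>D\<in>components (alive ?sl k). blk D) = B_block \<delta> (alive ?sl k) (\<omega> k)"
  proof (cases "p \<in> alive ?sl k")
    case True
    let ?D = "connected_component_set (alive ?sl k) p"
    have D: "?D \<in> components (alive ?sl k)" using True by (auto simp: components_def)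
    have pD: "p \<in> ?D" using True by simp
    have uniq: "D' = ?D" if "D' \<in> components (alive ?sl k)" "p \<in> D'" for D'
      using that components_nonoverlap[OF that(1) D] pD by blast
    have "blk D' \<subseteq> blk ?D" if D': "D' \<in> components (alive ?sl k)" for D'
    proof (cases "p \<in> D'")
      case True
      show ?thesis unfolding uniq[OF D' True] by (rule subset_refl)
    next
      case False
      then show ?thesis unfolding blk_def by (simp only: if_False empty_subsetI)
    qed
    then have "(\<Union>D\<in>components (alive ?sl k). blk D) = blk ?D"
      by (intro equalityI UN_least UN_upper D)
    also have "\<dots> = block \<delta> ?D p d" unfolding blk_def by (rule if_P[OF pD])
    also have "\<dots> = B_block \<delta> (alive ?sl k) (\<omega> k)" unfolding B_block_def p_def d_def ..
    finally show ?thesis .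
  next
    case False
    then have "blk D = {}" if "D \<in> components (alive ?sl k)" for D
      using in_components_subset[OF that] by (auto simp: blk_def)
    moreover have "B_block \<delta> (alive ?sl k) (\<omega> k) = {}"
      using B_block_eq[OF \<delta>, of ?sl k p d] False by (simp add: p_def d_def)
    ultimately show ?thesis by simp
  qed
  finally show ?case using Suc by simp
qed

lemma slab_B_hit: "fst (\<omega> k) \<in> box_of st \<Longrightarrow> slab_B \<delta> \<omega> k st = slab_of \<delta> st (fst (\<omega> k)) (snd (\<omega> k))"
  by (simp add: slab_B_def)

lemma B_deformation_Suc:
  assumes \<delta>: "\<delta> > 0"
  shows "B_deformation \<delta> z M \<omega> (Suc k) x =
    (let R = slab_part (slab_B \<delta> \<omega> k (cell_at (slab_B \<delta> \<omega>) k x)) (cell_at (slab_B \<delta> \<omega>) k x)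
     in if x \<in> R then z M R x else B_deformation \<delta> z M \<omega> k x)"
proof -
  let ?sl = "slab_B \<delta> \<omega>"
  define p where "p = fst (\<omega> k)"
  define d where "d = snd (\<omega> k)"
  let ?R = "slab_part (?sl k (cell_at ?sl k x)) (cell_at ?sl k x)"
  let ?B = "B_block \<delta> (alive ?sl k) (\<omega> k)"
  have B: "?B = (if p \<in> alive ?sl k then slab_part (slab_of \<delta> (cell_at ?sl k p) p d) (cell_at ?sl k p) else {})"
    using B_block_eq[OF \<delta>, of ?sl k p d] by (simp add: p_def d_def)
  have "x \<in> ?B \<longleftrightarrow> x \<in> ?R \<and> ?B = ?R"
  proof
    assume x: "x \<in> ?B"
    then have pa: "p \<in> alive ?sl k" and xp: "x \<in> box_of (cell_at ?sl k p)" using B by (auto simp: slab_part_def split: if_splits)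
    from cell_at_consistent[OF xp] have e: "cell_at ?sl k x = cell_at ?sl k p" .
    have "?sl k (cell_at ?sl k x) = slab_of \<delta> (cell_at ?sl k p) p d"
      using pa by (simp add: e slab_B_def p_def d_def alive_def)
    then show "x \<in> ?R \<and> ?B = ?R" using x B pa e by simp
  qed simp
  moreover have "x \<in> ?R \<Longrightarrow> x \<in> ?B"
  proof -
    assume x: "x \<in> ?R"
    have px: "p \<in> box_of (cell_at ?sl k x)"
      using x by (auto simp: slab_B_def slab_part_def p_def split: if_splits)
    from cell_at_consistent[OF this] have e: "cell_at ?sl k p = cell_at ?sl k x" .
    have pa: "p \<in> alive ?sl k" using px e by (simp add: alive_def)
    have "?sl k (cell_at ?sl k x) = slab_of \<delta> (cell_at ?sl k p) p d"
      unfolding e unfolding p_def d_def by (rule slab_B_hit[where \<omega>=\<omega> and k=k, OF px[unfolded p_def]])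
    then show "x \<in> ?B" using x B pa e by simp
  qed
  ultimately show ?thesis by (auto simp: B_set_alive[OF \<delta>] Let_def)
qed

section \<open>The law of a single choice\<close>

text \<open>The law of a choice as a density with respect to one fixed measure for all sets \<open>V\<close>. With a fixed reference
  measure, measurable dependence on \<open>V\<close> is a statement about a single function.\<close>

definition choice_density :: "real \<Rightarrow> (real^2) set \<Rightarrow> (real^2) \<times> 2 \<Rightarrow> ennreal" where
  "choice_density q V c = indicator V (fst c) / emeasure lborel V * ennreal (pmf (direction_pmf q) (snd c))"

abbreviation choice_base :: "((real^2) \<times> 2) measure" where
  "choice_base \<equiv> lborel \<Otimes>\<^sub>M count_space UNIV"

lemma sigma_finite_choice_base: "sigma_finite_measure choice_base"
proof -
  interpret c: sigma_finite_measure "count_space (UNIV :: 2 set)" by (rule sigma_finite_measure_count_space)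
  interpret p: pair_sigma_finite "lborel :: (real^2) measure" "count_space (UNIV :: 2 set)" ..
  show ?thesis by (rule p.sigma_finite_measure_axioms)
qed

lemma sets_choice_base: "sets choice_base = sets choice_space"
  by (intro sets_pair_measure_cong) auto

lemma choice_law_density:
  assumes V: "V \<in> sets borel" "emeasure lborel V \<noteq> 0" "emeasure lborel V \<noteq> \<infinity>"
  shows "choice_law q V = density choice_base (choice_density q V)"
proof -
  interpret u: prob_space "uniform_measure lborel V" using V by (intro prob_space_uniform_measure) auto
  interpret m: prob_space "measure_pmf (direction_pmf q)" by (rule prob_space_measure_pmf)
  have 1: "uniform_measure lborel V = density lborel (\<lambda>x. indicator V x / emeasure lborel V)"
    by (simp add: uniform_measure_def)
  have 2: "measure_pmf (direction_pmf q) = density (count_space UNIV) (\<lambda>e. ennreal (pmf (direction_pmf q) e))"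
    by (rule measure_pmf_eq_density)
  have "choice_law q V = density choice_base (\<lambda>(x, e). indicator V x / emeasure lborel V * ennreal (pmf (direction_pmf q) e))"
    unfolding choice_law_def 1 2
  proof (rule pair_measure_density)
    show "sigma_finite_measure (count_space (UNIV :: 2 set))" by (rule sigma_finite_measure_count_space)
    show "sigma_finite_measure (density (count_space UNIV) (\<lambda>e. ennreal (pmf (direction_pmf q) e)))"
      unfolding 2[symmetric] by (rule prob_space_imp_sigma_finite[OF prob_space_measure_pmf])
  qed (use V in auto)
  then show ?thesis by (simp add: choice_density_def[abs_def] split_beta')
qed

lemma nn_integral_choice_base:
  assumes "F \<in> borel_measurable choice_base"
  shows "(\<integral>\<^sup>+c. F c \<partial>choice_base) = (\<Sum>e\<in>UNIV. \<integral>\<^sup>+x. F (x, e) \<partial>lborel)"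
proof -
  interpret c: sigma_finite_measure "count_space (UNIV :: 2 set)" by (rule sigma_finite_measure_count_space)
  have m: "(\<lambda>x. F (x, e)) \<in> borel_measurable lborel" for e
    using assms by measurable
  have "(\<integral>\<^sup>+c. F c \<partial>choice_base) = (\<integral>\<^sup>+x. (\<integral>\<^sup>+e. F (x, e) \<partial>count_space UNIV) \<partial>lborel)"
    by (rule c.nn_integral_fst[OF assms, symmetric])
  also have "\<dots> = (\<integral>\<^sup>+x. (\<Sum>e\<in>UNIV. F (x, e)) \<partial>lborel)"
    by (simp add: nn_integral_count_space_finite)
  also have "\<dots> = (\<Sum>e\<in>UNIV. \<integral>\<^sup>+x. F (x, e) \<partial>lborel)"
    using m by (intro nn_integral_sum) auto
  finally show ?thesis .
qed

text \<open>\<open>sequence_law\<close> prescribes the joint law of the past and the next choice on products of measurable sets. These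
  generate the product sigma-algebra, so the prescription extends to functions of both. \<open>\<pi>\<close> selects
  the relevant part of the choice, an entry of it in Model A and the whole choice in Model B. \<open>S\<close> restricts to
  pasts for which the uniform law on \<open>W\<close> is meaningful.\<close>

lemma joint_law:
  fixes N :: "'c measure" and \<mu> :: "(nat \<Rightarrow> 'c) measure" and \<pi> :: "'c \<Rightarrow> (real^2) \<times> 2"
  defines "P k \<equiv> (\<Pi>\<^sub>M j\<in>{..<k}. N)"
  assumes law: "sequence_law N \<kappa> \<mu>"
    and \<pi>: "\<pi> \<in> measurable N choice_space"
    and S: "S \<in> sets (P k)"
    and W: "{w \<in> space (P k \<Otimes>\<^sub>M borel). snd w \<in> W (fst w)} \<in> sets (P k \<Otimes>\<^sub>M borel)"
    and Wfin: "\<And>h. h \<in> S \<Longrightarrow> emeasure lborel (W h) \<noteq> 0 \<and> emeasure lborel (W h) \<noteq> \<infinity>"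
    and kernel: "\<And>\<omega> A. \<omega> \<in> space \<mu> \<Longrightarrow> restrict \<omega> {..<k} \<in> S \<Longrightarrow> A \<in> sets choice_space \<Longrightarrow>
      emeasure (\<kappa> k \<omega>) (\<pi> -` A \<inter> space N) = emeasure (choice_law q (W (restrict \<omega> {..<k}))) A"
    and F: "F \<in> borel_measurable (P k \<Otimes>\<^sub>M choice_space)"
  shows "(\<integral>\<^sup>+\<omega>. indicator S (restrict \<omega> {..<k}) * F (restrict \<omega> {..<k}, \<pi> (\<omega> k)) \<partial>\<mu>) =
    (\<integral>\<^sup>+\<omega>. indicator S (restrict \<omega> {..<k}) * (\<Sum>e\<in>UNIV. ennreal (pmf (direction_pmf q) e) *
       (\<integral>\<^sup>+x. F (restrict \<omega> {..<k}, (x, e)) * indicator (W (restrict \<omega> {..<k})) x \<partial>lborel) / emeasure lborel (W (restrict \<omega> {..<k}))) \<partial>\<mu>)"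
proof -
  interpret \<mu>: prob_space \<mu> using law by (simp add: sequence_law_def)
  interpret cb: sigma_finite_measure choice_base by (rule sigma_finite_choice_base)
  have sets_\<mu>: "sets \<mu> = sets (\<Pi>\<^sub>M k\<in>UNIV. N)" using law by (simp add: sequence_law_def)
  let ?r = "\<lambda>\<omega>. restrict \<omega> {..<k}"
  have r [measurable]: "?r \<in> measurable \<mu> (P k)"
    unfolding P_def measurable_cong_sets[OF sets_\<mu> refl] by (rule measurable_restrict_subset) auto
  have nth [measurable]: "(\<lambda>\<omega>. \<omega> k) \<in> measurable \<mu> N"
    unfolding measurable_cong_sets[OF sets_\<mu> refl] by (rule measurable_component_singleton) auto
  note [measurable] = \<pi> S F
  have FB: "F \<in> borel_measurable (P k \<Otimes>\<^sub>M choice_base)"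
    using F by (subst measurable_cong_sets[OF sets_pair_measure_cong[OF refl sets_choice_base] refl])
  have Wm [measurable]: "Measurable.pred (P k \<Otimes>\<^sub>M borel) (\<lambda>w. snd w \<in> W (fst w))"
    using W unfolding pred_def by simp
  have Wm': "Measurable.pred (P k \<Otimes>\<^sub>M lborel) (\<lambda>w. snd w \<in> W (fst w))"
    using Wm by (subst measurable_cong_sets[OF sets_pair_measure_cong[OF refl sets_lborel] refl])
  have iW: "(\<lambda>w. indicator (W (fst w)) (snd w) :: ennreal) \<in> borel_measurable (P k \<Otimes>\<^sub>M lborel)"
  proof -
    have "(\<lambda>w. if snd w \<in> W (fst w) then 1 else 0 :: ennreal) \<in> borel_measurable (P k \<Otimes>\<^sub>M lborel)"
      using Wm' by measurable
    then show ?thesis by (simp add: indicator_def)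
  qed
  have eW [measurable]: "(\<lambda>h. emeasure lborel (W h)) \<in> borel_measurable (P k)"
  proof -
    have "(\<lambda>h. \<integral>\<^sup>+x. indicator (W h) x \<partial>lborel) \<in> borel_measurable (P k)"
      using iW by (intro lborel.borel_measurable_nn_integral) (simp add: split_beta')
    then show ?thesis
    proof (rule measurable_cong[THEN iffD1, rotated])
      fix h assume h: "h \<in> space (P k)"
      have "W h \<in> sets borel"
      proof -
        have "(\<lambda>x. (h, x)) \<in> measurable borel (P k \<Otimes>\<^sub>M borel)" using h by simp
        from measurable_sets[OF this W] show ?thesis using h by (simp add: vimage_def space_pair_measure)
      qed
      then show "(\<integral>\<^sup>+x. indicator (W h) x \<partial>lborel) = emeasure lborel (W h)" by simp
    qed
  qed
  have Wb: "W h \<in> sets borel" if "h \<in> space (P k)" for h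
  proof -
    have "(\<lambda>x. (h, x)) \<in> measurable borel (P k \<Otimes>\<^sub>M borel)" using that by simp
    from measurable_sets[OF this W] show ?thesis using that by (simp add: vimage_def space_pair_measure)
  qed
  define den where "den w = indicator S (fst w) * choice_density q (W (fst w)) (snd w)" for w :: "(nat \<Rightarrow> 'c) \<times> (real^2) \<times> 2"
  have cd: "(\<lambda>w. choice_density q (W (fst w)) (snd w)) \<in> borel_measurable (P k \<Otimes>\<^sub>M choice_base)"
  proof -
    have 1: "(\<lambda>w. (fst w, fst (snd w))) \<in> measurable (P k \<Otimes>\<^sub>M choice_base) (P k \<Otimes>\<^sub>M lborel)" by measurable
    have 2: "(\<lambda>w. indicator (W (fst w)) (fst (snd w)) :: ennreal) \<in> borel_measurable (P k \<Otimes>\<^sub>M choice_base)"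
      using measurable_compose[OF 1 iW] by simp
    have 3: "(\<lambda>w. emeasure lborel (W (fst w))) \<in> borel_measurable (P k \<Otimes>\<^sub>M choice_base)" by measurable
    have 4: "(\<lambda>w. ennreal (pmf (direction_pmf q) (snd (snd w)))) \<in> borel_measurable (P k \<Otimes>\<^sub>M choice_base)" by measurable
    show ?thesis unfolding choice_density_def
      using 2 3 4 by (intro borel_measurable_times_ennreal borel_measurable_divide_ennreal)
  qed
  have denm: "den \<in> borel_measurable (P k \<Otimes>\<^sub>M choice_base)"
    unfolding den_def[abs_def]
    by (intro borel_measurable_times_ennreal cd measurable_compose[OF measurable_fst borel_measurable_indicator] S)
  define Pd where "Pd = distr \<mu> (P k) ?r"
  interpret Pd: prob_space Pd unfolding Pd_def by (rule \<mu>.prob_space_distr) (rule r)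
  have sPd: "sets Pd = sets (P k)" by (simp add: Pd_def)
  have spP: "sets (Pd \<Otimes>\<^sub>M choice_base) = sets (P k \<Otimes>\<^sub>M choice_space)"
    by (intro sets_pair_measure_cong sPd sets_choice_base)
  have spP': "sets (Pd \<Otimes>\<^sub>M choice_base) = sets (P k \<Otimes>\<^sub>M choice_base)"
    by (intro sets_pair_measure_cong sPd refl)
  define M1 where "M1 = distr (density \<mu> (\<lambda>\<omega>. indicator S (?r \<omega>))) (P k \<Otimes>\<^sub>M choice_space) (\<lambda>\<omega>. (?r \<omega>, \<pi> (\<omega> k)))"
  define M2 where "M2 = density (Pd \<Otimes>\<^sub>M choice_base) den"
  have map: "(\<lambda>\<omega>. (?r \<omega>, \<pi> (\<omega> k))) \<in> measurable \<mu> (P k \<Otimes>\<^sub>M choice_space)" by measurable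
  have denm': "den \<in> borel_measurable (Pd \<Otimes>\<^sub>M choice_base)"
    using denm by (subst measurable_cong_sets[OF spP' refl])
  have sl: "space (P k) \<times> UNIV = space (P k \<Otimes>\<^sub>M choice_space)" by (simp add: space_pair_measure)
  have cl: "(\<integral>\<^sup>+c. indicator S h * choice_density q (W h) c * indicator A c \<partial>choice_base) = indicator S h * emeasure (choice_law q (W h)) A"
    if h: "h \<in> space (P k)" and A: "A \<in> sets choice_space" for h A
  proof (cases "h \<in> S")
    case True
    have A': "A \<in> sets choice_base" using A sets_choice_base by simp
    have m: "choice_density q (W h) \<in> borel_measurable choice_base"
    proof -
      have "(\<lambda>c. (h, c)) \<in> measurable choice_base (P k \<Otimes>\<^sub>M choice_base)" using h by simp
      from measurable_compose[OF this cd] show ?thesis by simp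
    qed
    have "emeasure (choice_law q (W h)) A = (\<integral>\<^sup>+c. choice_density q (W h) c * indicator A c \<partial>choice_base)"
      using Wfin[OF True] Wb[OF h] by (simp add: choice_law_density emeasure_density[OF m A'])
    then show ?thesis using True by simp
  qed simp
  have "M1 = M2"
  proof (rule measure_eqI_generator_eq[OF Int_stable_pair_measure_generator[of "P k" choice_space], where \<Omega>="space (P k) \<times> space choice_space" and A="\<lambda>_. space (P k) \<times> space choice_space"])
    show "{a \<times> b |a b. a \<in> sets (P k) \<and> b \<in> sets choice_space} \<subseteq> Pow (space (P k) \<times> space choice_space)"
      by (rule pair_measure_closed)
    show "sets M1 = sigma_sets (space (P k) \<times> space choice_space) {a \<times> b |a b. a \<in> sets (P k) \<and> b \<in> sets choice_space}"
      unfolding M1_def sets_distr by (rule sets_pair_measure)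
    show "sets M2 = sigma_sets (space (P k) \<times> space choice_space) {a \<times> b |a b. a \<in> sets (P k) \<and> b \<in> sets choice_space}"
      unfolding M2_def sets_density spP by (rule sets_pair_measure)
    show "range (\<lambda>_::nat. space (P k) \<times> space choice_space) \<subseteq> {a \<times> b |a b. a \<in> sets (P k) \<and> b \<in> sets choice_space}" by blast
    show "(\<Union>i::nat. space (P k) \<times> space choice_space) = space (P k) \<times> space choice_space" by simp
    have rect: "emeasure M1 (E \<times> A) = (\<integral>\<^sup>+\<omega>. indicator (S \<inter> E) (?r \<omega>) * emeasure (choice_law q (W (?r \<omega>))) A \<partial>\<mu>)"
      "emeasure M2 (E \<times> A) = (\<integral>\<^sup>+\<omega>. indicator (S \<inter> E) (?r \<omega>) * emeasure (choice_law q (W (?r \<omega>))) A \<partial>\<mu>)"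
      if E: "E \<in> sets (P k)" and A: "A \<in> sets choice_space" for E A
    proof -
      note [measurable] = E A
      have EA: "E \<times> A \<in> sets (P k \<Otimes>\<^sub>M choice_space)" by measurable
      let ?T = "(\<lambda>\<omega>. (?r \<omega>, \<pi> (\<omega> k))) -` (E \<times> A) \<inter> space \<mu>"
      have T: "?T \<in> sets \<mu>" by (rule measurable_sets[OF map EA])
      have SE: "S \<inter> E \<in> sets (P k)" by measurable
      have pA: "\<pi> -` A \<inter> space N \<in> sets N" by (rule measurable_sets[OF \<pi> A])
      have "emeasure M1 (E \<times> A) = emeasure (density \<mu> (\<lambda>\<omega>. indicator S (?r \<omega>))) ?T"
        unfolding M1_def using map EA by (subst emeasure_distr) (auto simp: measurable_cong_sets[OF sets_density refl])
      also have "\<dots> = (\<integral>\<^sup>+\<omega>. indicator S (?r \<omega>) * indicator ?T \<omega> \<partial>\<mu>)"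
        by (rule emeasure_density[OF _ T]) measurable
      also have "\<dots> = (\<integral>\<^sup>+\<omega>. indicator {\<omega> \<in> space \<mu>. ?r \<omega> \<in> S \<inter> E \<and> \<omega> k \<in> \<pi> -` A \<inter> space N} \<omega> \<partial>\<mu>)"
        using measurable_space[OF nth] by (intro nn_integral_cong) (auto simp: indicator_def)
      also have "\<dots> = emeasure \<mu> {\<omega> \<in> space \<mu>. ?r \<omega> \<in> S \<inter> E \<and> \<omega> k \<in> \<pi> -` A \<inter> space N}"
      proof (rule nn_integral_indicator)
        have "?r -` (S \<inter> E) \<inter> space \<mu> \<in> sets \<mu>" "(\<lambda>\<omega>. \<omega> k) -` (\<pi> -` A \<inter> space N) \<inter> space \<mu> \<in> sets \<mu>"
          by (rule measurable_sets[OF r SE], rule measurable_sets[OF nth pA])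
        then have "(?r -` (S \<inter> E) \<inter> space \<mu>) \<inter> ((\<lambda>\<omega>. \<omega> k) -` (\<pi> -` A \<inter> space N) \<inter> space \<mu>) \<in> sets \<mu>" by (rule sets.Int)
        moreover have "(?r -` (S \<inter> E) \<inter> space \<mu>) \<inter> ((\<lambda>\<omega>. \<omega> k) -` (\<pi> -` A \<inter> space N) \<inter> space \<mu>) = {\<omega> \<in> space \<mu>. ?r \<omega> \<in> S \<inter> E \<and> \<omega> k \<in> \<pi> -` A \<inter> space N}" by blast
        ultimately show "{\<omega> \<in> space \<mu>. ?r \<omega> \<in> S \<inter> E \<and> \<omega> k \<in> \<pi> -` A \<inter> space N} \<in> sets \<mu>" by simp
      qed
      also have "\<dots> = (\<integral>\<^sup>+\<omega>. indicator (S \<inter> E) (?r \<omega>) * emeasure (\<kappa> k \<omega>) (\<pi> -` A \<inter> space N) \<partial>\<mu>)"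
        using law SE pA unfolding sequence_law_def P_def by blast
      also have "\<dots> = (\<integral>\<^sup>+\<omega>. indicator (S \<inter> E) (?r \<omega>) * emeasure (choice_law q (W (?r \<omega>))) A \<partial>\<mu>)"
        using kernel A by (intro nn_integral_cong) (auto simp: indicator_def)
      finally show "emeasure M1 (E \<times> A) = \<dots>" .
      have "emeasure M2 (E \<times> A) = (\<integral>\<^sup>+w. den w * indicator (E \<times> A) w \<partial>(Pd \<Otimes>\<^sub>M choice_base))"
        unfolding M2_def using EA by (intro emeasure_density[OF denm']) (simp add: spP)
      also have "\<dots> = (\<integral>\<^sup>+h. (\<integral>\<^sup>+c. den (h, c) * indicator (E \<times> A) (h, c) \<partial>choice_base) \<partial>Pd)"
        using denm' EA by (intro cb.nn_integral_fst[symmetric] borel_measurable_times_ennreal borel_measurable_indicator) (simp_all add: spP)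
      also have "\<dots> = (\<integral>\<^sup>+h. indicator (S \<inter> E) h * emeasure (choice_law q (W h)) A \<partial>Pd)"
      proof (rule nn_integral_cong)
        fix h assume "h \<in> space Pd"
        then have h: "h \<in> space (P k)" by (simp add: Pd_def)
        have "(\<integral>\<^sup>+c. den (h, c) * indicator (E \<times> A) (h, c) \<partial>choice_base)
            = (\<integral>\<^sup>+c. indicator E h * (indicator S h * choice_density q (W h) c * indicator A c) \<partial>choice_base)"
          by (intro nn_integral_cong) (auto simp: den_def indicator_def)
        also have "\<dots> = indicator E h * (indicator S h * emeasure (choice_law q (W h)) A)"
          using cl[OF h A] by (cases "h \<in> E") auto
        finally show "(\<integral>\<^sup>+c. den (h, c) * indicator (E \<times> A) (h, c) \<partial>choice_base) = indicator (S \<inter> E) h * emeasure (choice_law q (W h)) A"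
          by (simp add: indicator_def)
      qed
      also have "\<dots> = (\<integral>\<^sup>+\<omega>. indicator (S \<inter> E) (?r \<omega>) * emeasure (choice_law q (W (?r \<omega>))) A \<partial>\<mu>)"
        unfolding Pd_def
      proof (rule nn_integral_distr[OF r], unfold measurable_distr_eq1)
        have "(\<lambda>h. \<integral>\<^sup>+c. indicator S h * choice_density q (W h) c * indicator A c \<partial>choice_base) \<in> borel_measurable (P k)"
        proof (rule cb.borel_measurable_nn_integral)
          have "(\<lambda>w. indicator A (snd w) :: ennreal) \<in> borel_measurable (P k \<Otimes>\<^sub>M choice_base)"
            using A by (intro measurable_compose[OF measurable_snd] borel_measurable_indicator) (simp add: sets_choice_base)
          from borel_measurable_times_ennreal[OF denm this]
          show "case_prod (\<lambda>h c. indicator S h * choice_density q (W h) c * indicator A c) \<in> borel_measurable (P k \<Otimes>\<^sub>M choice_base)"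
            unfolding den_def split_beta' .
        qed
        then have "(\<lambda>h. indicator S h * emeasure (choice_law q (W h)) A) \<in> borel_measurable (P k)"
          by (rule measurable_cong[THEN iffD1, rotated]) (rule cl[OF _ A])
        from borel_measurable_times_ennreal[OF borel_measurable_indicator[OF E] this]
        have "(\<lambda>h. indicator E h * (indicator S h * emeasure (choice_law q (W h)) A)) \<in> borel_measurable (P k)" .
        then show "(\<lambda>h. indicator (S \<inter> E) h * emeasure (choice_law q (W h)) A) \<in> borel_measurable (P k)"
          by (simp add: indicator_inter_arith mult_ac)
      qed
      finally show "emeasure M2 (E \<times> A) = (\<integral>\<^sup>+\<omega>. indicator (S \<inter> E) (?r \<omega>) * emeasure (choice_law q (W (?r \<omega>))) A \<partial>\<mu>)" .
    qed
    show "emeasure M1 X = emeasure M2 X" if "X \<in> {a \<times> b |a b. a \<in> sets (P k) \<and> b \<in> sets choice_space}" for X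
      using that rect by auto
    have "emeasure M1 (space (P k) \<times> space choice_space)
        = emeasure (density \<mu> (\<lambda>\<omega>. indicator S (?r \<omega>))) ((\<lambda>\<omega>. (?r \<omega>, \<pi> (\<omega> k))) -` (space (P k) \<times> space choice_space) \<inter> space (density \<mu> (\<lambda>\<omega>. indicator S (?r \<omega>))))"
      unfolding M1_def
    proof (rule emeasure_distr)
      show "(\<lambda>\<omega>. (?r \<omega>, \<pi> (\<omega> k))) \<in> measurable (density \<mu> (\<lambda>\<omega>. indicator S (?r \<omega>))) (P k \<Otimes>\<^sub>M choice_space)"
        using map by (subst measurable_cong_sets[OF sets_density refl])
      show "space (P k) \<times> space choice_space \<in> sets (P k \<Otimes>\<^sub>M choice_space)" by (intro pair_measureI sets.top)
    qed
    also have "\<dots> \<le> emeasure (density \<mu> (\<lambda>\<omega>. indicator S (?r \<omega>))) (space (density \<mu> (\<lambda>\<omega>. indicator S (?r \<omega>))))"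
      by (rule emeasure_mono) auto
    also have "\<dots> = emeasure (density \<mu> (\<lambda>\<omega>. indicator S (?r \<omega>))) (space \<mu>)" by simp
    also have "\<dots> = (\<integral>\<^sup>+\<omega>. indicator S (?r \<omega>) * indicator (space \<mu>) \<omega> \<partial>\<mu>)"
      by (rule emeasure_density) measurable
    also have "\<dots> \<le> (\<integral>\<^sup>+\<omega>. 1 \<partial>\<mu>)" by (intro nn_integral_mono) (auto simp: indicator_def)
    also have "\<dots> = 1" by (simp add: \<mu>.emeasure_space_1)
    finally show "emeasure M1 (space (P k) \<times> space choice_space) \<noteq> \<infinity>" by (auto simp: top_unique)
  qed
  then have "(\<integral>\<^sup>+w. F w \<partial>M1) = (\<integral>\<^sup>+w. F w \<partial>M2)" by simp
  moreover have "(\<integral>\<^sup>+w. F w \<partial>M1) = (\<integral>\<^sup>+\<omega>. indicator S (?r \<omega>) * F (?r \<omega>, \<pi> (\<omega> k)) \<partial>\<mu>)"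
  proof -
    have "(\<integral>\<^sup>+w. F w \<partial>M1) = (\<integral>\<^sup>+\<omega>. F (?r \<omega>, \<pi> (\<omega> k)) \<partial>density \<mu> (\<lambda>\<omega>. indicator S (?r \<omega>)))"
      unfolding M1_def using map F by (subst nn_integral_distr) (auto simp: measurable_cong_sets[OF sets_density refl])
    also have "\<dots> = (\<integral>\<^sup>+\<omega>. indicator S (?r \<omega>) * F (?r \<omega>, \<pi> (\<omega> k)) \<partial>\<mu>)"
      by (rule nn_integral_density) measurable
    finally show ?thesis .
  qed
  moreover have "(\<integral>\<^sup>+w. F w \<partial>M2) = (\<integral>\<^sup>+\<omega>. indicator S (?r \<omega>) * (\<Sum>e\<in>UNIV. ennreal (pmf (direction_pmf q) e) *
       (\<integral>\<^sup>+x. F (?r \<omega>, (x, e)) * indicator (W (?r \<omega>)) x \<partial>lborel) / emeasure lborel (W (?r \<omega>))) \<partial>\<mu>)"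
  proof -
    define H where "H h = (\<integral>\<^sup>+c. den (h, c) * F (h, c) \<partial>choice_base)" for h
    have FP: "F \<in> borel_measurable (Pd \<Otimes>\<^sub>M choice_base)" using F by (subst measurable_cong_sets[OF spP refl])
    have "(\<integral>\<^sup>+w. F w \<partial>M2) = (\<integral>\<^sup>+w. den w * F w \<partial>(Pd \<Otimes>\<^sub>M choice_base))"
      unfolding M2_def by (rule nn_integral_density[OF denm' FP])
    also have "\<dots> = (\<integral>\<^sup>+h. H h \<partial>Pd)"
      unfolding H_def by (rule cb.nn_integral_fst[symmetric]) (intro borel_measurable_times_ennreal denm' FP)
    also have "\<dots> = (\<integral>\<^sup>+\<omega>. H (?r \<omega>) \<partial>\<mu>)"
      unfolding Pd_def
    proof (rule nn_integral_distr[OF r], unfold measurable_distr_eq1)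
      show "H \<in> borel_measurable (P k)"
        unfolding H_def[abs_def] using denm FB by (intro cb.borel_measurable_nn_integral) (simp add: split_beta')
    qed
    also have "\<dots> = (\<integral>\<^sup>+\<omega>. indicator S (?r \<omega>) * (\<Sum>e\<in>UNIV. ennreal (pmf (direction_pmf q) e) *
       (\<integral>\<^sup>+x. F (?r \<omega>, (x, e)) * indicator (W (?r \<omega>)) x \<partial>lborel) / emeasure lborel (W (?r \<omega>))) \<partial>\<mu>)"
    proof (rule nn_integral_cong)
      fix \<omega> assume "\<omega> \<in> space \<mu>"
      then have h: "?r \<omega> \<in> space (P k)" by (rule measurable_space[OF r])
      have hm: "(\<lambda>c. (?r \<omega>, c)) \<in> measurable choice_base (P k \<Otimes>\<^sub>M choice_base)" using h by simp
      have Fh: "(\<lambda>c. F (?r \<omega>, c)) \<in> borel_measurable choice_base" by (rule measurable_compose[OF hm FB])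
      have dh: "(\<lambda>c. den (?r \<omega>, c)) \<in> borel_measurable choice_base" by (rule measurable_compose[OF hm denm])
      have Fe: "(\<lambda>x. F (?r \<omega>, (x, e))) \<in> borel_measurable lborel" for e using Fh by measurable
      have "H (?r \<omega>) = (\<Sum>e\<in>UNIV. \<integral>\<^sup>+x. den (?r \<omega>, (x, e)) * F (?r \<omega>, (x, e)) \<partial>lborel)"
        unfolding H_def by (intro nn_integral_choice_base borel_measurable_times_ennreal Fh dh)
      also have "\<dots> = (\<Sum>e\<in>UNIV. indicator S (?r \<omega>) * (ennreal (pmf (direction_pmf q) e) *
         (\<integral>\<^sup>+x. F (?r \<omega>, (x, e)) * indicator (W (?r \<omega>)) x \<partial>lborel) / emeasure lborel (W (?r \<omega>))))"
      proof (rule sum.cong[OF refl])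
        fix e :: 2
        have "(\<integral>\<^sup>+x. den (?r \<omega>, (x, e)) * F (?r \<omega>, (x, e)) \<partial>lborel)
          = (\<integral>\<^sup>+x. (indicator S (?r \<omega>) * ennreal (pmf (direction_pmf q) e) / emeasure lborel (W (?r \<omega>))) * (F (?r \<omega>, (x, e)) * indicator (W (?r \<omega>)) x) \<partial>lborel)"
          by (intro nn_integral_cong) (simp add: den_def choice_density_def divide_ennreal_def mult_ac)
        also have "\<dots> = (indicator S (?r \<omega>) * ennreal (pmf (direction_pmf q) e) / emeasure lborel (W (?r \<omega>))) * (\<integral>\<^sup>+x. F (?r \<omega>, (x, e)) * indicator (W (?r \<omega>)) x \<partial>lborel)"
          using Fe[of e] Wb[OF h] by (intro nn_integral_cmult borel_measurable_times_ennreal borel_measurable_indicator) auto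
        finally show "(\<integral>\<^sup>+x. den (?r \<omega>, (x, e)) * F (?r \<omega>, (x, e)) \<partial>lborel) = indicator S (?r \<omega>) * (ennreal (pmf (direction_pmf q) e) *
           (\<integral>\<^sup>+x. F (?r \<omega>, (x, e)) * indicator (W (?r \<omega>)) x \<partial>lborel) / emeasure lborel (W (?r \<omega>)))"
          by (simp add: divide_ennreal_def mult_ac)
      qed
      finally show "H (?r \<omega>) = indicator S (?r \<omega>) * (\<Sum>e\<in>UNIV. ennreal (pmf (direction_pmf q) e) *
         (\<integral>\<^sup>+x. F (?r \<omega>, (x, e)) * indicator (W (?r \<omega>)) x \<partial>lborel) / emeasure lborel (W (?r \<omega>)))"
        by (simp add: sum_distrib_left)
    qed
    finally show ?thesis .
  qed
  ultimately show ?thesis by simp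
qed

section \<open>Measurability\<close>

text \<open>Measurability in the coordinates, for which the rules about real-valued functions suffice.\<close>

definition measurable_rect :: "'w measure \<Rightarrow> ('w \<Rightarrow> rect) \<Rightarrow> bool" where
  "measurable_rect M f \<longleftrightarrow> (\<forall>i. (\<lambda>w. fst (f w) $ i) \<in> borel_measurable M \<and> (\<lambda>w. snd (f w) $ i) \<in> borel_measurable M)"

definition measurable_slab :: "'w measure \<Rightarrow> ('w \<Rightarrow> slab) \<Rightarrow> bool" where
  "measurable_slab M s \<longleftrightarrow> Measurable.pred M (\<lambda>w. fst (s w) = 1) \<and>
     (\<lambda>w. fst (snd (s w))) \<in> borel_measurable M \<and> (\<lambda>w. snd (snd (s w))) \<in> borel_measurable M"

lemma measurable_rectD:
  assumes "measurable_rect M f"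
  shows "(\<lambda>w. fst (f w) $ i) \<in> borel_measurable M" "(\<lambda>w. snd (f w) $ i) \<in> borel_measurable M"
  using assms by (auto simp: measurable_rect_def)

lemma measurable_mem_box_of:
  assumes f: "measurable_rect M f" and x: "\<And>i. (\<lambda>w. x w $ i) \<in> borel_measurable M"
  shows "Measurable.pred M (\<lambda>w. x w \<in> box_of (f w))"
proof -
  note [measurable] = measurable_rectD[OF f] x
  show ?thesis unfolding mem_box_cart forall_2 by measurable
qed

lemma nth_sel: "v $ e = (if e = 1 then v $ 1 else v $ 2)" for e :: 2
  using exhaust_2[of e] by auto

lemma measurable_nth_sel:
  assumes "Measurable.pred M (\<lambda>w. e w = (1::2))" "\<And>i. (\<lambda>w. v w $ i) \<in> borel_measurable M"
  shows "(\<lambda>w. v w $ e w) \<in> borel_measurable M"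
proof -
  note [measurable] = assms
  show ?thesis unfolding nth_sel[of _ "e _"] by measurable
qed

lemma pred_eq_index:
  assumes "Measurable.pred M (\<lambda>w. e w = (1::2))" shows "Measurable.pred M (\<lambda>w. i = e w)"
proof -
  note [measurable] = assms
  have "(\<lambda>w. i = e w) = (\<lambda>w. if i = 1 then e w = 1 else \<not> e w = 1)"
    using exhaust_2 by (intro ext) metis
  then show ?thesis by (cases "i = 1") simp_all
qed

lemma cut_nth:
  "fst (cut s x st) $ i = (if slab_hi s st \<le> slab_lo s st then fst st $ i else if x $ fst s < slab_lo s st then fst st $ i
     else if slab_hi s st < x $ fst s then (if i = fst s then slab_hi s st else fst st $ i) else 0)"
  "snd (cut s x st) $ i = (if slab_hi s st \<le> slab_lo s st then snd st $ i
     else if x $ fst s < slab_lo s st then (if i = fst s then slab_lo s st else snd st $ i)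
     else if slab_hi s st < x $ fst s then snd st $ i else 0)"
  by (simp_all add: cut_def lower_part_def upper_part_def upd_nth)

lemma measurable_rect_cut:
  assumes s: "measurable_slab M s" and f: "measurable_rect M f" and x: "\<And>i. (\<lambda>w. x w $ i) \<in> borel_measurable M"
  shows "measurable_rect M (\<lambda>w. cut (s w) (x w) (f w))"
proof -
  note fm = measurable_rectD[OF f]
  have e: "Measurable.pred M (\<lambda>w. fst (s w) = 1)" and ab: "(\<lambda>w. fst (snd (s w))) \<in> borel_measurable M" "(\<lambda>w. snd (snd (s w))) \<in> borel_measurable M"
    using s by (auto simp: measurable_slab_def)
  note [measurable] = fm x ab measurable_nth_sel[OF e fm(1)] measurable_nth_sel[OF e fm(2)] measurable_nth_sel[OF e x] pred_eq_index[OF e]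
  have [measurable]: "(\<lambda>w. slab_lo (s w) (f w)) \<in> borel_measurable M" "(\<lambda>w. slab_hi (s w) (f w)) \<in> borel_measurable M"
    unfolding slab_lo_def slab_hi_def by measurable
  show ?thesis unfolding measurable_rect_def cut_nth by measurable
qed

lemma measurable_slab_If:
  assumes [measurable]: "Measurable.pred M Q" and s: "measurable_slab M s" and s': "measurable_slab M s'"
  shows "measurable_slab M (\<lambda>w. if Q w then s w else s' w)"
proof -
  note [measurable] = s[unfolded measurable_slab_def, THEN conjunct1] s'[unfolded measurable_slab_def, THEN conjunct1]
    s[unfolded measurable_slab_def, THEN conjunct2, THEN conjunct1] s'[unfolded measurable_slab_def, THEN conjunct2, THEN conjunct1]
    s[unfolded measurable_slab_def, THEN conjunct2, THEN conjunct2] s'[unfolded measurable_slab_def, THEN conjunct2, THEN conjunct2]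
  have "Measurable.pred M (\<lambda>w. if Q w then fst (s w) = 1 else fst (s' w) = 1)" by measurable
  moreover have "(\<lambda>w. if Q w then fst (snd (s w)) else fst (snd (s' w))) \<in> borel_measurable M" by measurable
  moreover have "(\<lambda>w. if Q w then snd (snd (s w)) else snd (snd (s' w))) \<in> borel_measurable M" by measurable
  ultimately show ?thesis unfolding measurable_slab_def by (simp only: if_distrib[of fst] if_distrib[of snd] if_distrib[of "\<lambda>e. e = 1"])
qed

lemma measurable_slab_of_fixed:
  assumes f: "measurable_rect M f" and p: "\<And>i. (\<lambda>w. p w $ i) \<in> borel_measurable M"
  shows "measurable_slab M (\<lambda>w. slab_of \<delta> (f w) (p w) d)"
proof -
  note fm = measurable_rectD[OF f]
  define c where "c = (SOME \<sigma>::real. False)"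
  define n where "n w = snd (f w) $ perp d - fst (f w) $ perp d" for w
  define m where "m w = \<delta> * (snd (f w) $ d - fst (f w) $ d)" for w
  define q where "q w = p w $ perp d" for w
  define a where "a w = fst (f w) $ perp d" for w
  define b where "b w = snd (f w) $ perp d" for w
  have am [measurable]: "a \<in> borel_measurable M" and bm [measurable]: "b \<in> borel_measurable M" and qm [measurable]: "q \<in> borel_measurable M"
    unfolding a_def[abs_def] b_def[abs_def] q_def[abs_def] by (rule fm p)+
  have nm [measurable]: "n \<in> borel_measurable M" and mm [measurable]: "m \<in> borel_measurable M"
    unfolding n_def[abs_def] m_def[abs_def] by (intro borel_measurable_diff borel_measurable_times borel_measurable_const fm)+
  define l where "l w = max 0 ((q w + m w - b w) / m w)" for w
  define u where "u w = min 1 ((q w - a w) / m w)" for w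
  have lm [measurable]: "l \<in> borel_measurable M" and um [measurable]: "u \<in> borel_measurable M"
    unfolding l_def[abs_def] u_def[abs_def] by measurable
  define s where "s w = (if l w \<le> u w then max (l w) (min (u w) (1/2)) else c)" for w
  have sm [measurable]: "s \<in> borel_measurable M" unfolding s_def[abs_def] by measurable
  have eq: "slab_of \<delta> (f w) (p w) d = (if n w \<le> m w then (perp d, a w, b w) else (perp d, q w - s w * m w, q w + (1 - s w) * m w))" for w
    unfolding slab_of_def shift_def shift_lo_def shift_hi_def c_def n_def m_def q_def a_def b_def l_def u_def s_def ..
  show ?thesis unfolding eq
  proof (rule measurable_slab_If)
    show "Measurable.pred M (\<lambda>w. n w \<le> m w)" by measurable
    show "measurable_slab M (\<lambda>w. (perp d, a w, b w))"
      unfolding measurable_slab_def fst_conv snd_conv using am bm by simp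
    have "(\<lambda>w. q w - s w * m w) \<in> borel_measurable M" "(\<lambda>w. q w + (1 - s w) * m w) \<in> borel_measurable M" by measurable
    then show "measurable_slab M (\<lambda>w. (perp d, q w - s w * m w, q w + (1 - s w) * m w))"
      unfolding measurable_slab_def fst_conv snd_conv by simp
  qed
qed

lemma measurable_slab_of:
  assumes f: "measurable_rect M f" and p: "\<And>i. (\<lambda>w. p w $ i) \<in> borel_measurable M" and d: "Measurable.pred M (\<lambda>w. d w = 1)"
  shows "measurable_slab M (\<lambda>w. slab_of \<delta> (f w) (p w) (d w))"
proof -
  have "(\<lambda>w. slab_of \<delta> (f w) (p w) (d w)) = (\<lambda>w. if d w = 1 then slab_of \<delta> (f w) (p w) 1 else slab_of \<delta> (f w) (p w) 2)"
    using exhaust_2 by (intro ext) (metis (full_types))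
  then show ?thesis by (simp only:) (intro measurable_slab_If d measurable_slab_of_fixed f p)
qed

lemma measurable_rect_cell_at:
  assumes s: "\<And>j f. j < k \<Longrightarrow> measurable_rect M f \<Longrightarrow> measurable_slab M (\<lambda>w. sl w j (f w))"
    and x: "\<And>i. (\<lambda>w. x w $ i) \<in> borel_measurable M"
  shows "measurable_rect M (\<lambda>w. cell_at (sl w) k (x w))"
  using s
proof (induction k)
  case 0
  note [measurable] = x
  have [measurable]: "Measurable.pred M (\<lambda>w. x w \<in> unit_square)"
    unfolding unit_square_def mem_Collect_eq forall_2 by measurable
  have "measurable_rect M (\<lambda>w. if x w \<in> unit_square then (0, 1) else (0, 0))"
    unfolding measurable_rect_def if_distrib[of fst] if_distrib[of snd] if_distrib[of "\<lambda>v. v $ _"] fst_conv snd_conv by measurable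
  then show ?case by simp
next
  case (Suc k)
  have "measurable_rect M (\<lambda>w. cell_at (sl w) k (x w))" by (rule Suc.IH) (use Suc.prems in auto)
  then show ?case unfolding cell_at.simps by (intro measurable_rect_cut Suc.prems x) auto
qed

lemma measurable_label:
  assumes f: "measurable_rect M f"
  shows "(\<lambda>w. label (box_of (f w))) \<in> measurable M (count_space UNIV)"
  unfolding label_def by (intro measurable_Least measurable_mem_box_of[OF f]) simp

lemma measurable_slab_A:
  assumes f: "measurable_rect M f"
    and c: "\<And>n. (\<lambda>w. \<omega> w j n) \<in> measurable M choice_space"
  shows "measurable_slab M (\<lambda>w. slab_A \<delta> (\<omega> w) j (f w))"
  unfolding slab_A_def
proof (rule measurable_slab_of[OF f])
  note [measurable] = c
  show "(\<lambda>w. fst (\<omega> w j (label (box_of (f w)))) $ i) \<in> borel_measurable M" for i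
    by (rule measurable_compose_countable[OF _ measurable_label[OF f]]) measurable
  show "Measurable.pred M (\<lambda>w. snd (\<omega> w j (label (box_of (f w)))) = 1)"
    by (rule measurable_compose_countable[OF _ measurable_label[OF f]]) measurable
qed

lemma measurable_slab_B:
  assumes f: "measurable_rect M f"
    and c: "(\<lambda>w. \<omega> w j) \<in> measurable M choice_space"
  shows "measurable_slab M (\<lambda>w. slab_B \<delta> (\<omega> w) j (f w))"
  unfolding slab_B_def
proof (intro measurable_slab_If measurable_slab_of[OF f] measurable_mem_box_of[OF f])
  note [measurable] = c
  show "(\<lambda>w. fst (\<omega> w j) $ i) \<in> borel_measurable M" for i by measurable
  then show "(\<lambda>w. fst (\<omega> w j) $ i) \<in> borel_measurable M" for i .
  show "Measurable.pred M (\<lambda>w. snd (\<omega> w j) = 1)" by measurable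
  show "measurable_slab M (\<lambda>w. (1, 0, 0))" by (simp add: measurable_slab_def)
qed

lemma cell_at_cong: "(\<And>j. j < k \<Longrightarrow> sl j = sl' j) \<Longrightarrow> cell_at sl k x = cell_at sl' k x"
proof (induction k)
  case (Suc k)
  have "cell_at sl k x = cell_at sl' k x" by (rule Suc.IH) (use Suc.prems in auto)
  then show ?case using Suc.prems[of k] by simp
qed simp

lemma measurable_weight:
  assumes f: "measurable_rect M f" shows "(\<lambda>w. weight t (f w)) \<in> borel_measurable M"
proof -
  note [measurable] = measurable_rectD[OF f]
  show ?thesis unfolding weight_def by measurable
qed

lemma measurable_indicator_box_of:
  assumes f: "measurable_rect M f" and x: "\<And>i. (\<lambda>w. x w $ i) \<in> borel_measurable M"
  shows "(\<lambda>w. indicator (box_of (f w)) (x w) :: ennreal) \<in> borel_measurable M"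
proof -
  note [measurable] = measurable_mem_box_of[OF f x]
  show ?thesis unfolding indicator_def by measurable
qed

lemma measure_box_of: "measure lebesgue (box_of st) =
  max 0 (snd st $ 1 - fst st $ 1) * max 0 (snd st $ 2 - fst st $ 2)"
proof (cases "box_of st = {}")
  case True
  then have "snd st $ 1 \<le> fst st $ 1 \<or> snd st $ 2 \<le> fst st $ 2"
    using interval_ne_empty_cart(2)[of "fst st" "snd st"] by (auto simp: forall_2 not_less)
  then show ?thesis using True by auto
next
  case False
  note l = less_imp_le[OF box_of_less[OF False]]
  show ?thesis using measure_box_perp(2)[OF l, of 1] l[of 1] l[of 2] by (simp add: perp_def)
qed

lemma measure_box_of_pos: "box_of st \<noteq> {} \<Longrightarrow> measure lebesgue (box_of st) > 0"
proof -
  assume ne: "box_of st \<noteq> {}"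
  show ?thesis
    unfolding measure_box_perp(2)[OF less_imp_le[OF box_of_less[OF ne]], of 1]
    by (intro mult_pos_pos) (simp_all add: box_of_less[OF ne])
qed

lemma measurable_measure_box_of:
  assumes f: "measurable_rect M f" shows "(\<lambda>w. measure lebesgue (box_of (f w))) \<in> borel_measurable M"
proof -
  note [measurable] = measurable_rectD[OF f]
  show ?thesis unfolding measure_box_of by measurable
qed

lemma phi_empty: "phi t {} = 0" by (simp add: phi_def)

lemma phi_box_of: "phi t (box_of st) = measure lebesgue (box_of st) * weight t st"
  by (cases "box_of st = {}") (auto simp: phi_weight phi_empty)

lemma measurable_phi:
  assumes f: "measurable_rect M f" shows "(\<lambda>w. phi t (box_of (f w))) \<in> borel_measurable M"
  unfolding phi_box_of by (intro borel_measurable_times measurable_measure_box_of measurable_weight f)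

section \<open>The potential in one step\<close>

text \<open>The quantity that contracts in expectation.\<close>

definition potential :: "real \<Rightarrow> (nat \<Rightarrow> rect \<Rightarrow> slab) \<Rightarrow> nat \<Rightarrow> ennreal" where
  "potential t sl k = (\<Sum>i. ennreal (phi t (box_of (cell sl k i))))"

lemma measurable_rect_const: "measurable_rect M (\<lambda>_. st)" by (simp add: measurable_rect_def)

lemma measurable_slab_const: "measurable_slab M (\<lambda>_. s)" by (simp add: measurable_slab_def)

text \<open>Sorts the points of the next step by the component of the current step in which they lie.\<close>

lemma integral_cell_at_cells:
  assumes g: "\<And>st s. (\<lambda>x. g (cut s x st)) \<in> borel_measurable borel"
  shows "(\<integral>\<^sup>+x. g (cell_at sl (Suc k) x) * indicator (box_of (cell_at sl (Suc k) x)) x \<partial>lborel) =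
    (\<Sum>i. \<integral>\<^sup>+x. g (cut (sl k (cell sl k i)) x (cell sl k i)) * indicator (box_of (cut (sl k (cell sl k i)) x (cell sl k i))) x
        * indicator (box_of (cell sl k i)) x \<partial>lborel)"
    (is "?L = (\<Sum>i. \<integral>\<^sup>+x. ?h i x \<partial>lborel)")
proof -
  have "g (cell_at sl (Suc k) x) * indicator (box_of (cell_at sl (Suc k) x)) x = (\<Sum>i. ?h i x)" for x
  proof -
    have "g (cell_at sl (Suc k) x) * indicator (box_of (cell_at sl (Suc k) x)) x
        = g (cell_at sl (Suc k) x) * indicator (box_of (cell_at sl (Suc k) x)) x * indicator (alive sl k) x"
    proof (cases "x \<in> alive sl k")
      case False
      then have "x \<notin> box_of (cell_at sl (Suc k) x)" using cell_at_antimono[of sl k x] unfolding alive_def by blast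
      then show ?thesis by simp
    qed simp
    also have "\<dots> = (\<Sum>i. g (cell_at sl (Suc k) x) * indicator (box_of (cell_at sl (Suc k) x)) x * indicator (box_of (cell sl k i)) x)"
      unfolding alive_cells by (rule ennreal_suminf_cmult[symmetric])
    also have "\<dots> = (\<Sum>i. ?h i x)"
    proof (rule suminf_cong)
      fix i
      show "g (cell_at sl (Suc k) x) * indicator (box_of (cell_at sl (Suc k) x)) x * indicator (box_of (cell sl k i)) x = ?h i x"
      proof (cases "x \<in> box_of (cell sl k i)")
        case True
        show ?thesis unfolding cell_at.simps cell_at_eq_cell[OF True] ..
      qed simp
    qed
    finally show ?thesis .
  qed
  then have "?L = (\<integral>\<^sup>+x. (\<Sum>i. ?h i x) \<partial>lborel)" by (intro nn_integral_cong)
  also have "\<dots> = (\<Sum>i. \<integral>\<^sup>+x. ?h i x \<partial>lborel)"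
  proof (rule nn_integral_suminf)
    fix i
    have "measurable_rect borel (\<lambda>x. cut (sl k (cell sl k i)) x (cell sl k i))"
      by (intro measurable_rect_cut measurable_slab_const measurable_rect_const) measurable
    from measurable_indicator_box_of[OF this measurable_vec_nth]
    show "?h i \<in> borel_measurable lborel" using g
      by (subst measurable_cong_sets[OF sets_lborel refl]) (intro borel_measurable_times_ennreal borel_measurable_indicator, auto)
  qed
  finally show ?thesis .
qed

lemma integral_cells:
  "(\<integral>\<^sup>+x. g (cell_at sl k x) * indicator (alive sl k) x \<partial>lborel) = (\<Sum>i. g (cell sl k i) * emeasure lborel (box_of (cell sl k i)))"
proof -
  have "g (cell_at sl k x) * indicator (alive sl k) x = (\<Sum>i. g (cell sl k i) * indicator (box_of (cell sl k i)) x)" for x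
  proof -
    have "g (cell_at sl k x) * indicator (alive sl k) x = (\<Sum>i. g (cell_at sl k x) * indicator (box_of (cell sl k i)) x)"
      unfolding alive_cells by (rule ennreal_suminf_cmult[symmetric])
    also have "\<dots> = (\<Sum>i. g (cell sl k i) * indicator (box_of (cell sl k i)) x)"
    proof (rule suminf_cong)
      fix i
      show "g (cell_at sl k x) * indicator (box_of (cell sl k i)) x = g (cell sl k i) * indicator (box_of (cell sl k i)) x"
        using cell_at_eq_cell[of x sl k i] by (cases "x \<in> box_of (cell sl k i)") auto
    qed
    finally show ?thesis .
  qed
  then have "(\<integral>\<^sup>+x. g (cell_at sl k x) * indicator (alive sl k) x \<partial>lborel) = (\<integral>\<^sup>+x. (\<Sum>i. g (cell sl k i) * indicator (box_of (cell sl k i)) x) \<partial>lborel)"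
    by (intro nn_integral_cong)
  also have "\<dots> = (\<Sum>i. \<integral>\<^sup>+x. g (cell sl k i) * indicator (box_of (cell sl k i)) x \<partial>lborel)"
    by (rule nn_integral_suminf) measurable
  finally show ?thesis by (simp add: nn_integral_cmult)
qed

lemma indicator_alive: "indicator (alive sl k) x = indicator (box_of (cell_at sl k x)) x"
  by (simp add: indicator_def alive_def)

lemma potential_integral: "potential t sl k = (\<integral>\<^sup>+x. ennreal (weight t (cell_at sl k x)) * indicator (box_of (cell_at sl k x)) x \<partial>lborel)"
proof -
  have w: "weight t st \<ge> 0" for st by (simp add: weight_def)
  show ?thesis
    unfolding indicator_alive[symmetric] integral_cells[of "\<lambda>st. ennreal (weight t st)"] potential_def phi_box_of
    by (simp add: emeasure_box_of ennreal_mult[symmetric] w mult.commute)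
qed

lemma potential_Suc:
  "potential t sl (Suc k) = (\<Sum>i. \<integral>\<^sup>+x. ennreal (weight t (cut (sl k (cell sl k i)) x (cell sl k i)))
     * indicator (box_of (cut (sl k (cell sl k i)) x (cell sl k i))) x * indicator (box_of (cell sl k i)) x \<partial>lborel)"
  unfolding potential_integral
proof (rule integral_cell_at_cells)
  show "(\<lambda>x. ennreal (weight t (cut s x st))) \<in> borel_measurable borel" for st s
    by (intro measurable_compose[OF _ measurable_ennreal] measurable_weight measurable_rect_cut measurable_slab_const measurable_rect_const) measurable
qed

text \<open>The sides are at most one, so their negative powers are at least one.\<close>

lemma measure_cell_le_phi:
  assumes "t > 0" shows "emeasure lborel (box_of (cell sl k i)) \<le> ennreal (phi t (box_of (cell sl k i)))"
proof (cases "box_of (cell sl k i) = {}")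
  case False
  let ?st = "cell sl k i"
  obtain x where x: "x \<in> box_of ?st" using False by blast
  have sub: "box_of ?st \<subseteq> box 0 1" using cell_at_subset[of sl k x] cell_at_eq_cell[OF x] by (simp add: unit_square_box)
  have ab: "fst ?st $ j < snd ?st $ j" "0 \<le> fst ?st $ j" "snd ?st $ j \<le> 1" for j
  proof -
    show l: "fst ?st $ j < snd ?st $ j" for j by (rule box_of_less[OF False])
    have ne: "box 0 (1 :: real^2) \<noteq> {}" by (simp add: interval_ne_empty_cart)
    have "cbox (fst ?st) (snd ?st) \<subseteq> cbox 0 1"
      using closure_mono[OF sub] unfolding closure_box[OF False] closure_box[OF ne] .
    moreover have "fst ?st \<in> cbox (fst ?st) (snd ?st)" "snd ?st \<in> cbox (fst ?st) (snd ?st)"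
      using less_imp_le[OF l] by (auto simp: mem_box_cart)
    ultimately have "fst ?st \<in> cbox 0 1" "snd ?st \<in> cbox 0 1" by blast+
    then show "0 \<le> fst ?st $ j" "snd ?st $ j \<le> 1" by (auto simp: mem_box_cart)
  qed
  have "1 \<le> (snd ?st $ j - fst ?st $ j) powr - t" for j
  proof -
    define d where "d = snd ?st $ j - fst ?st $ j"
    have "0 < d" "d \<le> 1" using ab(1)[of j] ab(2)[of j] ab(3)[of j] unfolding d_def by linarith+
    then have "1 powr - t \<le> d powr - t" using assms by (intro powr_mono2') auto
    then show ?thesis unfolding d_def by simp
  qed
  from add_mono[OF this[of 1] this[of 2]] have "1 \<le> weight t ?st" by (simp add: weight_def)
  then have "measure lebesgue (box_of ?st) * 1 \<le> phi t (box_of ?st)" unfolding phi_box_of by (intro mult_left_mono) auto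
  then show ?thesis unfolding emeasure_box_of by (intro ennreal_leI) simp
qed simp

lemma open_alive: "open (alive sl k)"
proof (subst open_subopen, intro ballI)
  fix x assume "x \<in> alive sl k"
  then show "\<exists>T. open T \<and> x \<in> T \<and> T \<subseteq> alive sl k"
    using box_of_cell_at_subset_alive[of sl k x] by (intro exI[of _ "box_of (cell_at sl k x)"]) (auto simp: alive_def)
qed

lemma emeasure_alive_cells: "emeasure lborel (alive sl k) = (\<Sum>i. emeasure lborel (box_of (cell sl k i)))"
proof -
  have "emeasure lborel (alive sl k) = (\<integral>\<^sup>+x. 1 * indicator (alive sl k) x \<partial>lborel)"
    using open_alive by (simp add: borel_open)
  then show ?thesis unfolding integral_cells[of "\<lambda>_. 1"] by simp
qed

lemma emeasure_alive_le_potential: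
  assumes "t > 0" shows "emeasure lborel (alive sl k) \<le> potential t sl k"
  unfolding emeasure_alive_cells potential_def
  by (intro suminf_le measure_cell_le_phi assms) (auto intro: summableI)

text \<open>The factor by which the potential of a component changes at most under the choice \<open>c\<close>.\<close>

definition shrink :: "real \<Rightarrow> real \<Rightarrow> rect \<Rightarrow> (real^2) \<times> 2 \<Rightarrow> ennreal" where
  "shrink t \<delta> st c = (if fst c \<in> box_of st \<and> snd c = long st then ennreal (2 powr t * (1 - \<delta>) powr (1 - t)) else ennreal (2 powr t))"

lemma slab_of_step:
  assumes \<delta>: "0 < \<delta>" "\<delta> < 1" and t: "0 < t" "t < 1"
  shows "(\<integral>\<^sup>+x. ennreal (weight t (cut (slab_of \<delta> st (fst c) (snd c)) x st)) * indicator (box_of (cut (slab_of \<delta> st (fst c) (snd c)) x st)) x * indicator (box_of st) x \<partial>lborel)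
    \<le> shrink t \<delta> st c * ennreal (phi t (box_of st))"
proof (cases "box_of st = {}")
  case False
  let ?s = "slab_of \<delta> st (fst c) (snd c)"
  show ?thesis
  proof (cases "fst c \<in> box_of st \<and> snd c = long st")
    case True
    then have "snd st $ perp (snd c) - fst st $ perp (snd c) \<le> snd st $ snd c - fst st $ snd c" using long_side by simp
    from slab_of_thick[OF False \<delta> _ this, of "fst c"] True
    have "\<delta> * (snd st $ fst ?s - fst st $ fst ?s) \<le> max 0 (slab_hi ?s st - slab_lo ?s st)" by auto
    from cut_weight[OF False t _ _ this] \<delta> True show ?thesis by (simp add: shrink_def)
  next
    case F: False
    have "shrink t \<delta> st c = ennreal (2 powr t)" unfolding shrink_def by (rule if_not_P[OF F])
    then show ?thesis using cut_weight[OF False t, of 0 ?s] by simp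
  qed
qed simp

lemma cut_skip: "cut (1, 0, 0) x st = st"
proof -
  have "slab_hi (1, 0, 0) st \<le> 0" "0 \<le> slab_lo (1, 0, 0) st" by (simp_all add: slab_lo_def slab_hi_def)
  then show ?thesis by (simp add: cut_def)
qed

lemma weight_nonneg: "0 \<le> weight t st" by (simp add: weight_def)

lemma alive_cut_skip:
  "(\<integral>\<^sup>+x. ennreal (weight t (cut (1, 0, 0) x st)) * indicator (box_of (cut (1, 0, 0) x st)) x * indicator (box_of st) x \<partial>lborel) = ennreal (phi t (box_of st))"
proof -
  note c = cut_skip
  have "(\<integral>\<^sup>+x. ennreal (weight t st) * indicator (box_of st) x * indicator (box_of st) x \<partial>lborel) = (\<integral>\<^sup>+x. ennreal (weight t st) * indicator (box_of st) x \<partial>lborel)"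
    by (intro nn_integral_cong) (simp add: indicator_def)
  also have "\<dots> = ennreal (phi t (box_of st))"
    by (simp add: nn_integral_cmult emeasure_box_of phi_box_of ennreal_mult[symmetric] weight_nonneg mult.commute)
  finally show ?thesis unfolding c .
qed

lemma potential_step_A:
  assumes \<delta>: "0 < \<delta>" "\<delta> < 1" and t: "0 < t" "t < 1"
  shows "potential t (slab_A \<delta> \<omega>) (Suc k) \<le>
    (\<Sum>i. shrink t \<delta> (cell (slab_A \<delta> \<omega>) k i) (\<omega> k i) * ennreal (phi t (box_of (cell (slab_A \<delta> \<omega>) k i))))"
  unfolding potential_Suc
proof (rule suminf_le)
  fix i
  let ?st = "cell (slab_A \<delta> \<omega>) k i"
  show "(\<integral>\<^sup>+x. ennreal (weight t (cut (slab_A \<delta> \<omega> k ?st) x ?st)) * indicator (box_of (cut (slab_A \<delta> \<omega> k ?st) x ?st)) x * indicator (box_of ?st) x \<partial>lborel)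
     \<le> shrink t \<delta> ?st (\<omega> k i) * ennreal (phi t (box_of ?st))"
  proof (cases "box_of ?st = {}")
    case False
    then obtain x where x: "x \<in> box_of ?st" by blast
    have "label (box_of (cell_at (slab_A \<delta> \<omega>) k x)) = i" using x mem_cell[of x "slab_A \<delta> \<omega>" k i] by blast
    then have lab: "label (box_of ?st) = i" unfolding cell_at_eq_cell[OF x] .
    have e: "slab_A \<delta> \<omega> k ?st = slab_of \<delta> ?st (fst (\<omega> k i)) (snd (\<omega> k i))"
      unfolding slab_A_def[of \<delta> \<omega> k ?st] lab ..
    show ?thesis unfolding e by (rule slab_of_step[OF \<delta> t])
  qed simp
qed (auto intro: summableI)

text \<open>The value of \<open>phi\<close> on the component that contains the chosen point.\<close>

definition hit :: "real \<Rightarrow> real \<Rightarrow> (nat \<Rightarrow> (real^2) \<times> 2) \<Rightarrow> nat \<Rightarrow> ennreal" where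
  "hit t \<delta> \<omega> k = ennreal (phi t (box_of (cell_at (slab_B \<delta> \<omega>) k (fst (\<omega> k)))))"

lemma suminf_single: "(\<Sum>i. if i = j then c else 0 :: ennreal) = c"
  by (subst suminf_finite[of "{j}"]) auto

lemma hit_cells:
  fixes \<omega> k \<delta>
  defines "sl \<equiv> slab_B \<delta> \<omega>" and "p \<equiv> fst (\<omega> k)"
  assumes "p \<in> alive sl k"
  shows "cell sl k (label (box_of (cell_at sl k p))) = cell_at sl k p"
    "i \<noteq> label (box_of (cell_at sl k p)) \<Longrightarrow> sl k (cell sl k i) = (1, 0, 0)"
proof -
  have p: "p \<in> box_of (cell sl k (label (box_of (cell_at sl k p))))" using assms(3) by (simp add: mem_cell)
  show "cell sl k (label (box_of (cell_at sl k p))) = cell_at sl k p" using cell_at_eq_cell[OF p] by simp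
  show "sl k (cell sl k i) = (1, 0, 0)" if "i \<noteq> label (box_of (cell_at sl k p))"
  proof -
    have "p \<notin> box_of (cell sl k i)" using that mem_cell[of p sl k i] by blast
    then show ?thesis by (simp add: sl_def slab_B_def p_def)
  qed
qed

lemma no_hit:
  assumes "fst (\<omega> k) \<notin> alive (slab_B \<delta> \<omega>) k"
  shows "slab_B \<delta> \<omega> k (cell (slab_B \<delta> \<omega>) k i) = (1, 0, 0)" "hit t \<delta> \<omega> k = 0"
proof -
  have "fst (\<omega> k) \<notin> box_of (cell (slab_B \<delta> \<omega>) k i)" using assms mem_cell by blast
  then show "slab_B \<delta> \<omega> k (cell (slab_B \<delta> \<omega>) k i) = (1, 0, 0)" by (simp add: slab_B_def)
  have "box_of (cell_at (slab_B \<delta> \<omega>) k (fst (\<omega> k))) = {}" using assms cell_at_alive unfolding alive_def by blast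
  then show "hit t \<delta> \<omega> k = 0" by (simp add: hit_def phi_empty)
qed

text \<open>Stated with additions on both sides because subtraction of extended non-negative numbers is truncated: the
  component that is hit is replaced by its remainder, and no other component changes.\<close>

lemma potential_step_B:
  assumes \<delta>: "0 < \<delta>" "\<delta> < 1" and t: "0 < t" "t < 1"
  shows "potential t (slab_B \<delta> \<omega>) (Suc k) + hit t \<delta> \<omega> k
    \<le> potential t (slab_B \<delta> \<omega>) k + shrink t \<delta> (cell_at (slab_B \<delta> \<omega>) k (fst (\<omega> k))) (\<omega> k) * hit t \<delta> \<omega> k"
proof (cases "fst (\<omega> k) \<in> alive (slab_B \<delta> \<omega>) k")
  case True
  let ?sl = "slab_B \<delta> \<omega>"
  define st where "st = cell_at ?sl k (fst (\<omega> k))"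
  define j where "j = label (box_of st)"
  have cj: "cell ?sl k j = st" and ci: "i \<noteq> j \<Longrightarrow> ?sl k (cell ?sl k i) = (1, 0, 0)" for i
    using hit_cells[OF True] by (simp_all add: st_def j_def)
  define T where "T i = (\<integral>\<^sup>+x. ennreal (weight t (cut (?sl k (cell ?sl k i)) x (cell ?sl k i)))
     * indicator (box_of (cut (?sl k (cell ?sl k i)) x (cell ?sl k i))) x * indicator (box_of (cell ?sl k i)) x \<partial>lborel)" for i
  have Tj: "T j \<le> shrink t \<delta> st (\<omega> k) * ennreal (phi t (box_of st))"
  proof -
    have "?sl k st = slab_of \<delta> st (fst (\<omega> k)) (snd (\<omega> k))"
      by (rule slab_B_hit) (use True in \<open>simp add: st_def alive_def\<close>)
    then show ?thesis using slab_of_step[OF \<delta> t, of st "\<omega> k"] unfolding T_def cj by simp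
  qed
  have Ti: "T i = ennreal (phi t (box_of (cell ?sl k i)))" if "i \<noteq> j" for i
    unfolding T_def ci[OF that] by (rule alive_cut_skip)
  have h: "hit t \<delta> \<omega> k = ennreal (phi t (box_of st))" by (simp add: hit_def st_def)
  have "potential t ?sl (Suc k) + hit t \<delta> \<omega> k = (\<Sum>i. T i) + (\<Sum>i. if i = j then ennreal (phi t (box_of st)) else 0)"
    unfolding potential_Suc T_def suminf_single h ..
  also have "\<dots> = (\<Sum>i. T i + (if i = j then ennreal (phi t (box_of st)) else 0))" by (intro suminf_add summableI)
  also have "\<dots> \<le> (\<Sum>i. ennreal (phi t (box_of (cell ?sl k i))) + (if i = j then shrink t \<delta> st (\<omega> k) * ennreal (phi t (box_of st)) else 0))"
  proof (rule suminf_le)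
    fix i
    show "T i + (if i = j then ennreal (phi t (box_of st)) else 0) \<le> ennreal (phi t (box_of (cell ?sl k i))) + (if i = j then shrink t \<delta> st (\<omega> k) * ennreal (phi t (box_of st)) else 0)"
    proof (cases "i = j")
      case True
      then show ?thesis using Tj cj by (simp add: add.commute add_mono)
    next
      case False
      then show ?thesis using Ti by simp
    qed
  qed (auto intro: summableI)
  also have "\<dots> = potential t ?sl k + (\<Sum>i. if i = j then shrink t \<delta> st (\<omega> k) * ennreal (phi t (box_of st)) else 0)"
    unfolding potential_def by (intro suminf_add[symmetric] summableI)
  also have "(\<Sum>i. if i = j then shrink t \<delta> st (\<omega> k) * ennreal (phi t (box_of st)) else 0) = shrink t \<delta> st (\<omega> k) * ennreal (phi t (box_of st))"
    by (rule suminf_single)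
  finally show ?thesis unfolding h st_def .
next
  case False
  have "potential t (slab_B \<delta> \<omega>) (Suc k) = (\<Sum>i. ennreal (phi t (box_of (cell (slab_B \<delta> \<omega>) k i))))"
    unfolding potential_Suc no_hit(1)[OF False] alive_cut_skip ..
  also have "\<dots> = potential t (slab_B \<delta> \<omega>) k" unfolding potential_def ..
  finally have "potential t (slab_B \<delta> \<omega>) (Suc k) = potential t (slab_B \<delta> \<omega>) k" .
  then show ?thesis using no_hit(2)[OF False] by simp
qed

lemma hit_le_potential: "hit t \<delta> \<omega> k \<le> potential t (slab_B \<delta> \<omega>) k"
proof (cases "fst (\<omega> k) \<in> alive (slab_B \<delta> \<omega>) k")
  case True
  have "ennreal (phi t (box_of (cell (slab_B \<delta> \<omega>) k (label (box_of (cell_at (slab_B \<delta> \<omega>) k (fst (\<omega> k)))))))) \<le> potential t (slab_B \<delta> \<omega>) k"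
    unfolding potential_def by (rule ennreal_suminf_ge)
  then show ?thesis unfolding hit_def hit_cells(1)[OF True] .
next
  case False
  then show ?thesis using no_hit(2)[OF False] by simp
qed

lemma block_sum_A:
  assumes t: "0 < t" "t < 1"
  shows "(\<Sum>i. ennreal (phi t (cell_block sl k i))) \<le> potential t sl k"
  unfolding potential_def
proof (rule suminf_le)
  fix i
  show "ennreal (phi t (cell_block sl k i)) \<le> ennreal (phi t (box_of (cell sl k i)))"
  proof (cases "box_of (cell sl k i) = {}")
    case True
    then have "cell_block sl k i = {}" by (auto simp: cell_block_def slab_part_def)
    then show ?thesis by (simp add: phi_empty)
  next
    case False
    then show ?thesis unfolding cell_block_def by (intro ennreal_leI phi_slab_part t)
  qed
qed (auto intro: summableI)

lemma block_sum_B: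
  assumes t: "0 < t" "t < 1"
  shows "(\<Sum>i. ennreal (phi t (cell_block (slab_B \<delta> \<omega>) k i))) \<le> hit t \<delta> \<omega> k"
proof (cases "fst (\<omega> k) \<in> alive (slab_B \<delta> \<omega>) k")
  case True
  let ?sl = "slab_B \<delta> \<omega>"
  define st where "st = cell_at ?sl k (fst (\<omega> k))"
  define j where "j = label (box_of st)"
  have cj: "cell ?sl k j = st" and ci: "i \<noteq> j \<Longrightarrow> ?sl k (cell ?sl k i) = (1, 0, 0)" for i
    using hit_cells[OF True] by (simp_all add: st_def j_def)
  have ne: "box_of st \<noteq> {}" using True by (auto simp: alive_def st_def)
  have "ennreal (phi t (cell_block ?sl k i)) \<le> (if i = j then hit t \<delta> \<omega> k else 0)" for i
  proof (cases "i = j")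
    case True
    then show ?thesis unfolding cell_block_def hit_def using cj ne by (simp add: st_def phi_slab_part t ennreal_leI)
  next
    case False
    have "cell_block ?sl k i = {}" unfolding cell_block_def ci[OF False] by (auto simp: slab_part_def)
    then show ?thesis by (simp add: phi_empty)
  qed
  then have "(\<Sum>i. ennreal (phi t (cell_block ?sl k i))) \<le> (\<Sum>i. if i = j then hit t \<delta> \<omega> k else 0)"
    by (intro suminf_le) (auto intro: summableI)
  then show ?thesis unfolding suminf_single .
next
  case False
  have "cell_block (slab_B \<delta> \<omega>) k i = {}" for i unfolding cell_block_def no_hit(1)[OF False] by (auto simp: slab_part_def)
  then show ?thesis by (simp add: phi_empty)
qed

text \<open>The number of components, as an integral.\<close>

definition cells_count :: "(nat \<Rightarrow> rect \<Rightarrow> slab) \<Rightarrow> nat \<Rightarrow> ennreal" where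
  "cells_count sl k = (\<integral>\<^sup>+x. 1 / emeasure lborel (box_of (cell_at sl k x)) * indicator (alive sl k) x \<partial>lborel)"

text \<open>Each step of Model B replaces one component by at most two.\<close>

lemma cells_count_B: "cells_count (slab_B \<delta> \<omega>) k \<le> of_nat (Suc k)"
proof (induction k)
  case 0
  have "cells_count (slab_B \<delta> \<omega>) 0 = (\<integral>\<^sup>+x. indicator unit_square x \<partial>lborel)"
    unfolding cells_count_def
  proof (rule nn_integral_cong)
    fix x :: "real^2"
    have "emeasure lborel unit_square = 1"
      using emeasure_unit_square by (simp add: unit_square_box)
    then show "1 / emeasure lborel (box_of (cell_at (slab_B \<delta> \<omega>) 0 x)) * indicator (alive (slab_B \<delta> \<omega>) 0) x = indicator unit_square x"
      by (auto simp: alive_def indicator_def unit_square_box)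
  qed
  also have "\<dots> = 1" using emeasure_unit_square by (simp add: unit_square_box)
  finally show ?case by simp
next
  case (Suc k)
  let ?sl = "slab_B \<delta> \<omega>"
  let ?g = "\<lambda>st. 1 / emeasure lborel (box_of st)"
  define T where "T i = (\<integral>\<^sup>+x. ?g (cut (?sl k (cell ?sl k i)) x (cell ?sl k i))
     * indicator (box_of (cut (?sl k (cell ?sl k i)) x (cell ?sl k i))) x * indicator (box_of (cell ?sl k i)) x \<partial>lborel)" for i
  define C where "C i = ?g (cell ?sl k i) * emeasure lborel (box_of (cell ?sl k i))" for i
  have "cells_count ?sl (Suc k) = (\<Sum>i. T i)"
    unfolding cells_count_def T_def indicator_alive
  proof (rule integral_cell_at_cells[of ?g])
    fix st s
    have "(\<lambda>x. measure lebesgue (box_of (cut s x st))) \<in> borel_measurable borel"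
      by (intro measurable_measure_box_of measurable_rect_cut measurable_slab_const measurable_rect_const) measurable
    then show "(\<lambda>x. 1 / emeasure lborel (box_of (cut s x st))) \<in> borel_measurable borel"
      unfolding emeasure_box_of by measurable
  qed
  also have "\<dots> \<le> (\<Sum>i. C i + (if i = label (box_of (cell_at ?sl k (fst (\<omega> k)))) then 1 else 0))"
  proof (rule suminf_le)
    fix i
    have skip: "T i = C i" if "?sl k (cell ?sl k i) = (1, 0, 0)"
    proof -
      note c = cut_skip
      have "T i = (\<integral>\<^sup>+x. ?g (cell ?sl k i) * indicator (box_of (cell ?sl k i)) x \<partial>lborel)"
        unfolding T_def that c by (intro nn_integral_cong) (simp add: indicator_def)
      then show ?thesis by (simp add: nn_integral_cmult C_def)
    qed
    show "T i \<le> C i + (if i = label (box_of (cell_at ?sl k (fst (\<omega> k)))) then 1 else 0)"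
    proof (cases "fst (\<omega> k) \<in> alive ?sl k")
      case True
      show ?thesis
      proof (cases "i = label (box_of (cell_at ?sl k (fst (\<omega> k))))")
        case i: True
        have "box_of (cell_at ?sl k (fst (\<omega> k))) \<noteq> {}" using True by (auto simp: alive_def)
        then have "measure lebesgue (box_of (cell ?sl k i)) > 0"
          unfolding i hit_cells(1)[OF True] by (rule measure_box_of_pos)
        then have "emeasure lborel (box_of (cell ?sl k i)) \<noteq> 0" "emeasure lborel (box_of (cell ?sl k i)) < top"
          unfolding emeasure_box_of by simp_all
        then have "emeasure lborel (box_of (cell ?sl k i)) / emeasure lborel (box_of (cell ?sl k i)) = 1"
          by (rule ennreal_divide_self)
        then have "C i = 1" unfolding C_def by (simp add: ennreal_divide_times)
        moreover have "T i \<le> 2" unfolding T_def by (rule cut_count)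
        ultimately show ?thesis using i by (simp add: one_add_one)
      next
        case False
        then show ?thesis using skip hit_cells(2)[OF True False] by simp
      qed
    next
      case False
      then show ?thesis using skip no_hit(1)[OF False, of i] by simp
    qed
  qed (auto intro: summableI)
  also have "\<dots> = (\<Sum>i. C i) + 1" unfolding suminf_add[OF summableI summableI, symmetric] suminf_single ..
  also have "(\<Sum>i. C i) = cells_count ?sl k" unfolding C_def cells_count_def integral_cells[of ?g] ..
  also have "cells_count ?sl k + 1 \<le> of_nat (Suc k) + 1" using Suc by (rule add_right_mono)
  finally show ?case by (simp add: add.commute)
qed

section \<open>Contraction in expectation\<close>

lemma pmf_direction:
  assumes q: "0 \<le> q" "q \<le> 1"
  shows "pmf (direction_pmf q) 1 = q" "pmf (direction_pmf q) 2 = 1 - q"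
proof -
  have inj: "inj (\<lambda>b. if b then 1 else 2 :: 2)" by (auto simp: inj_def)
  show "pmf (direction_pmf q) 1 = q"
    unfolding direction_pmf_def using pmf_map_inj'[OF inj, of "bernoulli_pmf q" True] q by simp
  show "pmf (direction_pmf q) 2 = 1 - q"
    unfolding direction_pmf_def using pmf_map_inj'[OF inj, of "bernoulli_pmf q" False] q by simp
qed

lemma sum_pmf_direction: "(\<Sum>e\<in>UNIV. ennreal (pmf (direction_pmf q) e)) = 1"
proof -
  have "(\<Sum>e\<in>UNIV. ennreal (pmf (direction_pmf q) e)) = ennreal (\<Sum>e\<in>UNIV. pmf (direction_pmf q) e)"
    by (rule sum_ennreal) simp
  then show ?thesis by (simp add: sum_pmf_eq_1)
qed

text \<open>The expected factor for the potential of a component: the long direction is chosen with probability at least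
  \<open>min q (1 - q)\<close> and gains the factor \<open>(1 - \<delta>) powr (1 - t)\<close>.\<close>

definition contraction_ratio :: "real \<Rightarrow> real \<Rightarrow> real \<Rightarrow> real" where
  "contraction_ratio q \<delta> t = 2 powr t * (1 - min q (1 - q) + min q (1 - q) * (1 - \<delta>) powr (1 - t))"

lemma contraction_ratio_pos:
  assumes "0 < q" "q < 1" "0 < \<delta>" "\<delta> < 1" shows "contraction_ratio q \<delta> t > 0"
proof -
  have "1 - min q (1 - q) > 0" using assms by (auto simp: min_def)
  moreover have "min q (1 - q) * (1 - \<delta>) powr (1 - t) \<ge> 0" using assms by simp
  ultimately show ?thesis unfolding contraction_ratio_def by (intro mult_pos_pos) auto
qed

text \<open>At \<open>t = 0\<close> the value is \<open>1 - min q (1 - q) * \<delta>\<close>, and the ratio is continuous in \<open>t\<close>. This is where the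
  threshold of the theorem comes from.\<close>

lemma contraction_ratio_less_1:
  assumes "0 < q" "q < 1" "0 < \<delta>" "\<delta> < 1"
  shows "\<exists>\<tau>>0. \<forall>t. 0 < t \<and> t < \<tau> \<longrightarrow> contraction_ratio q \<delta> t < 1"
proof -
  have "(contraction_ratio q \<delta> \<longlongrightarrow> contraction_ratio q \<delta> 0) (at_right 0)"
    unfolding contraction_ratio_def using assms by (intro tendsto_intros) auto
  moreover have "min q (1 - q) * \<delta> > 0" using assms by simp
  then have "contraction_ratio q \<delta> 0 < 1" using assms by (simp add: contraction_ratio_def algebra_simps)
  ultimately have "\<forall>\<^sub>F t in at_right 0. contraction_ratio q \<delta> t < 1" by (rule order_tendstoD(2))
  then show ?thesis by (auto simp: eventually_at_right_field)
qed

lemma shrink_average: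
  assumes q: "0 < q" "q < 1" and \<delta>: "0 < \<delta>" "\<delta> < 1" and t: "0 < t" "t < 1" and x: "x \<in> box_of st"
  shows "(\<Sum>e\<in>UNIV. ennreal (pmf (direction_pmf q) e) * shrink t \<delta> st (x, e)) \<le> ennreal (contraction_ratio q \<delta> t)"
proof -
  define A where "A = 2 powr t * (1 - \<delta>) powr (1 - t)"
  define B where "B = (2::real) powr t"
  have A0: "A \<ge> 0" and B0: "B \<ge> 0" by (simp_all add: A_def B_def)
  have "(1 - \<delta>) powr (1 - t) \<le> 1 powr (1 - t)" using \<delta> t by (intro powr_mono2) auto
  then have AB: "A \<le> B" using mult_left_mono[of "(1 - \<delta>) powr (1 - t)" 1 "2 powr t"] by (simp add: A_def B_def)
  have p: "pmf (direction_pmf q) 1 = q" "pmf (direction_pmf q) 2 = 1 - q" using pmf_direction[of q] q by auto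
  have s: "shrink t \<delta> st (x, e) = ennreal (if e = long st then A else B)" for e
    using x by (simp add: shrink_def A_def B_def)
  have "(\<Sum>e\<in>UNIV. ennreal (pmf (direction_pmf q) e) * shrink t \<delta> st (x, e))
      = ennreal (\<Sum>e\<in>UNIV. pmf (direction_pmf q) e * (if e = long st then A else B))"
    unfolding s using A0 B0 by (subst sum_ennreal[symmetric]) (auto simp: ennreal_mult)
  also have "\<dots> \<le> ennreal (contraction_ratio q \<delta> t)"
  proof (rule ennreal_leI)
    have r: "contraction_ratio q \<delta> t = B - min q (1 - q) * (B - A)" by (simp add: contraction_ratio_def A_def B_def algebra_simps)
    have "min q (1 - q) * (B - A) \<le> q * (B - A)" "min q (1 - q) * (B - A) \<le> (1 - q) * (B - A)"
      using AB by (intro mult_right_mono; simp)+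
    then show "(\<Sum>e\<in>UNIV. pmf (direction_pmf q) e * (if e = long st then A else B)) \<le> contraction_ratio q \<delta> t"
      unfolding r UNIV_2 using exhaust_2[of "long st"] by (auto simp: p algebra_simps)
  qed
  finally show ?thesis .
qed

text \<open>One uniformly distributed choice in a random set \<open>W\<close> that is determined by the past, in a form that
  covers a component in Model A and the whole remaining set in Model B.\<close>

locale choice_step =
  fixes N :: "'c measure" and \<kappa> :: "nat \<Rightarrow> (nat \<Rightarrow> 'c) \<Rightarrow> 'c measure" and \<mu> :: "(nat \<Rightarrow> 'c) measure"
    and k :: nat and q :: real and \<pi> :: "'c \<Rightarrow> (real^2) \<times> 2" and S :: "(nat \<Rightarrow> 'c) set" and W :: "(nat \<Rightarrow> 'c) \<Rightarrow> (real^2) set"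
  assumes law: "sequence_law N \<kappa> \<mu>"
    and \<pi>: "\<pi> \<in> measurable N choice_space"
    and S: "S \<in> sets (\<Pi>\<^sub>M j\<in>{..<k}. N)"
    and W: "{w \<in> space ((\<Pi>\<^sub>M j\<in>{..<k}. N) \<Otimes>\<^sub>M borel). snd w \<in> W (fst w)} \<in> sets ((\<Pi>\<^sub>M j\<in>{..<k}. N) \<Otimes>\<^sub>M borel)"
    and Wfin: "\<And>h. h \<in> S \<Longrightarrow> emeasure lborel (W h) \<noteq> 0 \<and> emeasure lborel (W h) \<noteq> \<infinity>"
    and kernel: "\<And>\<omega> A. \<omega> \<in> space \<mu> \<Longrightarrow> restrict \<omega> {..<k} \<in> S \<Longrightarrow> A \<in> sets choice_space \<Longrightarrow>
      emeasure (\<kappa> k \<omega>) (\<pi> -` A \<inter> space N) = emeasure (choice_law q (W (restrict \<omega> {..<k}))) A"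
begin

abbreviation "past \<omega> \<equiv> restrict \<omega> {..<k}"

lemma past_in: "\<omega> \<in> space \<mu> \<Longrightarrow> past \<omega> \<in> space (\<Pi>\<^sub>M j\<in>{..<k}. N)"
proof -
  have "sets \<mu> = sets (\<Pi>\<^sub>M k\<in>UNIV. N)" using law by (simp add: sequence_law_def)
  then have "space \<mu> = space (\<Pi>\<^sub>M k\<in>(UNIV::nat set). N)" by (rule sets_eq_imp_space_eq)
  then show "\<omega> \<in> space \<mu> \<Longrightarrow> past \<omega> \<in> space (\<Pi>\<^sub>M j\<in>{..<k}. N)" by (auto simp: space_PiM)
qed

lemma W_borel: "h \<in> space (\<Pi>\<^sub>M j\<in>{..<k}. N) \<Longrightarrow> W h \<in> sets borel"
proof -
  assume h: "h \<in> space (\<Pi>\<^sub>M j\<in>{..<k}. N)"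
  have "(\<lambda>x. (h, x)) \<in> measurable borel ((\<Pi>\<^sub>M j\<in>{..<k}. N) \<Otimes>\<^sub>M borel)" using h by simp
  from measurable_sets[OF this W] show "W h \<in> sets borel" using h by (simp add: vimage_def space_pair_measure)
qed

lemma joint:
  assumes F: "F \<in> borel_measurable ((\<Pi>\<^sub>M j\<in>{..<k}. N) \<Otimes>\<^sub>M choice_space)"
  shows "(\<integral>\<^sup>+\<omega>. indicator S (past \<omega>) * F (past \<omega>, \<pi> (\<omega> k)) \<partial>\<mu>) =
    (\<integral>\<^sup>+\<omega>. indicator S (past \<omega>) * (\<Sum>e\<in>UNIV. ennreal (pmf (direction_pmf q) e) * (\<integral>\<^sup>+x. F (past \<omega>, (x, e)) * indicator (W (past \<omega>)) x \<partial>lborel) / emeasure lborel (W (past \<omega>))) \<partial>\<mu>)"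
  by (rule joint_law[OF law \<pi> S W _ _ F]) (use Wfin kernel in blast)+

lemma point_law:
  assumes g: "g \<in> borel_measurable ((\<Pi>\<^sub>M j\<in>{..<k}. N) \<Otimes>\<^sub>M borel)"
  shows "(\<integral>\<^sup>+\<omega>. indicator S (past \<omega>) * g (past \<omega>, fst (\<pi> (\<omega> k))) \<partial>\<mu>) =
    (\<integral>\<^sup>+\<omega>. indicator S (past \<omega>) * ((\<integral>\<^sup>+x. g (past \<omega>, x) * indicator (W (past \<omega>)) x \<partial>lborel) / emeasure lborel (W (past \<omega>))) \<partial>\<mu>)"
proof -
  have F: "(\<lambda>w. g (fst w, fst (snd w))) \<in> borel_measurable ((\<Pi>\<^sub>M j\<in>{..<k}. N) \<Otimes>\<^sub>M choice_space)"
    by (rule measurable_compose[OF _ g]) measurable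
  have "(\<Sum>e\<in>UNIV. ennreal (pmf (direction_pmf q) e) * X / Y) = X / Y" for X Y :: ennreal
    by (simp add: divide_ennreal_def sum_distrib_right[symmetric] sum_pmf_direction mult.assoc)
  then show ?thesis using joint[OF F] by simp
qed

lemma contraction:
  assumes g: "g \<in> borel_measurable ((\<Pi>\<^sub>M j\<in>{..<k}. N) \<Otimes>\<^sub>M borel)"
    and F: "F \<in> borel_measurable ((\<Pi>\<^sub>M j\<in>{..<k}. N) \<Otimes>\<^sub>M choice_space)"
    and le: "\<And>h x. h \<in> S \<Longrightarrow> x \<in> W h \<Longrightarrow> (\<Sum>e\<in>UNIV. ennreal (pmf (direction_pmf q) e) * F (h, (x, e))) \<le> c * g (h, x)"
  shows "(\<integral>\<^sup>+\<omega>. indicator S (past \<omega>) * F (past \<omega>, \<pi> (\<omega> k)) \<partial>\<mu>)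
    \<le> (\<integral>\<^sup>+\<omega>. c * (indicator S (past \<omega>) * ((\<integral>\<^sup>+x. g (past \<omega>, x) * indicator (W (past \<omega>)) x \<partial>lborel) / emeasure lborel (W (past \<omega>)))) \<partial>\<mu>)"
  unfolding joint[OF F]
proof (rule nn_integral_mono)
  fix \<omega> assume \<omega>: "\<omega> \<in> space \<mu>"
  define h where "h = past \<omega>"
  have hP: "h \<in> space (\<Pi>\<^sub>M j\<in>{..<k}. N)" unfolding h_def by (rule past_in[OF \<omega>])
  have Wm [measurable]: "W h \<in> sets borel" by (rule W_borel[OF hP])
  have Fe [measurable]: "(\<lambda>x. F (h, (x, e))) \<in> borel_measurable borel" for e
    by (rule measurable_compose[OF _ F]) (use hP in measurable)
  have ge [measurable]: "(\<lambda>x. g (h, x)) \<in> borel_measurable borel"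
    by (rule measurable_compose[OF _ g]) (use hP in measurable)
  show "indicator S (past \<omega>) * (\<Sum>e\<in>UNIV. ennreal (pmf (direction_pmf q) e) * (\<integral>\<^sup>+x. F (past \<omega>, (x, e)) * indicator (W (past \<omega>)) x \<partial>lborel) / emeasure lborel (W (past \<omega>)))
    \<le> c * (indicator S (past \<omega>) * ((\<integral>\<^sup>+x. g (past \<omega>, x) * indicator (W (past \<omega>)) x \<partial>lborel) / emeasure lborel (W (past \<omega>))))"
    unfolding h_def[symmetric]
  proof (cases "h \<in> S")
    case True
    have "(\<Sum>e\<in>UNIV. ennreal (pmf (direction_pmf q) e) * (\<integral>\<^sup>+x. F (h, (x, e)) * indicator (W h) x \<partial>lborel))
      = (\<integral>\<^sup>+x. (\<Sum>e\<in>UNIV. ennreal (pmf (direction_pmf q) e) * (F (h, (x, e)) * indicator (W h) x)) \<partial>lborel)"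
      by (simp add: nn_integral_sum nn_integral_cmult)
    also have "\<dots> \<le> (\<integral>\<^sup>+x. c * (g (h, x) * indicator (W h) x) \<partial>lborel)"
    proof (rule nn_integral_mono)
      fix x
      show "(\<Sum>e\<in>UNIV. ennreal (pmf (direction_pmf q) e) * (F (h, (x, e)) * indicator (W h) x)) \<le> c * (g (h, x) * indicator (W h) x)"
        using le[OF True, of x] by (cases "x \<in> W h") auto
    qed
    also have "\<dots> = c * (\<integral>\<^sup>+x. g (h, x) * indicator (W h) x \<partial>lborel)" by (simp add: nn_integral_cmult)
    finally have "(\<Sum>e\<in>UNIV. ennreal (pmf (direction_pmf q) e) * (\<integral>\<^sup>+x. F (h, (x, e)) * indicator (W h) x \<partial>lborel)) / emeasure lborel (W h)
      \<le> c * (\<integral>\<^sup>+x. g (h, x) * indicator (W h) x \<partial>lborel) / emeasure lborel (W h)"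
      by (rule divide_right_mono_ennreal)
    then show "indicator S h * (\<Sum>e\<in>UNIV. ennreal (pmf (direction_pmf q) e) * (\<integral>\<^sup>+x. F (h, (x, e)) * indicator (W h) x \<partial>lborel) / emeasure lborel (W h))
      \<le> c * (indicator S h * ((\<integral>\<^sup>+x. g (h, x) * indicator (W h) x \<partial>lborel) / emeasure lborel (W h)))"
      using True by (simp add: divide_ennreal_def sum_distrib_right mult.assoc)
  qed simp
qed

end

lemma potential_0: "potential t sl 0 = 2"
proof -
  have "potential t sl 0 = (\<integral>\<^sup>+x. 2 * indicator unit_square x \<partial>lborel)"
    unfolding potential_integral by (intro nn_integral_cong) (auto simp: weight_def unit_square_box indicator_def)
  also have "\<dots> = 2" using emeasure_unit_square by (simp add: nn_integral_cmult unit_square_box)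
  finally show ?thesis .
qed

lemma measurable_rect_compose:
  "measurable_rect M f \<Longrightarrow> g \<in> measurable M' M \<Longrightarrow> measurable_rect M' (\<lambda>w. f (g w))"
  unfolding measurable_rect_def using measurable_compose[of g M' M] by blast

lemma measurable_rect_cell:
  assumes s: "\<And>j f. j < k \<Longrightarrow> measurable_rect M f \<Longrightarrow> measurable_slab M (\<lambda>w. sl w j (f w))"
  shows "measurable_rect M (\<lambda>w. cell (sl w) k i)"
proof -
  have f: "measurable_rect M (\<lambda>w. cell_at (sl w) k (rational_point i))" by (rule measurable_rect_cell_at[OF s]) auto
  note [measurable] = measurable_rectD[OF f] measurable_mem_box_of[OF f, of "\<lambda>_. rational_point i"] measurable_label[OF f]
  show ?thesis
    unfolding cell_def Let_def measurable_rect_def if_distrib[of fst] if_distrib[of snd] if_distrib[of "\<lambda>v. v $ _"] fst_conv snd_conv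
    by measurable
qed

lemma measurable_shrink:
  assumes f: "measurable_rect M f" and c: "c \<in> measurable M choice_space"
  shows "(\<lambda>w. shrink t \<delta> (f w) (c w)) \<in> borel_measurable M"
proof -
  note [measurable] = c measurable_rectD[OF f]
  have [measurable]: "Measurable.pred M (\<lambda>w. fst (c w) \<in> box_of (f w))" by (rule measurable_mem_box_of[OF f]) measurable
  have "(\<lambda>w. snd (c w) = long (f w)) = (\<lambda>w. if snd (f w) $ 2 - fst (f w) $ 2 \<le> snd (f w) $ 1 - fst (f w) $ 1 then snd (c w) = 1 else snd (c w) = 2)"
    by (simp add: long_def fun_eq_iff)
  then have [measurable]: "Measurable.pred M (\<lambda>w. snd (c w) = long (f w))" by (simp only:) measurable
  show ?thesis unfolding shrink_def by measurable
qed

section \<open>Model A\<close>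

lemma emeasure_box_of_fin: "box_of st \<noteq> {} \<Longrightarrow> emeasure lborel (box_of st) \<noteq> 0 \<and> emeasure lborel (box_of st) \<noteq> \<infinity>"
  using measure_box_of_pos[of st] by (auto simp: emeasure_box_of)

text \<open>The kernel is a product measure, so its marginal at a label in use is the law of the choice in that component.\<close>

lemma A_kernel_marginal:
  assumes \<delta>: "0 < \<delta>" and ne: "box_of (cell (slab_A \<delta> \<omega>) k i) \<noteq> {}" and A: "A \<in> sets choice_space"
  shows "emeasure (A_kernel \<delta> q k \<omega>) ((\<lambda>c. c i) -` A \<inter> space (\<Pi>\<^sub>M i\<in>UNIV. choice_space)) = emeasure (choice_law q (box_of (cell (slab_A \<delta> \<omega>) k i))) A"
proof -
  let ?sl = "slab_A \<delta> \<omega>"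
  define Mi where "Mi i = (let V = A_set \<delta> \<omega> k; D = connected_component_set V (rational_point i)
      in if rational_point i \<in> V \<and> label D = i then choice_law q D else return choice_space (0, 1))" for i
  have K: "A_kernel \<delta> q k \<omega> = (\<Pi>\<^sub>M i\<in>UNIV. Mi i)" unfolding A_kernel_def Mi_def ..
  have Mi: "Mi i = (if rational_point i \<in> alive ?sl k \<and> label (box_of (cell_at ?sl k (rational_point i))) = i
      then choice_law q (box_of (cell_at ?sl k (rational_point i))) else return choice_space (0, 1))" for i
    unfolding Mi_def Let_def A_set_alive[OF \<delta>] alive_component ..
  have setsM: "sets (Mi j) = sets choice_space" for j
  proof -
    have "sets (choice_law q V) = sets choice_space" for V
      unfolding choice_law_def by (rule sets_pair_measure_cong) simp_all
    then show ?thesis unfolding Mi by simp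
  qed
  have dummy: "prob_space (return choice_space (0, 1))" by (rule prob_space_return) (simp add: space_pair_measure)
  have pM: "prob_space (Mi j)" for j
  proof (cases "rational_point j \<in> alive ?sl k")
    case True
    then have "box_of (cell_at ?sl k (rational_point j)) \<noteq> {}" by (auto simp: alive_def)
    from emeasure_box_of_fin[OF this] have u: "prob_space (uniform_measure lborel (box_of (cell_at ?sl k (rational_point j))))"
      by (intro prob_space_uniform_measure) auto
    interpret pair_prob_space "uniform_measure lborel (box_of (cell_at ?sl k (rational_point j)))" "measure_pmf (direction_pmf q)"
      unfolding pair_prob_space_def pair_sigma_finite_def
      by (intro conjI u prob_space_measure_pmf prob_space_imp_sigma_finite)
    have "prob_space (choice_law q (box_of (cell_at ?sl k (rational_point j))))" unfolding choice_law_def by unfold_locales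
    then show ?thesis unfolding Mi using dummy by simp
  next
    case False
    then show ?thesis unfolding Mi using dummy by simp
  qed
  interpret product_prob_space Mi UNIV
    unfolding product_prob_space_def product_prob_space_axioms_def product_sigma_finite_def
    using pM prob_space_imp_sigma_finite by blast
  obtain x where x: "x \<in> box_of (cell ?sl k i)" using ne by blast
  note cn = cell_nonempty[OF x]
  have "rational_point i \<in> box_of (cell ?sl k i)"
  proof -
    have "label (box_of (cell ?sl k i)) = i" using cn by simp
    then show ?thesis using rational_point_label[OF ne] by simp
  qed
  then have "rational_point i \<in> alive ?sl k" using mem_cell by blast
  then have Mii: "Mi i = choice_law q (box_of (cell ?sl k i))" unfolding Mi using cn(2) unfolding cn(1) by (intro if_P) blast
  have "emeasure (Mi i) A = emeasure (distr (\<Pi>\<^sub>M i\<in>UNIV. Mi i) (Mi i) (\<lambda>c. c i)) A" by (subst PiM_component) auto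
  also have "\<dots> = emeasure (\<Pi>\<^sub>M i\<in>UNIV. Mi i) ((\<lambda>c. c i) -` A \<inter> space (\<Pi>\<^sub>M i\<in>UNIV. Mi i))"
    using A setsM by (intro emeasure_distr) auto
  also have "space (\<Pi>\<^sub>M i\<in>UNIV. Mi i) = space (\<Pi>\<^sub>M i\<in>UNIV. choice_space)"
    unfolding space_PiM using sets_eq_imp_space_eq[OF setsM] by simp
  finally show ?thesis unfolding K Mii ..
qed

lemma slab_A_past: "cell_at (slab_A \<delta> (restrict \<omega> {..<k})) k x = cell_at (slab_A \<delta> \<omega>) k x"
  by (rule cell_at_cong) (auto simp: slab_A_def fun_eq_iff)

lemma slab_B_past: "cell_at (slab_B \<delta> (restrict \<omega> {..<k})) k x = cell_at (slab_B \<delta> \<omega>) k x"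
  by (rule cell_at_cong) (auto simp: slab_B_def fun_eq_iff)

text \<open>Each component contracts in expectation given the past, since its choice is uniform in it; the sum over
  labels commutes with the expectation.\<close>

lemma expectation_A_step:
  assumes law: "A_law \<delta> q \<mu>" and \<delta>: "0 < \<delta>" "\<delta> < 1" and q: "0 < q" "q < 1" and t: "0 < t" "t < 1"
  shows "(\<integral>\<^sup>+\<omega>. potential t (slab_A \<delta> \<omega>) (Suc k) \<partial>\<mu>) \<le> ennreal (contraction_ratio q \<delta> t) * (\<integral>\<^sup>+\<omega>. potential t (slab_A \<delta> \<omega>) k \<partial>\<mu>)"
    "(\<lambda>\<omega>. potential t (slab_A \<delta> \<omega>) k) \<in> borel_measurable \<mu>"
proof -
  let ?N = "\<Pi>\<^sub>M i\<in>(UNIV::nat set). choice_space"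
  let ?P = "\<Pi>\<^sub>M j\<in>{..<k}. ?N"
  have law': "sequence_law ?N (A_kernel \<delta> q) \<mu>" using law by (simp add: A_law_def)
  have sm: "sets \<mu> = sets (\<Pi>\<^sub>M k\<in>UNIV. ?N)" using law' by (simp add: sequence_law_def)
  have comp: "(\<lambda>\<omega>. \<omega> j n) \<in> measurable \<mu> choice_space" for j n
    unfolding measurable_cong_sets[OF sm refl]
    by (rule measurable_compose[OF measurable_component_singleton[of j UNIV "\<lambda>_. ?N"] measurable_component_singleton[of n UNIV "\<lambda>_. choice_space"]]) auto
  have compP: "(\<lambda>h. h j n) \<in> measurable ?P choice_space" if "j < k" for j n
    by (rule measurable_compose[OF measurable_component_singleton[of j "{..<k}" "\<lambda>_. ?N"] measurable_component_singleton[of n UNIV "\<lambda>_. choice_space"]]) (use that in auto)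
  have cm: "measurable_rect \<mu> (\<lambda>\<omega>. cell (slab_A \<delta> \<omega>) k' i)" for k' i
    by (intro measurable_rect_cell measurable_slab_A comp)
  have cP: "measurable_rect ?P (\<lambda>h. cell (slab_A \<delta> h) k i)" for i
    by (intro measurable_rect_cell measurable_slab_A compP)
  have potm: "(\<lambda>\<omega>. potential t (slab_A \<delta> \<omega>) k') \<in> borel_measurable \<mu>" for k'
    unfolding potential_def by (intro borel_measurable_suminf_order measurable_compose[OF measurable_phi[OF cm] measurable_ennreal])
  then show "(\<lambda>\<omega>. potential t (slab_A \<delta> \<omega>) k) \<in> borel_measurable \<mu>" .
  have past: "cell (slab_A \<delta> (restrict \<omega> {..<k})) k i = cell (slab_A \<delta> \<omega>) k i" for \<omega> i
    unfolding cell_def slab_A_past ..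
  let ?T = "\<lambda>i \<omega>. shrink t \<delta> (cell (slab_A \<delta> \<omega>) k i) (\<omega> k i) * ennreal (phi t (box_of (cell (slab_A \<delta> \<omega>) k i)))"
  let ?f = "\<lambda>i \<omega>. ennreal (phi t (box_of (cell (slab_A \<delta> \<omega>) k i)))"
  have Tm: "?T i \<in> borel_measurable \<mu>" and fm: "?f i \<in> borel_measurable \<mu>" for i
    by (intro borel_measurable_times_ennreal measurable_shrink cm comp measurable_compose[OF measurable_phi[OF cm] measurable_ennreal])+
  have cell_le: "(\<integral>\<^sup>+\<omega>. ?T i \<omega> \<partial>\<mu>) \<le> ennreal (contraction_ratio q \<delta> t) * (\<integral>\<^sup>+\<omega>. ?f i \<omega> \<partial>\<mu>)" for i
  proof -
    define W where "W h = box_of (cell (slab_A \<delta> h) k i)" for h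
    define S where "S = {h \<in> space ?P. measure lebesgue (W h) \<noteq> 0}"
    have SW: "h \<in> S \<Longrightarrow> W h \<noteq> {}" for h by (auto simp: S_def)
    have notS: "h \<in> space ?P \<Longrightarrow> h \<notin> S \<Longrightarrow> W h = {}" for h
      using measure_box_of_pos[of "cell (slab_A \<delta> h) k i"] by (auto simp: S_def W_def)
    have [measurable]: "(\<lambda>h. measure lebesgue (W h)) \<in> borel_measurable ?P"
      unfolding W_def by (rule measurable_measure_box_of[OF cP])
    interpret choice_step ?N "A_kernel \<delta> q" \<mu> k q "\<lambda>c. c i" S W
    proof
      show "sequence_law ?N (A_kernel \<delta> q) \<mu>" by (rule law')
      show "(\<lambda>c. c i) \<in> measurable ?N choice_space" by (rule measurable_component_singleton) simp
      show "S \<in> sets ?P" unfolding S_def by measurable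
      show "{w \<in> space (?P \<Otimes>\<^sub>M borel). snd w \<in> W (fst w)} \<in> sets (?P \<Otimes>\<^sub>M borel)"
        unfolding W_def pred_def[symmetric]
        by (rule measurable_mem_box_of[OF measurable_rect_compose[OF cP measurable_fst]]) measurable
      show "emeasure lborel (W h) \<noteq> 0 \<and> emeasure lborel (W h) \<noteq> \<infinity>" if "h \<in> S" for h
        using emeasure_box_of_fin SW[OF that] unfolding W_def by blast
      show "emeasure (A_kernel \<delta> q k \<omega>) ((\<lambda>c. c i) -` A \<inter> space ?N) = emeasure (choice_law q (W (restrict \<omega> {..<k}))) A"
        if "\<omega> \<in> space \<mu>" "restrict \<omega> {..<k} \<in> S" "A \<in> sets choice_space" for \<omega> A
        using A_kernel_marginal[OF \<delta>(1) _ that(3)] SW[OF that(2)] unfolding W_def past by blast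
    qed
    define g where "g w = ennreal (phi t (W (fst w)))" for w :: "(nat \<Rightarrow> nat \<Rightarrow> (real^2) \<times> 2) \<times> (real^2)"
    define F where "F w = shrink t \<delta> (cell (slab_A \<delta> (fst w)) k i) (snd w) * ennreal (phi t (W (fst w)))" for w
    have gm: "g \<in> borel_measurable (?P \<Otimes>\<^sub>M borel)"
      unfolding g_def[abs_def] W_def
      by (intro measurable_compose[OF measurable_phi measurable_ennreal] measurable_rect_compose[OF cP measurable_fst])
    have Fm: "F \<in> borel_measurable (?P \<Otimes>\<^sub>M choice_space)"
      unfolding F_def[abs_def] W_def
      by (intro borel_measurable_times_ennreal measurable_shrink measurable_snd
          measurable_compose[OF measurable_phi measurable_ennreal] measurable_rect_compose[OF cP measurable_fst])
    have le: "(\<Sum>e\<in>UNIV. ennreal (pmf (direction_pmf q) e) * F (h, (x, e))) \<le> ennreal (contraction_ratio q \<delta> t) * g (h, x)" if "x \<in> W h" for h x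
      using mult_right_mono[OF shrink_average[OF q \<delta> t, of x "cell (slab_A \<delta> h) k i"], of "ennreal (phi t (W h))"] that
      by (simp add: F_def g_def W_def sum_distrib_right mult.assoc)
    have "(\<integral>\<^sup>+\<omega>. ?T i \<omega> \<partial>\<mu>) = (\<integral>\<^sup>+\<omega>. indicator S (past \<omega>) * F (past \<omega>, \<omega> k i) \<partial>\<mu>)"
    proof (rule nn_integral_cong)
      fix \<omega> assume "\<omega> \<in> space \<mu>"
      then have "past \<omega> \<notin> S \<Longrightarrow> phi t (box_of (cell (slab_A \<delta> \<omega>) k i)) = 0"
        using notS[OF past_in] unfolding W_def past by (simp add: phi_empty)
      then show "?T i \<omega> = indicator S (past \<omega>) * F (past \<omega>, \<omega> k i)"
        by (cases "past \<omega> \<in> S") (simp_all add: F_def W_def past)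
    qed
    also have "\<dots> \<le> (\<integral>\<^sup>+\<omega>. ennreal (contraction_ratio q \<delta> t) * (indicator S (past \<omega>) * ((\<integral>\<^sup>+x. g (past \<omega>, x) * indicator (W (past \<omega>)) x \<partial>lborel) / emeasure lborel (W (past \<omega>)))) \<partial>\<mu>)"
      by (rule contraction[OF gm Fm le])
    also have "\<dots> \<le> (\<integral>\<^sup>+\<omega>. ennreal (contraction_ratio q \<delta> t) * ?f i \<omega> \<partial>\<mu>)"
    proof (rule nn_integral_mono, rule mult_left_mono)
      fix \<omega>
      show "indicator S (past \<omega>) * ((\<integral>\<^sup>+x. g (past \<omega>, x) * indicator (W (past \<omega>)) x \<partial>lborel) / emeasure lborel (W (past \<omega>))) \<le> ?f i \<omega>"
      proof (cases "past \<omega> \<in> S")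
        case True
        from emeasure_box_of_fin[OF SW[OF True, unfolded W_def]]
        have "emeasure lborel (W (past \<omega>)) \<noteq> 0" "emeasure lborel (W (past \<omega>)) < top" unfolding W_def by (auto simp: less_top)
        from ennreal_divide_self[OF this]
        have "ennreal (phi t (W (past \<omega>))) * emeasure lborel (W (past \<omega>)) / emeasure lborel (W (past \<omega>)) = ennreal (phi t (W (past \<omega>)))"
          by (simp add: ennreal_times_divide[symmetric])
        moreover have "(\<integral>\<^sup>+x. g (past \<omega>, x) * indicator (W (past \<omega>)) x \<partial>lborel) = ennreal (phi t (W (past \<omega>))) * emeasure lborel (W (past \<omega>))"
          unfolding g_def by (simp add: nn_integral_cmult W_def)
        ultimately show ?thesis using True by (simp add: W_def past)
      qed simp
    qed simp
    also have "\<dots> = ennreal (contraction_ratio q \<delta> t) * (\<integral>\<^sup>+\<omega>. ?f i \<omega> \<partial>\<mu>)" by (rule nn_integral_cmult[OF fm])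
    finally show ?thesis .
  qed
  have "(\<integral>\<^sup>+\<omega>. potential t (slab_A \<delta> \<omega>) (Suc k) \<partial>\<mu>) \<le> (\<integral>\<^sup>+\<omega>. (\<Sum>i. ?T i \<omega>) \<partial>\<mu>)"
    by (intro nn_integral_mono potential_step_A \<delta> t)
  also have "\<dots> = (\<Sum>i. \<integral>\<^sup>+\<omega>. ?T i \<omega> \<partial>\<mu>)" by (rule nn_integral_suminf[OF Tm])
  also have "\<dots> \<le> (\<Sum>i. ennreal (contraction_ratio q \<delta> t) * (\<integral>\<^sup>+\<omega>. ?f i \<omega> \<partial>\<mu>))"
    by (intro suminf_le cell_le) (auto intro: summableI)
  also have "\<dots> = ennreal (contraction_ratio q \<delta> t) * (\<Sum>i. \<integral>\<^sup>+\<omega>. ?f i \<omega> \<partial>\<mu>)" by (rule ennreal_suminf_cmult)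
  also have "(\<Sum>i. \<integral>\<^sup>+\<omega>. ?f i \<omega> \<partial>\<mu>) = (\<integral>\<^sup>+\<omega>. potential t (slab_A \<delta> \<omega>) k \<partial>\<mu>)"
    unfolding potential_def by (rule nn_integral_suminf[OF fm, symmetric])
  finally show "(\<integral>\<^sup>+\<omega>. potential t (slab_A \<delta> \<omega>) (Suc k) \<partial>\<mu>) \<le> ennreal (contraction_ratio q \<delta> t) * (\<integral>\<^sup>+\<omega>. potential t (slab_A \<delta> \<omega>) k \<partial>\<mu>)" .
qed

lemma ennreal_suminf_imp_tendsto_0:
  fixes f :: "nat \<Rightarrow> ennreal" assumes "(\<Sum>k. f k) < \<infinity>" shows "f \<longlonglongrightarrow> 0"
proof -
  have fin: "f k < top" for k using ennreal_suminf_ge[of f k] assms by (simp add: le_less_trans)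
  define r where "r k = enn2real (f k)" for k
  have fr: "f = (\<lambda>k. ennreal (r k))" using fin by (simp add: r_def fun_eq_iff)
  have "summable r" by (rule summable_suminf_not_top) (use assms in \<open>simp_all add: r_def fr[symmetric, unfolded r_def] less_top\<close>)
  then have "r \<longlonglongrightarrow> 0" by (rule summable_LIMSEQ_zero)
  then show ?thesis unfolding fr using tendsto_ennrealI[of r 0 sequentially] by simp
qed

lemma lebesgue_alive: "emeasure lebesgue (alive sl k) = emeasure lborel (alive sl k)"
proof -
  have b: "alive sl k \<in> sets borel" using open_alive by (rule borel_open)
  then have "emeasure lebesgue (alive sl k) = (\<integral>\<^sup>+x. indicator (alive sl k) x \<partial>lebesgue)" by (simp add: sets_completionI_sets)
  also have "\<dots> = (\<integral>\<^sup>+x. indicator (alive sl k) x \<partial>lborel)" by (rule nn_integral_completion)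
  finally show ?thesis using b by simp
qed

text \<open>The expected potentials form a geometric series, so the potentials are almost surely summable. They dominate
  both \<open>phi\<close> of the blocks and the area not yet covered.\<close>

lemma almost_surely_A:
  assumes law: "A_law \<delta> q \<mu>" and \<delta>: "0 < \<delta>" "\<delta> < 1" and q: "0 < q" "q < 1" and t: "0 < t" "t < 1" and r: "contraction_ratio q \<delta> t < 1"
  shows "AE \<omega> in \<mu>. (\<Sum>k. \<Sum>i. ennreal (phi t (cell_block (slab_A \<delta> \<omega>) k i))) < \<infinity> \<and>
    (\<lambda>k. emeasure lebesgue (alive (slab_A \<delta> \<omega>) k)) \<longlonglongrightarrow> 0"
proof -
  interpret prob_space \<mu> using law by (simp add: A_law_def sequence_law_def)
  note m = expectation_A_step(2)[OF law \<delta> q t]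
  have rp: "0 < contraction_ratio q \<delta> t" by (rule contraction_ratio_pos[OF q \<delta>])
  have b: "(\<integral>\<^sup>+\<omega>. potential t (slab_A \<delta> \<omega>) k \<partial>\<mu>) \<le> ennreal (2 * contraction_ratio q \<delta> t ^ k)" for k
  proof (induction k)
    case 0 then show ?case by (simp add: potential_0 emeasure_space_1)
  next
    case (Suc k)
    have "(\<integral>\<^sup>+\<omega>. potential t (slab_A \<delta> \<omega>) (Suc k) \<partial>\<mu>) \<le> ennreal (contraction_ratio q \<delta> t) * ennreal (2 * contraction_ratio q \<delta> t ^ k)"
      by (rule order_trans[OF expectation_A_step(1)[OF law \<delta> q t] mult_left_mono[OF Suc]]) simp
    then show ?case using rp by (simp add: ennreal_mult[symmetric] mult_ac)
  qed
  have "(\<integral>\<^sup>+\<omega>. (\<Sum>k. potential t (slab_A \<delta> \<omega>) k) \<partial>\<mu>) = (\<Sum>k. \<integral>\<^sup>+\<omega>. potential t (slab_A \<delta> \<omega>) k \<partial>\<mu>)"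
    by (rule nn_integral_suminf[OF m])
  also have "\<dots> \<le> (\<Sum>k. ennreal (2 * contraction_ratio q \<delta> t ^ k))" by (intro suminf_le b) (auto intro: summableI)
  also have "\<dots> = ennreal (2 / (1 - contraction_ratio q \<delta> t))" using rp r by (intro dyadic_sum) auto
  finally have "(\<integral>\<^sup>+\<omega>. (\<Sum>k. potential t (slab_A \<delta> \<omega>) k) \<partial>\<mu>) \<noteq> \<infinity>" by (auto simp: top_unique)
  then have "AE \<omega> in \<mu>. (\<Sum>k. potential t (slab_A \<delta> \<omega>) k) \<noteq> \<infinity>"
    by (intro nn_integral_PInf_AE borel_measurable_suminf_order m)
  then show ?thesis
  proof eventually_elim
    case (elim \<omega>)
    then have fin: "(\<Sum>k. potential t (slab_A \<delta> \<omega>) k) < \<infinity>" by (simp add: less_top)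
    have "(\<Sum>k. \<Sum>i. ennreal (phi t (cell_block (slab_A \<delta> \<omega>) k i))) \<le> (\<Sum>k. potential t (slab_A \<delta> \<omega>) k)"
      by (intro suminf_le block_sum_A t) (auto intro: summableI)
    moreover have "(\<lambda>k. emeasure lebesgue (alive (slab_A \<delta> \<omega>) k)) \<longlonglongrightarrow> 0"
      unfolding lebesgue_alive
    proof (rule tendsto_sandwich[OF _ _ tendsto_const ennreal_suminf_imp_tendsto_0[OF fin]])
      show "\<forall>\<^sub>F k in sequentially. emeasure lborel (alive (slab_A \<delta> \<omega>) k) \<le> potential t (slab_A \<delta> \<omega>) k"
        by (intro always_eventually allI emeasure_alive_le_potential t)
    qed simp
    ultimately show ?case using fin by (simp add: le_less_trans)
  qed
qed

section \<open>Model B\<close>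

lemma emeasure_alive_le_1: "emeasure lborel (alive sl k) \<le> 1"
proof -
  have "emeasure lborel (alive sl k) \<le> emeasure lborel unit_square"
    by (rule emeasure_mono[OF alive_subset]) (simp add: unit_square_box)
  then show ?thesis using emeasure_unit_square by (simp add: unit_square_box)
qed

lemma emeasure_alive_eq_0: "emeasure lborel (alive sl k) = 0 \<longleftrightarrow> alive sl k = {}"
proof
  assume 0: "emeasure lborel (alive sl k) = 0"
  show "alive sl k = {}"
  proof (rule ccontr)
    assume "alive sl k \<noteq> {}"
    then obtain x where x: "x \<in> box_of (cell_at sl k x)" by (auto simp: alive_def)
    have "emeasure lborel (box_of (cell_at sl k x)) \<le> emeasure lborel (alive sl k)"
      by (rule emeasure_mono[OF box_of_cell_at_subset_alive]) (simp add: open_alive borel_open)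
    then show False using 0 emeasure_box_of_fin[of "cell_at sl k x"] x by auto
  qed
qed simp

text \<open>A uniformly chosen point hits a component with probability proportional to its area \<open>m\<close>, so the
  average area of the hit component is the sum of the \<open>m\<^sup>2\<close> divided by the total area \<open>v\<close>.
  With at most \<open>k + 1\<close> components, Cauchy-Schwarz gives at least \<open>v / (k + 1)\<close>; it is used in the form
  \<open>2 * c * m \<le> m * m + c * c\<close> with \<open>c = v / (k + 1)\<close>, summed over components.\<close>

lemma hit_average_ge:
  assumes t: "t > 0" and count: "cells_count sl k \<le> of_nat (Suc k)"
  shows "emeasure lborel (alive sl k) / of_nat (Suc k)
    \<le> (\<integral>\<^sup>+x. ennreal (phi t (box_of (cell_at sl k x))) * indicator (alive sl k) x \<partial>lborel) / emeasure lborel (alive sl k)"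
proof (cases "emeasure lborel (alive sl k) = 0")
  case False
  define v where "v = enn2real (emeasure lborel (alive sl k))"
  have vol: "emeasure lborel (alive sl k) = ennreal v"
    using emeasure_alive_le_1[of sl k] unfolding v_def by (subst ennreal_enn2real) (auto simp: top_unique less_top[symmetric])
  have v: "v > 0" using False vol by (metis ennreal_eq_0_iff not_le)
  define c where "c = v / real (Suc k)"
  have c: "c > 0" using v by (simp add: c_def)
  define m where "m i = measure lebesgue (box_of (cell sl k i))" for i
  have m: "emeasure lborel (box_of (cell sl k i)) = ennreal (m i)" "m i \<ge> 0" for i
    by (simp_all add: m_def emeasure_box_of)
  let ?I = "\<Sum>i. ennreal (phi t (box_of (cell sl k i))) * ennreal (m i)"
  \<comment> \<open>Where \<open>m i = 0\<close> both sides vanish, as the label \<open>i\<close> is not in use.\<close>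
  have young: "ennreal (2 * c) * ennreal (m i)
      \<le> ennreal (phi t (box_of (cell sl k i))) * ennreal (m i) + ennreal (c * c) * (1 / ennreal (m i) * ennreal (m i))" for i
  proof (cases "m i = 0")
    case False
    then have mi: "m i > 0" using m(2)[of i] by simp
    have "1 / ennreal (m i) * ennreal (m i) = 1"
      using divide_ennreal[of 1 "m i"] mi by (simp add: ennreal_mult[symmetric])
    moreover have "ennreal (m i) \<le> ennreal (phi t (box_of (cell sl k i)))"
      using measure_cell_le_phi[OF t, of sl k i] unfolding m(1) .
    then have "ennreal (m i) * ennreal (m i) \<le> ennreal (phi t (box_of (cell sl k i))) * ennreal (m i)"
      by (rule mult_right_mono) simp
    moreover have "2 * c * m i \<le> m i * m i + c * c" using sum_squares_bound[of c "m i"] by (simp add: power2_eq_square)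
    then have "ennreal (2 * c) * ennreal (m i) \<le> ennreal (m i) * ennreal (m i) + ennreal (c * c)"
      using c mi by (simp add: ennreal_mult[symmetric] ennreal_plus[symmetric] del: ennreal_plus)
    ultimately show ?thesis by (simp add: order_trans[OF _ add_right_mono])
  qed simp
  have "ennreal (2 * c) * ennreal v = (\<Sum>i. ennreal (2 * c) * ennreal (m i))"
    unfolding ennreal_suminf_cmult vol[symmetric] emeasure_alive_cells m(1) ..
  also have "\<dots> \<le> (\<Sum>i. ennreal (phi t (box_of (cell sl k i))) * ennreal (m i) + ennreal (c * c) * (1 / ennreal (m i) * ennreal (m i)))"
    by (intro suminf_le young) (auto intro: summableI)
  also have "\<dots> = ?I + ennreal (c * c) * (\<Sum>i. 1 / ennreal (m i) * ennreal (m i))"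
    by (subst suminf_add[symmetric]) (auto intro: summableI simp: ennreal_suminf_cmult)
  also have "(\<Sum>i. 1 / ennreal (m i) * ennreal (m i)) = cells_count sl k"
    unfolding cells_count_def integral_cells[of "\<lambda>st. 1 / emeasure lborel (box_of st)"] m(1) ..
  also have "?I + ennreal (c * c) * cells_count sl k \<le> ?I + ennreal (c * c) * of_nat (Suc k)"
    by (intro add_left_mono mult_left_mono count) simp
  also have "ennreal (c * c) * of_nat (Suc k) = ennreal (c * v)"
  proof -
    have e: "c * c * real (Suc k) = c * v" by (simp add: c_def)
    have "ennreal (c * c) * of_nat (Suc k) = ennreal (c * c * real (Suc k))"
      using c by (simp add: ennreal_of_nat_eq_real_of_nat ennreal_mult[symmetric] del: of_nat_Suc)
    then show ?thesis unfolding e .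
  qed
  finally have main: "ennreal (2 * c) * ennreal v \<le> ?I + ennreal (c * v)" .
  have "ennreal (c * v) \<le> ?I"
  proof (cases ?I)
    case (real r)
    then have "ennreal (2 * c * v) \<le> ennreal (r + c * v)"
      using main c v by (simp add: ennreal_mult[symmetric])
    then have "2 * c * v \<le> r + c * v" using real c v by (subst (asm) ennreal_le_iff) auto
    then show ?thesis using real by (simp add: ennreal_leI)
  qed simp
  then have "ennreal (c * v) / ennreal v \<le> ?I / ennreal v" by (rule divide_right_mono_ennreal)
  moreover have "ennreal (c * v) / ennreal v = ennreal v / of_nat (Suc k)"
    using c v divide_ennreal[of v "real (Suc k)"]
    by (simp add: divide_ennreal c_def ennreal_of_nat_eq_real_of_nat del: of_nat_Suc)
  ultimately show ?thesis unfolding integral_cells[of "\<lambda>st. ennreal (phi t (box_of st))"] m(1) vol by simp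
qed simp

text \<open>Otherwise the series dominates a multiple of the harmonic series.\<close>

lemma decreasing_harmonic_tendsto_0:
  fixes v :: "nat \<Rightarrow> ennreal"
  assumes dec: "decseq v" and fin: "(\<Sum>k. v k / of_nat (Suc k)) < \<infinity>"
  shows "v \<longlonglongrightarrow> 0"
proof -
  have "(INF k. v k) = 0"
  proof (rule ccontr)
    assume ne: "(INF k. v k) \<noteq> 0"
    define l where "l = enn2real (min (INF k. v k) 1)"
    have lf: "ennreal l = min (INF k. v k) 1" unfolding l_def by (rule ennreal_enn2real) (simp add: min_less_iff_disj)
    then have "ennreal l \<noteq> 0" using ne by (auto simp: min_def)
    then have l: "l > 0" by (metis ennreal_eq_0_iff not_le)
    have le: "ennreal (l / real (Suc k)) \<le> v k / of_nat (Suc k)" for k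
    proof -
      have "ennreal l \<le> v k" unfolding lf by (rule min.coboundedI1) (rule INF_lower, simp)
      then have "ennreal l / of_nat (Suc k) \<le> v k / of_nat (Suc k)" by (rule divide_right_mono_ennreal)
      moreover have "ennreal l / of_nat (Suc k) = ennreal (l / real (Suc k))"
        using divide_ennreal[of l "real (Suc k)"] l by (simp add: ennreal_of_nat_eq_real_of_nat del: of_nat_Suc)
      ultimately show ?thesis by simp
    qed
    have "(\<Sum>k. ennreal (l / real (Suc k))) \<le> (\<Sum>k. v k / of_nat (Suc k))"
      by (intro suminf_le le) (auto intro: summableI)
    then have "(\<Sum>k. ennreal (l / real (Suc k))) \<noteq> top" using fin by (auto simp: top_unique)
    then have "summable (\<lambda>k. l / real (Suc k))" using l by (intro summable_suminf_not_top) auto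
    then have "summable (\<lambda>k. inverse l * (l / real (Suc k)))" by (rule summable_mult)
    then have "summable (\<lambda>k. inverse (real (Suc k)))" using l by (simp add: field_simps)
    then show False using not_summable_harmonic[where 'a = real] summable_Suc_iff[of "\<lambda>k. inverse (real k)"] by simp
  qed
  then show ?thesis using LIMSEQ_INF[OF dec] by simp
qed

text \<open>The chosen point is uniform in the remaining set and the direction is independent of it, so given the past and
  the point the component that is hit contracts in expectation. The other components do not change, which is why
  only \<open>hit\<close> is gained.\<close>

lemma expectation_B_step:
  assumes law: "B_law \<delta> q \<mu>" and \<delta>: "0 < \<delta>" "\<delta> < 1" and q: "0 < q" "q < 1" and t: "0 < t" "t < 1"
  shows "(\<integral>\<^sup>+\<omega>. potential t (slab_B \<delta> \<omega>) (Suc k) \<partial>\<mu>) + (\<integral>\<^sup>+\<omega>. hit t \<delta> \<omega> k \<partial>\<mu>)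
      \<le> (\<integral>\<^sup>+\<omega>. potential t (slab_B \<delta> \<omega>) k \<partial>\<mu>) + ennreal (contraction_ratio q \<delta> t) * (\<integral>\<^sup>+\<omega>. hit t \<delta> \<omega> k \<partial>\<mu>)"
    and "(\<integral>\<^sup>+\<omega>. emeasure lborel (alive (slab_B \<delta> \<omega>) k) / of_nat (Suc k) \<partial>\<mu>) \<le> (\<integral>\<^sup>+\<omega>. hit t \<delta> \<omega> k \<partial>\<mu>)"
    and "(\<lambda>\<omega>. hit t \<delta> \<omega> k) \<in> borel_measurable \<mu>"
    and "(\<lambda>\<omega>. emeasure lborel (alive (slab_B \<delta> \<omega>) k)) \<in> borel_measurable \<mu>"
proof -
  let ?P = "\<Pi>\<^sub>M j\<in>{..<k}. choice_space"
  have law': "sequence_law choice_space (B_kernel \<delta> q) \<mu>" using law by (simp add: B_law_def)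
  have sm: "sets \<mu> = sets (\<Pi>\<^sub>M k\<in>UNIV. choice_space)" using law' by (simp add: sequence_law_def)
  have comp: "(\<lambda>\<omega>. \<omega> j) \<in> measurable \<mu> choice_space" for j
    unfolding measurable_cong_sets[OF sm refl] by (rule measurable_component_singleton) simp
  have compP: "(\<lambda>h. h j) \<in> measurable ?P choice_space" if "j < k" for j
    by (rule measurable_component_singleton) (use that in simp)
  have nth: "(\<lambda>c :: (real^2) \<times> 2. fst c $ i) \<in> borel_measurable choice_space" for i by measurable
  have vec: "(\<lambda>x :: real^2. x $ i) \<in> borel_measurable borel" "(\<lambda>x :: real^2. x $ i) \<in> borel_measurable lborel" for i by measurable
  have vol: "(\<lambda>w. emeasure lborel (alive (slab_B \<delta> w) k)) \<in> borel_measurable Q"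
    if Q: "\<And>j. j < k \<Longrightarrow> (\<lambda>w. w j) \<in> measurable Q choice_space" for Q
  proof -
    have r: "measurable_rect (Q \<Otimes>\<^sub>M lborel) (\<lambda>w. cell_at (slab_B \<delta> (fst w)) k (snd w))"
      by (intro measurable_rect_cell_at measurable_slab_B measurable_compose[OF measurable_fst Q] measurable_compose[OF measurable_snd vec(2)])
    have "(\<lambda>w. \<integral>\<^sup>+x. indicator (box_of (cell_at (slab_B \<delta> (fst (w, x))) k (snd (w, x)))) (snd (w, x)) \<partial>lborel) \<in> borel_measurable Q"
      by (rule lborel.borel_measurable_nn_integral_fst) (rule measurable_indicator_box_of[OF r measurable_compose[OF measurable_snd vec(2)]])
    then show ?thesis by (simp add: indicator_alive[symmetric] open_alive borel_open)
  qed
  show volm: "(\<lambda>\<omega>. emeasure lborel (alive (slab_B \<delta> \<omega>) k)) \<in> borel_measurable \<mu>" by (rule vol[OF comp])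
  have fm: "measurable_rect \<mu> (\<lambda>\<omega>. cell_at (slab_B \<delta> \<omega>) k (fst (\<omega> k)))"
    by (intro measurable_rect_cell_at measurable_slab_B comp measurable_compose[OF comp nth])
  show hm: "(\<lambda>\<omega>. hit t \<delta> \<omega> k) \<in> borel_measurable \<mu>"
    unfolding hit_def by (rule measurable_compose[OF measurable_phi[OF fm] measurable_ennreal])
  have cm: "measurable_rect \<mu> (\<lambda>\<omega>. cell (slab_B \<delta> \<omega>) k' i)" for k' i
    by (intro measurable_rect_cell measurable_slab_B comp)
  have potm: "(\<lambda>\<omega>. potential t (slab_B \<delta> \<omega>) k') \<in> borel_measurable \<mu>" for k'
    unfolding potential_def by (intro borel_measurable_suminf_order measurable_compose[OF measurable_phi[OF cm] measurable_ennreal])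
  let ?T = "\<lambda>\<omega>. shrink t \<delta> (cell_at (slab_B \<delta> \<omega>) k (fst (\<omega> k))) (\<omega> k) * hit t \<delta> \<omega> k"
  have Tm: "?T \<in> borel_measurable \<mu>"
    by (intro borel_measurable_times_ennreal measurable_shrink fm comp hm)
  define W where "W h = alive (slab_B \<delta> h) k" for h
  define S where "S = {h \<in> space ?P. emeasure lborel (W h) \<noteq> 0}"
  have SW: "h \<in> S \<Longrightarrow> W h \<noteq> {}" for h by (auto simp: S_def)
  have notS: "h \<in> space ?P \<Longrightarrow> h \<notin> S \<Longrightarrow> W h = {}" for h
    using emeasure_alive_eq_0 by (auto simp: S_def W_def)
  have past: "W (restrict \<omega> {..<k}) = alive (slab_B \<delta> \<omega>) k" for \<omega>
    unfolding W_def alive_def slab_B_past ..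
  have [measurable]: "(\<lambda>h. emeasure lborel (W h)) \<in> borel_measurable ?P" unfolding W_def by (rule vol[OF compP])
  have rP: "measurable_rect (?P \<Otimes>\<^sub>M borel) (\<lambda>w. cell_at (slab_B \<delta> (fst w)) k (snd w))"
    by (intro measurable_rect_cell_at measurable_slab_B measurable_compose[OF measurable_fst compP] measurable_compose[OF measurable_snd vec(1)])
  have rC: "measurable_rect (?P \<Otimes>\<^sub>M choice_space) (\<lambda>w. cell_at (slab_B \<delta> (fst w)) k (fst (snd w)))"
    by (intro measurable_rect_cell_at measurable_slab_B measurable_compose[OF measurable_fst compP] measurable_compose[OF measurable_snd nth])
  interpret choice_step choice_space "B_kernel \<delta> q" \<mu> k q "\<lambda>c. c" S W
  proof
    show "sequence_law choice_space (B_kernel \<delta> q) \<mu>" by (rule law')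
    show "(\<lambda>c. c) \<in> measurable choice_space choice_space" by (rule measurable_ident_sets) simp
    show "S \<in> sets ?P" unfolding S_def by measurable
    show "{w \<in> space (?P \<Otimes>\<^sub>M borel). snd w \<in> W (fst w)} \<in> sets (?P \<Otimes>\<^sub>M borel)"
      unfolding W_def alive_def mem_Collect_eq pred_def[symmetric]
      by (rule measurable_mem_box_of[OF rP measurable_compose[OF measurable_snd vec(1)]])
    show "emeasure lborel (W h) \<noteq> 0 \<and> emeasure lborel (W h) \<noteq> \<infinity>" if "h \<in> S" for h
      using that emeasure_alive_le_1[of "slab_B \<delta> h" k] unfolding S_def W_def by (auto simp: top_unique)
    show "emeasure (B_kernel \<delta> q k \<omega>) ((\<lambda>c. c) -` A \<inter> space choice_space) = emeasure (choice_law q (W (restrict \<omega> {..<k}))) A"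
      if "\<omega> \<in> space \<mu>" "restrict \<omega> {..<k} \<in> S" "A \<in> sets choice_space" for \<omega> A
      using SW[OF that(2)] unfolding B_kernel_def B_set_alive[OF \<delta>(1)] past by (simp add: space_pair_measure)
  qed
  define g where "g w = ennreal (phi t (box_of (cell_at (slab_B \<delta> (fst w)) k (snd w))))" for w :: "(nat \<Rightarrow> (real^2) \<times> 2) \<times> (real^2)"
  define c where "c = ennreal (contraction_ratio q \<delta> t)"
  define F where "F w = shrink t \<delta> (cell_at (slab_B \<delta> (fst w)) k (fst (snd w))) (snd w) * g (fst w, fst (snd w))" for w
  have gm: "g \<in> borel_measurable (?P \<Otimes>\<^sub>M borel)"
    unfolding g_def[abs_def] by (rule measurable_compose[OF measurable_phi[OF rP] measurable_ennreal])
  have cgm: "(\<lambda>w. c * g w) \<in> borel_measurable (?P \<Otimes>\<^sub>M borel)" using gm by measurable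
  have Fm: "F \<in> borel_measurable (?P \<Otimes>\<^sub>M choice_space)"
    unfolding F_def[abs_def] g_def fst_conv snd_conv
    by (intro borel_measurable_times_ennreal measurable_shrink rC measurable_snd measurable_compose[OF measurable_phi[OF rC] measurable_ennreal])
  have le: "(\<Sum>e\<in>UNIV. ennreal (pmf (direction_pmf q) e) * F (h, (x, e))) \<le> 1 * (c * g (h, x))" if "x \<in> W h" for h x
    using mult_right_mono[OF shrink_average[OF q \<delta> t, of x "cell_at (slab_B \<delta> h) k x"], of "g (h, x)"] that
    by (simp add: F_def c_def W_def alive_def sum_distrib_right mult.assoc)
  have hit: "hit t \<delta> \<omega> k = indicator S (past \<omega>) * g (past \<omega>, fst (\<omega> k))" if \<omega>: "\<omega> \<in> space \<mu>" for \<omega>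
  proof (cases "past \<omega> \<in> S")
    case True then show ?thesis by (simp add: g_def hit_def slab_B_past)
  next
    case False
    then have "alive (slab_B \<delta> \<omega>) k = {}" using notS[OF past_in[OF \<omega>]] unfolding past by blast
    then show ?thesis using False no_hit(2)[of \<omega> k \<delta> t] by simp
  qed
  have T: "?T \<omega> = indicator S (past \<omega>) * F (past \<omega>, \<omega> k)" if \<omega>: "\<omega> \<in> space \<mu>" for \<omega>
    unfolding hit[OF \<omega>] by (simp add: F_def slab_B_past mult_ac)
  \<comment> \<open>The contraction for the integrand \<open>c * g\<close>, followed by the law of the point to return to \<open>hit\<close>.\<close>
  have "(\<integral>\<^sup>+\<omega>. ?T \<omega> \<partial>\<mu>) = (\<integral>\<^sup>+\<omega>. indicator S (past \<omega>) * F (past \<omega>, \<omega> k) \<partial>\<mu>)"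
    by (rule nn_integral_cong[OF T])
  also have "\<dots> \<le> (\<integral>\<^sup>+\<omega>. 1 * (indicator S (past \<omega>) * ((\<integral>\<^sup>+x. c * g (past \<omega>, x) * indicator (W (past \<omega>)) x \<partial>lborel) / emeasure lborel (W (past \<omega>)))) \<partial>\<mu>)"
    by (rule contraction[OF cgm Fm le])
  also have "\<dots> = (\<integral>\<^sup>+\<omega>. indicator S (past \<omega>) * (c * g (past \<omega>, fst (\<omega> k))) \<partial>\<mu>)"
    unfolding mult_1 by (rule point_law[OF cgm, symmetric])
  also have "\<dots> = (\<integral>\<^sup>+\<omega>. c * hit t \<delta> \<omega> k \<partial>\<mu>)"
    by (rule nn_integral_cong) (simp add: hit mult_ac)
  also have "\<dots> = c * (\<integral>\<^sup>+\<omega>. hit t \<delta> \<omega> k \<partial>\<mu>)" by (rule nn_integral_cmult[OF hm])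
  finally have shrinks: "(\<integral>\<^sup>+\<omega>. ?T \<omega> \<partial>\<mu>) \<le> c * (\<integral>\<^sup>+\<omega>. hit t \<delta> \<omega> k \<partial>\<mu>)" .
  have "(\<integral>\<^sup>+\<omega>. potential t (slab_B \<delta> \<omega>) (Suc k) \<partial>\<mu>) + (\<integral>\<^sup>+\<omega>. hit t \<delta> \<omega> k \<partial>\<mu>)
      = (\<integral>\<^sup>+\<omega>. potential t (slab_B \<delta> \<omega>) (Suc k) + hit t \<delta> \<omega> k \<partial>\<mu>)"
    by (rule nn_integral_add[OF potm hm, symmetric])
  also have "\<dots> \<le> (\<integral>\<^sup>+\<omega>. potential t (slab_B \<delta> \<omega>) k + ?T \<omega> \<partial>\<mu>)" by (intro nn_integral_mono potential_step_B \<delta> t)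
  also have "\<dots> = (\<integral>\<^sup>+\<omega>. potential t (slab_B \<delta> \<omega>) k \<partial>\<mu>) + (\<integral>\<^sup>+\<omega>. ?T \<omega> \<partial>\<mu>)" by (rule nn_integral_add[OF potm Tm])
  also have "\<dots> \<le> (\<integral>\<^sup>+\<omega>. potential t (slab_B \<delta> \<omega>) k \<partial>\<mu>) + c * (\<integral>\<^sup>+\<omega>. hit t \<delta> \<omega> k \<partial>\<mu>)"
    by (rule add_left_mono[OF shrinks])
  finally show "(\<integral>\<^sup>+\<omega>. potential t (slab_B \<delta> \<omega>) (Suc k) \<partial>\<mu>) + (\<integral>\<^sup>+\<omega>. hit t \<delta> \<omega> k \<partial>\<mu>)
      \<le> (\<integral>\<^sup>+\<omega>. potential t (slab_B \<delta> \<omega>) k \<partial>\<mu>) + ennreal (contraction_ratio q \<delta> t) * (\<integral>\<^sup>+\<omega>. hit t \<delta> \<omega> k \<partial>\<mu>)"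
    unfolding c_def .
  have "(\<integral>\<^sup>+\<omega>. emeasure lborel (alive (slab_B \<delta> \<omega>) k) / of_nat (Suc k) \<partial>\<mu>)
      \<le> (\<integral>\<^sup>+\<omega>. indicator S (past \<omega>) * ((\<integral>\<^sup>+x. g (past \<omega>, x) * indicator (W (past \<omega>)) x \<partial>lborel) / emeasure lborel (W (past \<omega>))) \<partial>\<mu>)"
  proof (rule nn_integral_mono)
    fix \<omega> assume \<omega>: "\<omega> \<in> space \<mu>"
    show "emeasure lborel (alive (slab_B \<delta> \<omega>) k) / of_nat (Suc k)
      \<le> indicator S (past \<omega>) * ((\<integral>\<^sup>+x. g (past \<omega>, x) * indicator (W (past \<omega>)) x \<partial>lborel) / emeasure lborel (W (past \<omega>)))"
    proof (cases "past \<omega> \<in> S")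
      case True
      then show ?thesis using hit_average_ge[OF t(1) cells_count_B, of \<delta> \<omega> k] unfolding past g_def fst_conv snd_conv slab_B_past by simp
    next
      case False
      then have "alive (slab_B \<delta> \<omega>) k = {}" using notS[OF past_in[OF \<omega>]] unfolding past by blast
      then show ?thesis by simp
    qed
  qed
  also have "\<dots> = (\<integral>\<^sup>+\<omega>. indicator S (past \<omega>) * g (past \<omega>, fst (\<omega> k)) \<partial>\<mu>)" by (rule point_law[OF gm, symmetric])
  also have "\<dots> = (\<integral>\<^sup>+\<omega>. hit t \<delta> \<omega> k \<partial>\<mu>)" by (rule nn_integral_cong) (simp add: hit)
  finally show "(\<integral>\<^sup>+\<omega>. emeasure lborel (alive (slab_B \<delta> \<omega>) k) / of_nat (Suc k) \<partial>\<mu>) \<le> (\<integral>\<^sup>+\<omega>. hit t \<delta> \<omega> k \<partial>\<mu>)" .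
qed

text \<open>The step estimate reads \<open>a (Suc k) + (1 - \<rho>) * h k \<le> a k\<close>; telescoping bounds the sum of the \<open>h k\<close>.
  Hence the values of \<open>hit\<close> are almost surely summable, and so are the areas \<open>v k / (k + 1)\<close>. As the
  areas decrease, the second fact forces them to zero.\<close>

lemma almost_surely_B:
  assumes law: "B_law \<delta> q \<mu>" and \<delta>: "0 < \<delta>" "\<delta> < 1" and q: "0 < q" "q < 1" and t: "0 < t" "t < 1" and r: "contraction_ratio q \<delta> t < 1"
  shows "AE \<omega> in \<mu>. (\<Sum>k. \<Sum>i. ennreal (phi t (cell_block (slab_B \<delta> \<omega>) k i))) < \<infinity> \<and>
    (\<lambda>k. emeasure lebesgue (alive (slab_B \<delta> \<omega>) k)) \<longlonglongrightarrow> 0"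
proof -
  interpret prob_space \<mu> using law by (simp add: B_law_def sequence_law_def)
  note m = expectation_B_step(3)[OF law \<delta> q t] and vm = expectation_B_step(4)[OF law \<delta> q t]
  define \<rho> where "\<rho> = contraction_ratio q \<delta> t"
  have \<rho>: "0 < \<rho>" "\<rho> < 1" using contraction_ratio_pos[OF q \<delta>] r by (simp_all add: \<rho>_def)
  define a where "a k = (\<integral>\<^sup>+\<omega>. potential t (slab_B \<delta> \<omega>) k \<partial>\<mu>)" for k
  define h where "h k = (\<integral>\<^sup>+\<omega>. hit t \<delta> \<omega> k \<partial>\<mu>)" for k
  have step: "a (Suc k) + h k \<le> a k + ennreal \<rho> * h k" for k
    unfolding a_def h_def \<rho>_def by (rule expectation_B_step(1)[OF law \<delta> q t])
  have ha: "h k \<le> a k" for k unfolding a_def h_def by (intro nn_integral_mono hit_le_potential)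
  have a0: "a 0 = 2" by (simp add: a_def potential_0 emeasure_space_1)
  have afin: "a k < top" for k
  proof (induction k)
    case 0 then show ?case by (simp add: a0)
  next
    case (Suc k)
    have "a (Suc k) \<le> a (Suc k) + h k" by simp
    also have "\<dots> \<le> a k + ennreal \<rho> * h k" by (rule step)
    also have "\<dots> < top" using Suc ha[of k] by (simp add: ennreal_mult_less_top le_less_trans)
    finally show ?case .
  qed
  have hfin: "h k < top" for k using ha[of k] afin[of k] by (rule le_less_trans)
  define \<alpha> where "\<alpha> k = enn2real (a k)" for k
  define \<eta> where "\<eta> k = enn2real (h k)" for k
  have \<alpha>: "a k = ennreal (\<alpha> k)" "\<alpha> k \<ge> 0" and \<eta>: "h k = ennreal (\<eta> k)" "\<eta> k \<ge> 0" for k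
    using afin[of k] hfin[of k] by (simp_all add: \<alpha>_def \<eta>_def)
  have step': "\<alpha> (Suc k) + (1 - \<rho>) * \<eta> k \<le> \<alpha> k" for k
  proof -
    have "ennreal (\<alpha> (Suc k) + \<eta> k) \<le> ennreal (\<alpha> k + \<rho> * \<eta> k)"
      using step[of k] \<rho> \<alpha>(2)[of k] \<alpha>(2)[of "Suc k"] \<eta>(2)[of k] unfolding \<alpha>(1) \<eta>(1) by (simp add: ennreal_mult)
    then have "\<alpha> (Suc k) + \<eta> k \<le> \<alpha> k + \<rho> * \<eta> k"
      using \<rho> \<alpha>(2)[of k] \<eta>(2)[of k] by (subst (asm) ennreal_le_iff) auto
    then show ?thesis by (simp add: algebra_simps)
  qed
  have "\<alpha> n + (1 - \<rho>) * (\<Sum>k<n. \<eta> k) \<le> 2" for n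
  proof (induction n)
    case 0 then show ?case by (simp add: \<alpha>_def a0)
  next
    case (Suc n) then show ?case using step'[of n] by (simp add: algebra_simps)
  qed
  then have "(1 - \<rho>) * (\<Sum>k<n. \<eta> k) \<le> 2" for n using \<alpha>(2)[of n] by (meson add_increasing order_refl order_trans)
  then have part: "(\<Sum>k<n. \<eta> k) \<le> 2 / (1 - \<rho>)" for n using \<rho> by (simp add: field_simps)
  have sumh: "(\<Sum>k. h k) \<le> ennreal (2 / (1 - \<rho>))"
  proof (rule suminf_le_const)
    show "sum h {..<n} \<le> ennreal (2 / (1 - \<rho>))" for n
      using part[of n] \<eta>(2) unfolding \<eta>(1) by (simp add: sum_ennreal ennreal_leI)
  qed (rule summableI)
  have hits: "AE \<omega> in \<mu>. (\<Sum>k. hit t \<delta> \<omega> k) \<noteq> \<infinity>"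
  proof (rule nn_integral_PInf_AE)
    show "(\<lambda>\<omega>. \<Sum>k. hit t \<delta> \<omega> k) \<in> borel_measurable \<mu>" by (intro borel_measurable_suminf_order m)
    have "(\<integral>\<^sup>+\<omega>. (\<Sum>k. hit t \<delta> \<omega> k) \<partial>\<mu>) = (\<Sum>k. h k)" unfolding h_def by (rule nn_integral_suminf[OF m])
    then show "(\<integral>\<^sup>+\<omega>. (\<Sum>k. hit t \<delta> \<omega> k) \<partial>\<mu>) \<noteq> \<infinity>" using sumh by (auto simp: top_unique)
  qed
  let ?v = "\<lambda>\<omega> k. emeasure lborel (alive (slab_B \<delta> \<omega>) k) / of_nat (Suc k)"
  have vm': "(\<lambda>\<omega>. ?v \<omega> k) \<in> borel_measurable \<mu>" for k by (intro borel_measurable_divide_ennreal vm borel_measurable_const)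
  have volumes: "AE \<omega> in \<mu>. (\<Sum>k. ?v \<omega> k) \<noteq> \<infinity>"
  proof (rule nn_integral_PInf_AE)
    show "(\<lambda>\<omega>. \<Sum>k. ?v \<omega> k) \<in> borel_measurable \<mu>" by (intro borel_measurable_suminf_order vm')
    have "(\<integral>\<^sup>+\<omega>. (\<Sum>k. ?v \<omega> k) \<partial>\<mu>) = (\<Sum>k. \<integral>\<^sup>+\<omega>. ?v \<omega> k \<partial>\<mu>)" by (rule nn_integral_suminf[OF vm'])
    also have "\<dots> \<le> (\<Sum>k. h k)"
      unfolding h_def by (intro suminf_le expectation_B_step(2)[OF law \<delta> q t]) (auto intro: summableI)
    finally show "(\<integral>\<^sup>+\<omega>. (\<Sum>k. ?v \<omega> k) \<partial>\<mu>) \<noteq> \<infinity>" using sumh by (auto simp: top_unique)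
  qed
  from hits volumes show ?thesis
  proof eventually_elim
    case (elim \<omega>)
    have "(\<Sum>k. \<Sum>i. ennreal (phi t (cell_block (slab_B \<delta> \<omega>) k i))) \<le> (\<Sum>k. hit t \<delta> \<omega> k)"
      by (intro suminf_le block_sum_B t) (auto intro: summableI)
    moreover have "(\<lambda>k. emeasure lborel (alive (slab_B \<delta> \<omega>) k)) \<longlonglongrightarrow> 0"
    proof (rule decreasing_harmonic_tendsto_0)
      show "decseq (\<lambda>k. emeasure lborel (alive (slab_B \<delta> \<omega>) k))"
        unfolding decseq_def by (intro allI impI emeasure_mono alive_decreasing) (auto simp: open_alive borel_open)
      show "(\<Sum>k. ?v \<omega> k) < \<infinity>" using elim(2) by (simp add: less_top)
    qed
    ultimately show ?case unfolding lebesgue_alive using elim(1) by (simp add: less_top le_less_trans)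
  qed
qed

section \<open>The theorem\<close>

lemma limit_deformation_of_process:
  assumes bb: "building_blocks \<gamma> \<theta>\<^sub>0 z" and M: "M \<in> int_Kqc \<gamma>"
    and s: "0 < s" "s < 1" and p: "1 < p" and sp: "s * p < \<theta>\<^sub>0"
    and y0: "\<And>x. y 0 x = M *v x"
    and ySuc: "\<And>k x. y (Suc k) x =
      (if x \<in> slab_part (sl k (cell_at sl k x)) (cell_at sl k x) then z M (slab_part (sl k (cell_at sl k x)) (cell_at sl k x)) x else y k x)"
    and sum: "(\<Sum>k. \<Sum>i. ennreal (phi (s * p) (cell_block sl k i))) < \<infinity>"
    and exhaust: "(\<lambda>k. emeasure lebesgue (alive sl k)) \<longlonglongrightarrow> 0"
  shows "\<exists>u. limit_deformation \<gamma> M s p y u"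
proof -
  have sp0: "0 < s * p" using s p by simp
  have \<theta>: "\<theta>\<^sub>0 < 1" using bb by (simp add: building_blocks_def)
  have z: "\<forall>R. rectangle R \<and> R \<subseteq> unit_square \<longrightarrow>
      in_W1inf R (z M R) \<and> (AE x in lebesgue_on R. weak_grad R (z M R) x \<in> wells \<gamma>) \<and> affine_boundary R (z M R) M"
    using bb M unfolding building_blocks_def by blast
  interpret well_blocks \<gamma> M "z M" by unfold_locales (use z in blast)
  have "\<forall>\<theta> p. 0 < \<theta> \<and> \<theta> < \<theta>\<^sub>0 \<and> 1 \<le> p \<longrightarrow>
           (\<exists>C\<^sub>0::real. \<forall>R s. rectangle R \<and> R \<subseteq> unit_square \<and> 0 < s \<and> s < 1 \<and> s * p \<le> \<theta> \<longrightarrow>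
              Wsp_pow R s p (weak_grad R (z M R))
                \<le> ennreal (C\<^sub>0 * rect_perimeter R powr (s * p) * measure lebesgue R powr (1 - s * p)))"
    using bb M unfolding building_blocks_def by blast
  from this[rule_format, of "s * p" p] obtain C\<^sub>0 :: real where C0: "\<forall>R s'. rectangle R \<and> R \<subseteq> unit_square \<and> 0 < s' \<and> s' < 1 \<and> s' * p \<le> s * p \<longrightarrow>
      Wsp_pow R s' p (weak_grad R (z M R)) \<le> ennreal (C\<^sub>0 * rect_perimeter R powr (s' * p) * measure lebesgue R powr (1 - s' * p))"
    using sp0 sp p by auto
  show ?thesis
    by (rule process_limit[OF y0 ySuc p s(1) _ _ exhaust sum]) (use sp \<theta> C0 s in auto)
qed

theorem theorem1:
  fixes \<gamma> \<delta> q \<theta>\<^sub>0 :: real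
  assumes "\<gamma> > 0"
    and "0 < \<delta>" "\<delta> < 1"
    and "0 < q" "q < 1"
  shows "\<exists>\<theta>\<^sub>A\<^sub>B>0. \<forall>z. building_blocks \<gamma> \<theta>\<^sub>0 z \<longrightarrow>
    (\<forall>s p. 0 < s \<and> s < 1 \<and> 1 < p \<and> s * p < \<theta>\<^sub>A\<^sub>B \<longrightarrow>
      (\<forall>M\<in>int_Kqc \<gamma>.
         (\<forall>\<mu>. A_law \<delta> q \<mu> \<longrightarrow>
            (AE \<omega> in \<mu>. \<exists>y. limit_deformation \<gamma> M s p (A_deformation \<delta> z M \<omega>) y)) \<and>
         (\<forall>\<mu>. B_law \<delta> q \<mu> \<longrightarrow>
            (AE \<omega> in \<mu>. \<exists>y. limit_deformation \<gamma> M s p (B_deformation \<delta> z M \<omega>) y))))"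
proof -
  note \<delta> = assms(2,3) and q = assms(4,5)
  obtain \<tau> where \<tau>: "\<tau> > 0" "\<And>t. 0 < t \<Longrightarrow> t < \<tau> \<Longrightarrow> contraction_ratio q \<delta> t < 1" using contraction_ratio_less_1[OF q \<delta>] by blast
  \<comment> \<open>For \<open>\<theta>\<^sub>0 \<le> 0\<close> there are no building blocks, and any positive number serves as threshold.\<close>
  define \<Theta> where "\<Theta> = (if \<theta>\<^sub>0 > 0 then min (min \<theta>\<^sub>0 1) \<tau> else 1)"
  have \<Theta>: "\<Theta> > 0" using \<tau>(1) by (simp add: \<Theta>_def)
  show ?thesis
  proof (intro exI[of _ \<Theta>] conjI[OF \<Theta>] allI impI ballI)
    fix z s p M
    assume bb: "building_blocks \<gamma> \<theta>\<^sub>0 z" and sp: "0 < s \<and> s < 1 \<and> 1 < p \<and> s * p < \<Theta>" and M: "M \<in> int_Kqc \<gamma>"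
    have "\<theta>\<^sub>0 > 0" using bb by (simp add: building_blocks_def)
    then have t: "0 < s * p" "s * p < 1" "s * p < \<theta>\<^sub>0" "s * p < \<tau>" using sp by (auto simp: \<Theta>_def)
    have r: "contraction_ratio q \<delta> (s * p) < 1" by (rule \<tau>(2)[OF t(1,4)])
    show "(\<forall>\<mu>. A_law \<delta> q \<mu> \<longrightarrow> (AE \<omega> in \<mu>. \<exists>y. limit_deformation \<gamma> M s p (A_deformation \<delta> z M \<omega>) y)) \<and>
         (\<forall>\<mu>. B_law \<delta> q \<mu> \<longrightarrow> (AE \<omega> in \<mu>. \<exists>y. limit_deformation \<gamma> M s p (B_deformation \<delta> z M \<omega>) y))"
    proof (intro conjI allI impI)
      fix \<mu> assume "A_law \<delta> q \<mu>"
      from almost_surely_A[OF this \<delta> q t(1,2) r]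
      show "AE \<omega> in \<mu>. \<exists>y. limit_deformation \<gamma> M s p (A_deformation \<delta> z M \<omega>) y"
      proof eventually_elim
        case (elim \<omega>)
        show ?case
          by (rule limit_deformation_of_process[OF bb M _ _ _ t(3) _ _ elim[THEN conjunct1] elim[THEN conjunct2]])
            (use sp in \<open>simp_all add: A_deformation_Suc[OF \<delta>(1)] Let_def del: A_deformation.simps(2)\<close>)
      qed
    next
      fix \<mu> assume "B_law \<delta> q \<mu>"
      from almost_surely_B[OF this \<delta> q t(1,2) r]
      show "AE \<omega> in \<mu>. \<exists>y. limit_deformation \<gamma> M s p (B_deformation \<delta> z M \<omega>) y"
      proof eventually_elim
        case (elim \<omega>)
        show ?case
          by (rule limit_deformation_of_process[OF bb M _ _ _ t(3) _ _ elim[THEN conjunct1] elim[THEN conjunct2]])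
            (use sp in \<open>simp_all add: B_deformation_Suc[OF \<delta>(1)] Let_def del: B_deformation.simps(2)\<close>)
      qed
    qed
  qed
qed

end
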